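(* Let $p$ be of class $\mathcal{C}^2$ on the compact smooth manifold $\mathcal{M}$. Suppose that the kernel $K:\mathbb{R}_+\to\mathbb{R}_+$ is measurable with $K(\infty)=0$ and of bounded variation, with total variation function $H$ satisfying $\int_0^\infty a^{d+3}\,dH(a)<\infty$, and that the sequence of positive reals $(h_n)$ satisfies $$\lim_{n\to+\infty}h_n=0\qquad\text{and}\qquad \lim_{n\to+\infty}\frac{\log h_n^{-1}}{n h_n^{d+2}}=0 .$$ Then, with probability $1$, for all $f\in\mathcal{C}^3(\mathcal{M})$, as $n\to\infty$, $$\sup_{x\in\mathcal{M}}\left|\mathcal{A}_{h_n,n}(f)(x)-\mathcal{A}(f)(x)\right| = O\left(\sqrt{\frac{\log h_n^{-1}}{n h_n^{d+2}}}+h_n\right).$$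
   Context: $\mathcal{M}$ is a compact smooth $d$-dimensional submanifold without boundary of $\mathbb{R}^m$, with the Riemannian structure induced by $\mathbb{R}^m$; $\|\cdot\|_2$ is the Euclidean norm of $\mathbb{R}^m$ and $\mu$ the Riemannian volume measure on $\mathcal{M}$. $(X_i)_{i\ge1}$ are i.i.d. points of $\mathcal{M}$ with law $p(x)\mu(\mathrm{d}x)$, where $p$ is a probability density with respect to $\mu$. For a kernel $K$, $K(\infty)=\lim_{a\to\infty}K(a)$, and the total variation function is $H(a)=\sup\sum_{i=1}^n|K(a_i)-K(a_{i-1})|$, the supremum being over all $n$ and all subdivisions $0=a_0<\dots<a_n=a$ of $[0,a]$; $dH$ denotes the associated Stieltjes measure. For $x\in\mathcal{M}$, $$\mathcal{A}_{h_n,n}(f)(x)=\frac{1}{n h_n^{d+2}}\sum_{i=1}^n K\left(\frac{\|x-X_i\|_2}{h_n}\right)(f(X_i)-f(x)),$$ $$\mathcal{A}(f)=c_0\Big(\langle\nabla_{\mathcal{M}}(p),\nabla_{\mathcal{M}}(f)\rangle+\tfrac12\,p\,\Delta_{\mathcal{M}}(f)\Big),\qquad c_0=\frac1d\int_{\mathbb{R}^d}K(\|v\|_2)\|v\|_2^2\,\mathrm{d}v,$$ where $\nabla_{\mathcal{M}}$ and $\Delta_{\mathcal{M}}$ are the Riemannian gradient and the Laplace–Beltrami operator (the divergence of the gradient) of $\mathcal{M}$. The implicit constant in $O(\cdot)$ may depend on $f$ and on the random realization, but not on $n$. *)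

theory Defs
  imports "HOL-Probability.Probability" "HOL-Library.Landau_Symbols"
begin

section \<open>Differentiability classes on open subsets of Euclidean space\<close>

text \<open>Only meant for open \<open>U\<close>. Requiring all first-order directional derivatives to be of class
  \<open>C\<^sup>k\<close> is the same as requiring the derivative, as a map into linear maps, to be of class \<open>C\<^sup>k\<close>,
  because the domain is finite-dimensional.\<close>

primrec Ck_on :: "nat \<Rightarrow> ('a::euclidean_space) set \<Rightarrow> ('a \<Rightarrow> 'b::real_normed_vector) \<Rightarrow> bool" where
  "Ck_on 0 U f \<longleftrightarrow> continuous_on U f"
| "Ck_on (Suc k) U f \<longleftrightarrow>
     (\<forall>x\<in>U. f differentiable (at x)) \<and>
     (\<forall>v. Ck_on k U (\<lambda>x. frechet_derivative f (at x) v))"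

definition smooth_on :: "('a::euclidean_space) set \<Rightarrow> ('a \<Rightarrow> 'b::real_normed_vector) \<Rightarrow> bool" where
  "smooth_on U f \<longleftrightarrow> (\<forall>k. Ck_on k U f)"

section \<open>Embedded submanifolds of Euclidean space\<close>

text \<open>The dimension of a submanifold is \<open>CARD('d)\<close>; where \<open>'d\<close> does not occur in the types of the
  other arguments it is supplied as \<open>TYPE('d)\<close>.\<close>

definition local_parametrization ::
    "(real^'m) set \<Rightarrow> (real^'d) set \<Rightarrow> (real^'d \<Rightarrow> real^'m) \<Rightarrow> bool" where
  "local_parametrization M U \<phi> \<longleftrightarrow>
     open U \<and> smooth_on U \<phi> \<and> (\<forall>u\<in>U. inj (frechet_derivative \<phi> (at u))) \<and>
     openin (top_of_set M) (\<phi> ` U) \<and> (\<exists>\<psi>. homeomorphism U (\<phi> ` U) \<phi> \<psi>)"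

definition smooth_submanifold :: "'d::finite itself \<Rightarrow> (real^'m) set \<Rightarrow> bool" where
  "smooth_submanifold _ M \<longleftrightarrow>
     (\<forall>x\<in>M. \<exists>(U :: (real^'d) set) \<phi>. local_parametrization M U \<phi> \<and> x \<in> \<phi> ` U)"

text \<open>Functions on \<open>M\<close> are represented by functions on the ambient space, of which only the values
  on \<open>M\<close> matter.\<close>

definition Ck_manifold ::
    "'d::finite itself \<Rightarrow> nat \<Rightarrow> (real^'m) set \<Rightarrow> (real^'m \<Rightarrow> real) \<Rightarrow> bool" where
  "Ck_manifold _ k M f \<longleftrightarrow>
     (\<forall>(U :: (real^'d) set) \<phi>. local_parametrization M U \<phi> \<longrightarrow> Ck_on k U (f \<circ> \<phi>))"

section \<open>Riemannian volume, gradient and Laplacian for the induced metric\<close>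

definition gram_matrix :: "(real^'d \<Rightarrow> real^'m) \<Rightarrow> real^'d \<Rightarrow> real^'d^'d" where
  "gram_matrix \<phi> u =
     (\<chi> i j. frechet_derivative \<phi> (at u) (axis i 1) \<bullet> frechet_derivative \<phi> (at u) (axis j 1))"

text \<open>The Borel measure on \<open>M\<close> given by \<open>sqrt (det g) du\<close> in every chart. On a submanifold it exists
  and these conditions determine it.\<close>

definition riemannian_volume ::
    "'d::finite itself \<Rightarrow> (real^'m) set \<Rightarrow> (real^'m) measure \<Rightarrow> bool" where
  "riemannian_volume _ M \<mu> \<longleftrightarrow>
     sets \<mu> = sets (restrict_space borel M) \<and>
     (\<forall>(U :: (real^'d) set) \<phi>. local_parametrization M U \<phi> \<longrightarrow>
        (\<forall>A\<in>sets \<mu>. A \<subseteq> \<phi> ` U \<longrightarrow>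
           emeasure \<mu> A =
             (\<integral>\<^sup>+ u\<in>{u\<in>U. \<phi> u \<in> A}. ennreal (sqrt (det (gram_matrix \<phi> u))) \<partial>lborel)))"

definition tangent_space :: "(real^'m) set \<Rightarrow> real^'m \<Rightarrow> (real^'m) set" where
  "tangent_space M x =
     {w. \<exists>\<epsilon>>0. \<exists>\<gamma>. smooth_on {-\<epsilon><..<\<epsilon>} \<gamma> \<and> \<gamma> ` {-\<epsilon><..<\<epsilon>} \<subseteq> M \<and> \<gamma> 0 = x \<and>
            (\<gamma> has_vector_derivative w) (at (0::real))}"

text \<open>A derivative of \<open>f\<close> within \<open>M\<close> at \<open>x\<close> is a linear map on the whole ambient space; it is not
  unique, but its restriction to the tangent space is, and equals the differential of \<open>f\<close> there.
  The two definitions below depend on that restriction only.\<close>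

definition manifold_gradient ::
    "(real^'m) set \<Rightarrow> (real^'m \<Rightarrow> real) \<Rightarrow> real^'m \<Rightarrow> real^'m" where
  "manifold_gradient M f x =
     (THE v. v \<in> tangent_space M x \<and>
        (\<exists>f'. (f has_derivative f') (at x within M) \<and> (\<forall>w\<in>tangent_space M x. v \<bullet> w = f' w)))"

text \<open>The divergence is the trace of the Levi-Civita covariant derivative \<open>w \<mapsto> P (Y' w)\<close>, with \<open>P\<close> the
  orthogonal projection onto the tangent space. In an orthonormal basis \<open>B\<close> of the tangent space
  the projection can be omitted, since \<open>P (Y' e) \<bullet> e = Y' e \<bullet> e\<close>. The value does not depend
  on \<open>B\<close>.\<close>

definition manifold_divergence ::
    "(real^'m) set \<Rightarrow> (real^'m \<Rightarrow> real^'m) \<Rightarrow> real^'m \<Rightarrow> real" where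
  "manifold_divergence M Y x =
     (THE r. \<exists>B Y'. pairwise orthogonal B \<and> (\<forall>e\<in>B. norm e = 1) \<and> span B = tangent_space M x \<and>
        (Y has_derivative Y') (at x within M) \<and> r = (\<Sum>e\<in>B. Y' e \<bullet> e))"

definition laplace_beltrami :: "(real^'m) set \<Rightarrow> (real^'m \<Rightarrow> real) \<Rightarrow> real^'m \<Rightarrow> real" where
  "laplace_beltrami M f = manifold_divergence M (manifold_gradient M f)"

section \<open>Total variation and the associated Stieltjes measure\<close>

definition variation_sums :: "(real \<Rightarrow> real) \<Rightarrow> real \<Rightarrow> real set" where
  "variation_sums K a =
     {(\<Sum>i=1..n. \<bar>K (t i) - K (t (i - 1))\<bar>) | (n :: nat) t.
        t 0 = 0 \<and> t n = a \<and> strict_mono_on {0..n} t}"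

definition bounded_variation_halfline :: "(real \<Rightarrow> real) \<Rightarrow> bool" where
  "bounded_variation_halfline K \<longleftrightarrow> bdd_above (\<Union>a\<in>{0..}. variation_sums K a)"

text \<open>Extended by zero to the left of the origin.\<close>

definition total_variation :: "(real \<Rightarrow> real) \<Rightarrow> real \<Rightarrow> real" where
  "total_variation K a = (if a < 0 then 0 else Sup (variation_sums K a))"

text \<open>The library's \<^const>\<open>interval_measure\<close> is meaningful for right-continuous functions only, and a
  total variation function need not be right-continuous. Hence the passage to right limits.\<close>

definition stieltjes_measure :: "(real \<Rightarrow> real) \<Rightarrow> real measure" where
  "stieltjes_measure H = interval_measure (\<lambda>a. Lim (at_right a) H)"

section \<open>The random operators and their limit\<close>

definition kernel_operator ::
    "'d::finite itself \<Rightarrow> (real \<Rightarrow> real) \<Rightarrow> real \<Rightarrow> nat \<Rightarrow> (nat \<Rightarrow> real^'m) \<Rightarrow>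
     (real^'m \<Rightarrow> real) \<Rightarrow> real^'m \<Rightarrow> real" where
  "kernel_operator _ K h n X f x =
     1 / (real n * h ^ (CARD('d) + 2)) * (\<Sum>i=1..n. K (norm (x - X i) / h) * (f (X i) - f x))"

definition kernel_constant :: "'d::finite itself \<Rightarrow> (real \<Rightarrow> real) \<Rightarrow> real" where
  "kernel_constant _ K =
     1 / real CARD('d) * (LINT v|(lborel :: (real^'d) measure). K (norm v) * (norm v)\<^sup>2)"

definition limit_operator ::
    "'d::finite itself \<Rightarrow> (real \<Rightarrow> real) \<Rightarrow> (real^'m) set \<Rightarrow> (real^'m \<Rightarrow> real) \<Rightarrow>
     (real^'m \<Rightarrow> real) \<Rightarrow> real^'m \<Rightarrow> real" where
  "limit_operator D K M p f x =
     kernel_constant D K *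
       (manifold_gradient M p x \<bullet> manifold_gradient M f x + 1/2 * p x * laplace_beltrami M f x)"

end

theory Submission
  imports Defs
begin

text \<open>Around every point of \<open>M\<close> there is a parametrization \<open>\<psi>\<close> with
  \<open>\<psi> w = x + E w + B w w / 2 + O(|w|\<^sup>3)\<close>, where \<open>E\<close> is isometric and \<open>B\<close> is normal to its range, and
  with constants that are locally uniform in \<open>x\<close>. In such a chart the gradient and the Laplacian at \<open>x\<close>
  are the flat ones, the volume density is \<open>1 + O(|w|\<^sup>2)\<close> and \<open>|\<psi> w - x| = |w| + O(|w|\<^sup>3)\<close>. Writing
  differences of \<open>K\<close> as masses of the variation measure and exchanging the integrals turns the last
  estimate into a bias of order \<open>h\<close>, uniformly in \<open>x\<close>.

  For the random part, the ambient expansion \<open>f y - f x = a (y - x) + s (y - x) (y - x) + O(|y - x|\<^sup>3)\<close>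
  reduces all functions \<open>f\<close> to the finitely many test functions \<open>z\<^sub>j\<close>, \<open>z\<^sub>j z\<^sub>k\<close> and \<open>|z|\<^sup>3\<close>. For each of
  them Bernstein's inequality on a net of mesh \<open>h\<close> to a large power, together with the Borel-Cantelli
  lemma, gives the deviation \<open>h ^ (d + 2) * rate\<close>. Since \<open>K\<close> may jump, two points of the net are compared
  by means of the variation of \<open>K\<close> over thin shells, which is itself a random sum of the same kind.\<close>

section \<open>Calculus of \<open>C\<^sup>k\<close> functions\<close>

text \<open>The null set has to serve uncountably many \<open>f\<close> at once, which is why
  randomness is confined to finitely many test functions and \<open>f\<close> enters only through
  bounded coefficients. The cubic test function absorbs the remainder: its kernel average is
  O(h^(d+3)). The hypotheses do not make log(1/h) dominate log n, so powers of h alone need not be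
  summable in n. The summand h of the rate cures this: its square adds n h^(d+4) to the exponent in
  Bernstein's bound, and exp(-u) \<le> 2/u^2 turns it into n^(-2) times a negative power of h, which
  is absorbed by a large power of h coming from the logarithm. The moment of order d + 3 is the
  price of the bias. When |\<psi> w - x| is replaced by |w|, a mass of the variation measure at s is
  crossed only for w in a shell of radius about hs and width of order (hs)^3, and the integral of
  |w| over this shell is of order (hs)^(d+3). Without normality of B the width would be of order
  (hs)^2, and the estimate would lose the factor h.\<close>

lemma frechet_derivative_cong_open:
  assumes "open U" "x \<in> U" "\<And>y. y \<in> U \<Longrightarrow> f y = g y"
  shows "frechet_derivative f (at x) = frechet_derivative g (at x)"
proof -
  have "(f has_derivative D) (at x) \<longleftrightarrow> (g has_derivative D) (at x)" for D
    using assms has_derivative_transform_within_open[of f D x UNIV U g]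
      has_derivative_transform_within_open[of g D x UNIV U f] by auto
  then show ?thesis unfolding frechet_derivative_def by simp
qed

lemma Ck_on_cong:
  assumes "open U" "\<And>x. x \<in> U \<Longrightarrow> f x = g x" "Ck_on k U f"
  shows "Ck_on k U g"
  using assms(2,3)
proof (induction k arbitrary: f g)
  case 0
  then show ?case by (simp cong: continuous_on_cong)
next
  case (Suc k)
  have "g differentiable (at x)" if "x \<in> U" for x
    using Suc.prems that assms(1) has_derivative_transform_within_open[of f _ x UNIV U g]
    unfolding differentiable_def Ck_on.simps by metis
  moreover have "Ck_on k U (\<lambda>x. frechet_derivative g (at x) v)" for v
  proof (rule Suc.IH[of "\<lambda>x. frechet_derivative f (at x) v"])
    show "frechet_derivative f (at x) v = frechet_derivative g (at x) v" if "x \<in> U" for x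
      using frechet_derivative_cong_open[of U x f g] assms(1) that Suc.prems(1) by simp
    show "Ck_on k U (\<lambda>x. frechet_derivative f (at x) v)"
      using Suc.prems(2) by simp
  qed
  ultimately show ?case by simp
qed

lemma Ck_on_SucD: "Ck_on (Suc k) U f \<Longrightarrow> Ck_on k U f"
proof (induction k arbitrary: f)
  case 0
  then show ?case
    by (auto intro!: continuous_at_imp_continuous_on differentiable_imp_continuous_within)
qed simp

lemma Ck_on_le: "Ck_on k U f \<Longrightarrow> j \<le> k \<Longrightarrow> Ck_on j U f"
proof (induction k)
  case (Suc k)
  then show ?case using Ck_on_SucD[of k U f] by (cases "j = Suc k") auto
qed simp

lemma Ck_on_continuous: "Ck_on k U f \<Longrightarrow> continuous_on U f"
  using Ck_on_le[of k U f 0] by simp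

lemma Ck_on_const: "Ck_on k U (\<lambda>x. c)"
  by (induction k arbitrary: c) simp_all

lemma Ck_on_has_derivative:
  "Ck_on (Suc k) U f \<Longrightarrow> x \<in> U \<Longrightarrow> (f has_derivative frechet_derivative f (at x)) (at x)"
  using frechet_derivative_works by auto

text \<open>Since \<open>frechet_derivative\<close> is a choice operator, concrete functions are
  treated by exhibiting a derivative field; uniqueness of the derivative and
  \<open>Ck_on_cong\<close> on the open set do the rest.\<close>

lemma Ck_on_SucI:
  assumes "open U" "\<And>x. x \<in> U \<Longrightarrow> (f has_derivative f' x) (at x)" "\<And>v. Ck_on k U (\<lambda>x. f' x v)"
  shows "Ck_on (Suc k) U f"
proof -
  have "f differentiable (at x)" if "x \<in> U" for x
    using assms(2) that by (auto simp: differentiable_def)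
  moreover have "Ck_on k U (\<lambda>x. frechet_derivative f (at x) v)" for v
    using frechet_derivative_at[OF assms(2)] assms(1,3) by (auto intro: Ck_on_cong[of U "\<lambda>x. f' x v"])
  ultimately show ?thesis by simp
qed

lemma Ck_on_add:
  assumes "open U" "Ck_on k U f" "Ck_on k U g"
  shows "Ck_on k U (\<lambda>x. f x + g x)"
  using assms(2,3)
proof (induction k arbitrary: f g)
  case (Suc k)
  show ?case
    by (rule Ck_on_SucI[OF assms(1), where f' = "\<lambda>x v. frechet_derivative f (at x) v + frechet_derivative g (at x) v"])
      (use Suc in \<open>auto intro!: derivative_eq_intros Ck_on_has_derivative\<close>)
qed (auto intro: continuous_intros)

lemma Ck_on_sum:
  assumes "open U" "\<And>i. i \<in> I \<Longrightarrow> Ck_on k U (f i)"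
  shows "Ck_on k U (\<lambda>x. \<Sum>i\<in>I. f i x)"
  using assms(2)
  by (induction I rule: infinite_finite_induct) (auto intro: Ck_on_const Ck_on_add[OF assms(1)])

lemma Ck_on_linear:
  assumes "open U" "Ck_on k U f" "bounded_linear L"
  shows "Ck_on k U (\<lambda>x. L (f x))"
  using assms(2)
proof (induction k arbitrary: f)
  case 0
  then show ?case
    using continuous_on_compose2[OF linear_continuous_on[OF assms(3), of UNIV]] by auto
next
  case (Suc k)
  show ?case
    by (rule Ck_on_SucI[OF assms(1), where f' = "\<lambda>x v. L (frechet_derivative f (at x) v)"])
      (use Suc in \<open>auto intro!: bounded_linear.has_derivative[OF assms(3)] Ck_on_has_derivative\<close>)
qed

lemma Ck_on_scaleR:
  assumes "open U" "Ck_on k U a" "Ck_on k U f"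
  shows "Ck_on k U (\<lambda>x. a x *\<^sub>R f x)"
  using assms(2,3)
proof (induction k arbitrary: a f)
  case (Suc k)
  have "Ck_on k U a" "Ck_on k U f" using Suc.prems Ck_on_SucD by blast+
  then have "Ck_on k U (\<lambda>x. a x *\<^sub>R frechet_derivative f (at x) v + frechet_derivative a (at x) v *\<^sub>R f x)" for v
    using Suc by (intro Ck_on_add[OF assms(1)]) auto
  then show ?case
    by (intro Ck_on_SucI[OF assms(1), where f' = "\<lambda>x v. a x *\<^sub>R frechet_derivative f (at x) v + frechet_derivative a (at x) v *\<^sub>R f x"])
      (use Suc.prems in \<open>auto intro!: derivative_eq_intros Ck_on_has_derivative\<close>)
qed (auto intro: continuous_intros)

lemma linear_euclidean_expansion:
  fixes L :: "'a::euclidean_space \<Rightarrow> 'b::real_vector"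
  assumes "linear L"
  shows "L v = (\<Sum>b\<in>Basis. (v \<bullet> b) *\<^sub>R L b)"
proof -
  have "L v = L (\<Sum>b\<in>Basis. (v \<bullet> b) *\<^sub>R b)" by (simp add: euclidean_representation)
  also have "\<dots> = (\<Sum>b\<in>Basis. (v \<bullet> b) *\<^sub>R L b)"
    using assms by (simp add: linear_sum linear_scale)
  finally show ?thesis .
qed

text \<open>Induction on \<open>k\<close> for all \<open>G\<close> at once. The derivative in
  direction v is a finite sum of coordinates of g' v times partial derivatives of \<open>G\<close>
  composed with \<open>g\<close>, and the induction hypothesis applies to the latter. The sum over
  \<open>Basis\<close> replaces the evaluation of a variable linear map at a variable
  vector.\<close>

lemma Ck_on_compose:
  fixes g :: "'a::euclidean_space \<Rightarrow> 'b::euclidean_space" and G :: "'b \<Rightarrow> 'c::real_normed_vector"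
  assumes "open U" "Ck_on k U g" "Ck_on k V G" "g ` U \<subseteq> V"
  shows "Ck_on k U (\<lambda>x. G (g x))"
  using assms(2,3)
proof (induction k arbitrary: G)
  case 0
  then show ?case using assms(4) continuous_on_compose2 by (metis Ck_on.simps(1))
next
  case (Suc k)
  have g: "Ck_on k U g" using Suc.prems Ck_on_SucD by blast
  have der: "((\<lambda>x. G (g x)) has_derivative (\<lambda>v. frechet_derivative G (at (g x)) (frechet_derivative g (at x) v))) (at x)"
    if "x \<in> U" for x
    using diff_chain_at[OF Ck_on_has_derivative[OF Suc.prems(1) that] Ck_on_has_derivative[OF Suc.prems(2)]] assms(4) that
    by (auto simp: o_def)
  show ?case
  proof (rule Ck_on_SucI[OF assms(1) der])
    fix v
    have "Ck_on k U (\<lambda>x. \<Sum>b\<in>Basis. (frechet_derivative g (at x) v \<bullet> b) *\<^sub>R frechet_derivative G (at (g x)) b)"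
      using Suc g by (intro Ck_on_sum Ck_on_scaleR assms(1) Ck_on_linear[OF _ _ bounded_linear_inner_left] Suc.IH) auto
    moreover have "(\<Sum>b\<in>Basis. (frechet_derivative g (at x) v \<bullet> b) *\<^sub>R frechet_derivative G (at (g x)) b) =
        frechet_derivative G (at (g x)) (frechet_derivative g (at x) v)" if "x \<in> U" for x
    proof -
      have "g x \<in> V" using that assms(4) by auto
      from linear_euclidean_expansion[OF has_derivative_linear[OF Ck_on_has_derivative[OF Suc.prems(2) this]]]
      show ?thesis by (rule sym)
    qed
    ultimately show "Ck_on k U (\<lambda>x. frechet_derivative G (at (g x)) (frechet_derivative g (at x) v))"
      using Ck_on_cong[OF assms(1)] by (smt (verit, best))
  qed
qed

lemma Ck_on_ident: "open U \<Longrightarrow> Ck_on k U (\<lambda>x. x)"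
proof (cases k)
  case (Suc j)
  assume "open U"
  then show ?thesis unfolding Suc
    by (intro Ck_on_SucI[where f' = "\<lambda>x v. v"]) (auto intro: Ck_on_const)
qed simp

lemma Ck_on_quadratic:
  fixes Q :: "'a::euclidean_space \<Rightarrow> 'a \<Rightarrow> 'b::euclidean_space"
  assumes "open U" "bounded_bilinear Q"
  shows "Ck_on k U (\<lambda>x. Q x x)"
proof (cases k)
  case 0
  then show ?thesis by (auto intro!: bounded_bilinear.continuous_on[OF assms(2)] continuous_intros)
next
  case (Suc j)
  show ?thesis unfolding Suc
  proof (rule Ck_on_SucI[OF assms(1), where f' = "\<lambda>x v. Q x v + Q v x"])
    show "((\<lambda>x. Q x x) has_derivative (\<lambda>v. Q x v + Q v x)) (at x)" for x
      using bounded_bilinear.FDERIV[OF assms(2), of "\<lambda>x. x" "\<lambda>x. x" x UNIV "\<lambda>x. x" "\<lambda>x. x"] by simp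
    show "Ck_on j U (\<lambda>x. Q x v + Q v x)" for v
      by (intro Ck_on_add assms(1) Ck_on_linear[OF assms(1) Ck_on_ident[OF assms(1)]]
         bounded_bilinear.bounded_linear_left[OF assms(2)] bounded_bilinear.bounded_linear_right[OF assms(2)])
  qed
qed

text \<open>\<open>z\<close> is the direction of the outer and \<open>v\<close> that of the inner
  differentiation, so the increment of the base point goes into the first slot when the derivative
  is expanded. Symmetry is proved in \<open>second_derivative_symmetric\<close>.\<close>

definition second_derivative ::
    "('a::euclidean_space \<Rightarrow> 'b::real_normed_vector) \<Rightarrow> 'a \<Rightarrow> 'a \<Rightarrow> 'a \<Rightarrow> 'b" where
  "second_derivative f u z v = frechet_derivative (\<lambda>x. frechet_derivative f (at x) v) (at u) z"

lemma linear_frechet_derivative: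
  "Ck_on (Suc k) U f \<Longrightarrow> u \<in> U \<Longrightarrow> linear (frechet_derivative f (at u))"
  using has_derivative_linear[OF Ck_on_has_derivative] by blast

lemma Ck_on_frechet: "Ck_on (Suc k) U f \<Longrightarrow> Ck_on k U (\<lambda>x. frechet_derivative f (at x) v)"
  by simp

text \<open>In the inner direction, the first derivative is linear at every point of the open set,
  and differentiating these identities at \<open>u\<close> preserves them. In the outer direction
  the map is itself a derivative.\<close>

lemma bilinear_second_derivative:
  fixes f :: "'a::euclidean_space \<Rightarrow> 'b::real_normed_vector"
  assumes f: "Ck_on (Suc (Suc k)) U f" and "open U" "u \<in> U"
  shows "bilinear (second_derivative f u)"
proof -
  note d = Ck_on_has_derivative[OF Ck_on_frechet[OF f] assms(3)]
  have lin: "linear (frechet_derivative f (at x))" if "x \<in> U" for x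
    using linear_frechet_derivative[OF f that] .
  have "linear (second_derivative f u z)" for z
  proof (rule linearI)
    fix v w
    have "((\<lambda>x. frechet_derivative f (at x) v + frechet_derivative f (at x) w) has_derivative
        (\<lambda>z. second_derivative f u z v + second_derivative f u z w)) (at u)"
      unfolding second_derivative_def by (intro has_derivative_add d)
    then have "frechet_derivative (\<lambda>x. frechet_derivative f (at x) v + frechet_derivative f (at x) w) (at u)
        = (\<lambda>z. second_derivative f u z v + second_derivative f u z w)"
      by (rule frechet_derivative_at[symmetric])
    moreover have "frechet_derivative (\<lambda>x. frechet_derivative f (at x) (v + w)) (at u) =
       frechet_derivative (\<lambda>x. frechet_derivative f (at x) v + frechet_derivative f (at x) w) (at u)"
      using lin by (intro frechet_derivative_cong_open[OF assms(2,3)]) (simp add: linear_add)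
    ultimately show "second_derivative f u z (v + w) = second_derivative f u z v + second_derivative f u z w"
      by (metis second_derivative_def)
  next
    fix c v
    have "((\<lambda>x. c *\<^sub>R frechet_derivative f (at x) v) has_derivative
        (\<lambda>z. c *\<^sub>R second_derivative f u z v)) (at u)"
      unfolding second_derivative_def by (intro has_derivative_scaleR_right d)
    then have "frechet_derivative (\<lambda>x. c *\<^sub>R frechet_derivative f (at x) v) (at u)
        = (\<lambda>z. c *\<^sub>R second_derivative f u z v)"
      by (rule frechet_derivative_at[symmetric])
    moreover have "frechet_derivative (\<lambda>x. frechet_derivative f (at x) (c *\<^sub>R v)) (at u) =
       frechet_derivative (\<lambda>x. c *\<^sub>R frechet_derivative f (at x) v) (at u)"
      using lin by (intro frechet_derivative_cong_open[OF assms(2,3)]) (simp add: linear_scale)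
    ultimately show "second_derivative f u z (c *\<^sub>R v) = c *\<^sub>R second_derivative f u z v"
      by (metis second_derivative_def)
  qed
  moreover have "linear (\<lambda>z. second_derivative f u z v)" for v
    unfolding second_derivative_def using has_derivative_linear[OF d] .
  ultimately show ?thesis by (simp add: bilinear_def)
qed

section \<open>Derivative bounds and Taylor remainders with constants uniform on compact convex
  sets\<close>

lemma frechet_derivative_bounded_on_compact:
  fixes f :: "'a::euclidean_space \<Rightarrow> 'b::real_normed_vector"
  assumes f: "Ck_on (Suc k) U f" and "compact V" "V \<subseteq> U"
  shows "\<exists>C\<ge>0. \<forall>u\<in>V. \<forall>v. norm (frechet_derivative f (at u) v) \<le> C * norm v"
proof -
  have "\<exists>C. \<forall>u\<in>V. norm (frechet_derivative f (at u) b) \<le> C" for b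
  proof -
    have "continuous_on V (\<lambda>u. frechet_derivative f (at u) b)"
      using Ck_on_continuous[OF Ck_on_frechet[OF f]] assms(3) continuous_on_subset by blast
    then have "bounded ((\<lambda>u. frechet_derivative f (at u) b) ` V)"
      using assms(2) compact_continuous_image compact_imp_bounded by blast
    then show ?thesis by (auto simp: bounded_iff)
  qed
  then obtain C where C: "\<And>b u. u \<in> V \<Longrightarrow> norm (frechet_derivative f (at u) b) \<le> C b"
    by metis
  define D where "D = (\<Sum>b\<in>Basis. \<bar>C b\<bar>)"
  have "norm (frechet_derivative f (at u) v) \<le> D * norm v" if "u \<in> V" for u v
  proof -
    have "frechet_derivative f (at u) v = (\<Sum>b\<in>Basis. (v \<bullet> b) *\<^sub>R frechet_derivative f (at u) b)"
      using linear_euclidean_expansion linear_frechet_derivative[OF f] assms(3) that by blast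
    also have "norm \<dots> \<le> (\<Sum>b\<in>Basis. norm v * \<bar>C b\<bar>)"
    proof (rule sum_norm_le)
      fix b :: 'a assume b: "b \<in> Basis"
      have "norm (frechet_derivative f (at u) b) \<le> \<bar>C b\<bar>" using C[OF that, of b] by linarith
      then show "norm ((v \<bullet> b) *\<^sub>R frechet_derivative f (at u) b) \<le> norm v * \<bar>C b\<bar>"
        unfolding norm_scaleR using Basis_le_norm[OF b, of v] by (intro mult_mono) auto
    qed
    also have "\<dots> = D * norm v" by (simp add: D_def sum_distrib_left mult.commute)
    finally show ?thesis .
  qed
  moreover have "D \<ge> 0" unfolding D_def by (auto intro: sum_nonneg)
  ultimately show ?thesis by blast
qed

lemma has_derivative_line:
  assumes "(f has_derivative f') (at (u + t *\<^sub>R z))"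
  shows "((\<lambda>t. f (u + t *\<^sub>R z)) has_derivative (\<lambda>s. s *\<^sub>R f' z)) (at t within S)"
proof -
  have "((\<lambda>t. f (u + t *\<^sub>R z)) has_derivative (\<lambda>s. f' (s *\<^sub>R z))) (at t within S)"
    by (rule has_derivative_compose[of "\<lambda>t. u + t *\<^sub>R z" "\<lambda>s. s *\<^sub>R z" t S f f'])
       (auto intro!: derivative_eq_intros assms)
  then show ?thesis using has_derivative_linear[OF assms] by (simp add: linear_scale)
qed

text \<open>The mean value inequality for a curve with velocity \<open>g' t\<close>. Taylor
  remainders along segments reduce to it once the Taylor polynomial in t has been subtracted from
  the curve.\<close>

lemma unit_interval_bound:
  fixes g :: "real \<Rightarrow> 'b::real_normed_vector"
  assumes "\<And>t. t \<in> {0..1} \<Longrightarrow> (g has_derivative (\<lambda>s. s *\<^sub>R g' t)) (at t within {0..1})"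
    and "\<And>t. t \<in> {0..1} \<Longrightarrow> norm (g' t) \<le> B"
  shows "norm (g 1 - g 0) \<le> B"
proof -
  have "0 \<le> B" using assms(2)[of 0] norm_ge_zero[of "g' 0"] by (simp del: norm_ge_zero)
  have "norm (g 1 - g 0) \<le> B * norm (1 - 0::real)"
  proof (rule differentiable_bound[of "{0..1::real}", OF _ assms(1)])
    show "onorm (\<lambda>s. s *\<^sub>R g' t) \<le> B" if "t \<in> {0..1}" for t
      using assms(2)[OF that] \<open>0 \<le> B\<close>
      by (intro onorm_bound) (auto simp: mult.commute[of B] intro: mult_left_mono)
  qed auto
  then show ?thesis by simp
qed

lemma lipschitz_on_compact_convex:
  fixes f :: "'a::euclidean_space \<Rightarrow> 'b::real_normed_vector"
  assumes f: "Ck_on (Suc k) U f" and "compact V" "convex V" "V \<subseteq> U"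
  shows "\<exists>C\<ge>0. \<forall>u\<in>V. \<forall>u'\<in>V. norm (f u - f u') \<le> C * norm (u - u')"
proof -
  obtain C where C: "C \<ge> 0" "\<And>u v. u \<in> V \<Longrightarrow> norm (frechet_derivative f (at u) v) \<le> C * norm v"
    using frechet_derivative_bounded_on_compact[OF f assms(2,4)] by blast
  have "norm (f u - f u') \<le> C * norm (u - u')" if "u \<in> V" "u' \<in> V" for u u'
  proof (rule differentiable_bound[OF assms(3) _ _ that])
    show "(f has_derivative frechet_derivative f (at x)) (at x within V)" if "x \<in> V" for x
      using Ck_on_has_derivative[OF f] that assms(4) by (meson has_derivative_at_withinI in_mono)
    show "onorm (frechet_derivative f (at x)) \<le> C" if "x \<in> V" for x
      using C that by (intro onorm_bound) auto
  qed
  then show ?thesis using C(1) by blast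
qed

text \<open>The derivative is Lipschitz on \<open>V\<close> in each basis direction, so along the
  segment from u to u' the curve minus its tangent has velocity O(|u' - u|^2). The point is that one
  \<open>C\<close> serves all pairs of points.\<close>

lemma taylor1_on_compact_convex:
  fixes f :: "'a::euclidean_space \<Rightarrow> 'b::real_normed_vector"
  assumes f: "Ck_on (Suc (Suc k)) U f" and "compact V" "convex V" "V \<subseteq> U"
  shows "\<exists>C\<ge>0. (\<forall>u\<in>V. \<forall>u'\<in>V. norm (f u' - f u - frechet_derivative f (at u) (u' - u)) \<le> C * norm (u' - u) ^ 2)
    \<and> (\<forall>u\<in>V. \<forall>u'\<in>V. \<forall>v. norm (frechet_derivative f (at u') v - frechet_derivative f (at u) v) \<le> C * norm (u' - u) * norm v)"
proof -
  have "\<exists>C\<ge>0. \<forall>u\<in>V. \<forall>u'\<in>V. norm (frechet_derivative f (at u) b - frechet_derivative f (at u') b) \<le> C * norm (u - u')" for b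
    using lipschitz_on_compact_convex[OF Ck_on_frechet[OF f] assms(2,3,4)] .
  then obtain C where C: "\<And>b. C b \<ge> 0" "\<And>b u u'. u \<in> V \<Longrightarrow> u' \<in> V \<Longrightarrow>
      norm (frechet_derivative f (at u) b - frechet_derivative f (at u') b) \<le> C b * norm (u - u')"
    by metis
  define D where "D = (\<Sum>b\<in>Basis. C b)"
  have D0: "D \<ge> 0" unfolding D_def using C(1) by (auto intro: sum_nonneg)
  have D: "norm (frechet_derivative f (at u') v - frechet_derivative f (at u) v) \<le> D * norm (u' - u) * norm v"
    if "u \<in> V" "u' \<in> V" for u u' v
  proof -
    have "frechet_derivative f (at u') v - frechet_derivative f (at u) v =
        (\<Sum>b\<in>Basis. (v \<bullet> b) *\<^sub>R (frechet_derivative f (at u') b - frechet_derivative f (at u) b))"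
      using linear_euclidean_expansion[OF linear_frechet_derivative[OF f], of u v]
       linear_euclidean_expansion[OF linear_frechet_derivative[OF f], of u' v]
       subsetD[OF assms(4) that(1)] subsetD[OF assms(4) that(2)]
      by (simp add: sum_subtractf scaleR_diff_right)
    also have "norm \<dots> \<le> (\<Sum>b\<in>Basis. norm v * (C b * norm (u' - u)))"
    proof (rule sum_norm_le)
      fix b :: 'a assume b: "b \<in> Basis"
      show "norm ((v \<bullet> b) *\<^sub>R (frechet_derivative f (at u') b - frechet_derivative f (at u) b)) \<le> norm v * (C b * norm (u' - u))"
        unfolding norm_scaleR using Basis_le_norm[OF b, of v] C that by (intro mult_mono) auto
    qed
    also have "\<dots> = D * norm (u' - u) * norm v"
      by (simp add: D_def sum_distrib_left sum_distrib_right mult_ac)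
    finally show ?thesis .
  qed
  have "norm (f u' - f u - frechet_derivative f (at u) (u' - u)) \<le> D * norm (u' - u) ^ 2"
    if u: "u \<in> V" "u' \<in> V" for u u'
  proof -
    have seg: "u + t *\<^sub>R (u' - u) \<in> V" if "t \<in> {0..1}" for t
      using convexD_alt[OF assms(3) u] that by (auto simp: algebra_simps)
    have "norm ((f (u + 1 *\<^sub>R (u' - u)) - 1 *\<^sub>R frechet_derivative f (at u) (u' - u))
      - (f (u + 0 *\<^sub>R (u' - u)) - 0 *\<^sub>R frechet_derivative f (at u) (u' - u))) \<le> D * norm (u' - u) ^ 2"
    proof (rule unit_interval_bound[where
        g = "\<lambda>t. f (u + t *\<^sub>R (u' - u)) - t *\<^sub>R frechet_derivative f (at u) (u' - u)"])
      fix t :: real assume t: "t \<in> {0..1}"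
      have "u + t *\<^sub>R (u' - u) \<in> U" using seg[OF t] assms(4) by auto
      note d = has_derivative_line[OF Ck_on_has_derivative[OF f this]]
      show "((\<lambda>t. f (u + t *\<^sub>R (u' - u)) - t *\<^sub>R frechet_derivative f (at u) (u' - u)) has_derivative
         (\<lambda>s. s *\<^sub>R (frechet_derivative f (at (u + t *\<^sub>R (u' - u))) (u' - u) - frechet_derivative f (at u) (u' - u)))) (at t within {0..1})"
        unfolding scaleR_diff_right[of _ "frechet_derivative f (at (u + t *\<^sub>R (u' - u))) (u' - u)"]
        by (intro has_derivative_diff d has_derivative_scaleR_left has_derivative_ident)
      have "norm (frechet_derivative f (at (u + t *\<^sub>R (u' - u))) (u' - u) - frechet_derivative f (at u) (u' - u))
        \<le> D * norm (u + t *\<^sub>R (u' - u) - u) * norm (u' - u)"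
        by (rule D[OF u(1) seg[OF t]])
      also have "\<dots> \<le> D * norm (u' - u) * norm (u' - u)"
        using t D0 by (intro mult_right_mono mult_left_mono) (auto intro: mult_left_le_one_le)
      finally show "norm (frechet_derivative f (at (u + t *\<^sub>R (u' - u))) (u' - u) - frechet_derivative f (at u) (u' - u)) \<le> D * norm (u' - u) ^ 2"
        by (simp add: power2_eq_square mult.assoc)
    qed
    then show ?thesis by (simp add: algebra_simps)
  qed
  with D D0 show ?thesis by blast
qed

text \<open>The second bound is the first-order estimate applied to the directional derivatives of
  \<open>f\<close>, and the first follows from it along segments. The last two are carried along so
  that a single \<open>C\<close> controls all the Taylor data consumed by a change of
  parameters.\<close>

lemma taylor2_on_compact_convex:
  fixes f :: "'a::euclidean_space \<Rightarrow> 'b::real_normed_vector"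
  assumes f: "Ck_on (Suc (Suc (Suc k))) U f" and "open U" "compact V" "convex V" "V \<subseteq> U"
  shows "\<exists>C\<ge>0. (\<forall>u\<in>V. \<forall>u'\<in>V. norm (f u' - f u - frechet_derivative f (at u) (u' - u)
        - (1/2) *\<^sub>R second_derivative f u (u' - u) (u' - u)) \<le> C * norm (u' - u) ^ 3)
    \<and> (\<forall>u\<in>V. \<forall>u'\<in>V. \<forall>v. norm (frechet_derivative f (at u') v - frechet_derivative f (at u) v
        - second_derivative f u (u' - u) v) \<le> C * norm (u' - u) ^ 2 * norm v)
    \<and> (\<forall>u\<in>V. \<forall>z v. norm (second_derivative f u z v) \<le> C * norm z * norm v)
    \<and> (\<forall>u\<in>V. \<forall>v. norm (frechet_derivative f (at u) v) \<le> C * norm v)"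
proof -
  have f2: "Ck_on (Suc (Suc k)) U f" using f Ck_on_SucD by blast
  have bil: "bilinear (second_derivative f u)" if "u \<in> V" for u
    using bilinear_second_derivative[OF f2 assms(2)] that assms(5) by auto
  have "\<exists>C\<ge>0. \<forall>u\<in>V. \<forall>z. norm (second_derivative f u z b) \<le> C * norm z" for b
    unfolding second_derivative_def
    using frechet_derivative_bounded_on_compact[OF Ck_on_frechet[OF f] assms(3,5)] .
  then obtain C1 where C1: "\<And>b. C1 b \<ge> 0" "\<And>b u z. u \<in> V \<Longrightarrow> norm (second_derivative f u z b) \<le> C1 b * norm z"
    by metis
  have "\<exists>C\<ge>0. \<forall>u\<in>V. \<forall>u'\<in>V. norm (frechet_derivative f (at u') b - frechet_derivative f (at u) b - second_derivative f u (u' - u) b)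
      \<le> C * norm (u' - u) ^ 2" for b
    unfolding second_derivative_def
    using taylor1_on_compact_convex[OF Ck_on_frechet[OF f] assms(3,4,5), of b] by blast
  then obtain C2 where C2: "\<And>b. C2 b \<ge> 0" "\<And>b u u'. u \<in> V \<Longrightarrow> u' \<in> V \<Longrightarrow>
      norm (frechet_derivative f (at u') b - frechet_derivative f (at u) b - second_derivative f u (u' - u) b) \<le> C2 b * norm (u' - u) ^ 2"
    by metis
  obtain C3 where C3: "C3 \<ge> 0" "\<And>u v. u \<in> V \<Longrightarrow> norm (frechet_derivative f (at u) v) \<le> C3 * norm v"
    using frechet_derivative_bounded_on_compact[OF f assms(3,5)] by blast
  define D1 where "D1 = (\<Sum>b\<in>Basis. C1 b)"
  define D2 where "D2 = (\<Sum>b\<in>Basis. C2 b)"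
  have pos: "D1 \<ge> 0" "D2 \<ge> 0" unfolding D1_def D2_def using C1(1) C2(1) by (auto intro: sum_nonneg)
  have D1: "norm (second_derivative f u z v) \<le> D1 * norm z * norm v" if "u \<in> V" for u z v
  proof -
    have "second_derivative f u z v = (\<Sum>b\<in>Basis. (v \<bullet> b) *\<^sub>R second_derivative f u z b)"
      using bil[OF that] linear_euclidean_expansion by (auto simp: bilinear_def)
    also have "norm \<dots> \<le> (\<Sum>b\<in>Basis. norm v * (C1 b * norm z))"
      unfolding norm_scaleR using C1 that Basis_le_norm[of _ v]
      by (intro sum_norm_le) (auto intro!: mult_mono)
    also have "\<dots> = D1 * norm z * norm v"
      by (simp add: D1_def sum_distrib_left sum_distrib_right mult_ac)
    finally show ?thesis .
  qed
  have D2: "norm (frechet_derivative f (at u') v - frechet_derivative f (at u) v - second_derivative f u (u' - u) v)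
      \<le> D2 * norm (u' - u) ^ 2 * norm v" if "u \<in> V" "u' \<in> V" for u u' v
  proof -
    have "second_derivative f u (u' - u) v = (\<Sum>b\<in>Basis. (v \<bullet> b) *\<^sub>R second_derivative f u (u' - u) b)"
      using bil[OF that(1)] linear_euclidean_expansion by (auto simp: bilinear_def)
    then have "frechet_derivative f (at u') v - frechet_derivative f (at u) v - second_derivative f u (u' - u) v =
       (\<Sum>b\<in>Basis. (v \<bullet> b) *\<^sub>R (frechet_derivative f (at u') b - frechet_derivative f (at u) b - second_derivative f u (u' - u) b))"
      using linear_euclidean_expansion[OF linear_frechet_derivative[OF f], of u v]
       linear_euclidean_expansion[OF linear_frechet_derivative[OF f], of u' v]
       subsetD[OF assms(5) that(1)] subsetD[OF assms(5) that(2)]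
      by (simp add: sum_subtractf scaleR_diff_right)
    also have "norm \<dots> \<le> (\<Sum>b\<in>Basis. norm v * (C2 b * norm (u' - u) ^ 2))"
      unfolding norm_scaleR using C2 that Basis_le_norm[of _ v]
      by (intro sum_norm_le) (auto intro!: mult_mono)
    also have "\<dots> = D2 * norm (u' - u) ^ 2 * norm v"
      by (simp add: D2_def sum_distrib_left sum_distrib_right mult_ac)
    finally show ?thesis .
  qed
  have T: "norm (f u' - f u - frechet_derivative f (at u) (u' - u)
        - (1/2) *\<^sub>R second_derivative f u (u' - u) (u' - u)) \<le> D2 * norm (u' - u) ^ 3"
    if u: "u \<in> V" "u' \<in> V" for u u'
  proof -
    define z where "z = u' - u"
    have seg: "u + t *\<^sub>R z \<in> V" if "t \<in> {0..1}" for t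
      using convexD_alt[OF assms(4) u] that by (auto simp: algebra_simps z_def)
    have "norm ((f (u + 1 *\<^sub>R z) - 1 *\<^sub>R frechet_derivative f (at u) z - (1\<^sup>2/2) *\<^sub>R second_derivative f u z z)
      - (f (u + 0 *\<^sub>R z) - 0 *\<^sub>R frechet_derivative f (at u) z - (0\<^sup>2/2) *\<^sub>R second_derivative f u z z)) \<le> D2 * norm z ^ 3"
    proof (rule unit_interval_bound[where
        g = "\<lambda>t. f (u + t *\<^sub>R z) - t *\<^sub>R frechet_derivative f (at u) z - (t\<^sup>2/2) *\<^sub>R second_derivative f u z z"])
      fix t :: real assume t: "t \<in> {0..1}"
      have "u + t *\<^sub>R z \<in> U" using seg[OF t] assms(5) by auto
      note d = has_derivative_line[OF Ck_on_has_derivative[OF f this]]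
      show "((\<lambda>t. f (u + t *\<^sub>R z) - t *\<^sub>R frechet_derivative f (at u) z - (t\<^sup>2/2) *\<^sub>R second_derivative f u z z) has_derivative
         (\<lambda>s. s *\<^sub>R (frechet_derivative f (at (u + t *\<^sub>R z)) z - frechet_derivative f (at u) z - second_derivative f u (t *\<^sub>R z) z)))
          (at t within {0..1})"
        using bil[OF u(1)]
        by (auto intro!: derivative_eq_intros d simp: scaleR_diff_right bilinear_lmul power2_eq_square algebra_simps)
      have "norm (frechet_derivative f (at (u + t *\<^sub>R z)) z - frechet_derivative f (at u) z - second_derivative f u (t *\<^sub>R z) z)
        \<le> D2 * norm (t *\<^sub>R z) ^ 2 * norm z"
        using D2[OF u(1) seg[OF t], of z] by simp
      also have "\<dots> \<le> D2 * norm z ^ 2 * norm z"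
        using t pos by (intro mult_right_mono mult_left_mono power_mono) (auto intro: mult_left_le_one_le)
      finally show "norm (frechet_derivative f (at (u + t *\<^sub>R z)) z - frechet_derivative f (at u) z - second_derivative f u (t *\<^sub>R z) z)
         \<le> D2 * norm z ^ 3"
        by (simp add: power2_eq_square power3_eq_cube mult.assoc)
    qed
    then show ?thesis by (simp add: z_def algebra_simps)
  qed
  define C where "C = D1 + D2 + C3"
  have le: "D1 \<le> C" "D2 \<le> C" "C3 \<le> C" "C \<ge> 0" using pos C3(1) by (auto simp: C_def)
  show ?thesis
  proof (intro exI[of _ C] conjI ballI allI)
    show "0 \<le> C" by fact
  next
    fix u u' assume "u \<in> V" "u' \<in> V"
    then show "norm (f u' - f u - frechet_derivative f (at u) (u' - u)
        - (1/2) *\<^sub>R second_derivative f u (u' - u) (u' - u)) \<le> C * norm (u' - u) ^ 3"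
      using T le(2) by (meson mult_right_mono norm_ge_zero order_trans zero_le_power)
  next
    fix u u' v assume "u \<in> V" "u' \<in> V"
    then show "norm (frechet_derivative f (at u') v - frechet_derivative f (at u) v
        - second_derivative f u (u' - u) v) \<le> C * norm (u' - u) ^ 2 * norm v"
      using D2 le(2) by (meson mult_right_mono norm_ge_zero order_trans zero_le_power)
  next
    fix u z v assume "u \<in> V"
    then show "norm (second_derivative f u z v) \<le> C * norm z * norm v"
      using D1 le(1) by (meson mult_right_mono norm_ge_zero order_trans)
  next
    fix u v assume "u \<in> V"
    then show "norm (frechet_derivative f (at u) v) \<le> C * norm v"
      using C3(2) le(3) by (meson mult_right_mono norm_ge_zero order_trans)
  qed
qed


lemma norm_le_linear_imp_zero:
  fixes x :: "'a::real_normed_vector"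
  assumes "\<And>t. 0 < t \<Longrightarrow> t < r \<Longrightarrow> norm x \<le> C * t" "r > 0"
  shows "x = 0"
proof -
  have "((\<lambda>t. C * t) \<longlongrightarrow> C * 0) (at_right (0::real))"
    by (intro tendsto_intros)
  moreover have "eventually (\<lambda>t. norm x \<le> C * t) (at_right 0)"
    using assms unfolding eventually_at_right_field by (metis add.left_neutral)
  ultimately have "norm x \<le> 0"
    using tendsto_lowerbound[of "\<lambda>t. C * t" "C * 0" "at_right (0::real)" "norm x"] by simp
  then show ?thesis by simp
qed

text \<open>The increment from u + tz to u + t(z + v) is computed twice: by integrating the
  expansion of the first derivative, which yields t^2 D2 z v, and as a difference of Taylor
  polynomials at u, which yields the symmetrized term. The results differ by O(t^3), so division by
  t^2 leaves a multiple of t.\<close>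

lemma second_derivative_symmetric:
  fixes f :: "'a::euclidean_space \<Rightarrow> 'b::real_normed_vector"
  assumes f: "Ck_on (Suc (Suc (Suc k))) U f" and U: "open U" "u \<in> U"
  shows "second_derivative f u z v = second_derivative f u v z"
proof -
  obtain r where r: "r > 0" "cball u r \<subseteq> U" using U open_contains_cball by blast
  have f2: "Ck_on (Suc (Suc k)) U f" using f Ck_on_SucD by blast
  note bil = bilinear_second_derivative[OF f2 U]
  note lin = linear_frechet_derivative[OF f U(2)]
  define D where "D = frechet_derivative f (at u)"
  define D2 where "D2 = second_derivative f u"
  obtain C where C: "C \<ge> 0"
    "\<And>u'. u' \<in> cball u r \<Longrightarrow> norm (f u' - f u - D (u' - u) - (1/2) *\<^sub>R D2 (u' - u) (u' - u)) \<le> C * norm (u' - u) ^ 3"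
    "\<And>u' v. u' \<in> cball u r \<Longrightarrow> norm (frechet_derivative f (at u') v - D v - D2 (u' - u) v) \<le> C * norm (u' - u) ^ 2 * norm v"
    using taylor2_on_compact_convex[OF f U(1) compact_cball convex_cball r(2)] r(1) unfolding D_def D2_def
    by (metis centre_in_cball less_imp_le)
  define N where "N = norm z + norm v"
  have main: "norm (D2 v z - D2 z v) \<le> (6 * C * N ^ 3) * t" if t: "0 < t" "t < r / (N + 1)" for t
  proof -
    have N0: "N \<ge> 0" "norm z \<le> N" "norm v \<le> N" "norm (z + v) \<le> N" by (auto simp: N_def norm_triangle_ineq)
    have tN: "t * N \<le> r"
    proof -
      have "t * N \<le> t * (N + 1)" using t by simp
      also have "\<dots> \<le> r" using t N0 by (simp add: field_simps)
      finally show ?thesis .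
    qed
    have in_ball: "u + t *\<^sub>R y \<in> cball u r" if "norm y \<le> N" for y
    proof -
      have "t * norm y \<le> t * N" using that t by (intro mult_left_mono) auto
      with tN have "t * norm y \<le> r" by linarith
      then show ?thesis using t by (simp add: dist_norm)
    qed
    have tay: "norm (f (u + t *\<^sub>R y) - f u - t *\<^sub>R D y - (t\<^sup>2/2) *\<^sub>R D2 y y) \<le> C * t ^ 3 * N ^ 3" if "norm y \<le> N" for y
    proof -
      have "f (u + t *\<^sub>R y) - f u - t *\<^sub>R D y - (t\<^sup>2/2) *\<^sub>R D2 y y =
         f (u + t *\<^sub>R y) - f u - D (t *\<^sub>R y) - (1/2) *\<^sub>R D2 (t *\<^sub>R y) (t *\<^sub>R y)"
        using lin bil by (simp add: D_def D2_def linear_scale bilinear_lmul bilinear_rmul power2_eq_square)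
      then have "norm (f (u + t *\<^sub>R y) - f u - t *\<^sub>R D y - (t\<^sup>2/2) *\<^sub>R D2 y y) \<le> C * norm (t *\<^sub>R y) ^ 3"
        using C(2)[OF in_ball[OF that]] by (simp only: add_diff_cancel_left')
      also have "\<dots> \<le> C * (t * N) ^ 3"
        using that t C(1) by (intro mult_left_mono power_mono) auto
      finally show ?thesis by (simp add: power_mult_distrib mult.assoc)
    qed
    have "norm ((f (u + t *\<^sub>R z + 1 *\<^sub>R (t *\<^sub>R v)) - 1 *\<^sub>R (D (t *\<^sub>R v) + D2 (t *\<^sub>R z) (t *\<^sub>R v)) - (1\<^sup>2/2) *\<^sub>R D2 (t *\<^sub>R v) (t *\<^sub>R v))
      - (f (u + t *\<^sub>R z + 0 *\<^sub>R (t *\<^sub>R v)) - 0 *\<^sub>R (D (t *\<^sub>R v) + D2 (t *\<^sub>R z) (t *\<^sub>R v)) - (0\<^sup>2/2) *\<^sub>R D2 (t *\<^sub>R v) (t *\<^sub>R v))) \<le> C * t ^ 3 * N ^ 3"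
    proof (rule unit_interval_bound[where g =
        "\<lambda>s. f (u + t *\<^sub>R z + s *\<^sub>R (t *\<^sub>R v)) - s *\<^sub>R (D (t *\<^sub>R v) + D2 (t *\<^sub>R z) (t *\<^sub>R v)) - (s\<^sup>2/2) *\<^sub>R D2 (t *\<^sub>R v) (t *\<^sub>R v)"])
      fix s :: real assume s: "s \<in> {0..1}"
      have "norm (z + s *\<^sub>R v) \<le> norm z + s * norm v" using norm_triangle_ineq[of z "s *\<^sub>R v"] s by simp
      also have "\<dots> \<le> N" unfolding N_def using s by (simp add: mult_left_le_one_le)
      finally have nz: "norm (z + s *\<^sub>R v) \<le> N" .
      have eq: "u + t *\<^sub>R z + s *\<^sub>R (t *\<^sub>R v) = u + t *\<^sub>R (z + s *\<^sub>R v)" by (simp add: algebra_simps)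
      have inb: "u + t *\<^sub>R z + s *\<^sub>R (t *\<^sub>R v) \<in> cball u r" unfolding eq by (rule in_ball[OF nz])
      note d = has_derivative_line[OF Ck_on_has_derivative[OF f subsetD[OF r(2) inb]]]
      show "((\<lambda>s. f (u + t *\<^sub>R z + s *\<^sub>R (t *\<^sub>R v)) - s *\<^sub>R (D (t *\<^sub>R v) + D2 (t *\<^sub>R z) (t *\<^sub>R v)) - (s\<^sup>2/2) *\<^sub>R D2 (t *\<^sub>R v) (t *\<^sub>R v))
        has_derivative (\<lambda>h. h *\<^sub>R (frechet_derivative f (at (u + t *\<^sub>R z + s *\<^sub>R (t *\<^sub>R v))) (t *\<^sub>R v) - D (t *\<^sub>R v)
            - D2 (t *\<^sub>R z + s *\<^sub>R (t *\<^sub>R v)) (t *\<^sub>R v)))) (at s within {0..1})"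
        by (rule derivative_eq_intros d refl | simp)+
          (use bil in \<open>simp add: fun_eq_iff D2_def bilinear_ladd bilinear_lmul bilinear_rmul power2_eq_square algebra_simps\<close>)
      have "norm (frechet_derivative f (at (u + t *\<^sub>R z + s *\<^sub>R (t *\<^sub>R v))) (t *\<^sub>R v) - D (t *\<^sub>R v)
            - D2 (t *\<^sub>R z + s *\<^sub>R (t *\<^sub>R v)) (t *\<^sub>R v)) \<le> C * norm (t *\<^sub>R (z + s *\<^sub>R v)) ^ 2 * norm (t *\<^sub>R v)"
        using C(3)[OF inb, of "t *\<^sub>R v"] by (simp add: algebra_simps)
      also have "\<dots> \<le> C * (t * N) ^ 2 * (t * N)"
        using nz N0 t C(1) by (intro mult_mono power_mono mult_left_mono) auto
      finally show "norm (frechet_derivative f (at (u + t *\<^sub>R z + s *\<^sub>R (t *\<^sub>R v))) (t *\<^sub>R v) - D (t *\<^sub>R v)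
            - D2 (t *\<^sub>R z + s *\<^sub>R (t *\<^sub>R v)) (t *\<^sub>R v)) \<le> C * t ^ 3 * N ^ 3"
        by (simp add: power2_eq_square power3_eq_cube mult_ac)
    qed
    then have e3: "norm (f (u + t *\<^sub>R (z + v)) - f (u + t *\<^sub>R z) - t *\<^sub>R D v - t\<^sup>2 *\<^sub>R D2 z v - (t\<^sup>2/2) *\<^sub>R D2 v v) \<le> C * t ^ 3 * N ^ 3"
      using bil lin by (simp add: D_def D2_def linear_scale bilinear_lmul bilinear_rmul power2_eq_square algebra_simps)
    note e1 = tay[OF N0(4)] and e2 = tay[OF N0(2)]
    have "(t\<^sup>2/2) *\<^sub>R (D2 v z - D2 z v) =
       (f (u + t *\<^sub>R (z + v)) - f (u + t *\<^sub>R z) - t *\<^sub>R D v - t\<^sup>2 *\<^sub>R D2 z v - (t\<^sup>2/2) *\<^sub>R D2 v v)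
       + (f (u + t *\<^sub>R z) - f u - t *\<^sub>R D z - (t\<^sup>2/2) *\<^sub>R D2 z z)
       - (f (u + t *\<^sub>R (z + v)) - f u - t *\<^sub>R D (z + v) - (t\<^sup>2/2) *\<^sub>R D2 (z + v) (z + v))"
    proof -
      have a: "D2 (z + v) (z + v) = D2 z z + D2 z v + D2 v z + D2 v v" "D (z + v) = D z + D v"
        using bil lin by (simp_all add: D2_def D_def bilinear_ladd bilinear_radd linear_add)
      have half: "t\<^sup>2 *\<^sub>R D2 z v = (t\<^sup>2/2) *\<^sub>R D2 z v + (t\<^sup>2/2) *\<^sub>R D2 z v"
        by (simp flip: scaleR_left_distrib)
      show ?thesis unfolding a half by (simp add: algebra_simps)
    qed
    also have "norm \<dots> \<le> C * t ^ 3 * N ^ 3 + C * t ^ 3 * N ^ 3 + C * t ^ 3 * N ^ 3"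
      by (intro order_trans[OF norm_triangle_ineq4] order_trans[OF norm_triangle_ineq] add_mono e1 e2 e3)
    finally have "(t\<^sup>2/2) * norm (D2 v z - D2 z v) \<le> 3 * (C * t ^ 3 * N ^ 3)" by (simp add: mult_ac)
    also have "3 * (C * t ^ 3 * N ^ 3) = (t\<^sup>2/2) * ((6 * C * N ^ 3) * t)"
      by (simp add: power2_eq_square power3_eq_cube)
    finally have "(t\<^sup>2/2) * norm (D2 v z - D2 z v) \<le> (t\<^sup>2/2) * ((6 * C * N ^ 3) * t)" .
    then show ?thesis by (rule mult_left_le_imp_le) (use t in simp)
  qed
  have "N \<ge> 0" by (simp add: N_def)
  then have "D2 v z - D2 z v = 0" using norm_le_linear_imp_zero[OF main] r(1) by simp
  then show ?thesis by (simp add: D2_def)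
qed

section \<open>Normal charts\<close>

text \<open>The same \<open>K\<close> bounds the value, the linear coefficient and the remainder, so
  that uniformity over base points becomes a statement about one real number in which the predicate
  is monotone.\<close>

definition jet1 :: "real \<Rightarrow> real \<Rightarrow> ('a::euclidean_space \<Rightarrow> real) \<Rightarrow> bool" where
  "jet1 r K F \<longleftrightarrow> \<bar>F 0\<bar> \<le> K \<and>
     (\<exists>a. linear a \<and> (\<forall>w. \<bar>a w\<bar> \<le> K * norm w) \<and>
        (\<forall>w\<in>ball 0 r. \<bar>F w - F 0 - a w\<bar> \<le> K * norm w ^ 2))"

text \<open>The form \<open>s\<close> may be asymmetric; the function determines it on the diagonal,
  which is enough for its trace.\<close>

definition jet2 :: "real \<Rightarrow> real \<Rightarrow> ('a::euclidean_space \<Rightarrow> real) \<Rightarrow> bool" where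
  "jet2 r K F \<longleftrightarrow> \<bar>F 0\<bar> \<le> K \<and>
     (\<exists>a s. linear a \<and> bilinear s \<and> (\<forall>w. \<bar>a w\<bar> \<le> K * norm w) \<and>
        (\<forall>w v. \<bar>s w v\<bar> \<le> K * norm w * norm v) \<and>
        (\<forall>w\<in>ball 0 r. \<bar>F w - F 0 - a w - s w w / 2\<bar> \<le> K * norm w ^ 3))"

lemma inner_of_norm_preserving:
  assumes "linear f" "\<And>v. norm (f v) = norm v"
  shows "f v \<bullet> f w = v \<bullet> (w :: 'a::real_inner)"
  using assms by (simp add: dot_norm flip: linear_add)

lemma norm_adjoint_isometry_le:
  fixes E :: "'a::euclidean_space \<Rightarrow> 'b::euclidean_space"
  assumes "linear E" "\<And>v. norm (E v) = norm v"
  shows "norm (adjoint E y) \<le> norm y"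
proof -
  have "norm (adjoint E y) ^ 2 = E (adjoint E y) \<bullet> y"
    using adjoint_works[OF assms(1), of "adjoint E y" y] by (simp add: dot_square_norm)
  also have "\<dots> \<le> norm (adjoint E y) * norm y"
    using norm_cauchy_schwarz[of "E (adjoint E y)" y] by (simp add: assms(2))
  finally show ?thesis by (cases "norm (adjoint E y) = 0") (auto simp: power2_eq_square)
qed

text \<open>For an isometric embedding \<open>E\<close> the adjoint reads off the coordinates of the
  orthogonal projection onto the range; it serves as the left inverse of \<open>E\<close>
  throughout.\<close>

lemma adjoint_isometry:
  fixes E :: "'a::euclidean_space \<Rightarrow> 'b::euclidean_space"
  assumes "linear E" "\<And>v. norm (E v) = norm v"
  shows "adjoint E (E v) = v"
proof -
  have "w \<bullet> adjoint E (E v) = w \<bullet> v" for w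
    using adjoint_works[OF assms(1)] inner_of_norm_preserving[OF assms] by metis
  then show ?thesis using vector_eq_ldot by blast
qed

text \<open>The derivative of \<psi> - E has norm at most 1/4 on a convex set. The conclusion gives
  injectivity and two-sided distance bounds at the same time.\<close>

lemma near_isometry_on_ball:
  fixes \<psi> :: "'a::euclidean_space \<Rightarrow> 'b::euclidean_space"
  assumes "linear E" "\<And>w. w \<in> ball 0 r \<Longrightarrow> (\<psi> has_derivative \<psi>' w) (at w)"
    and "\<And>w v. w \<in> ball 0 r \<Longrightarrow> norm (\<psi>' w v - E v) \<le> norm v / 4"
    and "w \<in> ball 0 r" "w' \<in> ball 0 r"
  shows "norm (\<psi> w - \<psi> w' - E (w - w')) \<le> norm (w - w') / 4"
proof -
  have "norm ((\<psi> w - E w) - (\<psi> w' - E w')) \<le> (1/4) * norm (w - w')"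
  proof (rule differentiable_bound[OF convex_ball _ _ assms(4,5)])
    show "((\<lambda>w. \<psi> w - E w) has_derivative (\<lambda>v. \<psi>' w v - E v)) (at w within ball 0 r)" if "w \<in> ball 0 r" for w
      using assms(2)[OF that] assms(1)
      by (intro has_derivative_diff linear_imp_has_derivative) (auto intro: has_derivative_at_withinI)
    show "onorm (\<lambda>v. \<psi>' w v - E v) \<le> 1/4" if "w \<in> ball 0 r" for w
      using assms(3)[OF that] by (intro onorm_bound) auto
  qed
  then show ?thesis using assms(1) by (simp add: linear_diff algebra_simps)
qed

lemma bilinear_linear_compose: "bilinear h \<Longrightarrow> linear f \<Longrightarrow> bilinear (\<lambda>x y. f (h x y))"
  unfolding bilinear_def using linear_compose[of "h x" f for x] linear_compose[of "\<lambda>x. h x y" f for y]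
  by (simp add: o_def)

lemma abs_remainder_le:
  "\<bar>x\<bar> \<le> x' \<Longrightarrow> \<bar>p\<bar> \<le> p' \<Longrightarrow> \<bar>q\<bar> \<le> q' \<Longrightarrow> \<bar>r\<bar> \<le> r' \<Longrightarrow> r' \<le> r'' \<Longrightarrow>
    \<bar>x + (p + q + r) / 2\<bar> \<le> x' + (p' + q' + r'') / (2::real)"
  unfolding abs_le_iff by (elim conjE, intro conjI) (simp_all add: field_simps)

text \<open>\<open>E\<close> is an orthonormal frame of the tangent space at \<open>x\<close> and
  \<open>B\<close> the second fundamental form in this frame: as in geodesic normal coordinates
  there is no tangential quadratic term. \<open>cover\<close> also says that no other sheet of
  \<open>M\<close> comes within \<open>r0\<close> of \<open>x\<close>. The smallness of
  \<open>C * r1\<close> keeps the error terms on the ball a small fraction of the main term.\<close>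

locale normal_chart =
  fixes M :: "(real^'m) set" and r0 r1 C :: real and x :: "real^'m"
    and \<psi> :: "real^'d \<Rightarrow> real^'m" and E :: "real^'d \<Rightarrow> real^'m" and B :: "real^'d \<Rightarrow> real^'d \<Rightarrow> real^'m"
  assumes r0: "0 < r0" and r1: "0 < r1" "r1 \<le> 1" and C: "0 \<le> C" "16 * C * r1 \<le> 1"
    and param: "local_parametrization M (ball 0 r1) \<psi>" and center: "\<psi> 0 = x"
    and cover: "M \<inter> ball x r0 \<subseteq> \<psi> ` ball 0 r1"
    and linE: "linear E" and normE: "norm (E v) = norm v"
    and bilB: "bilinear B" and normalB: "E u \<bullet> B w v = 0" and B_bound: "norm (B w v) \<le> C * norm w * norm v"
    and derivative_expansion: "w \<in> ball 0 r1 \<Longrightarrow>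
      norm (frechet_derivative \<psi> (at w) v - E v - B w v) \<le> C * norm w ^ 2 * norm v"

text \<open>Data of an arbitrary parametrization at one base point \<open>u\<close>:
  \<open>E\<close> maps isometrically onto the tangent space, and \<open>A\<close> is the linear
  change of parameters that turns the differential into \<open>E\<close>. \<open>C1\<close> and
  \<open>a0\<close> are the bounds that compactness will make independent of
  \<open>u\<close>.\<close>

locale chart_model =
  fixes M :: "(real^'m) set" and U and \<phi> :: "real^'d \<Rightarrow> real^'m" and u :: "real^'d" and s C1 a0 :: real
    and A :: "real^'d \<Rightarrow> real^'d" and E :: "real^'d \<Rightarrow> real^'m"
  assumes param: "local_parametrization M U \<phi>" and s: "0 < s" "cball u s \<subseteq> U"
    and C1: "1 \<le> C1" and a0: "1 \<le> a0"
    and linE: "linear E" and normE: "norm (E v) = norm v"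
    and linA: "linear A" and A_bound: "norm (A v) \<le> a0 * norm v"
    and DA: "frechet_derivative \<phi> (at u) (A v) = E v"
    and E_range: "range (frechet_derivative \<phi> (at u)) \<subseteq> range E"
    and tay: "norm z \<le> s \<Longrightarrow> norm (frechet_derivative \<phi> (at (u + z)) v - frechet_derivative \<phi> (at u) v
        - second_derivative \<phi> u z v) \<le> C1 * norm z ^ 2 * norm v"
    and D2_bound: "norm (second_derivative \<phi> u z v) \<le> C1 * norm z * norm v"
    and D_bound: "norm (frechet_derivative \<phi> (at u) v) \<le> C1 * norm v"
begin

text \<open>The map w -> Q w w has derivative 2 Q w v, and the differential of \<phi> sends this to
  minus the tangential part of the second derivative. The quadratic change of parameters therefore
  cancels exactly that part and leaves the normal rest \<open>B\<close>.\<close>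

definition Q :: "real^'d \<Rightarrow> real^'d \<Rightarrow> real^'d" where
  "Q w v = (- 1/2) *\<^sub>R A (adjoint E (second_derivative \<phi> u (A w) (A v)))"

definition q :: "real^'d \<Rightarrow> real^'d" where "q w = A w + Q w w"

definition \<psi> :: "real^'d \<Rightarrow> real^'m" where "\<psi> w = \<phi> (u + q w)"

definition B :: "real^'d \<Rightarrow> real^'d \<Rightarrow> real^'m" where
  "B w v = second_derivative \<phi> u (A w) (A v) - E (adjoint E (second_derivative \<phi> u (A w) (A v)))"

text \<open>Dominates \<open>A\<close>, twice \<open>Q\<close>, and on the unit ball also their
  combination \<open>q\<close>: one number measures the whole change of parameters.\<close>

definition b :: real where "b = a0 + a0 ^ 3 * C1"

lemma smooth: "Ck_on k U \<phi>" and openU: "open U" and uU: "u \<in> U"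
  using param s by (auto simp: local_parametrization_def smooth_on_def)

lemma inj_derivative: "w \<in> U \<Longrightarrow> inj (frechet_derivative \<phi> (at w))"
  using param by (auto simp: local_parametrization_def)

lemma derivative_phi: "w \<in> U \<Longrightarrow> (\<phi> has_derivative frechet_derivative \<phi> (at w)) (at w)"
  using Ck_on_has_derivative[OF smooth] by blast

lemma linD: "linear (frechet_derivative \<phi> (at u))"
  by (rule has_derivative_linear[OF derivative_phi[OF uU]])

lemma bilD2: "bilinear (second_derivative \<phi> u)"
  by (rule bilinear_second_derivative[OF smooth openU uU])

lemma symD2: "second_derivative \<phi> u z v = second_derivative \<phi> u v z"
  by (rule second_derivative_symmetric[OF smooth openU uU])

lemma linE': "linear (adjoint E)" by (rule adjoint_linear[OF linE])

lemma adjE: "norm (adjoint E y) \<le> norm y" by (rule norm_adjoint_isometry_le[OF linE normE])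

lemma bilinear_D2A: "bilinear (\<lambda>w v. second_derivative \<phi> u (A w) (A v))"
  using bilD2 linA unfolding bilinear_def by (auto intro: linear_compose[unfolded o_def])

lemma bilQ: "bilinear Q"
  unfolding Q_def[abs_def]
  by (intro bilinear_linear_compose[OF bilinear_linear_compose[OF bilinear_D2A linE'], where f = "\<lambda>y. (- 1/2) *\<^sub>R A y"]
     linear_compose_scale_right linA)

lemma bilB: "bilinear B"
proof -
  have "linear (\<lambda>y. y - E (adjoint E y))"
    using linear_compose[OF linE' linE] by (intro linear_compose_sub linear_ident) (simp add: o_def)
  from bilinear_linear_compose[OF bilinear_D2A this] show ?thesis unfolding B_def[abs_def] .
qed

lemma symQ: "Q w v = Q v w"
  unfolding Q_def using symD2 by metis

lemma D2A_bound: "norm (second_derivative \<phi> u (A w) (A v)) \<le> C1 * a0 ^ 2 * norm w * norm v"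
proof -
  have "norm (second_derivative \<phi> u (A w) (A v)) \<le> C1 * norm (A w) * norm (A v)" by (rule D2_bound)
  also have "\<dots> \<le> C1 * (a0 * norm w) * (a0 * norm v)"
    using A_bound C1 a0 by (intro mult_mono mult_nonneg_nonneg) auto
  finally show ?thesis by (simp add: power2_eq_square mult_ac)
qed

lemma Q_bound: "2 * norm (Q w v) \<le> C1 * a0 ^ 3 * norm w * norm v"
proof -
  have "2 * norm (Q w v) = norm (A (adjoint E (second_derivative \<phi> u (A w) (A v))))"
    by (simp add: Q_def)
  also have "\<dots> \<le> a0 * norm (second_derivative \<phi> u (A w) (A v))"
    using A_bound adjE a0 by (meson mult_left_mono order_trans zero_le_one)
  also have "\<dots> \<le> a0 * (C1 * a0 ^ 2 * norm w * norm v)"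
    using D2A_bound a0 by (intro mult_left_mono) auto
  finally show ?thesis by (simp add: power2_eq_square power3_eq_cube mult_ac)
qed

lemma b_ge: "1 \<le> b" "a0 \<le> b" "a0 ^ 3 * C1 \<le> b"
  using a0 C1 by (auto simp: b_def intro: add_increasing2)

lemma A_bound': "norm (A v) \<le> b * norm v"
  using A_bound[of v] b_ge(2) mult_right_mono[of a0 b "norm v"] by simp

lemma Q_bound': "2 * norm (Q w v) \<le> b * norm w * norm v"
proof -
  have "C1 * a0 ^ 3 * norm w * norm v \<le> b * norm w * norm v"
    using b_ge(3) by (intro mult_right_mono) (auto simp: mult.commute)
  then show ?thesis using Q_bound[of w v] by linarith
qed

lemma q_bound: "norm w \<le> 1 \<Longrightarrow> norm (q w) \<le> b * norm w"
proof -
  assume w: "norm w \<le> 1"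
  have "norm (q w) \<le> norm (A w) + norm (Q w w)" unfolding q_def by (rule norm_triangle_ineq)
  also have "\<dots> \<le> a0 * norm w + C1 * a0 ^ 3 * norm w * norm w"
    using A_bound[of w] Q_bound[of w w] norm_ge_zero[of "Q w w"] by linarith
  also have "\<dots> \<le> a0 * norm w + C1 * a0 ^ 3 * norm w * 1"
    using w a0 C1 by (intro add_left_mono mult_left_mono) auto
  finally show ?thesis by (simp add: b_def algebra_simps)
qed

text \<open>Both sides have the same image under the injective differential, because that image lies
  in the range of \<open>E\<close>, where \<open>adjoint E\<close> inverts \<open>E\<close>.\<close>

lemma A_right_inverse: "A (adjoint E (frechet_derivative \<phi> (at u) z)) = z"
proof -
  obtain y where y: "frechet_derivative \<phi> (at u) z = E y" using E_range by auto
  have "frechet_derivative \<phi> (at u) (A (adjoint E (frechet_derivative \<phi> (at u) z))) = frechet_derivative \<phi> (at u) z"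
    by (simp add: DA adjoint_isometry[OF linE normE] y)
  then show ?thesis by (rule injD[OF inj_derivative[OF uU]])
qed

lemma derivative_q: "(q has_derivative (\<lambda>v. A v + 2 *\<^sub>R Q w v)) (at w)"
proof -
  have bb: "bounded_bilinear Q" using bilQ by (simp add: bilinear_conv_bounded_bilinear)
  have "((\<lambda>w. Q w w) has_derivative (\<lambda>v. Q w v + Q v w)) (at w)"
    using bb bounded_bilinear.FDERIV[of Q "\<lambda>x. x" "\<lambda>x. x" w UNIV "\<lambda>x. x" "\<lambda>x. x"] by simp
  then have "((\<lambda>w. A w + Q w w) has_derivative (\<lambda>v. A v + (Q w v + Q v w))) (at w)"
    using linA by (intro has_derivative_add linear_imp_has_derivative)
  then show ?thesis unfolding q_def[abs_def] symQ[of _ w] by (simp add: scaleR_2)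
qed

text \<open>Three errors occur in \<open>derivative_expansion\<close>: a Taylor remainder of size C1
  b^3 and two values of the second derivative of size C1 b^2 each. As b \<ge> 1, all three are at
  most C1 b^3.\<close>

definition C :: real where "C = 3 * C1 * b ^ 3"

lemma C_ge: "3 \<le> C" "C1 * a0 ^ 2 \<le> C" "2 * C1 * a0\<^sup>2 \<le> C" "C1 * b ^ 2 \<le> C"
proof -
  have p: "1 \<le> b ^ 3" "a0 ^ 2 \<le> b ^ 2" "b ^ 2 \<le> b ^ 3"
    using b_ge a0 by (auto intro: power_mono power_increasing)
  have "1 * 1 \<le> C1 * b ^ 3" using C1 p by (intro mult_mono) auto
  then show "3 \<le> C" by (simp add: C_def)
  have a: "C1 * a0 ^ 2 \<le> C1 * b ^ 3" "C1 * b ^ 2 \<le> C1 * b ^ 3" using C1 p by (auto intro: mult_left_mono)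
  have "0 \<le> C1 * b ^ 3" using C1 b_ge(1) by simp
  then show "C1 * a0 ^ 2 \<le> C" "2 * C1 * a0\<^sup>2 \<le> C" "C1 * b ^ 2 \<le> C" using a unfolding C_def by linarith+
qed

lemma B_bound: "norm (B w v) \<le> C * norm w * norm v"
proof -
  let ?y = "second_derivative \<phi> u (A w) (A v)"
  have "norm (B w v) \<le> norm ?y + norm (E (adjoint E ?y))" unfolding B_def by (rule norm_triangle_ineq4)
  also have "\<dots> \<le> 2 * norm ?y" using adjE[of ?y] by (simp add: normE)
  also have "\<dots> \<le> 2 * (C1 * a0 ^ 2 * norm w * norm v)" using D2A_bound by (intro mult_left_mono) auto
  also have "\<dots> \<le> C * norm w * norm v" using C_ge(3) mult_right_mono[of "2 * C1 * a0\<^sup>2" C "norm w * norm v"]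
    by (simp add: mult_ac)
  finally show ?thesis .
qed

lemma normalB: "E z \<bullet> B w v = 0"
  unfolding B_def inner_diff_right inner_of_norm_preserving[OF linE normE] adjoint_works[OF linE] by simp

lemma derivative_psi:
  assumes "norm w \<le> 1" "b * norm w \<le> s"
  shows "(\<psi> has_derivative (\<lambda>v. frechet_derivative \<phi> (at (u + q w)) (A v + 2 *\<^sub>R Q w v))) (at w)"
proof -
  have "u + q w \<in> U" using s assms q_bound[of w] by (auto intro!: subsetD[OF s(2)] simp: dist_norm)
  moreover have "((\<lambda>w. u + q w) has_derivative (\<lambda>v. A v + 2 *\<^sub>R Q w v)) (at w)"
    using has_derivative_add[OF has_derivative_const derivative_q, of u w] by simp
  ultimately show ?thesis unfolding \<psi>_def[abs_def]
    by (intro has_derivative_compose[where g = \<phi> and f = "\<lambda>w. u + q w"] derivative_phi)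
qed

text \<open>The first-order term applied to 2 Q w v removes the tangential part of D2(A w)(A v).
  Beyond \<open>E v + B w v\<close> there remain the Taylor remainder, D2(Q w w)(A v) and D2(q w)(2
  Q w v), each with two factors w.\<close>

lemma derivative_expansion:
  assumes w: "norm w \<le> 1" "b * norm w \<le> s"
  shows "norm (frechet_derivative \<psi> (at w) v - E v - B w v) \<le> C * norm w ^ 2 * norm v"
proof -
  let ?D = "frechet_derivative \<phi> (at u)" and ?D2 = "second_derivative \<phi> u" and ?y = "A v + 2 *\<^sub>R Q w v"
  have fd: "frechet_derivative \<psi> (at w) v = frechet_derivative \<phi> (at (u + q w)) ?y"
    by (simp add: frechet_derivative_at[OF derivative_psi[OF w], symmetric])
  have DQ: "?D (2 *\<^sub>R Q w v) = - E (adjoint E (?D2 (A w) (A v)))"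
    using linD by (simp add: Q_def DA linear_scale linear_neg)
  have eq: "frechet_derivative \<phi> (at (u + q w)) ?y - E v - B w v =
     (frechet_derivative \<phi> (at (u + q w)) ?y - ?D ?y - ?D2 (q w) ?y) + (?D2 (Q w w) (A v) + ?D2 (q w) (2 *\<^sub>R Q w v))"
  proof -
    have "?D ?y = E v - E (adjoint E (?D2 (A w) (A v)))"
      using linD DQ by (simp add: linear_add DA)
    moreover have "?D2 (q w) ?y = ?D2 (A w) (A v) + ?D2 (Q w w) (A v) + ?D2 (q w) (2 *\<^sub>R Q w v)"
      using bilD2 by (simp add: q_def bilinear_ladd bilinear_radd)
    ultimately show ?thesis unfolding B_def by (simp add: algebra_simps)
  qed
  have "norm (frechet_derivative \<phi> (at (u + q w)) ?y - E v - B w v) \<le> C1 * norm (q w) ^ 2 * norm ?y + (C1 * norm (Q w w) * norm (A v) + C1 * norm (q w) * norm (2 *\<^sub>R Q w v))"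
    unfolding eq using q_bound[OF w(1)] w(2)
    by (intro order_trans[OF norm_triangle_ineq] add_mono tay D2_bound) simp
  also have "\<dots> \<le> C1 * (b * norm w) ^ 2 * (b * norm v) + (C1 * (b * norm w * norm w) * (b * norm v)
     + C1 * (b * norm w) * (b * norm w * norm v))"
  proof -
    have "norm ?y \<le> norm (A v) + 2 * norm (Q w v)"
      using norm_triangle_ineq[of "A v" "2 *\<^sub>R Q w v"] by simp
    also have "\<dots> \<le> a0 * norm v + C1 * a0 ^ 3 * norm w * norm v" using A_bound[of v] Q_bound[of w v] by linarith
    also have "\<dots> \<le> a0 * norm v + C1 * a0 ^ 3 * 1 * norm v"
      using w a0 C1 by (intro add_left_mono mult_right_mono mult_left_mono) auto
    finally have y: "norm ?y \<le> b * norm v" by (simp add: b_def algebra_simps)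
    have Q1: "norm (Q w w) \<le> b * norm w * norm w" using Q_bound'[of w w] norm_ge_zero[of "Q w w"] by linarith
    show ?thesis
      using y Q1 Q_bound'[of w v] A_bound'[of v] q_bound[OF w(1)] C1 b_ge
      by (intro add_mono mult_mono power_mono mult_nonneg_nonneg) auto
  qed
  also have "\<dots> = C1 * (b ^ 3 + 2 * b ^ 2) * (norm w ^ 2 * norm v)"
    by (simp add: power2_eq_square power3_eq_cube algebra_simps)
  also have "\<dots> \<le> C * (norm w ^ 2 * norm v)"
  proof (rule mult_right_mono)
    have "b ^ 2 \<le> b ^ 3" using b_ge by (intro power_increasing) auto
    then have "C1 * (b ^ 3 + 2 * b ^ 2) \<le> C1 * (3 * b ^ 3)" using C1 by (intro mult_left_mono) auto
    then show "C1 * (b ^ 3 + 2 * b ^ 2) \<le> C" by (simp add: C_def)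
  qed simp
  finally show ?thesis using fd by (simp add: mult.assoc)
qed

context
  fixes r1 :: real
  assumes r1: "0 < r1" "r1 \<le> 1" "b * r1 \<le> s" "16 * C * r1 \<le> 1"
begin

lemma in_ball: "w \<in> cball 0 r1 \<Longrightarrow> norm w \<le> 1 \<and> b * norm w \<le> s"
proof -
  assume "w \<in> cball 0 r1"
  then have "norm w \<le> r1" by simp
  moreover from this have "b * norm w \<le> b * r1" using b_ge by (intro mult_left_mono) auto
  ultimately show ?thesis using r1(2,3) by linarith
qed

lemma qU: "w \<in> cball 0 r1 \<Longrightarrow> u + q w \<in> cball u s"
  using in_ball q_bound[of w] by (fastforce simp: dist_norm)

lemma psi_near_isometry:
  assumes "w \<in> ball 0 r1" "w' \<in> ball 0 r1"
  shows "norm (\<psi> w - \<psi> w' - E (w - w')) \<le> norm (w - w') / 4"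
proof (rule near_isometry_on_ball[OF linE _ _ assms])
  fix w :: "real^'d" assume w: "w \<in> ball 0 r1"
  then have w1: "norm w \<le> 1" "b * norm w \<le> s" using in_ball[of w] by auto
  show d: "(\<psi> has_derivative frechet_derivative \<psi> (at w)) (at w)"
    using derivative_psi[OF w1] frechet_derivative_at[OF derivative_psi[OF w1]] by simp
  fix v
  have "norm (frechet_derivative \<psi> (at w) v - E v) \<le> norm (frechet_derivative \<psi> (at w) v - E v - B w v) + norm (B w v)"
    using norm_triangle_ineq[of "frechet_derivative \<psi> (at w) v - E v - B w v" "B w v"] by simp
  also have "\<dots> \<le> C * norm w ^ 2 * norm v + C * norm w * norm v"
    by (intro add_mono derivative_expansion w1 B_bound)
  also have "\<dots> \<le> (C * r1 + C * r1) * norm v"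
  proof -
    have "norm w ^ 2 \<le> r1" using w r1 w1 mult_left_le[of "norm w" "norm w"] by (simp add: power2_eq_square)
    then have "C * norm w ^ 2 * norm v \<le> C * r1 * norm v" "C * norm w * norm v \<le> C * r1 * norm v"
      using w C_ge(1) by (auto intro!: mult_right_mono mult_left_mono)
    then show ?thesis by (simp add: algebra_simps)
  qed
  also have "\<dots> \<le> (1/4) * norm v" using r1(4) by (intro mult_right_mono) (linarith, simp)
  finally show "norm (frechet_derivative \<psi> (at w) v - E v) \<le> norm v / 4" by simp
qed

lemma psi_inj: "inj_on \<psi> (ball 0 r1)"
proof (rule inj_onI)
  fix w w' :: "real^'d" assume w: "w \<in> ball 0 r1" "w' \<in> ball 0 r1" "\<psi> w = \<psi> w'"
  then show "w = w'" using psi_near_isometry[OF w(1,2)] by (simp add: normE)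
qed

lemma q_inj: "inj_on q (ball 0 r1)"
  using psi_inj by (auto simp: inj_on_def \<psi>_def)

lemma Ck_q: "Ck_on k (ball 0 r1) (\<lambda>w. u + q w)"
  unfolding q_def[abs_def]
  using linA bilQ
  by (intro Ck_on_add Ck_on_const Ck_on_quadratic Ck_on_linear[OF _ Ck_on_ident])
    (auto simp: linear_conv_bounded_linear bilinear_conv_bounded_bilinear)

lemma psi_smooth: "smooth_on (ball 0 r1) \<psi>"
  unfolding smooth_on_def \<psi>_def[abs_def]
  using s(2) qU by (intro allI Ck_on_compose[OF _ Ck_q smooth]) auto

text \<open>Invariance of domain for the injective change of parameters and the homeomorphism \<phi>
  make the image open in \<open>M\<close>. The differential stays injective because on this ball it
  differs from the isometry \<open>E\<close> by at most a quarter.\<close>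

lemma psi_param: "local_parametrization M (ball 0 r1) \<psi>"
proof -
  obtain \<theta> where \<theta>: "homeomorphism U (\<phi> ` U) \<phi> \<theta>" and opU: "openin (top_of_set M) (\<phi> ` U)"
    using param by (auto simp: local_parametrization_def)
  define g where "g w = u + q w" for w
  have sub: "g ` ball 0 r1 \<subseteq> U" using qU s(2) by (auto simp: g_def)
  have contg: "continuous_on (ball 0 r1) g" using Ck_on_continuous[OF Ck_q] by (simp add: g_def[abs_def])
  have injg: "inj_on g (ball 0 r1)" using q_inj by (auto simp: g_def inj_on_def)
  have opg: "open (g ` ball 0 r1)" by (rule invariance_of_domain[OF contg _ injg]) simp
  obtain k where k: "homeomorphism (ball 0 r1) (g ` ball 0 r1) g k"
    using invariance_of_domain_homeomorphism[OF _ contg _ injg] by auto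
  have hom: "homeomorphism (g ` ball 0 r1) (\<phi> ` g ` ball 0 r1) \<phi> \<theta>"
    using homeomorphism_of_subsets[OF \<theta> sub] sub by blast
  have eq: "\<psi> = \<phi> \<circ> g" by (auto simp: \<psi>_def g_def)
  have "homeomorphism (ball 0 r1) (\<psi> ` ball 0 r1) \<psi> (k \<circ> \<theta>)"
    using homeomorphism_compose[OF k hom] by (simp add: eq image_comp)
  moreover have "openin (top_of_set M) (\<psi> ` ball 0 r1)"
  proof -
    have "openin (top_of_set (\<phi> ` U)) (\<phi> ` g ` ball 0 r1)"
      using sub opg by (intro homeomorphism_imp_open_map[OF \<theta>]) (auto intro: open_subset)
    then show ?thesis using opU openin_trans by (auto simp: eq image_comp)
  qed
  moreover have "inj (frechet_derivative \<psi> (at w))" if w: "w \<in> ball 0 r1" for w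
  proof -
    have w1: "norm w \<le> 1" "b * norm w \<le> s" using in_ball[of w] w by auto
    have lin: "linear (frechet_derivative \<psi> (at w))"
      using linear_frechet_derivative psi_smooth w unfolding smooth_on_def by blast
    show ?thesis unfolding linear_injective_0[OF lin]
    proof safe
      fix v assume v: "frechet_derivative \<psi> (at w) v = 0"
      have "norm (E v) \<le> norm (frechet_derivative \<psi> (at w) v - E v - B w v) + norm (B w v)"
        using v norm_triangle_ineq[of "frechet_derivative \<psi> (at w) v - E v - B w v" "B w v"] by simp
      also have "\<dots> \<le> C * norm w ^ 2 * norm v + C * norm w * norm v"
        by (intro add_mono derivative_expansion w1 B_bound)
      also have "\<dots> \<le> (C * r1 + C * r1) * norm v"
      proof -
        have "norm w ^ 2 \<le> r1" using w r1 w1 mult_left_le[of "norm w" "norm w"] by (simp add: power2_eq_square)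
        then have "C * norm w ^ 2 * norm v \<le> C * r1 * norm v" "C * norm w * norm v \<le> C * r1 * norm v"
          using w C_ge(1) by (auto intro!: mult_right_mono mult_left_mono)
        then show ?thesis by (simp add: algebra_simps)
      qed
      also have "\<dots> \<le> (1/4) * norm v" using r1(4) by (intro mult_right_mono) (linarith, simp)
      finally show "v = 0" by (simp add: normE)
    qed
  qed
  ultimately show ?thesis using psi_smooth unfolding local_parametrization_def by blast
qed

text \<open>As \<open>A\<close> undoes z -> adjoint E (D z), a solution of q w = z is obtained from
  the fixed point equation w = T w, where T has Lipschitz constant 1/2. The hypothesis gives |T 0| <
  r1/4, so T maps the closed ball of radius r1/2 into itself.\<close>

lemma q_covers:
  assumes "4 * C1 * norm z < r1"
  shows "\<exists>w\<in>ball 0 r1. q w = z"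
proof -
  let ?D = "frechet_derivative \<phi> (at u)" and ?D2 = "second_derivative \<phi> u"
  define T where "T w = adjoint E (?D z) + (1/2) *\<^sub>R adjoint E (?D2 (A w) (A w))" for w
  have small: "C1 * a0 ^ 2 * r1 \<le> 1/16"
    using mult_right_mono[OF C_ge(2), of r1] r1(1,4) by linarith
  have diff: "norm (T w - T w') \<le> (1/2) * norm (w - w')" if w: "norm w \<le> r1" "norm w' \<le> r1" for w w'
  proof -
    have "T w - T w' = (1/2) *\<^sub>R adjoint E (?D2 (A w) (A w) - ?D2 (A w') (A w'))"
      using linE' by (simp add: T_def linear_diff scaleR_diff_right)
    also have "?D2 (A w) (A w) - ?D2 (A w') (A w') = ?D2 (A (w - w')) (A w) + ?D2 (A w') (A (w - w'))"
      using bilD2 linA by (simp add: linear_diff bilinear_lsub bilinear_rsub)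
    finally have "norm (T w - T w') \<le> (1/2) * norm (?D2 (A (w - w')) (A w) + ?D2 (A w') (A (w - w')))"
      using adjE by simp
    also have "\<dots> \<le> (1/2) * (C1 * a0 ^ 2 * norm (w - w') * norm w + C1 * a0 ^ 2 * norm w' * norm (w - w'))"
      by (intro mult_left_mono order_trans[OF norm_triangle_ineq] add_mono D2A_bound) auto
    also have "\<dots> \<le> (1/2) * (C1 * a0 ^ 2 * norm (w - w') * r1 + C1 * a0 ^ 2 * r1 * norm (w - w'))"
      using w C1 by (intro mult_left_mono add_mono mult_right_mono) auto
    also have "\<dots> = (C1 * a0 ^ 2 * r1) * norm (w - w')" by (simp add: algebra_simps)
    also have "\<dots> \<le> (1/2) * norm (w - w')" using small by (intro mult_right_mono) auto
    finally show ?thesis .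
  qed
  have "\<exists>!w\<in>cball 0 (r1/2). T w = w"
  proof (rule Banach_fix)
    show "T ` cball 0 (r1/2) \<subseteq> cball 0 (r1/2)"
    proof clarsimp
      fix w :: "real^'d" assume w: "norm w * 2 \<le> r1"
      have "norm (T w) \<le> norm (adjoint E (?D z)) + norm (T w - T 0)"
        using norm_triangle_ineq[of "adjoint E (?D z)" "T w - T 0"] linE' bilD2 linA
        by (simp add: T_def linear_0 bilinear_lzero)
      also have "\<dots> \<le> C1 * norm z + (1/2) * norm (w - 0)"
        using w r1 diff[of w 0] order_trans[OF adjE D_bound[of z]] by (intro add_mono) auto
      also have "\<dots> \<le> r1 / 2" using assms w by simp
      finally show "norm (T w) * 2 \<le> r1" by simp
    qed
    show "dist (T w) (T w') \<le> (1/2) * dist w w'" if "w \<in> cball 0 (r1/2)" "w' \<in> cball 0 (r1/2)" for w w'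
      using diff[of w w'] that r1 by (simp add: dist_norm)
  qed (use r1 in \<open>auto simp: complete_eq_closed\<close>)
  then obtain w where w: "w \<in> cball 0 (r1/2)" "T w = w" by auto
  have "A w = A (T w)" by (simp add: w)
  also have "\<dots> = A (adjoint E (?D z)) + (1/2) *\<^sub>R A (adjoint E (?D2 (A w) (A w)))"
    using linA by (simp add: T_def linear_add linear_scale)
  also have "\<dots> = z - Q w w" by (simp add: A_right_inverse Q_def)
  finally have "q w = z" by (simp add: q_def)
  then show ?thesis using w(1) r1(1) by (intro bexI[of _ w]) auto
qed

text \<open>Substitute z = A w + Q w w into the expansion of \<open>G\<close>. The linear form
  contributes a quadratic term through \<open>Q\<close>, doubled in \<open>sg\<close> because of the
  factor 1/2 in \<open>jet2\<close>; every term of \<open>g2\<close> that contains \<open>Q\<close>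
  is already cubic.\<close>

lemma jet2_pullback:
  assumes g1: "linear g1" "\<And>z. \<bar>g1 z\<bar> \<le> K * norm z" and g2: "bilinear g2" "\<And>z v. \<bar>g2 z v\<bar> \<le> K * norm z * norm v"
    and G0: "\<bar>G u\<bar> \<le> K"
    and G: "\<And>z. norm z \<le> s \<Longrightarrow> \<bar>G (u + z) - G u - g1 z - g2 z z / 2\<bar> \<le> K * norm z ^ 3"
  shows "jet2 r1 (4 * K * b ^ 3) (\<lambda>w. G (u + q w))"
proof -
  have K: "0 \<le> K" using G0 by linarith
  have b3: "1 \<le> b ^ 3" "b \<le> b ^ 3" "b ^ 2 \<le> b ^ 3"
    using b_ge power_increasing[of 1 3 b] power_increasing[of 2 3 b] by auto
  have Kb: "K * b \<le> K * b ^ 3" "K * b ^ 2 \<le> K * b ^ 3" "K \<le> K * b ^ 3" "0 \<le> K * b ^ 3"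
    using K b3 mult_left_mono[of 1 "b ^ 3" K] by (auto intro: mult_left_mono)
  define sg where "sg w v = 2 * g1 (Q w v) + g2 (A w) (A v)" for w v
  have q0: "q 0 = 0" using linA bilQ by (simp add: q_def linear_0 bilinear_lzero)
  have "linear (\<lambda>w. g1 (A w))" using linear_compose[OF linA g1(1)] by (simp add: o_def)
  moreover have "bilinear sg"
    using bilQ g1(1) g2(1) linA unfolding bilinear_def sg_def
    by (auto intro!: linear_compose_add linear_compose_scale_right[where 'b = real, simplified] linear_compose[unfolded o_def, of _ g1]
        linear_compose[unfolded o_def, of A])
  moreover have "\<bar>g1 (A w)\<bar> \<le> 4 * K * b ^ 3 * norm w" for w
  proof -
    have "\<bar>g1 (A w)\<bar> \<le> K * (b * norm w)"
      using g1(2)[of "A w"] A_bound'[of w] K by (meson mult_left_mono order_trans)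
    also have "\<dots> \<le> (4 * K * b ^ 3) * norm w"
      unfolding mult.assoc[symmetric] using Kb by (intro mult_right_mono) auto
    finally show ?thesis .
  qed
  moreover have "\<bar>sg w v\<bar> \<le> 4 * K * b ^ 3 * norm w * norm v" for w v
  proof -
    have "\<bar>sg w v\<bar> \<le> 2 * \<bar>g1 (Q w v)\<bar> + \<bar>g2 (A w) (A v)\<bar>" unfolding sg_def by linarith
    also have "\<dots> \<le> 2 * (K * norm (Q w v)) + K * norm (A w) * norm (A v)"
      using g1(2) g2(2) by (intro add_mono mult_left_mono) auto
    also have "\<dots> = K * (2 * norm (Q w v)) + K * norm (A w) * norm (A v)" by simp
    also have "\<dots> \<le> K * (b * norm w * norm v) + K * (b * norm w) * (b * norm v)"
      by (intro add_mono mult_mono mult_left_mono mult_nonneg_nonneg Q_bound' A_bound' K order_refl) (use b_ge in auto)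
    also have "\<dots> = (K * b + K * b ^ 2) * (norm w * norm v)" by (simp add: power2_eq_square algebra_simps)
    also have "\<dots> \<le> (4 * K * b ^ 3) * (norm w * norm v)" using Kb by (intro mult_right_mono) auto
    finally show ?thesis by (simp add: mult.assoc)
  qed
  moreover have "\<bar>G (u + q w) - G (u + q 0) - g1 (A w) - sg w w / 2\<bar> \<le> 4 * K * b ^ 3 * norm w ^ 3" if w: "w \<in> ball 0 r1" for w
  proof -
    have w1: "norm w \<le> 1" and ws: "b * norm w \<le> s" using in_ball[of w] w by auto
    have Qw: "norm (Q w w) \<le> b * norm w ^ 2"
      using Q_bound'[of w w] norm_ge_zero[of "Q w w"] unfolding power2_eq_square mult.assoc by linarith
    have eq: "G (u + q w) - G (u + q 0) - g1 (A w) - sg w w / 2 =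
      (G (u + q w) - G u - g1 (q w) - g2 (q w) (q w) / 2) + (g2 (A w) (Q w w) + g2 (Q w w) (A w) + g2 (Q w w) (Q w w)) / 2"
      unfolding q0 using g1(1) g2(1) by (simp add: sg_def q_def linear_add bilinear_ladd bilinear_radd field_simps)
    have "\<bar>G (u + q w) - G u - g1 (q w) - g2 (q w) (q w) / 2\<bar> \<le> K * (b * norm w) ^ 3"
      using G[of "q w"] q_bound[OF w1] ws K
      by (meson mult_left_mono norm_ge_zero order_trans power_mono)
    moreover have "\<bar>g2 (A w) (Q w w)\<bar> \<le> K * (b * norm w) * (b * norm w ^ 2)"
      "\<bar>g2 (Q w w) (A w)\<bar> \<le> K * (b * norm w ^ 2) * (b * norm w)"
      using K b_ge A_bound'[of w] Qw by (auto intro!: order_trans[OF g2(2)] mult_mono mult_nonneg_nonneg)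
    moreover have "\<bar>g2 (Q w w) (Q w w)\<bar> \<le> K * (b * norm w ^ 2) * (b * norm w ^ 2)"
      using K b_ge Qw by (auto intro!: order_trans[OF g2(2)] mult_mono mult_nonneg_nonneg)
    moreover have "K * (b * norm w ^ 2) * (b * norm w ^ 2) \<le> K * (b * norm w ^ 2) * (b * norm w)"
      using K b_ge w1 mult_left_le[of "norm w" "norm w"] by (intro mult_left_mono mult_nonneg_nonneg) (auto simp: power2_eq_square)
    ultimately have "\<bar>G (u + q w) - G (u + q 0) - g1 (A w) - sg w w / 2\<bar>
      \<le> K * (b * norm w) ^ 3 + (K * (b * norm w) * (b * norm w ^ 2) + K * (b * norm w ^ 2) * (b * norm w) + K * (b * norm w ^ 2) * (b * norm w)) / 2"
      unfolding eq by (rule abs_remainder_le)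
    also have "\<dots> = (K * b ^ 3 + (3/2) * (K * b ^ 2)) * norm w ^ 3"
      by (simp add: power2_eq_square power3_eq_cube algebra_simps)
    also have "\<dots> \<le> (4 * K * b ^ 3) * norm w ^ 3" using Kb by (intro mult_right_mono) auto
    finally show ?thesis .
  qed
  moreover have "\<bar>G (u + q 0)\<bar> \<le> 4 * K * b ^ 3" using G0 Kb by (simp add: q0)
  ultimately show ?thesis unfolding jet2_def by (intro conjI exI[of _ "\<lambda>w. g1 (A w)"] exI[of _ sg]) auto
qed

lemma jet1_pullback:
  assumes g1: "linear g1" "\<And>z. \<bar>g1 z\<bar> \<le> K * norm z" and G0: "\<bar>G u\<bar> \<le> K"
    and G: "\<And>z. norm z \<le> s \<Longrightarrow> \<bar>G (u + z) - G u - g1 z\<bar> \<le> K * norm z ^ 2"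
  shows "jet1 r1 (2 * K * b ^ 2) (\<lambda>w. G (u + q w))"
proof -
  have K: "0 \<le> K" using G0 by linarith
  have b3: "1 \<le> b ^ 2" "b \<le> b ^ 2"
    using b_ge power_increasing[of 1 2 b] by auto
  have Kb: "K * b \<le> K * b ^ 2" "K \<le> K * b ^ 2" "0 \<le> K * b ^ 2"
    using K b3 mult_left_mono[of 1 "b ^ 2" K] by (auto intro: mult_left_mono)
  have q0: "q 0 = 0" using linA bilQ by (simp add: q_def linear_0 bilinear_lzero)
  have "linear (\<lambda>w. g1 (A w))" using linear_compose[OF linA g1(1)] by (simp add: o_def)
  moreover have "\<bar>g1 (A w)\<bar> \<le> 2 * K * b ^ 2 * norm w" for w
  proof -
    have "\<bar>g1 (A w)\<bar> \<le> K * (b * norm w)"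
      using g1(2)[of "A w"] A_bound'[of w] K by (meson mult_left_mono order_trans)
    also have "\<dots> \<le> (2 * K * b ^ 2) * norm w"
      unfolding mult.assoc[symmetric] using Kb by (intro mult_right_mono) auto
    finally show ?thesis .
  qed
  moreover have "\<bar>G (u + q w) - G (u + q 0) - g1 (A w)\<bar> \<le> 2 * K * b ^ 2 * norm w ^ 2" if w: "w \<in> ball 0 r1" for w
  proof -
    have w1: "norm w \<le> 1" and ws: "b * norm w \<le> s" using in_ball[of w] w by auto
    have Qw: "norm (Q w w) \<le> b * norm w ^ 2"
      using Q_bound'[of w w] norm_ge_zero[of "Q w w"] unfolding power2_eq_square mult.assoc by linarith
    have eq: "G (u + q w) - G (u + q 0) - g1 (A w) = (G (u + q w) - G u - g1 (q w)) + g1 (Q w w)"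
      unfolding q0 using g1(1) by (simp add: q_def linear_add)
    have "\<bar>G (u + q w) - G u - g1 (q w)\<bar> \<le> K * (b * norm w) ^ 2"
      using G[of "q w"] q_bound[OF w1] ws K
      by (meson mult_left_mono norm_ge_zero order_trans power_mono)
    moreover have "\<bar>g1 (Q w w)\<bar> \<le> K * (b * norm w ^ 2)"
      using g1(2)[of "Q w w"] Qw K by (meson mult_left_mono order_trans)
    ultimately have "\<bar>G (u + q w) - G (u + q 0) - g1 (A w)\<bar> \<le> K * (b * norm w) ^ 2 + K * (b * norm w ^ 2)"
      unfolding eq by linarith
    also have "\<dots> = (K * b ^ 2 + K * b) * norm w ^ 2"
      by (simp add: power2_eq_square algebra_simps)
    also have "\<dots> \<le> (2 * K * b ^ 2) * norm w ^ 2" using Kb by (intro mult_right_mono) auto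
    finally show ?thesis .
  qed
  moreover have "\<bar>G (u + q 0)\<bar> \<le> 2 * K * b ^ 2" using G0 Kb by (simp add: q0)
  ultimately show ?thesis unfolding jet1_def by (intro conjI exI[of _ "\<lambda>w. g1 (A w)"]) auto
qed

end

end


section \<open>Normal charts around all points near a given one, with common constants\<close>

lemma derivative_bounded_below:
  fixes \<phi> :: "'a::euclidean_space \<Rightarrow> 'b::euclidean_space"
  assumes \<phi>: "Ck_on (Suc k) U \<phi>" and V: "compact V" "V \<subseteq> U"
    and inj: "\<And>u. u \<in> V \<Longrightarrow> inj (frechet_derivative \<phi> (at u))"
  shows "\<exists>\<kappa>>0. \<forall>u\<in>V. \<forall>v. \<kappa> * norm v \<le> norm (frechet_derivative \<phi> (at u) v)"
proof (cases "V = {}")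
  case False
  let ?D = "\<lambda>u. frechet_derivative \<phi> (at u)"
  have lin: "linear (?D u)" if "u \<in> V" for u using linear_frechet_derivative[OF \<phi>] that V by auto
  let ?S = "V \<times> sphere (0::'a) 1"
  have cb: "continuous_on V (\<lambda>u. ?D u b)" for b
    using Ck_on_continuous[OF Ck_on_frechet[OF \<phi>]] V(2) continuous_on_subset by blast
  have "continuous_on ?S (\<lambda>y. ?D (fst y) b)" for b
    by (rule continuous_on_compose2[OF cb continuous_on_fst[OF continuous_on_id]]) auto
  then have "continuous_on ?S (\<lambda>y. norm (\<Sum>b\<in>Basis. (snd y \<bullet> b) *\<^sub>R ?D (fst y) b))"
    by (intro continuous_on_norm continuous_on_sum continuous_on_scaleR continuous_on_inner
      continuous_on_snd continuous_on_const continuous_on_id)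
  then have cont: "continuous_on ?S (\<lambda>y. norm (?D (fst y) (snd y)))"
    by (rule continuous_on_eq) (use linear_euclidean_expansion[OF lin] in auto)
  have "compact ?S" using V by (intro compact_Times) auto
  moreover have "?S \<noteq> {}" using False by auto
  ultimately obtain y where y: "y \<in> ?S" "\<And>z. z \<in> ?S \<Longrightarrow> norm (?D (fst y) (snd y)) \<le> norm (?D (fst z) (snd z))"
    using continuous_attains_inf[OF _ _ cont] by blast
  define \<kappa> where "\<kappa> = norm (?D (fst y) (snd y))"
  have "snd y \<noteq> 0" "fst y \<in> V" using y(1) by auto
  then have "?D (fst y) (snd y) \<noteq> 0"
    using linear_injective_0[OF lin, of "fst y"] inj[of "fst y"] by auto
  then have "\<kappa> > 0" by (simp add: \<kappa>_def)
  moreover have "\<kappa> * norm v \<le> norm (?D u v)" if u: "u \<in> V" for u v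
  proof (cases "v = 0")
    case False
    have "\<kappa> \<le> norm (?D u ((1 / norm v) *\<^sub>R v))" using y(2)[of "(u, (1 / norm v) *\<^sub>R v)"] u False by (simp add: \<kappa>_def)
    also have "\<dots> = norm (?D u v) / norm v" using lin[OF u] by (simp add: linear_scale)
    finally show ?thesis using False by (simp add: field_simps)
  qed simp
  ultimately show ?thesis by blast
qed (auto intro: exI[of _ 1])

text \<open>The image of the small ball is compact inside the image of the large one, which is open
  in \<open>M\<close>; hence all points of \<open>M\<close> close to it are chart points. Uniform
  continuity of the inverse chart then makes their parameters close. Openness in \<open>M\<close> is
  what excludes other sheets nearby.\<close>

lemma uniform_preimage:
  fixes \<phi> :: "real^'d \<Rightarrow> real^'m"
  assumes param: "local_parametrization M U \<phi>" and s: "0 < s" "cball c (2 * s) \<subseteq> U" and \<delta>: "0 < \<delta>"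
  shows "\<exists>r0>0. \<forall>u\<in>cball c s. \<forall>y\<in>M. dist (\<phi> u) y < r0 \<longrightarrow> (\<exists>u'. y = \<phi> u' \<and> norm (u' - u) < \<delta>)"
proof -
  obtain \<theta> where \<theta>: "homeomorphism U (\<phi> ` U) \<phi> \<theta>" and opU: "openin (top_of_set M) (\<phi> ` U)"
    using param by (auto simp: local_parametrization_def)
  have sub: "ball c (2 * s) \<subseteq> U" "cball c s \<subseteq> ball c (2 * s)" using s ball_subset_cball by (blast, auto)
  have "openin (top_of_set (\<phi> ` U)) (\<phi> ` ball c (2 * s))"
    using sub by (intro homeomorphism_imp_open_map[OF \<theta>]) (auto intro: open_subset)
  then have "openin (top_of_set M) (\<phi> ` ball c (2 * s))" using opU openin_trans by blast
  then obtain O' where O': "open O'" "\<phi> ` ball c (2 * s) = M \<inter> O'" by (auto simp: openin_open)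
  have cont: "continuous_on U \<phi>" using \<theta> by (simp add: homeomorphism_def)
  have "compact (\<phi> ` cball c s)"
    using continuous_on_subset[OF cont] sub by (intro compact_continuous_image) auto
  moreover have "\<phi> ` cball c s \<subseteq> O'" using O'(2) sub(2) by blast
  ultimately obtain e where e: "e > 0" "(\<Union>k\<in>\<phi> ` cball c s. ball k e) \<subseteq> O'"
    using compact_subset_open_imp_ball_epsilon_subset[OF _ O'(1)] by metis
  have "compact (\<phi> ` cball c (2 * s))"
    using continuous_on_subset[OF cont s(2)] by (intro compact_continuous_image) auto
  moreover have "continuous_on (\<phi> ` cball c (2 * s)) \<theta>"
    using \<theta> s(2) by (auto simp: homeomorphism_def intro: continuous_on_subset)
  ultimately have "uniformly_continuous_on (\<phi> ` cball c (2 * s)) \<theta>"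
    by (intro compact_uniformly_continuous)
  then obtain e' where e': "e' > 0" "\<And>y y'. y \<in> \<phi> ` cball c (2 * s) \<Longrightarrow> y' \<in> \<phi> ` cball c (2 * s) \<Longrightarrow>
      dist y' y < e' \<Longrightarrow> dist (\<theta> y') (\<theta> y) < \<delta>"
    using \<delta> unfolding uniformly_continuous_on_def by metis
  have "\<exists>u'. y = \<phi> u' \<and> norm (u' - u) < \<delta>"
    if u: "u \<in> cball c s" and y: "y \<in> M" "dist (\<phi> u) y < min e e'" for u y
  proof -
    have "y \<in> O'" using u y by (intro subsetD[OF e(2)] UN_I[of "\<phi> u"]) auto
    then obtain u' where u': "u' \<in> ball c (2 * s)" "y = \<phi> u'" using y O'(2) by (metis IntI imageE)
    have "u \<in> cball c (2 * s)" "u' \<in> cball c (2 * s)" using u u'(1) sub(2) by auto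
    then have "dist (\<theta> (\<phi> u')) (\<theta> (\<phi> u)) < \<delta>" using u' y by (intro e'(2)) (auto simp: dist_commute)
    moreover have "\<theta> (\<phi> u') = u'" "\<theta> (\<phi> u) = u"
      using homeomorphism_apply1[OF \<theta>] \<open>u \<in> cball c (2 * s)\<close> \<open>u' \<in> cball c (2 * s)\<close> s(2) by blast+
    ultimately show ?thesis using u'(2) by (auto simp: dist_norm)
  qed
  then show ?thesis using e(1) e'(1) by (intro exI[of _ "min e e'"]) auto
qed

text \<open>\<open>E\<close> is an isometry of the parameter space onto the range of the
  differential, a subspace of equal dimension, and \<open>A\<close> is \<open>E\<close> followed by
  a left inverse of the differential. The lower bound \<kappa> for the differential becomes the
  upper bound 1/\<kappa> for \<open>A\<close>.\<close>

lemma chart_model_exists: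
  fixes \<phi> :: "real^'d \<Rightarrow> real^'m"
  assumes param: "local_parametrization M U \<phi>" and s: "0 < s" "cball u s \<subseteq> U"
    and \<kappa>: "0 < \<kappa>" "\<And>v. \<kappa> * norm v \<le> norm (frechet_derivative \<phi> (at u) v)"
    and C1: "1 \<le> C1"
    and tay: "\<And>z v. norm z \<le> s \<Longrightarrow> norm (frechet_derivative \<phi> (at (u + z)) v - frechet_derivative \<phi> (at u) v
        - second_derivative \<phi> u z v) \<le> C1 * norm z ^ 2 * norm v"
    and D2_bound: "\<And>z v. norm (second_derivative \<phi> u z v) \<le> C1 * norm z * norm v"
    and D_bound: "\<And>v. norm (frechet_derivative \<phi> (at u) v) \<le> C1 * norm v"
  shows "\<exists>A E. chart_model M U \<phi> u s C1 (max 1 (1 / \<kappa>)) A E"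
proof -
  let ?D = "frechet_derivative \<phi> (at u)"
  have uU: "u \<in> U" using s by auto
  then have lin: "linear ?D" and inj: "inj ?D"
    using param linear_frechet_derivative[of 0 U \<phi> u] by (auto simp: local_parametrization_def smooth_on_def)
  have dim: "dim (UNIV :: (real^'d) set) = dim (range ?D)"
    using dim_image_eq[OF lin, of UNIV] inj by simp
  have "\<exists>E :: real^'d \<Rightarrow> real^'m. linear E \<and> range E = range ?D \<and> (\<forall>v. norm (E v) = norm v)"
  proof (rule isometries_subspaces[OF subspace_UNIV linear_subspace_image[OF lin subspace_UNIV] dim])
    fix f :: "real^'d \<Rightarrow> real^'m"
    assume "linear f" "range f = range ?D" "\<And>x. x \<in> UNIV \<Longrightarrow> norm (f x) = norm x"
    then show ?thesis by auto
  qed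
  then obtain E :: "real^'d \<Rightarrow> real^'m" where E: "linear E" "E ` UNIV = range ?D" "\<And>v. norm (E v) = norm v" by blast
  obtain g where g: "linear g" "g \<circ> ?D = id" using linear_injective_left_inverse[OF lin inj] by blast
  have gD: "g (?D v) = v" for v using g(2) by (metis comp_apply id_apply)
  have Dg: "?D (g (E v)) = E v" for v
  proof -
    have "E v \<in> range ?D" using E(2) by auto
    then show ?thesis using gD by auto
  qed
  have A_bound: "norm (g (E v)) \<le> max 1 (1 / \<kappa>) * norm v" for v
  proof -
    have "\<kappa> * norm (g (E v)) \<le> norm v" using \<kappa>(2)[of "g (E v)"] by (simp add: Dg E(3))
    then have "norm (g (E v)) \<le> (1 / \<kappa>) * norm v" using \<kappa>(1) by (simp add: field_simps)
    also have "\<dots> \<le> max 1 (1 / \<kappa>) * norm v" by (intro mult_right_mono) auto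
    finally show ?thesis .
  qed
  have "linear (\<lambda>v. g (E v))" using linear_compose[OF E(1) g(1)] by (simp add: o_def)
  moreover have "range ?D \<subseteq> range E" using E(2) by simp
  moreover have "1 \<le> max 1 (1 / \<kappa>)" by simp
  ultimately have "chart_model M U \<phi> u s C1 (max 1 (1 / \<kappa>)) (\<lambda>v. g (E v)) E"
    using param s C1 E(1,3) Dg A_bound tay D2_bound D_bound by (intro chart_model.intro)
  then show ?thesis by blast
qed

text \<open>The frames are chosen separately for every u, without any continuity in u. Uniformity
  lies in \<open>s\<close>, \<open>r0\<close>, \<open>r1\<close>, \<open>C\<close> and the jet
  bounds alone, all of which come from Taylor data on one compact set.\<close>

lemma normal_charts_near:
  fixes \<phi> :: "real^'d \<Rightarrow> real^'m"
  assumes param: "local_parametrization M U \<phi>" and c: "c \<in> U"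
  shows "\<exists>s r0 r1 C (\<Psi> :: real^'d \<Rightarrow> real^'d \<Rightarrow> real^'m). 0 < s \<and> cball c s \<subseteq> U \<and> (\<forall>u\<in>cball c s. \<exists>E B. normal_chart M r0 r1 C (\<phi> u) (\<Psi> u) E B) \<and>
    (\<forall>f. Ck_on 3 U (\<lambda>u. f (\<phi> u)) \<longrightarrow> (\<exists>K. \<forall>u\<in>cball c s. jet2 r1 K (\<lambda>w. f (\<Psi> u w)))) \<and>
    (\<forall>f. Ck_on 2 U (\<lambda>u. f (\<phi> u)) \<longrightarrow> (\<exists>K. \<forall>u\<in>cball c s. jet1 r1 K (\<lambda>w. f (\<Psi> u w))))"
proof -
  have U: "open U" and smooth: "\<And>k. Ck_on k U \<phi>" and inj: "\<And>u. u \<in> U \<Longrightarrow> inj (frechet_derivative \<phi> (at u))"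
    using param by (auto simp: local_parametrization_def smooth_on_def)
  obtain s' where s': "s' > 0" "cball c s' \<subseteq> U" using U c open_contains_cball by blast
  \<comment> \<open>Half of the radius, so that \<open>u + z\<close> stays in the compact set
    \<open>V\<close> for \<open>u\<close> in the inner ball and
    \<open>norm z \<le> s\<close>.\<close>
  define s where "s = s' / 2"
  define V where "V = cball c (2 * s)"
  have s: "s > 0" "V \<subseteq> U" "compact V" "convex V" using s' by (auto simp: s_def V_def)
  have VU: "V \<subseteq> U" by (rule s(2))
  have uV: "u \<in> V" "u + z \<in> V" "cball u s \<subseteq> V" if "u \<in> cball c s" "norm z \<le> s" for u z
  proof -
    have "dist c y \<le> 2 * s" if "dist u y \<le> s" for y using dist_triangle[of c y u] \<open>u \<in> cball c s\<close> that by simp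
    then show "u \<in> V" "u + z \<in> V" "cball u s \<subseteq> V" using s(1) that(2) by (auto simp: V_def dist_norm)
  qed
  obtain \<kappa> where \<kappa>: "\<kappa> > 0" "\<And>u v. u \<in> V \<Longrightarrow> \<kappa> * norm v \<le> norm (frechet_derivative \<phi> (at u) v)"
    using derivative_bounded_below[OF smooth s(3,2)] inj s(2) by blast
  obtain C0 where C0: "C0 \<ge> 0"
    "\<And>u u' v. u \<in> V \<Longrightarrow> u' \<in> V \<Longrightarrow> norm (frechet_derivative \<phi> (at u') v - frechet_derivative \<phi> (at u) v
        - second_derivative \<phi> u (u' - u) v) \<le> C0 * norm (u' - u) ^ 2 * norm v"
    "\<And>u z v. u \<in> V \<Longrightarrow> norm (second_derivative \<phi> u z v) \<le> C0 * norm z * norm v"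
    "\<And>u v. u \<in> V \<Longrightarrow> norm (frechet_derivative \<phi> (at u) v) \<le> C0 * norm v"
    using taylor2_on_compact_convex[OF smooth U s(3,4,2)] by blast
  define C1 where "C1 = max 1 C0"
  define a0 where "a0 = max 1 (1 / \<kappa>)"
  have C1: "1 \<le> C1" "C0 \<le> C1" by (auto simp: C1_def)
  have "\<exists>A E. chart_model M U \<phi> u s C1 a0 A E" if u: "u \<in> cball c s" for u
    unfolding a0_def
  proof (rule chart_model_exists[OF param s(1) _ \<kappa>(1) \<kappa>(2)])
    show "cball u s \<subseteq> U" "u \<in> V" using uV[OF u, of 0] s by auto
    show "norm (frechet_derivative \<phi> (at (u + z)) v - frechet_derivative \<phi> (at u) v - second_derivative \<phi> u z v)
       \<le> C1 * norm z ^ 2 * norm v" if "norm z \<le> s" for z v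
    proof -
      have "norm (frechet_derivative \<phi> (at (u + z)) v - frechet_derivative \<phi> (at u) v - second_derivative \<phi> u z v)
         \<le> C0 * norm z ^ 2 * norm v" using C0(2)[OF uV(1,2)[OF u that], of v] by simp
      also have "\<dots> \<le> C1 * norm z ^ 2 * norm v" using C1 by (intro mult_right_mono) auto
      finally show ?thesis .
    qed
    show "norm (second_derivative \<phi> u z v) \<le> C1 * norm z * norm v" for z v
      using C0(3)[OF \<open>u \<in> V\<close>, of z v] C1(2) by (smt (verit) mult_right_mono norm_ge_zero)
    show "norm (frechet_derivative \<phi> (at u) v) \<le> C1 * norm v" for v
      using C0(4)[OF \<open>u \<in> V\<close>, of v] C1(2) by (smt (verit) mult_right_mono norm_ge_zero)
  qed (use C1 in auto)
  then obtain A E where model: "\<And>u. u \<in> cball c s \<Longrightarrow> chart_model M U \<phi> u s C1 a0 (A u) (E u)" by metis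
  define bb where "bb = chart_model.b C1 a0"
  define CC where "CC = chart_model.C C1 a0"
  have cc: "c \<in> cball c s" using s by simp
  have b: "1 \<le> bb" and C: "3 \<le> CC"
    using chart_model.b_ge(1)[OF model[OF cc]] chart_model.C_ge(1)[OF model[OF cc]] by (auto simp: bb_def CC_def)
  \<comment> \<open>The three entries give \<open>r1 \<le> 1\<close>, keep \<open>u + q w\<close>
    within distance \<open>s\<close> of u, where the Taylor bounds hold, and secure the smallness of
    \<open>CC * r1\<close>.\<close>
  define r1 where "r1 = min 1 (min (s / bb) (1 / (16 * CC)))"
  have r1: "0 < r1" "r1 \<le> 1" "bb * r1 \<le> s" "16 * CC * r1 \<le> 1"
  proof -
    show "0 < r1" "r1 \<le> 1" using s b C by (auto simp: r1_def)
    have "r1 \<le> s / bb" "r1 \<le> 1 / (16 * CC)" by (auto simp: r1_def)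
    then show "bb * r1 \<le> s" "16 * CC * r1 \<le> 1" using b C by (auto simp: field_simps)
  qed
  \<comment> \<open>The radius r1 / (4 C1) is the threshold of \<open>q_covers\<close>, so
    parameters this close to u are values of \<open>q\<close>.\<close>
  obtain r0 where r0: "r0 > 0" "\<And>u y. u \<in> cball c s \<Longrightarrow> y \<in> M \<Longrightarrow> dist (\<phi> u) y < r0 \<Longrightarrow>
      \<exists>u'. y = \<phi> u' \<and> norm (u' - u) < r1 / (4 * C1)"
    using uniform_preimage[OF param s(1), of c "r1 / (4 * C1)"] s(2) r1(1) C1(1) unfolding V_def by auto
  define qq where "qq u = chart_model.q \<phi> u (A u) (E u)" for u
  define \<Psi> where "\<Psi> u w = \<phi> (u + qq u w)" for u w
  have Psi: "\<Psi> u = chart_model.\<psi> \<phi> u (A u) (E u)" if "u \<in> cball c s" for u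
    using chart_model.\<psi>_def[OF model[OF that]] by (simp add: \<Psi>_def qq_def fun_eq_iff)
  have "\<exists>E B. normal_chart M r0 r1 CC (\<phi> u) (\<Psi> u) E B" if u: "u \<in> cball c s" for u
  proof -
    interpret chart_model M U \<phi> u s C1 a0 "A u" "E u" by (rule model[OF u])
    note r1' = r1[unfolded bb_def CC_def]
    have "normal_chart M r0 r1 CC (\<phi> u) \<psi> (E u) B"
    proof (rule normal_chart.intro)
      show "\<psi> 0 = \<phi> u" using linA bilQ by (simp add: \<psi>_def q_def linear_0 bilinear_lzero)
      show "M \<inter> ball (\<phi> u) r0 \<subseteq> \<psi> ` ball 0 r1"
      proof safe
        fix y assume "y \<in> M" "y \<in> ball (\<phi> u) r0"
        then obtain u' where u': "y = \<phi> u'" "norm (u' - u) < r1 / (4 * C1)" using r0(2)[OF u] by auto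
        then obtain w where "w \<in> ball 0 r1" "q w = u' - u"
          using q_covers[OF r1', of "u' - u"] C1(1) by (auto simp: field_simps)
        then show "y \<in> \<psi> ` ball 0 r1" using u'(1) by (intro image_eqI[of _ _ w]) (auto simp: \<psi>_def)
      qed
      show "local_parametrization M (ball 0 r1) \<psi>" by (rule psi_param[OF r1'])
      show "norm (frechet_derivative \<psi> (at w) v - E u v - B w v) \<le> CC * norm w ^ 2 * norm v" if "w \<in> ball 0 r1" for w v
        using derivative_expansion[of w v] in_ball[OF r1', of w] that by (simp add: CC_def)
      show "norm (B w v) \<le> CC * norm w * norm v" for w v using B_bound by (simp add: CC_def)
    qed (use r0 r1 C linE normE bilB normalB in auto)
    then show ?thesis unfolding Psi[OF u] by blast
  qed
  moreover have "\<exists>K. \<forall>u\<in>cball c s. jet2 r1 K (\<lambda>w. f (\<Psi> u w))" if f: "Ck_on 3 U (\<lambda>u. f (\<phi> u))" for f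
  proof -
    define G where "G u = f (\<phi> u)" for u
    have G: "Ck_on (Suc (Suc (Suc 0))) U G" using f by (simp add: G_def[abs_def] numeral_3_eq_3)
    have G2: "Ck_on (Suc (Suc 0)) U G" using G Ck_on_SucD by blast
    obtain K0 where K0: "K0 \<ge> 0"
      "\<And>u u'. u \<in> V \<Longrightarrow> u' \<in> V \<Longrightarrow> norm (G u' - G u - frechet_derivative G (at u) (u' - u)
        - (1/2) *\<^sub>R second_derivative G u (u' - u) (u' - u)) \<le> K0 * norm (u' - u) ^ 3"
      "\<And>u z v. u \<in> V \<Longrightarrow> norm (second_derivative G u z v) \<le> K0 * norm z * norm v"
      "\<And>u v. u \<in> V \<Longrightarrow> norm (frechet_derivative G (at u) v) \<le> K0 * norm v"
      using taylor2_on_compact_convex[OF G U s(3,4,2)] by metis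
    have "bounded (G ` V)"
      using Ck_on_continuous[OF G] s(2,3) continuous_on_subset compact_continuous_image compact_imp_bounded by blast
    then obtain K1 where K1: "\<And>u. u \<in> V \<Longrightarrow> \<bar>G u\<bar> \<le> K1" by (auto simp: bounded_iff)
    define K where "K = max K0 K1"
    have K: "K0 \<le> K" "K1 \<le> K" by (auto simp: K_def)
    have "jet2 r1 (4 * K * bb ^ 3) (\<lambda>w. f (\<Psi> u w))" if u: "u \<in> cball c s" for u
    proof -
      interpret chart_model M U \<phi> u s C1 a0 "A u" "E u" by (rule model[OF u])
      note r1' = r1[unfolded bb_def CC_def]
      have uV': "u \<in> V" using uV(1)[OF u, of 0] s(1) by simp
      then have uU': "u \<in> U" using VU by auto
      have "jet2 r1 (4 * K * chart_model.b C1 a0 ^ 3) (\<lambda>w. G (u + chart_model.q \<phi> u (A u) (E u) w))"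
      proof (rule jet2_pullback[OF r1'])
        show "linear (frechet_derivative G (at u))" by (rule linear_frechet_derivative[OF G uU'])
        show "bilinear (second_derivative G u)" by (rule bilinear_second_derivative[OF G2 U uU'])
        show "\<bar>frechet_derivative G (at u) z\<bar> \<le> K * norm z" for z
          using K0(4)[OF uV', of z] K(1) by (smt (verit) mult_right_mono norm_ge_zero real_norm_def)
        show "\<bar>second_derivative G u z v\<bar> \<le> K * norm z * norm v" for z v
          using K0(3)[OF uV', of z v] K(1) by (smt (verit) mult_right_mono norm_ge_zero real_norm_def)
        show "\<bar>G u\<bar> \<le> K" using K1[OF uV'] K(2) by linarith
        show "\<bar>G (u + z) - G u - frechet_derivative G (at u) z - second_derivative G u z z / 2\<bar> \<le> K * norm z ^ 3"
          if "norm z \<le> s" for z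
        proof -
          have "\<bar>G (u + z) - G u - frechet_derivative G (at u) z - second_derivative G u z z / 2\<bar> \<le> K0 * norm z ^ 3"
            using K0(2)[OF uV(1,2)[OF u that]] by simp
          also have "\<dots> \<le> K * norm z ^ 3" using K(1) by (intro mult_right_mono) auto
          finally show ?thesis .
        qed
      qed
      then show ?thesis by (simp add: \<Psi>_def qq_def bb_def G_def)
    qed
    then show ?thesis by blast
  qed
  moreover have "\<exists>K. \<forall>u\<in>cball c s. jet1 r1 K (\<lambda>w. f (\<Psi> u w))" if f: "Ck_on 2 U (\<lambda>u. f (\<phi> u))" for f
  proof -
    define G where "G u = f (\<phi> u)" for u
    have G: "Ck_on (Suc (Suc 0)) U G" using f by (simp add: G_def[abs_def] numeral_2_eq_2)
    obtain K0 where K0: "\<And>u u'. u \<in> V \<Longrightarrow> u' \<in> V \<Longrightarrow> norm (G u' - G u - frechet_derivative G (at u) (u' - u)) \<le> K0 * norm (u' - u) ^ 2"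
      using taylor1_on_compact_convex[OF G s(3,4,2)] by blast
    obtain K2 where K2: "\<And>u v. u \<in> V \<Longrightarrow> norm (frechet_derivative G (at u) v) \<le> K2 * norm v"
      using frechet_derivative_bounded_on_compact[OF G s(3,2)] by blast
    have "bounded (G ` V)"
      using Ck_on_continuous[OF G] s(2,3) continuous_on_subset compact_continuous_image compact_imp_bounded by blast
    then obtain K1 where K1: "\<And>u. u \<in> V \<Longrightarrow> \<bar>G u\<bar> \<le> K1" by (auto simp: bounded_iff)
    define K where "K = max K0 (max K1 K2)"
    have K: "K0 \<le> K" "K1 \<le> K" "K2 \<le> K" by (auto simp: K_def)
    have "jet1 r1 (2 * K * bb ^ 2) (\<lambda>w. f (\<Psi> u w))" if u: "u \<in> cball c s" for u
    proof -
      interpret chart_model M U \<phi> u s C1 a0 "A u" "E u" by (rule model[OF u])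
      note r1' = r1[unfolded bb_def CC_def]
      have uV': "u \<in> V" using uV(1)[OF u, of 0] s(1) by simp
      then have uU': "u \<in> U" using VU by auto
      have "jet1 r1 (2 * K * chart_model.b C1 a0 ^ 2) (\<lambda>w. G (u + chart_model.q \<phi> u (A u) (E u) w))"
      proof (rule jet1_pullback[OF r1'])
        show "linear (frechet_derivative G (at u))" by (rule linear_frechet_derivative[OF G uU'])
        show "\<bar>frechet_derivative G (at u) z\<bar> \<le> K * norm z" for z
          using K2[OF uV', of z] K(3) by (smt (verit) mult_right_mono norm_ge_zero real_norm_def)
        show "\<bar>G u\<bar> \<le> K" using K1[OF uV'] K(2) by linarith
        show "\<bar>G (u + z) - G u - frechet_derivative G (at u) z\<bar> \<le> K * norm z ^ 2"
          if "norm z \<le> s" for z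
        proof -
          have "\<bar>G (u + z) - G u - frechet_derivative G (at u) z\<bar> \<le> K0 * norm z ^ 2"
            using K0[OF uV(1,2)[OF u that]] by simp
          also have "\<dots> \<le> K * norm z ^ 2" using K(1) by (intro mult_right_mono) auto
          finally show ?thesis .
        qed
      qed
      then show ?thesis by (simp add: \<Psi>_def qq_def bb_def G_def)
    qed
    then show ?thesis by blast
  qed
  moreover have "cball c s \<subseteq> U" using s s' by (auto simp: s_def)
  ultimately show ?thesis using s(1) by blast
qed

text \<open>The inverse chart replaces the parameter u by the point y itself; \<open>N\<close> is a
  neighbourhood in the ambient space, as finite subcovers of \<open>M\<close> require.\<close>

lemma normal_charts_patch:
  fixes M :: "(real^'m) set"
  assumes "smooth_submanifold TYPE('d::finite) M" "x \<in> M"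
  shows "\<exists>N r0 r1 C (\<Psi> :: real^'m \<Rightarrow> real^'d \<Rightarrow> real^'m). open N \<and> x \<in> N \<and>
    (\<forall>y\<in>M \<inter> N. \<exists>E B. normal_chart M r0 r1 C y (\<Psi> y) E B) \<and>
    (\<forall>f. Ck_manifold TYPE('d) 3 M f \<longrightarrow> (\<exists>K. \<forall>y\<in>M \<inter> N. jet2 r1 K (\<lambda>w. f (\<Psi> y w)))) \<and>
    (\<forall>f. Ck_manifold TYPE('d) 2 M f \<longrightarrow> (\<exists>K. \<forall>y\<in>M \<inter> N. jet1 r1 K (\<lambda>w. f (\<Psi> y w))))"
proof -
  obtain U and \<phi> :: "real^'d \<Rightarrow> real^'m" and c where param: "local_parametrization M U \<phi>" and c: "c \<in> U" "x = \<phi> c"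
    using assms by (auto simp: smooth_submanifold_def)
  obtain \<theta> where \<theta>: "homeomorphism U (\<phi> ` U) \<phi> \<theta>" and opU: "openin (top_of_set M) (\<phi> ` U)"
    using param by (auto simp: local_parametrization_def)
  obtain s r0 r1 C and \<Psi> :: "real^'d \<Rightarrow> real^'d \<Rightarrow> real^'m" where *: "0 < s" "cball c s \<subseteq> U"
    "\<And>u. u \<in> cball c s \<Longrightarrow> \<exists>E B. normal_chart M r0 r1 C (\<phi> u) (\<Psi> u) E B"
    "\<And>f. Ck_on 3 U (\<lambda>u. f (\<phi> u)) \<Longrightarrow> \<exists>K. \<forall>u\<in>cball c s. jet2 r1 K (\<lambda>w. f (\<Psi> u w))"
    "\<And>f. Ck_on 2 U (\<lambda>u. f (\<phi> u)) \<Longrightarrow> \<exists>K. \<forall>u\<in>cball c s. jet1 r1 K (\<lambda>w. f (\<Psi> u w))"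
    using normal_charts_near[OF param c(1)] by blast
  have "ball c s \<subseteq> U" using *(2) ball_subset_cball by blast
  then have "openin (top_of_set (\<phi> ` U)) (\<phi> ` ball c s)"
    by (intro homeomorphism_imp_open_map[OF \<theta>]) (auto intro: open_subset)
  then have "openin (top_of_set M) (\<phi> ` ball c s)" using opU openin_trans by blast
  then obtain N where N: "open N" "\<phi> ` ball c s = M \<inter> N" by (auto simp: openin_open)
  have \<theta>': "\<theta> y \<in> cball c s \<and> \<phi> (\<theta> y) = y" if y: "y \<in> M \<inter> N" for y
  proof -
    obtain u where u: "u \<in> ball c s" "y = \<phi> u" using y N(2) by (metis imageE)
    then have "\<theta> y = u" using \<theta> \<open>ball c s \<subseteq> U\<close> by (auto simp: homeomorphism_def)
    then show ?thesis using u by auto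
  qed
  have "x \<in> N" using N(2) c(2) *(1) by auto
  moreover have "\<exists>E B. normal_chart M r0 r1 C y (\<Psi> (\<theta> y)) E B" if "y \<in> M \<inter> N" for y
    using *(3)[of "\<theta> y"] \<theta>'[OF that] by simp
  moreover have "\<exists>K. \<forall>y\<in>M \<inter> N. jet2 r1 K (\<lambda>w. f (\<Psi> (\<theta> y) w))" if "Ck_manifold TYPE('d) 3 M f" for f
  proof -
    have "Ck_on 3 U (\<lambda>u. f (\<phi> u))" using that param by (auto simp: Ck_manifold_def o_def)
    then obtain K where "\<forall>u\<in>cball c s. jet2 r1 K (\<lambda>w. f (\<Psi> u w))" using *(4) by blast
    then show ?thesis using \<theta>' by (intro exI[of _ K]) blast
  qed
  moreover have "\<exists>K. \<forall>y\<in>M \<inter> N. jet1 r1 K (\<lambda>w. f (\<Psi> (\<theta> y) w))" if "Ck_manifold TYPE('d) 2 M f" for f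
  proof -
    have "Ck_on 2 U (\<lambda>u. f (\<phi> u))" using that param by (auto simp: Ck_manifold_def o_def)
    then obtain K where "\<forall>u\<in>cball c s. jet1 r1 K (\<lambda>w. f (\<Psi> u w))" using *(5) by blast
    then show ?thesis using \<theta>' by (intro exI[of _ K]) blast
  qed
  ultimately have "open N \<and> x \<in> N \<and>
    (\<forall>y\<in>M \<inter> N. \<exists>E B. normal_chart M r0 r1 C y (\<Psi> (\<theta> y)) E B) \<and>
    (\<forall>f. Ck_manifold TYPE('d) 3 M f \<longrightarrow> (\<exists>K. \<forall>y\<in>M \<inter> N. jet2 r1 K (\<lambda>w. f (\<Psi> (\<theta> y) w)))) \<and>
    (\<forall>f. Ck_manifold TYPE('d) 2 M f \<longrightarrow> (\<exists>K. \<forall>y\<in>M \<inter> N. jet1 r1 K (\<lambda>w. f (\<Psi> (\<theta> y) w))))"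
    using N(1) by (intro conjI allI impI ballI)
  then show ?thesis
    by - (rule exI[of _ N], rule exI[of _ r0], rule exI[of _ r1], rule exI[of _ C],
      rule exI[of _ "\<lambda>y. \<Psi> (\<theta> y)"], assumption)
qed

text \<open>A finite subcover and the maximum of the local constants; the value 0 covers empty
  \<open>M\<close>. This is the reason why estimates are phrased so that they remain true when the
  constant grows.\<close>

lemma compact_uniform_constant:
  fixes P :: "'a::topological_space \<Rightarrow> real \<Rightarrow> bool"
  assumes "compact M" and mono: "\<And>y c c'. P y c \<Longrightarrow> c \<le> c' \<Longrightarrow> P y c'"
    and "\<And>x. x \<in> M \<Longrightarrow> \<exists>N c. open N \<and> x \<in> N \<and> (\<forall>y\<in>M \<inter> N. P y c)"
  shows "\<exists>c. \<forall>y\<in>M. P y c"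
proof -
  obtain N c where N: "\<And>x. x \<in> M \<Longrightarrow> open (N x) \<and> x \<in> N x \<and> (\<forall>y\<in>M \<inter> N x. P y (c x))"
    using assms(3) by metis
  obtain D where D: "D \<subseteq> M" "finite D" "M \<subseteq> (\<Union>x\<in>D. N x)"
    using compactE_image[OF assms(1), of M N] N by (metis UN_I subsetI)
  define c0 where "c0 = (if D = {} then 0 else Max (c ` D))"
  have "P y c0" if y: "y \<in> M" for y
  proof -
    obtain x where x: "x \<in> D" "y \<in> N x" using D(3) y by blast
    then have "P y (c x)" using N D(1) y by blast
    moreover have "c x \<le> c0" using x D(2) by (auto simp: c0_def)
    ultimately show ?thesis by (rule mono)
  qed
  then show ?thesis by blast
qed

section \<open>Gradient and Laplacian in a normal chart\<close>

lemma normal_chart_exists: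
  fixes M :: "(real^'m) set"
  assumes "smooth_submanifold TYPE('d::finite) M" "x \<in> M"
  shows "\<exists>r0 r1 C (\<psi> :: real^'d \<Rightarrow> real^'m) E B. normal_chart M r0 r1 C x \<psi> E B"
proof -
  from normal_charts_patch[OF assms] show ?thesis
  proof (elim exE conjE)
    fix N r0 r1 C and \<Psi> :: "real^'m \<Rightarrow> real^'d \<Rightarrow> real^'m"
    assume "x \<in> N" "\<forall>y\<in>M \<inter> N. \<exists>E B. normal_chart M r0 r1 C y (\<Psi> y) E B"
    then have "\<exists>E B. normal_chart M r0 r1 C x (\<Psi> x) E B" using assms(2) by blast
    then show ?thesis by blast
  qed
qed

lemma norm_le_of_inner_le:
  fixes z :: "'a::real_inner"
  assumes "0 \<le> k" "\<And>v. \<bar>z \<bullet> v\<bar> \<le> k * norm v"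
  shows "norm z \<le> k"
proof (cases "z = 0")
  case False
  have "norm z * norm z \<le> k * norm z"
    using assms(2)[of z] by (simp flip: power2_eq_square add: power2_norm_eq_inner)
  then show ?thesis using False by simp
qed (use assms(1) in simp)

lemma orthonormal_expansion:
  fixes S :: "'a::euclidean_space set"
  assumes "pairwise orthogonal S" "\<And>e. e \<in> S \<Longrightarrow> norm e = 1" "x \<in> span S"
  shows "x = (\<Sum>e\<in>S. (x \<bullet> e) *\<^sub>R e)"
proof -
  have fin: "finite S" by (rule pairwise_orthogonal_imp_finite[OF assms(1)])
  define y where "y = x - (\<Sum>e\<in>S. (x \<bullet> e) *\<^sub>R e)"
  have "y \<bullet> e = 0" if e: "e \<in> S" for e
  proof -
    have "(\<Sum>e'\<in>S. (x \<bullet> e') *\<^sub>R e') \<bullet> e = (\<Sum>e'\<in>S. (if e' = e then x \<bullet> e else 0))"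
      unfolding inner_sum_left
    proof (rule sum.cong[OF refl])
      fix e' assume e': "e' \<in> S"
      show "((x \<bullet> e') *\<^sub>R e') \<bullet> e = (if e' = e then x \<bullet> e else 0)"
        using assms(1,2) e e' by (auto simp: pairwise_def orthogonal_def norm_eq_1)
    qed
    then show ?thesis using fin e by (simp add: y_def inner_diff_left)
  qed
  then have "orthogonal y z" if "z \<in> span S" for z
    using orthogonal_to_span[OF that, of y] by (simp add: orthogonal_def)
  moreover have "y \<in> span S"
    unfolding y_def by (intro span_diff span_sum span_scale span_base assms(3))
  ultimately have "orthogonal y y" by blast
  then have "y = 0" by (simp add: orthogonal_self)
  then show ?thesis by (simp add: y_def)
qed

text \<open>Expanding \<open>s\<close> in the standard basis leaves the sums of (b . e)(c . e) over
  e in \<open>S\<close>, which Parseval's identity turns into b . c.\<close>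

lemma trace_orthonormal:
  fixes s :: "'a::euclidean_space \<Rightarrow> 'a \<Rightarrow> real"
  assumes s: "bilinear s" and S: "pairwise orthogonal S" "\<And>e. e \<in> S \<Longrightarrow> norm e = 1" "span S = UNIV"
  shows "(\<Sum>e\<in>S. s e e) = (\<Sum>b\<in>Basis. s b b)"
proof -
  have ex: "x = (\<Sum>e\<in>S. (x \<bullet> e) *\<^sub>R e)" for x
    by (rule orthonormal_expansion[OF S(1,2)]) (simp_all add: S(3))
  have inner: "x \<bullet> y = (\<Sum>e\<in>S. (x \<bullet> e) * (y \<bullet> e))" for x y
  proof -
    have "x \<bullet> y = x \<bullet> (\<Sum>e\<in>S. (y \<bullet> e) *\<^sub>R e)" by (rule arg_cong[OF ex])
    then show ?thesis by (simp add: inner_sum_right mult.commute)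
  qed
  have s2: "s x y = (\<Sum>b\<in>Basis. \<Sum>c\<in>Basis. (x \<bullet> b) * (y \<bullet> c) * s b c)" for x y
  proof -
    have "s x y = (\<Sum>b\<in>Basis. (x \<bullet> b) *\<^sub>R s b y)"
      using s by (intro linear_euclidean_expansion) (simp add: bilinear_def)
    also have "\<dots> = (\<Sum>b\<in>Basis. (x \<bullet> b) *\<^sub>R (\<Sum>c\<in>Basis. (y \<bullet> c) *\<^sub>R s b c))"
      using s by (intro sum.cong arg_cong2[where f = "(*\<^sub>R)"] linear_euclidean_expansion refl) (simp add: bilinear_def)
    finally show ?thesis by (simp add: sum_distrib_left mult.assoc)
  qed
  have "(\<Sum>e\<in>S. s e e) = (\<Sum>e\<in>S. \<Sum>b\<in>Basis. \<Sum>c\<in>Basis. (b \<bullet> e) * (c \<bullet> e) * s b c)"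
    by (subst s2) (simp add: inner_commute)
  also have "\<dots> = (\<Sum>b\<in>Basis. \<Sum>c\<in>Basis. \<Sum>e\<in>S. (b \<bullet> e) * (c \<bullet> e) * s b c)"
    by (subst sum.swap) (intro sum.cong refl sum.swap)
  also have "\<dots> = (\<Sum>b\<in>Basis. \<Sum>c\<in>Basis. (b \<bullet> c) * s b c)"
    by (simp flip: inner sum_distrib_right)
  also have "\<dots> = (\<Sum>b\<in>Basis. s b b)"
  proof (intro sum.cong refl)
    fix b :: 'a assume b: "b \<in> Basis"
    have "(\<Sum>c\<in>Basis. (b \<bullet> c) * s b c) = (\<Sum>c\<in>Basis. (if c = b then s b b else 0))"
      using b by (intro sum.cong) (auto simp: inner_Basis)
    then show "(\<Sum>c\<in>Basis. (b \<bullet> c) * s b c) = s b b" using b by simp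
  qed
  finally show ?thesis .
qed

lemma has_derivative_at_zeroI:
  fixes f :: "'a::euclidean_space \<Rightarrow> 'b::real_normed_vector"
  assumes "linear L" "r > 0" "\<And>w. norm w < r \<Longrightarrow> norm (f w - f 0 - L w) \<le> K * norm w ^ 2"
  shows "(f has_derivative L) (at 0)"
  unfolding has_derivative_at_alt
proof (intro conjI allI impI)
  show "bounded_linear L" using assms(1) by (simp add: linear_conv_bounded_linear)
  fix e :: real assume e: "e > 0"
  define d where "d = min r (e / (\<bar>K\<bar> + 1))"
  have "d > 0" using e assms(2) by (simp add: d_def)
  moreover have "norm (f y - f 0 - L (y - 0)) \<le> e * norm (y - 0)" if y: "norm (y - 0) < d" for y
  proof -
    have "norm (f y - f 0 - L y) \<le> K * norm y ^ 2" using assms(3)[of y] y by (simp add: d_def)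
    also have "\<dots> \<le> ((\<bar>K\<bar> + 1) * norm y) * norm y"
      by (simp add: power2_eq_square mult.assoc[symmetric] mult_right_mono)
    also have "\<dots> \<le> e * norm y"
      using y e by (intro mult_right_mono) (auto simp: d_def field_simps)
    finally show ?thesis by simp
  qed
  ultimately show "\<exists>d>0. \<forall>y. norm (y - 0) < d \<longrightarrow> norm (f y - f 0 - L (y - 0)) \<le> e * norm (y - 0)" by blast
qed

lemma inner_sum_Basis: "(\<Sum>b\<in>Basis. h b *\<^sub>R b) \<bullet> v = (\<Sum>b\<in>Basis. (v \<bullet> b) *\<^sub>R h b)"
  unfolding inner_sum_left by (intro sum.cong refl) (simp add: inner_commute mult.commute)

definition grad_at :: "('a::euclidean_space \<Rightarrow> real) \<Rightarrow> 'a \<Rightarrow> 'a" where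
  "grad_at F w = (\<Sum>b\<in>Basis. frechet_derivative F (at w) b *\<^sub>R b)"

lemma grad_at_inner:
  assumes "linear (frechet_derivative F (at w))"
  shows "grad_at F w \<bullet> v = frechet_derivative F (at w) v"
  unfolding linear_euclidean_expansion[OF assms, of v] grad_at_def inner_sum_left
  by (simp add: inner_commute mult.commute)

section \<open>Geometry of a single normal chart\<close>

context normal_chart
begin

lemma smooth: "Ck_on k (ball 0 r1) \<psi>" and inj_psi: "inj_on \<psi> (ball 0 r1)"
  and psi_open: "openin (top_of_set M) (\<psi> ` ball 0 r1)"
  using param by (auto simp: local_parametrization_def smooth_on_def homeomorphism_def intro: inj_on_inverseI)

lemma psi_in_M: "w \<in> ball 0 r1 \<Longrightarrow> \<psi> w \<in> M"
  using openin_imp_subset[OF psi_open] by blast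

lemma normalB': "B w v \<bullet> E u = 0"
  using normalB by (simp add: inner_commute)

lemma x_in_M: "x \<in> M" using psi_in_M[of 0] r1 by (simp add: center)

lemma derivative_psi: "w \<in> ball 0 r1 \<Longrightarrow> (\<psi> has_derivative frechet_derivative \<psi> (at w)) (at w)"
  using Ck_on_has_derivative[OF smooth] by blast

lemma derivative_center: "(\<psi> has_derivative E) (at 0)"
proof -
  have z: "0 \<in> ball (0::real^'d) r1" using r1 by simp
  have "norm (frechet_derivative \<psi> (at 0) v - E v) \<le> 0" for v
    using derivative_expansion[OF z, of v] bilB by (simp add: bilinear_lzero)
  then have "frechet_derivative \<psi> (at 0) = E" by (auto simp: fun_eq_iff)
  then show ?thesis using derivative_psi[OF z] by simp
qed

lemma Cw: "w \<in> ball 0 r1 \<Longrightarrow> C * norm w \<le> 1/16" "w \<in> ball 0 r1 \<Longrightarrow> norm w \<le> 1"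
proof -
  assume w: "w \<in> ball 0 r1"
  then show "norm w \<le> 1" using r1 by simp
  have "C * norm w \<le> C * r1" using w C by (intro mult_left_mono) auto
  then show "C * norm w \<le> 1/16" using C by linarith
qed

lemma near_isometry:
  assumes "w \<in> ball 0 r1" "w' \<in> ball 0 r1"
  shows "norm (\<psi> w - \<psi> w' - E (w - w')) \<le> norm (w - w') / 4"
proof (rule near_isometry_on_ball[OF linE derivative_psi _ assms])
  fix w v :: "real^'d" assume w: "w \<in> ball 0 r1"
  have "norm (frechet_derivative \<psi> (at w) v - E v) \<le> norm (frechet_derivative \<psi> (at w) v - E v - B w v) + norm (B w v)"
    using norm_triangle_ineq[of "frechet_derivative \<psi> (at w) v - E v - B w v" "B w v"] by simp
  also have "\<dots> \<le> (C * norm w) * (norm w * norm v) + (C * norm w) * norm v"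
    using derivative_expansion[OF w, of v] B_bound[of w v] by (simp add: power2_eq_square mult.assoc)
  also have "\<dots> \<le> (1/16) * (1 * norm v) + (1/16) * norm v"
    using Cw[OF w] C by (intro add_mono mult_mono mult_nonneg_nonneg mult_right_mono) auto
  also have "\<dots> \<le> norm v / 4" by simp
  finally show "norm (frechet_derivative \<psi> (at w) v - E v) \<le> norm v / 4" .
qed

lemma norm_bounds:
  assumes w: "w \<in> ball 0 r1"
  shows "norm w \<le> (4/3) * norm (\<psi> w - x)" "norm (\<psi> w - x) \<le> (5/4) * norm w"
proof -
  have "norm (\<psi> w - x - E w) \<le> norm w / 4" using near_isometry[OF w, of 0] r1 by (simp add: center)
  moreover have "norm (E w) \<le> norm (\<psi> w - x) + norm (\<psi> w - x - E w)"
    using norm_triangle_ineq4[of "\<psi> w - x" "\<psi> w - x - E w"] by simp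
  moreover have "norm (\<psi> w - x) \<le> norm (\<psi> w - x - E w) + norm (E w)"
    using norm_triangle_ineq[of "\<psi> w - x - E w" "E w"] by simp
  ultimately show "norm w \<le> (4/3) * norm (\<psi> w - x)" "norm (\<psi> w - x) \<le> (5/4) * norm w"
    by (simp_all add: normE)
qed

lemma expansion:
  assumes w: "w \<in> ball 0 r1"
  shows "norm (\<psi> w - x - E w - (1/2) *\<^sub>R B w w) \<le> C * norm w ^ 3"
proof -
  have "norm ((\<psi> (1 *\<^sub>R w) - 1 *\<^sub>R E w - (1\<^sup>2/2) *\<^sub>R B w w) - (\<psi> (0 *\<^sub>R w) - 0 *\<^sub>R E w - (0\<^sup>2/2) *\<^sub>R B w w)) \<le> C * norm w ^ 3"
  proof (rule unit_interval_bound[where g = "\<lambda>t. \<psi> (t *\<^sub>R w) - t *\<^sub>R E w - (t\<^sup>2/2) *\<^sub>R B w w"])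
    fix t :: real assume t: "t \<in> {0..1}"
    have "t * norm w \<le> 1 * norm w" using t by (intro mult_right_mono) auto
    then have tw: "t *\<^sub>R w \<in> ball 0 r1" using w t by simp
    have d: "((\<lambda>t. \<psi> (t *\<^sub>R w)) has_derivative (\<lambda>s. s *\<^sub>R frechet_derivative \<psi> (at (t *\<^sub>R w)) w)) (at t within {0..1})"
      using has_derivative_line[of \<psi> _ 0 t w] derivative_psi[OF tw] by simp
    show "((\<lambda>t. \<psi> (t *\<^sub>R w) - t *\<^sub>R E w - (t\<^sup>2/2) *\<^sub>R B w w) has_derivative
       (\<lambda>s. s *\<^sub>R (frechet_derivative \<psi> (at (t *\<^sub>R w)) w - E w - B (t *\<^sub>R w) w))) (at t within {0..1})"
      using bilB
      by (auto intro!: derivative_eq_intros d simp: scaleR_diff_right bilinear_lmul power2_eq_square algebra_simps)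
    have "norm (frechet_derivative \<psi> (at (t *\<^sub>R w)) w - E w - B (t *\<^sub>R w) w) \<le> C * norm (t *\<^sub>R w) ^ 2 * norm w"
      using derivative_expansion[OF tw, of w] by simp
    also have "\<dots> \<le> C * norm w ^ 2 * norm w"
      using t C by (intro mult_right_mono mult_left_mono power_mono) (auto intro: mult_left_le_one_le)
    finally show "norm (frechet_derivative \<psi> (at (t *\<^sub>R w)) w - E w - B (t *\<^sub>R w) w) \<le> C * norm w ^ 3"
      by (simp add: power2_eq_square power3_eq_cube mult.assoc)
  qed
  then show ?thesis by (simp add: center algebra_simps)
qed

text \<open>Projection to the tangent space annihilates the quadratic term because \<open>B\<close>
  is normal; the chart coordinate and the projected displacement differ only at third order.\<close>

lemma adjoint_expansion:
  assumes w: "w \<in> ball 0 r1"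
  shows "norm (w - adjoint E (\<psi> w - x)) \<le> C * norm w ^ 3"
proof -
  have "v \<bullet> adjoint E (B w w) = 0" for v by (simp add: adjoint_works[OF linE] normalB)
  then have "adjoint E (B w w) = 0" using inner_eq_zero_iff by blast
  then have "adjoint E (\<psi> w - x - E w - (1/2) *\<^sub>R B w w) = adjoint E (\<psi> w - x) - w"
    using adjoint_linear[OF linE] by (simp add: linear_diff linear_scale adjoint_isometry[OF linE normE])
  then have "norm (w - adjoint E (\<psi> w - x)) = norm (adjoint E (\<psi> w - x - E w - (1/2) *\<^sub>R B w w))"
    by (simp add: norm_minus_commute)
  also have "\<dots> \<le> C * norm w ^ 3"
    by (rule order_trans[OF norm_adjoint_isometry_le[OF linE normE] expansion[OF w]])
  finally show ?thesis .
qed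

text \<open>By Pythagoras the squared length of E w + B w w / 2 exceeds |w|^2 only by |B w w|^2 / 4,
  a term of fourth order, so the length itself changes at third order.\<close>

lemma distance_expansion:
  assumes w: "w \<in> ball 0 r1"
  shows "\<bar>norm (\<psi> w - x) - norm w\<bar> \<le> (C + C ^ 2) * norm w ^ 3"
proof -
  define y where "y = E w + (1/2) *\<^sub>R B w w"
  have sq: "norm y ^ 2 = norm w ^ 2 + norm (B w w) ^ 2 / 4"
  proof -
    have "y \<bullet> y = E w \<bullet> E w + (1/4) * (B w w \<bullet> B w w)"
      unfolding y_def inner_add_left inner_add_right inner_scaleR_left inner_scaleR_right normalB normalB' by simp
    then show ?thesis unfolding power2_norm_eq_inner inner_of_norm_preserving[OF linE normE] by linarith
  qed
  have "norm w ^ 2 \<le> norm y ^ 2" unfolding sq by simp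
  then have ge: "norm w \<le> norm y" by (rule power2_le_imp_le) simp
  have "norm (B w w) ^ 2 \<le> (C * norm w * norm w) ^ 2" using B_bound by (intro power_mono) auto
  also have "\<dots> = C\<^sup>2 * norm w ^ 3 * norm w" by (simp add: power2_eq_square power3_eq_cube)
  finally have "norm y ^ 2 \<le> norm w ^ 2 + C\<^sup>2 * norm w ^ 3 * norm w"
    unfolding sq using zero_le_power2[of "norm (B w w)"] by linarith
  also have "\<dots> \<le> (norm w + C\<^sup>2 * norm w ^ 3) ^ 2" unfolding power2_sum by simp
  finally have "norm y \<le> norm w + C\<^sup>2 * norm w ^ 3" by (rule power2_le_imp_le) simp
  moreover have "norm (\<psi> w - x - y) \<le> C * norm w ^ 3" using expansion[OF w] by (simp add: y_def diff_diff_eq add.assoc)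
  moreover have "\<bar>norm (\<psi> w - x) - norm y\<bar> \<le> norm (\<psi> w - x - y)" by (rule norm_triangle_ineq3)
  ultimately show ?thesis using ge by (simp add: distrib_right)
qed

text \<open>The products of \<open>E\<close> with \<open>B\<close> vanish by normality, so the
  metric has no first-order term. What is left, \<open>B\<close> against \<open>B\<close> and
  everything containing the remainder, is of second order.\<close>

lemma derivative_inner_estimate:
  assumes w: "w \<in> ball 0 r1"
  shows "\<bar>frechet_derivative \<psi> (at w) c \<bullet> frechet_derivative \<psi> (at w) v - c \<bullet> v\<bar> \<le> (C ^ 2 + 3 * C) * norm w ^ 2 * norm c * norm v"
proof -
  define R where "R v = frechet_derivative \<psi> (at w) v - E v - B w v" for v
  define T where "T = C * (norm w ^ 2 * norm c * norm v)"
  have R: "norm (R v) \<le> C * norm w ^ 2 * norm v" for v unfolding R_def by (rule derivative_expansion[OF w])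
  have Cw2: "C * norm w ^ 2 \<le> 1/16"
  proof -
    have "C * norm w * norm w \<le> C * norm w * 1" using Cw(2)[OF w] C by (intro mult_left_mono) auto
    then show ?thesis using Cw(1)[OF w] by (simp add: power2_eq_square mult.assoc)
  qed
  have B': "norm (B w v) \<le> (1/16) * norm v" for v
    using B_bound[of w v] mult_right_mono[OF Cw(1)[OF w], of "norm v"] by simp
  have D: "frechet_derivative \<psi> (at w) v = E v + B w v + R v" for v by (simp add: R_def)
  have "frechet_derivative \<psi> (at w) c \<bullet> frechet_derivative \<psi> (at w) v - c \<bullet> v =
     B w c \<bullet> B w v + (B w c \<bullet> R v + R c \<bullet> B w v) + (E c \<bullet> R v + R c \<bullet> E v) + R c \<bullet> R v"
    unfolding D by (simp add: inner_add_left inner_add_right normalB normalB' inner_of_norm_preserving[OF linE normE])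
  moreover have "\<bar>B w c \<bullet> B w v\<bar> \<le> C ^ 2 * (norm w ^ 2 * norm c * norm v)"
  proof -
    have "\<bar>B w c \<bullet> B w v\<bar> \<le> (C * norm w * norm c) * (C * norm w * norm v)"
      by (rule order_trans[OF Cauchy_Schwarz_ineq2 mult_mono[OF B_bound B_bound]]) (use C in auto)
    then show ?thesis by (simp add: power2_eq_square mult_ac)
  qed
  moreover have "\<bar>B w c \<bullet> R v\<bar> \<le> (1/16) * T" "\<bar>R c \<bullet> B w v\<bar> \<le> (1/16) * T"
  proof -
    have "\<bar>B w c \<bullet> R v\<bar> \<le> ((1/16) * norm c) * (C * norm w ^ 2 * norm v)"
      by (rule order_trans[OF Cauchy_Schwarz_ineq2 mult_mono[OF B' R]]) auto
    moreover have "\<bar>R c \<bullet> B w v\<bar> \<le> (C * norm w ^ 2 * norm c) * ((1/16) * norm v)"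
      by (rule order_trans[OF Cauchy_Schwarz_ineq2 mult_mono[OF R B']]) (use C in auto)
    ultimately show "\<bar>B w c \<bullet> R v\<bar> \<le> (1/16) * T" "\<bar>R c \<bullet> B w v\<bar> \<le> (1/16) * T"
      by (simp_all add: T_def mult_ac)
  qed
  moreover have "\<bar>E c \<bullet> R v\<bar> \<le> T" "\<bar>R c \<bullet> E v\<bar> \<le> T"
  proof -
    have "\<bar>E c \<bullet> R v\<bar> \<le> norm c * (C * norm w ^ 2 * norm v)"
      by (rule order_trans[OF Cauchy_Schwarz_ineq2 mult_mono[OF eq_refl[OF normE] R]]) auto
    moreover have "\<bar>R c \<bullet> E v\<bar> \<le> (C * norm w ^ 2 * norm c) * norm v"
      by (rule order_trans[OF Cauchy_Schwarz_ineq2 mult_mono[OF R eq_refl[OF normE]]]) (use C in auto)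
    ultimately show "\<bar>E c \<bullet> R v\<bar> \<le> T" "\<bar>R c \<bullet> E v\<bar> \<le> T"
      by (simp_all add: T_def mult_ac)
  qed
  moreover have "\<bar>R c \<bullet> R v\<bar> \<le> (1/16) * T"
  proof -
    have R': "norm (R c) \<le> (1/16) * norm c" using R[of c] mult_right_mono[OF Cw2, of "norm c"] by simp
    have "\<bar>R c \<bullet> R v\<bar> \<le> ((1/16) * norm c) * (C * norm w ^ 2 * norm v)"
      by (rule order_trans[OF Cauchy_Schwarz_ineq2 mult_mono[OF R' R]]) auto
    then show ?thesis by (simp add: T_def mult_ac)
  qed
  moreover have "0 \<le> T" using C by (simp add: T_def)
  ultimately have "\<bar>frechet_derivative \<psi> (at w) c \<bullet> frechet_derivative \<psi> (at w) v - c \<bullet> v\<bar>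
    \<le> C ^ 2 * (norm w ^ 2 * norm c * norm v) + 3 * T"
    unfolding abs_le_iff by linarith
  then show ?thesis by (simp add: T_def algebra_simps)
qed

lemma gram_estimate:
  assumes w: "w \<in> ball 0 r1"
  shows "\<bar>gram_matrix \<psi> w $ i $ j - mat 1 $ i $ j\<bar> \<le> (C ^ 2 + 3 * C) * norm w ^ 2"
proof -
  have eq: "axis i 1 \<bullet> (axis j 1 :: real^'d) = mat 1 $ i $ j" by (simp add: inner_axis_axis mat_def)
  have g: "gram_matrix \<psi> w $ i $ j = frechet_derivative \<psi> (at w) (axis i 1) \<bullet> frechet_derivative \<psi> (at w) (axis j 1)"
    by (simp add: gram_matrix_def)
  from derivative_inner_estimate[OF w, of "axis i 1" "axis j 1"]
  show ?thesis unfolding g eq norm_axis_1 mult_1_right .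
qed

definition \<theta> :: "real^'m \<Rightarrow> real^'d" where "\<theta> = inv_into (ball 0 r1) \<psi>"

lemma theta:
  assumes "y \<in> M" "dist y x < r0"
  shows "\<theta> y \<in> ball 0 r1" "\<psi> (\<theta> y) = y" "norm (\<theta> y) \<le> (4/3) * norm (y - x)"
proof -
  have "y \<in> \<psi> ` ball 0 r1" using cover assms by (auto simp: dist_commute)
  then show *: "\<theta> y \<in> ball 0 r1" "\<psi> (\<theta> y) = y"
    unfolding \<theta>_def by (rule inv_into_into, rule f_inv_into_f)
  show "norm (\<theta> y) \<le> (4/3) * norm (y - x)" using norm_bounds(1)[OF *(1)] *(2) by simp
qed

lemma theta_center: "\<theta> x = 0"
  using theta(3)[OF x_in_M] r0 by simp

text \<open>The notions defined through derivatives \<open>within M\<close> reach the chart by this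
  map: composition with it turns a derivative at 0 in the chart into a derivative within
  \<open>M\<close> at x. The error is even cubic, by \<open>adjoint_expansion\<close>.\<close>

lemma derivative_theta: "(\<theta> has_derivative adjoint E) (at x within M)"
  unfolding has_derivative_within_alt
proof (intro conjI allI impI)
  show "bounded_linear (adjoint E)" using adjoint_linear[OF linE] by (simp add: linear_conv_bounded_linear)
  fix e :: real assume e: "e > 0"
  define d where "d = min r0 (min 1 (e / (3 * C + 1)))"
  have d: "d > 0" using e r0 C by (simp add: d_def)
  moreover have "norm (\<theta> y - \<theta> x - adjoint E (y - x)) \<le> e * norm (y - x)" if y: "y \<in> M" "norm (y - x) < d" for y
  proof -
    have yd: "dist y x < r0" using y by (simp add: dist_norm d_def)
    note t = theta[OF y(1) yd]
    let ?n = "norm (y - x)"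
    have "norm (\<theta> y - \<theta> x - adjoint E (y - x)) \<le> C * norm (\<theta> y) ^ 3"
      using adjoint_expansion[OF t(1)] t(2) by (simp add: theta_center)
    also have "\<dots> \<le> C * ((4/3) * ?n) ^ 3" using t(3) C by (intro mult_left_mono power_mono) auto
    also have "\<dots> = C * (64/27) * ?n ^ 3" by (simp add: power_mult_distrib power_divide)
    also have "\<dots> \<le> (3 * C) * ?n ^ 3" using C by (intro mult_right_mono) auto
    also have "\<dots> = (3 * C * ?n) * ?n * ?n" by (simp add: power3_eq_cube)
    also have "\<dots> \<le> (3 * C * ?n) * 1 * ?n"
      using y C by (intro mult_right_mono mult_left_mono) (auto simp: d_def)
    also have "\<dots> \<le> e * ?n"
    proof -
      have "?n * (3 * C + 1) \<le> e" using y C by (simp add: d_def field_simps)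
      then have "3 * C * ?n \<le> e" by (simp add: algebra_simps) (smt (verit) norm_ge_zero)
      then show ?thesis by (intro mult_right_mono) auto
    qed
    finally show ?thesis .
  qed
  ultimately show "\<exists>d>0. \<forall>y\<in>M. norm (y - x) < d \<longrightarrow> norm (\<theta> y - \<theta> x - adjoint E (y - x)) \<le> e * norm (y - x)"
    by blast
qed

lemma derivative_within_of_chart:
  assumes "((\<lambda>w. f (\<psi> w)) has_derivative F') (at 0)"
  shows "(f has_derivative (\<lambda>z. F' (adjoint E z))) (at x within M)"
proof -
  have "((\<lambda>y. (f (\<psi> (\<theta> y)))) has_derivative (\<lambda>z. F' (adjoint E z))) (at x within M)"
    using assms by (intro has_derivative_compose[OF derivative_theta, where g = "\<lambda>w. f (\<psi> w)"]) (simp add: theta_center)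
  then show ?thesis
    by (rule has_derivative_transform_within[OF _ r0 x_in_M]) (simp add: theta)
qed

lemma derivative_chart_of_within:
  assumes "(f has_derivative f') (at x within M)"
  shows "((\<lambda>w. f (\<psi> w)) has_derivative (\<lambda>v. f' (E v))) (at 0)"
proof -
  have "((\<lambda>w. f (\<psi> w)) has_derivative (\<lambda>v. f' (E v))) (at 0 within ball 0 r1)"
  proof (rule has_derivative_in_compose[where f = \<psi> and f' = E and g = f and g' = f'])
    show "(\<psi> has_derivative E) (at 0 within ball 0 r1)" using derivative_center has_derivative_at_withinI by blast
    show "(f has_derivative f') (at (\<psi> 0) within \<psi> ` ball 0 r1)"
      unfolding center by (rule has_derivative_subset[OF assms]) (use psi_in_M in auto)
  qed
  moreover have "at 0 within ball 0 r1 = at (0 :: real^'d)" by (rule at_within_open) (use r1 in auto)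
  ultimately show ?thesis by simp
qed

section \<open>Tangent space, gradient and Laplacian\<close>

lemma subspace_range_E: "subspace (range E)"
  by (intro linear_subspace_image linE subspace_UNIV)

text \<open>The vector E v is the velocity of t -> \<psi>(tv). Conversely, \<psi> after \<theta>
  fixes the points of \<open>M\<close> near x, so differentiating along a curve in \<open>M\<close>
  gives E (adjoint E w) = w for its velocity w.\<close>

lemma tangent_space_eq: "tangent_space M x = range E"
proof (intro equalityI subsetI)
  fix w assume "w \<in> range E"
  then obtain v where v: "w = E v" by auto
  define \<epsilon> where "\<epsilon> = r1 / (norm v + 1)"
  have \<epsilon>: "\<epsilon> > 0" using r1 by (simp add: \<epsilon>_def add_nonneg_pos)
  have ball: "t *\<^sub>R v \<in> ball 0 r1" if "t \<in> {-\<epsilon><..<\<epsilon>}" for t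
  proof -
    have "\<bar>t\<bar> < \<epsilon>" using that by auto
    have "\<bar>t\<bar> * norm v \<le> \<bar>t\<bar> * (norm v + 1)" by (intro mult_left_mono) auto
    also have "\<dots> < \<epsilon> * (norm v + 1)" using \<open>\<bar>t\<bar> < \<epsilon>\<close> by (intro mult_strict_right_mono) (auto simp: add_nonneg_pos)
    also have "\<dots> = r1" by (simp add: \<epsilon>_def add_nonneg_eq_0_iff)
    finally show ?thesis by simp
  qed
  have "smooth_on {-\<epsilon><..<\<epsilon>} (\<lambda>t. \<psi> (t *\<^sub>R v))"
    unfolding smooth_on_def using ball
    by (intro allI Ck_on_compose[OF _ Ck_on_linear[OF _ Ck_on_ident] smooth]) (auto intro: bounded_linear_scaleR_left)
  moreover have "((\<lambda>t. \<psi> (t *\<^sub>R v)) has_vector_derivative w) (at 0)"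
    using has_derivative_line[of \<psi> E 0 0 v UNIV] derivative_center by (simp add: has_vector_derivative_def v)
  ultimately show "w \<in> tangent_space M x"
    unfolding tangent_space_def using \<epsilon> ball psi_in_M
    by (intro CollectI exI[of _ \<epsilon>] conjI exI[of _ "\<lambda>t. \<psi> (t *\<^sub>R v)"]) (auto simp: center)
next
  fix w assume "w \<in> tangent_space M x"
  then obtain \<epsilon> \<gamma> where \<epsilon>: "\<epsilon> > 0" and \<gamma>: "\<gamma> ` {-\<epsilon><..<\<epsilon>} \<subseteq> M" "\<gamma> 0 = x" "(\<gamma> has_vector_derivative w) (at (0::real))"
    by (auto simp: tangent_space_def)
  have zero: "0 \<in> {-\<epsilon><..<\<epsilon>}" using \<epsilon> by simp
  have d\<gamma>: "(\<gamma> has_derivative (\<lambda>s. s *\<^sub>R w)) (at 0 within {-\<epsilon><..<\<epsilon>})"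
    using \<gamma>(3) has_derivative_at_withinI unfolding has_vector_derivative_def by blast
  have "((\<lambda>t. \<theta> (\<gamma> t)) has_derivative (\<lambda>s. adjoint E (s *\<^sub>R w))) (at 0 within {-\<epsilon><..<\<epsilon>})"
  proof (rule has_derivative_in_compose[OF d\<gamma>, where g = \<theta> and g' = "adjoint E"])
    show "(\<theta> has_derivative adjoint E) (at (\<gamma> 0) within \<gamma> ` {- \<epsilon><..<\<epsilon>})"
      unfolding \<gamma>(2) by (rule has_derivative_subset[OF derivative_theta \<gamma>(1)])
  qed
  then have "((\<lambda>t. \<psi> (\<theta> (\<gamma> t))) has_derivative (\<lambda>s. E (adjoint E (s *\<^sub>R w)))) (at 0 within {-\<epsilon><..<\<epsilon>})"
    by (rule has_derivative_compose[where g = \<psi> and g' = E]) (simp add: \<gamma>(2) theta_center derivative_center)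
  then have d1: "((\<lambda>t. \<psi> (\<theta> (\<gamma> t))) has_derivative (\<lambda>s. E (adjoint E (s *\<^sub>R w)))) (at 0)"
    unfolding at_within_open[OF zero open_greaterThanLessThan] .
  have "isCont \<gamma> 0" using \<gamma>(3) has_vector_derivative_continuous by blast
  then obtain \<delta> where \<delta>: "\<delta> > 0" "\<And>t. dist t 0 < \<delta> \<Longrightarrow> dist (\<gamma> t) x < r0"
    using r0 \<gamma>(2) unfolding continuous_at_eps_delta by metis
  have "(\<gamma> has_derivative (\<lambda>s. E (adjoint E (s *\<^sub>R w)))) (at 0)"
  proof (rule has_derivative_transform_within[OF d1])
    show "0 < min \<epsilon> \<delta>" using \<epsilon> \<delta> by simp
    show "\<psi> (\<theta> (\<gamma> t)) = \<gamma> t" if "dist t 0 < min \<epsilon> \<delta>" for t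
    proof (rule theta(2))
      have "\<bar>t\<bar> < \<epsilon>" using that by (simp add: dist_real_def)
      then have "t \<in> {-\<epsilon><..<\<epsilon>}" by (simp add: abs_less_iff)
      then show "\<gamma> t \<in> M" using \<gamma>(1) by blast
      show "dist (\<gamma> t) x < r0" using \<delta>(2)[of t] that by simp
    qed
  qed simp
  then have "(\<lambda>s. E (adjoint E (s *\<^sub>R w))) = (\<lambda>s. s *\<^sub>R w)"
    using has_derivative_unique \<gamma>(3) unfolding has_vector_derivative_def by blast
  then have "E (adjoint E (1 *\<^sub>R w)) = 1 *\<^sub>R w" by metis
  then show "w \<in> range E" by (metis rangeI scaleR_one)
qed

text \<open>Two derivatives within \<open>M\<close> agree after composition with \<open>E\<close>,
  by uniqueness of the derivative in the chart. The gradient is then the Riesz vector of this common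
  functional on the tangent space.\<close>

lemma gradient_properties:
  assumes "(f has_derivative f') (at x within M)"
  shows "manifold_gradient M f x \<in> range E" and "manifold_gradient M f x \<bullet> E u = f' (E u)"
    and "manifold_gradient M f x = E (\<Sum>b\<in>Basis. f' (E b) *\<^sub>R b)"
proof -
  have lin: "linear (\<lambda>u. f' (E u))"
    using linear_compose[OF linE has_derivative_linear[OF assms]] by (simp add: o_def)
  define a where "a = (\<Sum>b\<in>Basis. f' (E b) *\<^sub>R b)"
  have a: "a \<bullet> u = f' (E u)" for u
    unfolding a_def linear_euclidean_expansion[OF lin, of u] inner_sum_left by (simp add: inner_commute mult.commute)
  have "manifold_gradient M f x = E a"
    unfolding manifold_gradient_def tangent_space_eq
  proof (rule the_equality)
    show "E a \<in> range E \<and> (\<exists>f'. (f has_derivative f') (at x within M) \<and> (\<forall>w\<in>range E. E a \<bullet> w = f' w))"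
      using assms a by (auto simp: inner_of_norm_preserving[OF linE normE])
  next
    fix v assume v: "v \<in> range E \<and> (\<exists>f'. (f has_derivative f') (at x within M) \<and> (\<forall>w\<in>range E. v \<bullet> w = f' w))"
    then obtain c f'' where c: "v = E c" and f'': "(f has_derivative f'') (at x within M)" "\<And>w. w \<in> range E \<Longrightarrow> v \<bullet> w = f'' w"
      by auto
    have "(\<lambda>u. f'' (E u)) = (\<lambda>u. f' (E u))"
      using has_derivative_unique[OF derivative_chart_of_within[OF f''(1)] derivative_chart_of_within[OF assms]] .
    then have "f'' (E u) = f' (E u)" for u by metis
    then have "c \<bullet> u = a \<bullet> u" for u
      using f''(2)[of "E u"] a[of u] by (simp add: c inner_of_norm_preserving[OF linE normE])
    then have "c = a" using vector_eq_rdot by blast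
    then show "v = E a" by (simp add: c)
  qed
  then show "manifold_gradient M f x \<in> range E" "manifold_gradient M f x \<bullet> E u = f' (E u)"
     "manifold_gradient M f x = E (\<Sum>b\<in>Basis. f' (E b) *\<^sub>R b)"
    using a by (auto simp: inner_of_norm_preserving[OF linE normE] a_def)
qed

lemma derivative_in_tangent_space:
  assumes w: "w \<in> ball 0 r1"
  shows "frechet_derivative \<psi> (at w) u \<in> tangent_space M (\<psi> w)"
proof -
  have "open (ball (0::real^'d) r1)" by simp
  then obtain e where e: "e > 0" "ball w e \<subseteq> ball 0 r1" using w open_contains_ball by blast
  define \<epsilon> where "\<epsilon> = e / (norm u + 1)"
  have \<epsilon>: "\<epsilon> > 0" using e by (simp add: \<epsilon>_def add_nonneg_pos)
  have ball: "w + t *\<^sub>R u \<in> ball 0 r1" if "t \<in> {-\<epsilon><..<\<epsilon>}" for t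
  proof -
    have "\<bar>t\<bar> < \<epsilon>" using that by auto
    have "\<bar>t\<bar> * norm u \<le> \<bar>t\<bar> * (norm u + 1)" by (intro mult_left_mono) auto
    also have "\<dots> < \<epsilon> * (norm u + 1)" using \<open>\<bar>t\<bar> < \<epsilon>\<close> by (intro mult_strict_right_mono) (auto simp: add_nonneg_pos)
    also have "\<dots> = e" by (simp add: \<epsilon>_def add_nonneg_eq_0_iff)
    finally have "w + t *\<^sub>R u \<in> ball w e" by (simp add: dist_norm)
    then show ?thesis using e(2) by blast
  qed
  have "Ck_on k {-\<epsilon><..<\<epsilon>} (\<lambda>t. w + t *\<^sub>R u)" for k
    by (intro Ck_on_add Ck_on_const Ck_on_linear[OF _ Ck_on_ident]) (auto intro: bounded_linear_scaleR_left)
  then have "smooth_on {-\<epsilon><..<\<epsilon>} (\<lambda>t. \<psi> (w + t *\<^sub>R u))"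
    unfolding smooth_on_def using ball by (intro allI Ck_on_compose[OF _ _ smooth]) auto
  moreover have "((\<lambda>t. \<psi> (w + t *\<^sub>R u)) has_vector_derivative frechet_derivative \<psi> (at w) u) (at 0)"
    using has_derivative_line[of \<psi> _ w 0 u UNIV] derivative_psi[OF w] by (simp add: has_vector_derivative_def)
  ultimately show ?thesis
    unfolding tangent_space_def using \<epsilon> ball psi_in_M
    by (intro CollectI exI[of _ \<epsilon>] conjI exI[of _ "\<lambda>t. \<psi> (w + t *\<^sub>R u)"]) auto
qed

lemma Ck_pullback: "Ck_manifold TYPE('d) k M f \<Longrightarrow> Ck_on k (ball 0 r1) (\<lambda>w. f (\<psi> w))"
  using param by (auto simp: Ck_manifold_def o_def)

lemma derivative_within:
  assumes "Ck_manifold TYPE('d) (Suc k) M f"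
  shows "(f has_derivative (\<lambda>z. frechet_derivative (\<lambda>w. f (\<psi> w)) (at 0) (adjoint E z))) (at x within M)"
  using Ck_on_has_derivative[OF Ck_pullback[OF assms], of 0] r1
  by (intro derivative_within_of_chart) simp

lemma gradient_center:
  assumes "Ck_manifold TYPE('d) (Suc k) M f"
  shows "manifold_gradient M f x = E (grad_at (\<lambda>w. f (\<psi> w)) 0)"
  using gradient_properties(3)[OF derivative_within[OF assms]]
  by (simp add: adjoint_isometry[OF linE normE] grad_at_def)

text \<open>Away from its centre the chart is not adapted to the tangent space. An auxiliary normal
  chart centred at \<psi> w evaluates the gradient there, and one inclusion together with equal
  dimensions identifies the two descriptions of the tangent space.\<close>

lemma gradient_along_chart:
  assumes sub: "smooth_submanifold TYPE('d) M" and f: "Ck_manifold TYPE('d) (Suc k) M f" and w: "w \<in> ball 0 r1"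
  shows "\<exists>c. manifold_gradient M f (\<psi> w) = frechet_derivative \<psi> (at w) c \<and>
    (\<forall>v. frechet_derivative \<psi> (at w) c \<bullet> frechet_derivative \<psi> (at w) v = frechet_derivative (\<lambda>w. f (\<psi> w)) (at w) v)"
proof -
  obtain r0' r1' C' and \<psi>' E' :: "real^'d \<Rightarrow> real^'m" and B' where "normal_chart M r0' r1' C' (\<psi> w) \<psi>' E' B'"
    using normal_chart_exists[OF sub psi_in_M[OF w]] by (elim exE)
  then interpret N: normal_chart M r0' r1' C' "\<psi> w" \<psi>' E' B' .
  let ?D = "frechet_derivative \<psi> (at w)"
  define f' where "f' z = frechet_derivative (\<lambda>w. f (\<psi>' w)) (at 0) (adjoint E' z)" for z
  have f': "(f has_derivative f') (at (\<psi> w) within M)" unfolding f'_def[abs_def] by (rule N.derivative_within[OF f])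
  have linD: "linear ?D" by (rule has_derivative_linear[OF derivative_psi[OF w]])
  have injD: "inj ?D" using param w by (auto simp: local_parametrization_def)
  have injE: "inj E'" unfolding linear_injective_0[OF N.linE] using N.normE by (metis norm_eq_zero)
  have "range ?D = range E'"
  proof (rule subspace_dim_equal)
    show "subspace (range ?D)" by (intro linear_subspace_image linD subspace_UNIV)
    show "subspace (range E')" by (rule N.subspace_range_E)
    show "range ?D \<subseteq> range E'" using derivative_in_tangent_space[OF w] N.tangent_space_eq by auto
    show "dim (range E') \<le> dim (range ?D)"
      using dim_image_eq[OF linD, of UNIV] dim_image_eq[OF N.linE, of UNIV] injD injE by simp
  qed
  then obtain c where c: "manifold_gradient M f (\<psi> w) = ?D c" using N.gradient_properties(1)[OF f'] by auto
  have "((\<lambda>w. f (\<psi> w)) has_derivative (\<lambda>v. f' (?D v))) (at w within ball 0 r1)"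
  proof (rule has_derivative_in_compose[where f = \<psi> and f' = ?D and g = f and g' = f'])
    show "(\<psi> has_derivative ?D) (at w within ball 0 r1)" using derivative_psi[OF w] has_derivative_at_withinI by blast
    show "(f has_derivative f') (at (\<psi> w) within \<psi> ` ball 0 r1)"
      by (rule has_derivative_subset[OF f']) (use psi_in_M in auto)
  qed
  moreover have "at w within ball 0 r1 = at w" by (rule at_within_open[OF w]) simp
  ultimately have "((\<lambda>w. f (\<psi> w)) has_derivative (\<lambda>v. f' (?D v))) (at w)" by simp
  then have fd: "frechet_derivative (\<lambda>w. f (\<psi> w)) (at w) = (\<lambda>v. f' (?D v))"
    by (rule frechet_derivative_at[symmetric])
  have "?D c \<bullet> ?D v = frechet_derivative (\<lambda>w. f (\<psi> w)) (at w) v" for v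
  proof -
    have "?D v \<in> range E'" unfolding \<open>range ?D = range E'\<close>[symmetric] by (rule rangeI)
    then obtain u where "?D v = E' u" by (rule rangeE)
    then show ?thesis using N.gradient_properties(2)[OF f', of u] by (simp add: c fd)
  qed
  then show ?thesis using c by blast
qed

text \<open>The coefficient vector c of the gradient solves a linear system whose matrix is the
  identity up to O(|w|^2) and whose right-hand side is the flat gradient g. Smallness gives |c|
  \<le> 2 |g|, hence |g - c| = O(|w|^2 |g|).\<close>

lemma gradient_approximation:
  assumes sub: "smooth_submanifold TYPE('d) M" and f: "Ck_manifold TYPE('d) (Suc k) M f" and w: "w \<in> ball 0 r1"
    and small: "(C ^ 2 + 3 * C) * norm w ^ 2 \<le> 1/2"
  shows "norm (manifold_gradient M f (\<psi> w) - frechet_derivative \<psi> (at w) (grad_at (\<lambda>w. f (\<psi> w)) w))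
    \<le> 4 * (C ^ 2 + 3 * C) * norm w ^ 2 * norm (grad_at (\<lambda>w. f (\<psi> w)) w)"
proof -
  let ?D = "frechet_derivative \<psi> (at w)"
  define g where "g = grad_at (\<lambda>w. f (\<psi> w)) w"
  define k where "k = (C ^ 2 + 3 * C) * norm w ^ 2"
  have k0: "0 \<le> k" using C by (simp add: k_def)
  obtain c where c: "manifold_gradient M f (\<psi> w) = ?D c"
    "\<And>v. ?D c \<bullet> ?D v = frechet_derivative (\<lambda>w. f (\<psi> w)) (at w) v"
    using gradient_along_chart[OF sub f w] by blast
  have g: "g \<bullet> v = ?D c \<bullet> ?D v" for v
    unfolding g_def c(2) by (intro grad_at_inner linear_frechet_derivative[OF Ck_pullback[OF f] w])
  have "\<bar>(g - c) \<bullet> v\<bar> \<le> k * norm c * norm v" for v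
    using derivative_inner_estimate[OF w, of c v] by (simp add: inner_diff_left g k_def)
  then have gc: "norm (g - c) \<le> k * norm c" using k0 by (intro norm_le_of_inner_le) auto
  have "norm c \<le> norm g + norm (g - c)" using norm_triangle_ineq4[of g "g - c"] by simp
  also have "\<dots> \<le> norm g + (1/2) * norm c"
    using gc mult_right_mono[OF small, of "norm c"] by (simp add: k_def)
  finally have "norm c \<le> 2 * norm g" by simp
  then have gc2: "norm (g - c) \<le> 2 * (k * norm g)" using gc k0 mult_left_mono[of "norm c" "2 * norm g" k] by simp
  have D2: "norm (?D v) \<le> 2 * norm v" for v
  proof -
    have "?D v \<bullet> ?D v \<le> v \<bullet> v + k * norm v * norm v" using derivative_inner_estimate[OF w, of v v] by (simp add: k_def)
    also have "\<dots> \<le> v \<bullet> v + (1/2) * norm v * norm v" using small by (intro add_left_mono mult_right_mono) (auto simp: k_def)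
    also have "\<dots> \<le> (2 * norm v) ^ 2" by (simp add: power2_eq_square flip: power2_norm_eq_inner)
    finally have "norm (?D v) ^ 2 \<le> (2 * norm v) ^ 2" by (simp only: power2_norm_eq_inner)
    then show ?thesis by (rule power2_le_imp_le) simp
  qed
  have "norm (manifold_gradient M f (\<psi> w) - ?D g) = norm (?D (g - c))"
    using linear_diff[OF has_derivative_linear[OF derivative_psi[OF w]], of g c] by (simp add: c(1) norm_minus_commute)
  also have "\<dots> \<le> 2 * (2 * (k * norm g))" using D2[of "g - c"] gc2 by linarith
  finally show ?thesis by (simp add: k_def g_def algebra_simps)
qed

text \<open>A product rule for the differential of \<psi> applied to the flat gradient: the first
  factor varies by \<open>B\<close>, the second by the Hessian. Passing to the flat gradient costs
  O(|w|^2), invisible in the derivative at 0.\<close>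

lemma gradient_derivative:
  assumes sub: "smooth_submanifold TYPE('d) M" and f: "Ck_manifold TYPE('d) (Suc (Suc (Suc k))) M f"
  defines "F \<equiv> \<lambda>w. f (\<psi> w)"
  shows "((\<lambda>w. manifold_gradient M f (\<psi> w)) has_derivative
    (\<lambda>v. B v (grad_at F 0) + E (\<Sum>b\<in>Basis. second_derivative F 0 v b *\<^sub>R b))) (at 0)"
proof -
  have F: "Ck_on (Suc (Suc (Suc k))) (ball 0 r1) F" unfolding F_def by (rule Ck_pullback[OF f])
  then have F2: "Ck_on (Suc (Suc k)) (ball 0 r1) F" using Ck_on_SucD by blast
  have z: "0 \<in> ball (0::real^'d) r1" using r1 by simp
  define L where "L v = (\<Sum>b\<in>Basis. second_derivative F 0 v b *\<^sub>R b)" for v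
  note bil = bilinear_second_derivative[OF F2 open_ball z]
  have "linear L" unfolding L_def
    using bil by (intro linear_compose_sum ballI linear_compose[unfolded o_def, of "\<lambda>v. second_derivative F 0 v b" "\<lambda>t. t *\<^sub>R b" for b])
      (auto simp: bilinear_def intro: linear_scale_left)
  have L: "L w \<bullet> v = second_derivative F 0 w v" for w v
  proof -
    have "second_derivative F 0 w v = (\<Sum>b\<in>Basis. (v \<bullet> b) *\<^sub>R second_derivative F 0 w b)"
      using bil by (intro linear_euclidean_expansion) (simp add: bilinear_def)
    then show ?thesis by (simp add: L_def inner_sum_Basis)
  qed
  have grad: "grad_at F w \<bullet> v = frechet_derivative F (at w) v" if "w \<in> ball 0 r1" for w v
    by (intro grad_at_inner linear_frechet_derivative[OF F that])
  have "cball (0::real^'d) (r1 / 2) \<subseteq> ball 0 r1" using r1 by auto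
  from taylor2_on_compact_convex[OF F open_ball compact_cball convex_cball this]
  obtain K where K: "K \<ge> 0"
    "\<forall>u\<in>cball 0 (r1/2). \<forall>u'\<in>cball 0 (r1/2). \<forall>v. norm (frechet_derivative F (at u') v - frechet_derivative F (at u) v - second_derivative F u (u' - u) v) \<le> K * norm (u' - u) ^ 2 * norm v"
    "\<forall>u\<in>cball 0 (r1/2). \<forall>z v. norm (second_derivative F u z v) \<le> K * norm z * norm v"
    "\<forall>u\<in>cball 0 (r1/2). \<forall>v. norm (frechet_derivative F (at u) v) \<le> K * norm v"
    by metis
  have zc: "0 \<in> cball (0::real^'d) (r1/2)" using r1 by simp
  define \<kappa> where "\<kappa> = C ^ 2 + 3 * C"
  have \<kappa>: "0 \<le> \<kappa>" using C by (simp add: \<kappa>_def)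
  \<comment> \<open>The second entry makes \<kappa> |w|^2 at most 1/2, the smallness assumed in
    \<open>gradient_approximation\<close>.\<close>
  define r where "r = min (r1 / 2) (1 / (2 * (\<kappa> + 1)))"
  have r: "r > 0" using r1 \<kappa> by (simp add: r_def)
  define Y where "Y w = manifold_gradient M f (\<psi> w)" for w
  have bound: "norm (Y w - Y 0 - (B w (grad_at F 0) + E (L w))) \<le> (4 * \<kappa> * K + C * K + K + C * 2 * K) * norm w ^ 2" if w: "norm w < r" for w
  proof -
    have wb: "w \<in> ball 0 r1" "w \<in> cball 0 (r1/2)" using w r1 by (auto simp: r_def)
    have w1: "norm w \<le> 1" using Cw(2)[OF wb(1)] .
    have gb: "norm (grad_at F w) \<le> K"
      using K(1,4) wb grad[OF wb(1)] by (intro norm_le_of_inner_le) auto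
    have "\<bar>(grad_at F w - grad_at F 0 - L w) \<bullet> v\<bar> \<le> K * norm w ^ 2 * norm v" for v
      using K(2)[rule_format, OF zc wb(2), of v] by (simp add: inner_diff_left grad[OF wb(1)] grad[OF z] L)
    then have t2: "norm (grad_at F w - grad_at F 0 - L w) \<le> K * norm w ^ 2"
      using K(1) by (intro norm_le_of_inner_le) auto
    have Lb: "norm (L w) \<le> K * norm w"
      using K(1,3) zc by (intro norm_le_of_inner_le) (auto simp: L)
    have "norm (grad_at F w - grad_at F 0) \<le> norm (grad_at F w - grad_at F 0 - L w) + norm (L w)"
      using norm_triangle_ineq[of "grad_at F w - grad_at F 0 - L w" "L w"] by simp
    also have "\<dots> \<le> K * (norm w * 1) + K * norm w"
      using t2 Lb w1 K(1) mult_left_mono[of "norm w * norm w" "norm w * 1" K] mult_left_mono[OF w1, of "norm w"]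
      by (simp add: power2_eq_square)
    finally have t1: "norm (grad_at F w - grad_at F 0) \<le> 2 * K * norm w" by simp
    have "\<kappa> * norm w ^ 2 \<le> \<kappa> * (norm w * 1)"
      using \<kappa> w1 by (simp add: power2_eq_square mult_left_mono mult_left_le)
    also have "\<dots> \<le> (\<kappa> + 1) * (1 / (2 * (\<kappa> + 1)))"
      using w \<kappa> by (intro mult_mono) (auto simp: r_def)
    also have "\<dots> = 1/2" using \<kappa> by (simp add: field_simps)
    finally have small: "(C ^ 2 + 3 * C) * norm w ^ 2 \<le> 1/2" by (simp add: \<kappa>_def)
    have Y0: "Y 0 = E (grad_at F 0)" using gradient_center[OF f] by (simp add: Y_def center F_def)
    define g where "g = grad_at F w"
    define g0 where "g0 = grad_at F 0"
    have eq: "Y w - Y 0 - (B w g0 + E (L w)) =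
       (Y w - frechet_derivative \<psi> (at w) g) + (frechet_derivative \<psi> (at w) g - E g - B w g)
       + (E (g - g0 - L w) + B w (g - g0))"
      unfolding Y0 using linE bilB by (simp add: linear_diff bilinear_rsub g0_def[symmetric])
    have "norm (Y w - Y 0 - (B w g0 + E (L w))) \<le> 4 * \<kappa> * norm w ^ 2 * K + C * norm w ^ 2 * K + (K * norm w ^ 2 + C * norm w * (2 * K * norm w))"
      unfolding eq
    proof (intro order_trans[OF norm_triangle_ineq] add_mono)
      have "norm (Y w - frechet_derivative \<psi> (at w) g) \<le> 4 * \<kappa> * norm w ^ 2 * norm g"
        using gradient_approximation[OF sub f wb(1) small] by (simp add: Y_def g_def F_def \<kappa>_def)
      also have "\<dots> \<le> 4 * \<kappa> * norm w ^ 2 * K" using gb \<kappa> by (intro mult_left_mono) (auto simp: g_def)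
      finally show "norm (Y w - frechet_derivative \<psi> (at w) g) \<le> 4 * \<kappa> * norm w ^ 2 * K" .
      have "norm (frechet_derivative \<psi> (at w) g - E g - B w g) \<le> C * norm w ^ 2 * norm g" by (rule derivative_expansion[OF wb(1)])
      also have "\<dots> \<le> C * norm w ^ 2 * K" using gb C by (intro mult_left_mono) (auto simp: g_def)
      finally show "norm (frechet_derivative \<psi> (at w) g - E g - B w g) \<le> C * norm w ^ 2 * K" .
      show "norm (E (g - g0 - L w)) \<le> K * norm w ^ 2" using t2 by (simp add: normE g_def g0_def)
      have "norm (B w (g - g0)) \<le> C * norm w * norm (g - g0)" by (rule B_bound)
      also have "\<dots> \<le> C * norm w * (2 * K * norm w)" using t1 C by (intro mult_left_mono) (auto simp: g_def g0_def)
      finally show "norm (B w (g - g0)) \<le> C * norm w * (2 * K * norm w)" .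
    qed
    then show ?thesis by (simp add: g0_def power2_eq_square algebra_simps)
  qed
  have "linear (\<lambda>v. B v (grad_at F 0) + E (L v))"
    using bilB linear_compose[OF \<open>linear L\<close> linE] by (intro linear_compose_add) (auto simp: bilinear_def o_def)
  from has_derivative_at_zeroI[OF this r bound] show ?thesis by (simp add: Y_def[abs_def] L_def)
qed

text \<open>Against E v the summand with \<open>B\<close> in the derivative of the gradient drops
  out, and the Hessian of f in the chart remains. The fact \<open>trace\<close> covers every
  admissible basis and derivative, since the definite description in
  \<open>manifold_divergence\<close> asks for uniqueness.\<close>

lemma laplace_beltrami_center:
  assumes sub: "smooth_submanifold TYPE('d) M" and f: "Ck_manifold TYPE('d) (Suc (Suc (Suc k))) M f"
  shows "laplace_beltrami M f x = (\<Sum>b\<in>Basis. second_derivative (\<lambda>w. f (\<psi> w)) 0 b b)"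
proof -
  define F where "F w = f (\<psi> w)" for w
  have F: "Ck_on (Suc (Suc (Suc k))) (ball 0 r1) F" unfolding F_def by (rule Ck_pullback[OF f])
  then have F2: "Ck_on (Suc (Suc k)) (ball 0 r1) F" using Ck_on_SucD by blast
  have z: "0 \<in> ball (0::real^'d) r1" using r1 by simp
  note bil = bilinear_second_derivative[OF F2 open_ball z]
  define L where "L v = B v (grad_at F 0) + E (\<Sum>b\<in>Basis. second_derivative F 0 v b *\<^sub>R b)" for v
  define Y where "Y = manifold_gradient M f"
  have dY: "((\<lambda>w. Y (\<psi> w)) has_derivative L) (at 0)"
    using gradient_derivative[OF sub f] by (simp add: Y_def L_def[abs_def] F_def[abs_def])
  have L: "L v \<bullet> E v = second_derivative F 0 v v" for v
  proof -
    have "second_derivative F 0 v v = (\<Sum>b\<in>Basis. (v \<bullet> b) *\<^sub>R second_derivative F 0 v b)"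
      using bil by (intro linear_euclidean_expansion) (simp add: bilinear_def)
    then show ?thesis
      by (simp add: L_def inner_add_left normalB' inner_of_norm_preserving[OF linE normE] inner_sum_Basis)
  qed
  have trace: "(\<Sum>e\<in>S. Y' e \<bullet> e) = (\<Sum>b\<in>Basis. second_derivative F 0 b b)"
    if S: "pairwise orthogonal S" "\<forall>e\<in>S. norm e = 1" "span S = range E" and Y': "(Y has_derivative Y') (at x within M)" for S Y'
  proof -
    have "(\<lambda>v. Y' (E v)) = L" by (rule has_derivative_unique[OF derivative_chart_of_within[OF Y'] dY])
    then have Y'E: "Y' (E v) = L v" for v by metis
    have SE: "E (adjoint E e) = e" if "e \<in> S" for e
    proof -
      have "e \<in> range E" using that S(3) span_base by blast
      then show ?thesis using adjoint_isometry[OF linE normE] by auto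
    qed
    have inj: "inj_on (adjoint E) S" by (metis SE inj_onI)
    have "(\<Sum>e\<in>S. Y' e \<bullet> e) = (\<Sum>e\<in>S. second_derivative F 0 (adjoint E e) (adjoint E e))"
    proof (rule sum.cong[OF refl])
      fix e assume "e \<in> S"
      then show "Y' e \<bullet> e = second_derivative F 0 (adjoint E e) (adjoint E e)"
        using Y'E[of "adjoint E e"] L[of "adjoint E e"] SE by simp
    qed
    also have "\<dots> = (\<Sum>e\<in>adjoint E ` S. second_derivative F 0 e e)" by (simp add: sum.reindex[OF inj])
    also have "\<dots> = (\<Sum>b\<in>Basis. second_derivative F 0 b b)"
    proof (rule trace_orthonormal[OF bil])
      have *: "adjoint E e \<bullet> adjoint E e' = e \<bullet> e'" if "e \<in> S" "e' \<in> S" for e e'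
        using adjoint_works[OF linE, of "adjoint E e" e'] SE[OF that(1)] by simp
      show "pairwise orthogonal (adjoint E ` S)"
        using S(1) * by (auto simp: pairwise_def orthogonal_def)
      show "norm e = 1" if "e \<in> adjoint E ` S" for e
        using that S(2) * by (auto simp: norm_eq_1)
      have "span (adjoint E ` S) = adjoint E ` range E"
        using span_linear_image[OF adjoint_linear[OF linE], of S] S(3) by simp
      also have "\<dots> = UNIV"
      proof safe
        fix v show "v \<in> adjoint E ` range E"
          by (rule image_eqI[of _ _ "E v"]) (simp_all add: adjoint_isometry[OF linE normE])
      qed simp
      finally show "span (adjoint E ` S) = UNIV" .
    qed
    finally show ?thesis .
  qed
  have dYM: "(Y has_derivative (\<lambda>z. L (adjoint E z))) (at x within M)" by (rule derivative_within_of_chart[OF dY])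
  have basis: "pairwise orthogonal (E ` Basis)" "\<forall>e\<in>E ` Basis. norm e = 1" "span (E ` Basis) = range E"
  proof -
    show "pairwise orthogonal (E ` Basis)"
      by (auto simp: pairwise_def orthogonal_def inner_of_norm_preserving[OF linE normE] inner_Basis)
    show "\<forall>e\<in>E ` Basis. norm e = 1" by (auto simp: normE)
    show "span (E ` Basis) = range E" using span_linear_image[OF linE, of Basis] by simp
  qed
  have "manifold_divergence M Y x = (\<Sum>b\<in>Basis. second_derivative F 0 b b)"
    unfolding manifold_divergence_def tangent_space_eq
  proof (rule the_equality)
    show "\<exists>B Y'. pairwise orthogonal B \<and> (\<forall>e\<in>B. norm e = 1) \<and> span B = range E \<and> (Y has_derivative Y') (at x within M) \<and>
        (\<Sum>b\<in>Basis. second_derivative F 0 b b) = (\<Sum>e\<in>B. Y' e \<bullet> e)"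
      by (intro exI[of _ "E ` Basis"] exI[of _ "\<lambda>z. L (adjoint E z)"] conjI basis dYM trace[OF basis dYM, symmetric])
  qed (use trace in blast)
  then show ?thesis by (simp add: laplace_beltrami_def Y_def F_def[abs_def])
qed

end

text \<open>Along the ray through v the two expansions leave t (A + t D / 2) = O(t^3) for the
  differences A and D of the coefficients; letting t tend to 0 gives first A = 0 and then D =
  0.\<close>

lemma jet2_unique:
  fixes F :: "'a::euclidean_space \<Rightarrow> real"
  assumes F: "Ck_on (Suc (Suc (Suc k))) (ball 0 r) F" "r > 0" and a: "linear a" and s: "bilinear s"
    and jet: "\<And>w. w \<in> ball 0 r \<Longrightarrow> \<bar>F w - F 0 - a w - s w w / 2\<bar> \<le> K * norm w ^ 3"
  shows "frechet_derivative F (at 0) v = a v" "second_derivative F 0 v v = s v v"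
proof -
  have F2: "Ck_on (Suc (Suc k)) (ball 0 r) F" using F(1) Ck_on_SucD by blast
  have z: "0 \<in> ball (0::'a) r" using F(2) by simp
  note bil = bilinear_second_derivative[OF F2 open_ball z]
  note lin = linear_frechet_derivative[OF F2 z]
  have "cball (0::'a) (r / 2) \<subseteq> ball 0 r" using F(2) by auto
  from taylor2_on_compact_convex[OF F(1) open_ball compact_cball convex_cball this]
  obtain K' where K': "\<forall>u\<in>cball 0 (r/2). \<forall>u'\<in>cball 0 (r/2). norm (F u' - F u - frechet_derivative F (at u) (u' - u)
        - (1/2) *\<^sub>R second_derivative F u (u' - u) (u' - u)) \<le> K' * norm (u' - u) ^ 3" by metis
  define A where "A = frechet_derivative F (at 0) v - a v"
  define D where "D = second_derivative F 0 v v - s v v"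
  define c where "c = (\<bar>K\<bar> + \<bar>K'\<bar>) * norm v ^ 3"
  define \<rho> where "\<rho> = r / 2 / (norm v + 1)"
  have \<rho>: "\<rho> > 0" using F(2) by (simp add: \<rho>_def add_nonneg_pos)
  have main: "\<bar>A + t * D / 2\<bar> \<le> c * t ^ 2" if t: "0 < t" "t < \<rho>" for t
  proof -
    have "t * norm v \<le> t * (norm v + 1)" using t by (intro mult_left_mono) auto
    also have "\<dots> \<le> \<rho> * (norm v + 1)" using t by (intro mult_right_mono) auto
    also have "\<dots> = r / 2"
    proof -
      have "norm v + 1 \<noteq> 0" using norm_ge_zero[of v] by linarith
      then show ?thesis by (simp add: \<rho>_def field_simps)
    qed
    finally have tv: "t *\<^sub>R v \<in> cball 0 (r/2)" "t *\<^sub>R v \<in> ball 0 r" using t F(2) by auto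
    have "\<bar>F (t *\<^sub>R v) - F 0 - t * frechet_derivative F (at 0) v - t ^ 2 * second_derivative F 0 v v / 2\<bar> \<le> K' * norm (t *\<^sub>R v) ^ 3"
      using K'[rule_format, of 0 "t *\<^sub>R v"] tv F(2) bil lin
      by (simp add: linear_scale bilinear_lmul bilinear_rmul power2_eq_square)
    moreover have "\<bar>F (t *\<^sub>R v) - F 0 - t * a v - t ^ 2 * s v v / 2\<bar> \<le> K * norm (t *\<^sub>R v) ^ 3"
      using jet[OF tv(2)] a s by (simp add: linear_scale bilinear_lmul bilinear_rmul power2_eq_square)
    moreover have "t * (A + t * D / 2) = (F (t *\<^sub>R v) - F 0 - t * a v - t ^ 2 * s v v / 2) -
       (F (t *\<^sub>R v) - F 0 - t * frechet_derivative F (at 0) v - t ^ 2 * second_derivative F 0 v v / 2)"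
      by (simp add: A_def D_def power2_eq_square algebra_simps diff_divide_distrib add_divide_distrib)
    ultimately have "\<bar>t * (A + t * D / 2)\<bar> \<le> K * norm (t *\<^sub>R v) ^ 3 + K' * norm (t *\<^sub>R v) ^ 3" by linarith
    also have "\<dots> \<le> \<bar>K\<bar> * norm (t *\<^sub>R v) ^ 3 + \<bar>K'\<bar> * norm (t *\<^sub>R v) ^ 3" by (intro add_mono mult_right_mono) auto
    also have "\<dots> = t * (c * t ^ 2)" using t by (simp add: c_def power_mult_distrib power2_eq_square power3_eq_cube algebra_simps)
    finally show ?thesis using t by (simp add: abs_mult)
  qed
  have c0: "c \<ge> 0" by (simp add: c_def)
  have A0: "A = 0"
  proof (rule norm_le_linear_imp_zero)
    show "0 < min \<rho> 1" using \<rho> by simp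
    show "norm A \<le> (\<bar>D\<bar> + c) * t" if t: "0 < t" "t < min \<rho> 1" for t
    proof -
      have "0 \<le> t * \<bar>D\<bar>" using t by simp
      have "\<bar>A\<bar> \<le> \<bar>A + t * D / 2\<bar> + \<bar>t * D / 2\<bar>" by linarith
      also have "\<dots> \<le> c * (t * 1) + t * \<bar>D\<bar>"
      proof (rule add_mono)
        show "\<bar>A + t * D / 2\<bar> \<le> c * (t * 1)"
          using main[of t] t c0 mult_left_mono[of "t * t" "t * 1" c] by (simp add: power2_eq_square)
        have "\<bar>t * D / 2\<bar> = t * \<bar>D\<bar> / 2" using t by (simp add: abs_mult)
        then show "\<bar>t * D / 2\<bar> \<le> t * \<bar>D\<bar>" using \<open>0 \<le> t * \<bar>D\<bar>\<close> by linarith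
      qed
      finally show ?thesis by (simp add: algebra_simps)
    qed
  qed
  then show "frechet_derivative F (at 0) v = a v" by (simp add: A_def)
  have "D = 0"
  proof (rule norm_le_linear_imp_zero[OF _ \<rho>])
    show "norm D \<le> (2 * c) * t" if t: "0 < t" "t < \<rho>" for t
    proof -
      have "t * (\<bar>D\<bar> / 2) \<le> t * (c * t)" using main[OF t] t by (simp add: A0 abs_mult power2_eq_square)
      then show ?thesis using t by simp
    qed
  qed
  then show "second_derivative F 0 v v = s v v" by (simp add: D_def)
qed

lemma jet1_unique:
  fixes F :: "'a::euclidean_space \<Rightarrow> real"
  assumes "Ck_on (Suc k) (ball 0 r) F" "r > 0" and a: "linear a"
    and jet: "\<And>w. w \<in> ball 0 r \<Longrightarrow> \<bar>F w - F 0 - a w\<bar> \<le> K * norm w ^ 2"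
  shows "frechet_derivative F (at 0) = a"
proof -
  have "(F has_derivative a) (at 0)"
    using jet by (intro has_derivative_at_zeroI[OF a assms(2)]) auto
  then show ?thesis by (rule frechet_derivative_at[symmetric])
qed

section \<open>Kernels of bounded variation\<close>

lemma variation_sums_zero: "0 \<in> variation_sums K 0"
  unfolding variation_sums_def
  by (intro CollectI exI[of _ 0] exI[of _ "\<lambda>_. 0"]) (auto simp: strict_mono_on_def)

lemma variation_sums_extend:
  assumes "S \<in> variation_sums K a" "a < b"
  shows "S + \<bar>K b - K a\<bar> \<in> variation_sums K b"
proof -
  obtain n :: nat and t where t: "S = (\<Sum>i=1..n. \<bar>K (t i) - K (t (i - 1))\<bar>)" "t 0 = 0" "t n = a" "strict_mono_on {0..n} t"
    using assms(1) unfolding variation_sums_def by blast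
  define t' where "t' i = (if i \<le> n then t i else b)" for i
  have "(\<Sum>i=1..Suc n. \<bar>K (t' i) - K (t' (i - 1))\<bar>) = (\<Sum>i=1..n. \<bar>K (t' i) - K (t' (i - 1))\<bar>) + \<bar>K b - K a\<bar>"
    by (simp add: t'_def t(3))
  also have "(\<Sum>i=1..n. \<bar>K (t' i) - K (t' (i - 1))\<bar>) = (\<Sum>i=1..n. \<bar>K (t i) - K (t (i - 1))\<bar>)"
    by (intro sum.cong refl) (auto simp: t'_def)
  finally have "(\<Sum>i=1..Suc n. \<bar>K (t' i) - K (t' (i - 1))\<bar>) = (\<Sum>i=1..n. \<bar>K (t i) - K (t (i - 1))\<bar>) + \<bar>K b - K a\<bar>" .
  moreover have "t' 0 = 0" "t' (Suc n) = b" using t by (auto simp: t'_def)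
  moreover have "strict_mono_on {0..Suc n} t'"
  proof (rule strict_mono_onI)
    fix i j assume ij: "i \<in> {0..Suc n}" "j \<in> {0..Suc n}" "i < j"
    show "t' i < t' j"
    proof (cases "j \<le> n")
      case True
      then show ?thesis using ij t(4) by (auto simp: t'_def strict_mono_on_def)
    next
      case False
      then have "t' j = b" "i \<le> n" using ij by (auto simp: t'_def)
      moreover have "t i \<le> a" using t(3,4) \<open>i \<le> n\<close> by (cases "i = n") (auto simp: strict_mono_on_def less_imp_le)
      ultimately show ?thesis using assms(2) by (simp add: t'_def)
    qed
  qed
  ultimately show ?thesis unfolding variation_sums_def t(1) by (intro CollectI exI[of _ "Suc n"] exI[of _ t']) simp
qed

lemma variation_sums_nonempty: "0 \<le> a \<Longrightarrow> variation_sums K a \<noteq> {}"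
  using variation_sums_zero[of K] variation_sums_extend[OF variation_sums_zero, of a K] by (cases "a = 0") auto

text \<open>Each subdivision of [0, a] extends by the single point b, and its sum grows by |K b - K
  a|; take the supremum over subdivisions of [0, a].\<close>

lemma total_variation_diff:
  assumes "bounded_variation_halfline K" "0 \<le> a" "a \<le> b"
  shows "\<bar>K b - K a\<bar> \<le> total_variation K b - total_variation K a"
proof (cases "a = b")
  case False
  have bdd: "bdd_above (variation_sums K c)" if "0 \<le> c" for c
    using assms(1) that unfolding bounded_variation_halfline_def by (rule_tac bdd_above_mono) auto
  have "S \<le> Sup (variation_sums K b) - \<bar>K b - K a\<bar>" if "S \<in> variation_sums K a" for S
    using cSup_upper[OF variation_sums_extend[OF that, of b] bdd] assms(2,3) False by linarith
  then have "Sup (variation_sums K a) \<le> Sup (variation_sums K b) - \<bar>K b - K a\<bar>"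
    using variation_sums_nonempty[OF assms(2)] by (intro cSup_least) auto
  then show ?thesis using assms(2,3) by (simp add: total_variation_def)
qed simp

lemma total_variation_zero: "total_variation K 0 = 0"
proof -
  have "S = 0" if S: "S \<in> variation_sums K 0" for S
  proof -
    obtain n :: nat and t where t: "S = (\<Sum>i=1..n. \<bar>K (t i) - K (t (i - 1))\<bar>)" "t 0 = 0" "t n = 0" "strict_mono_on {0..n} t"
      using S unfolding variation_sums_def by blast
    have "n = 0"
    proof (rule ccontr)
      assume "n \<noteq> 0"
      then have "t 0 < t n" using t(4) by (auto simp: strict_mono_on_def)
      then show False using t by simp
    qed
    then show ?thesis by (simp add: t(1))
  qed
  then have "variation_sums K 0 = {0}" using variation_sums_zero by blast
  then show ?thesis by (simp add: total_variation_def)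
qed

lemma total_variation_mono:
  assumes "bounded_variation_halfline K" "a \<le> b"
  shows "total_variation K a \<le> total_variation K b"
proof (cases "0 \<le> a")
  case True
  then show ?thesis using total_variation_diff[OF assms(1) True assms(2)] by linarith
next
  case False
  have "0 \<le> total_variation K b"
    using total_variation_diff[OF assms(1), of 0 b] total_variation_zero[of K]
    by (cases "0 \<le> b") (auto simp: total_variation_def)
  then show ?thesis using False by (simp add: total_variation_def)
qed

text \<open>\<open>\<nu>\<close> plays the role of the variation measure of \<open>K\<close>; negative arguments of \<open>K\<close> never occur.\<close>

locale kernel_bound =
  fixes K :: "real \<Rightarrow> real" and \<nu> :: "real measure" and d :: nat
  assumes K_borel [measurable]: "K \<in> borel_measurable borel"
    and sets_\<nu> [measurable_cong]: "sets \<nu> = sets borel"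
    and finite_\<nu>: "finite_measure \<nu>"
    and K_diff: "\<And>s a b t. 0 \<le> a \<Longrightarrow> 0 \<le> b \<Longrightarrow> s < a \<Longrightarrow> s < b \<Longrightarrow> a \<le> t \<Longrightarrow> b \<le> t \<Longrightarrow> \<bar>K a - K b\<bar> \<le> measure \<nu> {s<..t}"
    and K_tail: "\<And>s a. 0 \<le> a \<Longrightarrow> s < a \<Longrightarrow> \<bar>K a\<bar> \<le> measure \<nu> {s<..}"
    and moment: "(\<integral>\<^sup>+ a\<in>{0..}. ennreal (a ^ (d + 3)) \<partial>\<nu>) < \<infinity>"

text \<open>The right limit \<open>F\<close> of the variation \<open>H\<close> satisfies H x \<le> F
  x, and F x \<le> H y for x < y. For s < a \<le> b \<le> t the increment H b - H a is thus at most
  F t - F s, the mass of the half-open interval. The strict inequality s < a is essential if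
  \<open>K\<close> jumps right after s. The tail bound follows by letting b tend to infinity, where
  \<open>K\<close> vanishes.\<close>

lemma kernel_bound_stieltjes:
  assumes bv: "bounded_variation_halfline K" and lim: "(K \<longlongrightarrow> 0) at_top"
    and meas: "K \<in> borel_measurable (restrict_space borel {0..})"
    and moment: "(\<integral>\<^sup>+ a\<in>{0..}. ennreal (a ^ (d + 3)) \<partial>stieltjes_measure (total_variation K)) < \<infinity>"
  shows "kernel_bound (\<lambda>a. if a \<in> {0..} then K a else 0) (stieltjes_measure (total_variation K)) d"
proof -
  define H where "H = total_variation K"
  define F where "F x = Lim (at_right x) H" for x
  have \<nu>: "stieltjes_measure (total_variation K) = interval_measure F"
    by (simp add: stieltjes_measure_def F_def[abs_def] H_def)
  have Hmono: "H a \<le> H b" if "a \<le> b" for a b unfolding H_def by (rule total_variation_mono[OF bv that])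
  have H0: "0 \<le> H a" for a
  proof -
    have "H (min a (-1)) = 0" by (simp add: H_def total_variation_def)
    then show ?thesis using Hmono[of "min a (-1)" a] by simp
  qed
  obtain V where V: "\<And>a S. 0 \<le> a \<Longrightarrow> S \<in> variation_sums K a \<Longrightarrow> S \<le> V"
    using bv unfolding bounded_variation_halfline_def bdd_above_def by auto
  have V0: "0 \<le> V" using V[OF order_refl variation_sums_zero] .
  have HV: "H a \<le> V" for a
  proof (cases "a < 0")
    case False
    then show ?thesis
      using V[of a] variation_sums_nonempty[of a K] by (auto simp: H_def total_variation_def intro!: cSup_least)
  qed (simp add: H_def total_variation_def V0)
  have lim_F: "(H \<longlongrightarrow> Inf (H ` {x<..})) (at_right x)" for x
    using Lim_right_bound[of UNIV x H 0] Hmono H0 by simp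
  have F_Inf: "F x = Inf (H ` {x<..})" for x
    unfolding F_def by (rule tendsto_Lim[OF _ lim_F]) simp
  have bddH: "bdd_below (H ` S)" for S using H0 by (auto intro!: bdd_belowI2)
  have HF: "H x \<le> F x" for x
    unfolding F_Inf by (rule cInf_greatest) (auto intro: Hmono)
  have FH: "F x \<le> H y" if "x < y" for x y
    unfolding F_Inf by (rule cInf_lower[OF _ bddH]) (use that in auto)
  have Fmono: "F x \<le> F y" if "x \<le> y" for x y
    using that FH[of x y] HF[of y] by (cases "x = y") auto
  have Fcont: "continuous (at_right x) F" for x
    unfolding continuous_within
  proof (rule order_tendstoI)
    fix a assume "a < F x"
    then show "\<forall>\<^sub>F y in at_right x. a < F y"
      unfolding eventually_at_right_field by (intro exI[of _ "x + 1"]) (auto intro!: less_le_trans[OF \<open>a < F x\<close> Fmono])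
  next
    fix a assume "F x < a"
    then have "\<forall>\<^sub>F y in at_right x. H y < a" using order_tendstoD(2)[OF lim_F[of x, folded F_Inf]] by blast
    then obtain b where b: "b > x" "\<And>y. x < y \<Longrightarrow> y < b \<Longrightarrow> H y < a" unfolding eventually_at_right_field by blast
    define y where "y = (x + b) / 2"
    have y: "x < y" "y < b" using b(1) by (auto simp: y_def)
    show "\<forall>\<^sub>F z in at_right x. F z < a"
      unfolding eventually_at_right_field
      using y b(2)[OF y] by (intro exI[of _ y]) (auto intro: le_less_trans[OF FH])
  qed
  have em: "emeasure (interval_measure F) {s<..t} = ennreal (F t - F s)" if "s \<le> t" for s t
    using emeasure_interval_measure_Ioc[OF that, of F] Fmono Fcont by auto
  have F_range: "0 \<le> F a" "F a \<le> V" for a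
    using H0[of a] HF[of a] FH[of a "a + 1"] HV[of "a + 1"] by auto
  have fin: "finite_measure (interval_measure F)"
  proof (rule finite_measureI)
    have "emeasure (interval_measure F) (\<Union>n. {- real n<..real n}) = (SUP n. emeasure (interval_measure F) {- real n<..real n})"
      by (rule SUP_emeasure_incseq[symmetric]) (auto simp: incseq_def)
    also have "\<dots> \<le> ennreal V"
    proof (rule SUP_least)
      fix n :: nat
      have "F (real n) - F (- real n) \<le> V" using F_range[of "real n"] F_range[of "- real n"] by linarith
      then show "emeasure (interval_measure F) {- real n<..real n} \<le> ennreal V" by (simp add: em ennreal_leI)
    qed
    also have "(\<Union>n. {- real n<..real n}) = UNIV"
    proof safe
      fix x :: real
      obtain n :: nat where "\<bar>x\<bar> < real n" using reals_Archimedean2 by blast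
      then show "x \<in> (\<Union>n. {- real n<..real n})" by (intro UN_I[of n]) auto
    qed simp
    finally show "emeasure (interval_measure F) (space (interval_measure F)) \<noteq> \<infinity>" by (auto simp: top_unique)
  qed
  have me: "measure (interval_measure F) {s<..t} = F t - F s" if "s \<le> t" for s t
    using em[OF that] Fmono[OF that] by (simp add: measure_def)
  have diff: "\<bar>K a - K b\<bar> \<le> F t - F s" if "0 \<le> a" "0 \<le> b" "s < a" "s < b" "a \<le> t" "b \<le> t" for s a b t
  proof -
    have *: "\<bar>K a - K b\<bar> \<le> F t - F s" if ab: "0 \<le> a" "a \<le> b" "s < a" "b \<le> t" for a b
      using total_variation_diff[OF bv ab(1,2)] FH[OF ab(3)] HF[of b] Fmono[OF ab(4)] by (simp add: H_def)
    show ?thesis using *[of a b] *[of b a] that by (cases "a \<le> b") auto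
  qed
  let ?K = "\<lambda>a. if a \<in> {0..} then K a else 0"
  have tail: "\<bar>K a\<bar> \<le> measure (interval_measure F) {s<..}" if a: "0 \<le> a" "s < a" for a s
  proof -
    interpret finite_measure "interval_measure F" by (rule fin)
    have "((\<lambda>b. measure (interval_measure F) {s<..} + \<bar>K b\<bar>) \<longlongrightarrow> measure (interval_measure F) {s<..} + \<bar>0\<bar>) at_top"
      by (intro tendsto_intros lim)
    moreover have "\<forall>\<^sub>F b in at_top. \<bar>K a\<bar> \<le> measure (interval_measure F) {s<..} + \<bar>K b\<bar>"
      using eventually_ge_at_top[of a]
    proof eventually_elim
      case (elim b)
      have "\<bar>K a - K b\<bar> \<le> measure (interval_measure F) {s<..b}" using diff[of a b s b] a elim by (simp add: me)
      also have "\<dots> \<le> measure (interval_measure F) {s<..}" by (rule finite_measure_mono) auto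
      finally show ?case by linarith
    qed
    ultimately show ?thesis using tendsto_lowerbound[of _ _ at_top "\<bar>K a\<bar>"] by fastforce
  qed
  show ?thesis unfolding \<nu>
  proof (rule kernel_bound.intro)
    have "?K = (\<lambda>a. indicator {0..} a *\<^sub>R K a)" by (auto simp: fun_eq_iff)
    then show "?K \<in> borel_measurable borel" using meas by (simp add: borel_measurable_restrict_space_iff)
    show "\<bar>?K a - ?K b\<bar> \<le> measure (interval_measure F) {s<..t}"
      if "0 \<le> a" "0 \<le> b" "s < a" "s < b" "a \<le> t" "b \<le> t" for s a b t
      using diff[OF that] that by (simp add: me)
    show "\<bar>?K a\<bar> \<le> measure (interval_measure F) {s<..}" if "0 \<le> a" "s < a" for s a
      using tail[OF that] that by simp
    show "(\<integral>\<^sup>+ a\<in>{0..}. ennreal (a ^ (d + 3)) \<partial>interval_measure F) < \<infinity>" using moment by (simp add: \<nu>)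
  qed (simp, rule fin)
qed

lemma power_diff_le:
  fixes x y :: real
  assumes "0 \<le> x" "x \<le> y"
  shows "y ^ n - x ^ n \<le> real n * y ^ (n - 1) * (y - x)"
proof (induction n)
  case (Suc n)
  have "y ^ Suc n - x ^ Suc n = y * (y ^ n - x ^ n) + x ^ n * (y - x)" by (simp add: algebra_simps)
  also have "\<dots> \<le> y * (real n * y ^ (n - 1) * (y - x)) + y ^ n * (y - x)"
    using assms Suc by (intro add_mono mult_left_mono mult_right_mono power_mono) auto
  also have "y * (real n * y ^ (n - 1) * (y - x)) = real n * y ^ n * (y - x)"
    by (cases n) (auto simp: mult_ac)
  finally show ?case by (simp add: algebra_simps)
qed simp

lemma emeasure_annulus_le:
  fixes r1 r2 :: real
  assumes "0 \<le> r1" "r1 \<le> r2"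
  shows "emeasure lborel {w :: 'a::euclidean_space. r1 \<le> norm w \<and> norm w \<le> r2}
    \<le> ennreal (unit_ball_vol DIM('a) * (real DIM('a) * r2 ^ (DIM('a) - 1) * (r2 - r1)))"
proof -
  have eq: "{w :: 'a. r1 \<le> norm w \<and> norm w \<le> r2} = cball 0 r2 - ball 0 r1" by auto
  have "emeasure lborel {w :: 'a. r1 \<le> norm w \<and> norm w \<le> r2} = emeasure lborel (cball (0::'a) r2) - emeasure lborel (ball (0::'a) r1)"
    unfolding eq
  proof (rule emeasure_Diff)
    show "emeasure lborel (ball (0::'a) r1) \<noteq> \<infinity>"
      using emeasure_lborel_ball_finite[of "0::'a" r1] by (simp only: less_top infinity_ennreal_def)
    show "cball (0::'a) r2 \<in> sets lborel" "ball (0::'a) r1 \<in> sets lborel" by simp_all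
    show "ball (0::'a) r1 \<subseteq> cball 0 r2" using assms by (intro subsetI) simp
  qed
  also have "\<dots> = ennreal (unit_ball_vol DIM('a) * r2 ^ DIM('a) - unit_ball_vol DIM('a) * r1 ^ DIM('a))"
    using assms by (simp add: emeasure_cball emeasure_ball ennreal_minus)
  also have "\<dots> \<le> ennreal (unit_ball_vol DIM('a) * (real DIM('a) * r2 ^ (DIM('a) - 1) * (r2 - r1)))"
    using power_diff_le[OF assms, of "DIM('a)"]
    by (intro ennreal_leI) (simp flip: right_diff_distrib add: mult_left_mono)
  finally show ?thesis .
qed

section \<open>Integrals controlled by the variation measure\<close>

context kernel_bound
begin

sublocale finite_measure \<nu> by (rule finite_\<nu>)

definition V :: real where "V = measure \<nu> UNIV"

text \<open>With the total mass added, \<open>Mom\<close> dominates the moments of all orders up to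
  d + 3, because a^k \<le> 1 + a^(d+3).\<close>

definition Mom :: real where "Mom = V + enn2real (\<integral>\<^sup>+ a\<in>{0..}. ennreal (a ^ (d + 3)) \<partial>\<nu>)"

lemma space_\<nu> [simp]: "space \<nu> = UNIV"
  using sets_eq_imp_space_eq[OF sets_\<nu>] by simp

lemma V_nonneg: "0 \<le> V" by (simp add: V_def)

lemma tail_measurable [measurable]: "(\<lambda>a. measure \<nu> {a<..}) \<in> borel_measurable borel"
proof -
  have "mono (\<lambda>a. - measure \<nu> {a<..})" by (intro monoI le_imp_neg_le finite_measure_mono) auto
  then have "(\<lambda>a. - (- measure \<nu> {a<..})) \<in> borel_measurable borel"
    by (intro borel_measurable_uminus borel_measurable_mono)
  then show ?thesis by simp
qed

lemma cdf_measurable [measurable]: "(\<lambda>a. measure \<nu> {..a}) \<in> borel_measurable borel"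
  by (intro borel_measurable_mono monoI finite_measure_mono) auto

lemma measure_interval_diff: "a \<le> b \<Longrightarrow> measure \<nu> {a<..b} = measure \<nu> {..b} - measure \<nu> {..a}"
proof -
  assume "a \<le> b"
  moreover have "{a<..b} = {..b} - {..a}" by auto
  ultimately show ?thesis by (simp add: finite_measure_Diff)
qed

lemma Mom_ge: "V \<le> Mom" "0 \<le> Mom" using V_nonneg by (auto simp: Mom_def)

lemma moment_le:
  assumes "k \<le> d + 3"
  shows "(\<integral>\<^sup>+ a\<in>{0..}. ennreal (a ^ k) \<partial>\<nu>) \<le> ennreal Mom"
proof -
  have "(\<integral>\<^sup>+ a\<in>{0..}. ennreal (a ^ k) \<partial>\<nu>) \<le> (\<integral>\<^sup>+ a. 1 + ennreal (a ^ (d + 3)) * indicator {0..} a \<partial>\<nu>)"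
  proof (rule nn_integral_mono)
    fix a :: real
    have "a ^ k \<le> 1 + a ^ (d + 3)" if "0 \<le> a"
    proof (cases "a \<le> 1")
      case True
      then show ?thesis using that power_le_one[of a k] by (auto intro: add_increasing2)
    next
      case False
      then have "a ^ k \<le> a ^ (d + 3)" using assms by (intro power_increasing) auto
      then show ?thesis by linarith
    qed
    then have "ennreal (a ^ k) \<le> ennreal (1 + a ^ (d + 3))" if "0 \<le> a" using that by (intro ennreal_leI)
    then show "ennreal (a ^ k) * indicator {0..} a \<le> 1 + ennreal (a ^ (d + 3)) * indicator {0..} a"
      by (simp add: indicator_def ennreal_plus)
  qed
  also have "\<dots> = emeasure \<nu> UNIV + (\<integral>\<^sup>+ a\<in>{0..}. ennreal (a ^ (d + 3)) \<partial>\<nu>)"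
    by (subst nn_integral_add) auto
  also have "\<dots> = ennreal Mom"
    using moment by (simp add: Mom_def V_def emeasure_eq_measure ennreal_plus less_top[symmetric])
  finally show ?thesis .
qed

lemma K_le: "0 \<le> a \<Longrightarrow> \<bar>K a\<bar> \<le> V"
  using K_tail[of a "a - 1"] finite_measure_mono[of "{a - 1<..}" UNIV] by (simp add: V_def)

lemma tail_decay: "0 \<le> a \<Longrightarrow> measure \<nu> {a<..} * a ^ (d + 3) \<le> Mom"
proof -
  assume a: "0 \<le> a"
  have "ennreal (a ^ (d + 3) * measure \<nu> {a<..}) = (\<integral>\<^sup>+ s. ennreal (a ^ (d + 3)) * indicator {a<..} s \<partial>\<nu>)"
    using a by (simp add: nn_integral_cmult_indicator emeasure_eq_measure ennreal_mult')
  also have "\<dots> \<le> (\<integral>\<^sup>+ s\<in>{0..}. ennreal (s ^ (d + 3)) \<partial>\<nu>)"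
    using a by (intro nn_integral_mono) (auto simp: indicator_def intro!: ennreal_leI power_mono)
  also have "\<dots> \<le> ennreal Mom" by (rule moment_le) simp
  finally show ?thesis using Mom_ge(2) by (simp add: mult.commute)
qed

text \<open>Markov's inequality for the variation measure, at a/2 because \<open>K_tail\<close> asks
  for a strictly smaller left end.\<close>

lemma K_decay: "0 < a \<Longrightarrow> \<bar>K a\<bar> \<le> 2 ^ (d + 3) * Mom / a ^ (d + 3)"
proof -
  assume a: "0 < a"
  have "\<bar>K a\<bar> * (a / 2) ^ (d + 3) \<le> measure \<nu> {a / 2<..} * (a / 2) ^ (d + 3)"
    using a K_tail[of a "a / 2"] by (intro mult_right_mono) auto
  also have "\<dots> \<le> Mom" using a by (intro tail_decay) auto
  finally show ?thesis using a by (simp add: power_divide field_simps)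
qed

text \<open>Tonelli's theorem. A kernel bound by the mass of a moving set turns into an integral
  over the level s of volumes in y; discontinuities of \<open>K\<close> are dealt with in this way
  only.\<close>

lemma layer_integral:
  assumes N: "sigma_finite_measure N" and A: "A \<in> sets (N \<Otimes>\<^sub>M borel)" and g [measurable]: "g \<in> borel_measurable N"
  shows "(\<integral>\<^sup>+ y. ennreal (measure \<nu> {s. (y, s) \<in> A}) * g y \<partial>N) = (\<integral>\<^sup>+ s. (\<integral>\<^sup>+ y. g y * indicator A (y, s) \<partial>N) \<partial>\<nu>)"
proof -
  interpret N: sigma_finite_measure N by (rule N)
  interpret pair_sigma_finite N \<nu> ..
  have [measurable]: "A \<in> sets (N \<Otimes>\<^sub>M \<nu>)" using A sets_pair_measure_cong[OF refl sets_\<nu>, of N] by simp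
  have "(\<integral>\<^sup>+ y. ennreal (measure \<nu> {s. (y, s) \<in> A}) * g y \<partial>N) = (\<integral>\<^sup>+ y. (\<integral>\<^sup>+ s. g y * indicator A (y, s) \<partial>\<nu>) \<partial>N)"
  proof (rule nn_integral_cong)
    fix y assume y: "y \<in> space N"
    have "Pair y -` A \<in> sets \<nu>" using sets_Pair1[OF \<open>A \<in> sets (N \<Otimes>\<^sub>M \<nu>)\<close>] .
    then have m: "{s. (y, s) \<in> A} \<in> sets \<nu>" by (simp add: vimage_def)
    have "(\<integral>\<^sup>+ s. g y * indicator A (y, s) \<partial>\<nu>) = (\<integral>\<^sup>+ s. g y * indicator {s. (y, s) \<in> A} s \<partial>\<nu>)"
      by (intro nn_integral_cong) (auto simp: indicator_def)
    then show "ennreal (measure \<nu> {s. (y, s) \<in> A}) * g y = (\<integral>\<^sup>+ s. g y * indicator A (y, s) \<partial>\<nu>)"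
      using m by (simp add: nn_integral_cmult_indicator emeasure_eq_measure mult.commute)
  qed
  also have "\<dots> = (\<integral>\<^sup>+ s. (\<integral>\<^sup>+ y. g y * indicator A (y, s) \<partial>N) \<partial>\<nu>)"
    by (rule Fubini'[symmetric]) measurable
  finally show ?thesis .
qed

text \<open>At level s the admissible w lie in the ball of radius hs/c, where |w|^j integrates to at
  most a constant times (hs/c)^(d+j). Integration over s then uses the moment of order d +
  j.\<close>

lemma tail_integral:
  assumes "DIM('a) = d" "j \<le> 3" "0 < c" "0 < h"
  shows "(\<integral>\<^sup>+ w. ennreal (measure \<nu> {c * norm w / h<..} * norm w ^ j) \<partial>(lborel :: 'a::euclidean_space measure))
    \<le> ennreal (unit_ball_vol d * Mom * (h / c) ^ (d + j))"
proof -
  let ?A = "{(w :: 'a, s :: real). c * norm w / h < s}"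
  have A: "?A \<in> sets (lborel \<Otimes>\<^sub>M borel)"
  proof -
    have "{y \<in> space (borel \<Otimes>\<^sub>M borel). c * norm (fst y :: 'a) / h < (snd y :: real)} \<in> sets (borel \<Otimes>\<^sub>M borel)"
      by measurable
    moreover have "{y \<in> space (borel \<Otimes>\<^sub>M borel). c * norm (fst y :: 'a) / h < (snd y :: real)} = ?A"
      by (auto simp: space_pair_measure)
    ultimately show ?thesis using sets_pair_measure_cong[OF sets_lborel refl, of borel] by simp
  qed
  have "(\<integral>\<^sup>+ w. ennreal (measure \<nu> {c * norm w / h<..} * norm w ^ j) \<partial>(lborel :: 'a measure))
    = (\<integral>\<^sup>+ w. ennreal (measure \<nu> {s. (w, s) \<in> ?A}) * ennreal (norm w ^ j) \<partial>(lborel :: 'a measure))"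
    by (intro nn_integral_cong) (simp add: ennreal_mult' greaterThan_def)
  also have "\<dots> = (\<integral>\<^sup>+ s. (\<integral>\<^sup>+ w. ennreal (norm w ^ j) * indicator ?A (w, s) \<partial>(lborel :: 'a measure)) \<partial>\<nu>)"
    by (rule layer_integral[OF _ A]) (auto intro: sigma_finite_lborel)
  also have "\<dots> \<le> (\<integral>\<^sup>+ s. ennreal (unit_ball_vol d * (h / c) ^ (d + j)) * (ennreal (s ^ (d + j)) * indicator {0..} s) \<partial>\<nu>)"
  proof (rule nn_integral_mono)
    fix s :: real
    show "(\<integral>\<^sup>+ w. ennreal (norm w ^ j) * indicator ?A (w, s) \<partial>(lborel :: 'a measure))
      \<le> ennreal (unit_ball_vol d * (h / c) ^ (d + j)) * (ennreal (s ^ (d + j)) * indicator {0..} s)"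
    proof (cases "0 \<le> s")
      case True
      let ?R = "h * s / c"
      have R: "0 \<le> ?R" using True assms by simp
      have "(\<integral>\<^sup>+ w. ennreal (norm w ^ j) * indicator ?A (w, s) \<partial>(lborel :: 'a measure))
        \<le> (\<integral>\<^sup>+ w. ennreal (?R ^ j) * indicator (cball 0 ?R) w \<partial>(lborel :: 'a measure))"
      proof (rule nn_integral_mono)
        fix w :: 'a
        have "norm w \<le> ?R" if "c * norm w / h < s" using that assms by (simp add: field_simps)
        then show "ennreal (norm w ^ j) * indicator ?A (w, s) \<le> ennreal (?R ^ j) * indicator (cball 0 ?R) w"
          by (auto simp: indicator_def intro!: ennreal_leI power_mono)
      qed
      also have "\<dots> = ennreal (?R ^ j) * ennreal (unit_ball_vol d * ?R ^ d)"
        using R assms(1) by (simp add: nn_integral_cmult_indicator emeasure_cball)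
      also have "\<dots> = ennreal (unit_ball_vol d * (h / c) ^ (d + j)) * ennreal (s ^ (d + j))"
        using R True assms by (simp add: power_add power_mult_distrib power_divide field_simps flip: ennreal_mult)
      finally show ?thesis using True by simp
    next
      case False
      then have "indicator ?A (w, s) = (0 :: ennreal)" for w :: 'a
        using assms by (auto simp: indicator_def) (smt (verit) divide_nonneg_pos mult_nonneg_nonneg norm_ge_zero)
      then show ?thesis by simp
    qed
  qed
  also have "\<dots> = ennreal (unit_ball_vol d * (h / c) ^ (d + j)) * (\<integral>\<^sup>+ s\<in>{0..}. ennreal (s ^ (d + j)) \<partial>\<nu>)"
    by (rule nn_integral_cmult) measurable
  also have "\<dots> \<le> ennreal (unit_ball_vol d * (h / c) ^ (d + j)) * ennreal Mom"
    using assms by (intro mult_left_mono moment_le) auto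
  also have "\<dots> = ennreal (unit_ball_vol d * Mom * (h / c) ^ (d + j))"
    using assms Mom_ge by (simp add: mult_ac flip: ennreal_mult)
  finally show ?thesis .
qed

text \<open>At level s, with \<sigma> = hs, only an annulus of radius about \<sigma> and width 24 L
  \<sigma>^3 contributes, and |w| integrates over it to O(\<sigma>^(d+3)). The integral over s
  consumes the moment of order d + 3 and leaves h^(d+3). The factor 48 is the 24 of the width times
  the 2 in |w| \<le> 2 \<sigma>.\<close>

lemma perturbed_integral:
  fixes \<rho> :: "'a::euclidean_space \<Rightarrow> real"
  assumes d: "DIM('a) = d" and h: "0 < h" and L: "0 < L" "4 * L * r ^ 2 \<le> 1" and r: "r \<le> 1"
    and \<rho>: "\<And>w. w \<in> ball 0 r \<Longrightarrow> 0 \<le> \<rho> w" "\<And>w. w \<in> ball 0 r \<Longrightarrow> \<bar>\<rho> w - norm w\<bar> \<le> L * norm w ^ 3"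
  shows "(\<integral>\<^sup>+ w\<in>ball 0 r. ennreal (\<bar>K (\<rho> w / h) - K (norm w / h)\<bar> * norm w) \<partial>lborel)
    \<le> ennreal (48 * unit_ball_vol d * real d * L * (1 + 64 * L) ^ (d - 1) * Mom * h ^ (d + 3))"
proof -
  \<comment> \<open>The factor 2 at the left end puts both arguments of \<open>K\<close> strictly
    above it, as \<open>K_diff\<close> demands.\<close>
  let ?A = "{(w :: 'a, s :: real). (norm w - 2 * L * norm w ^ 3) / h < s \<and> s \<le> (norm w + L * norm w ^ 3) / h}"
  have [measurable]: "ball (0::'a) r \<in> sets borel" by simp
  define c where "c = 48 * unit_ball_vol d * real d * L * (1 + 64 * L) ^ (d - 1)"
  have c0: "0 \<le> c" using L by (simp add: c_def)
  have A: "?A \<in> sets (lborel \<Otimes>\<^sub>M borel)"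
  proof -
    have "{y \<in> space (borel \<Otimes>\<^sub>M borel). (norm (fst y :: 'a) - 2 * L * norm (fst y) ^ 3) / h < (snd y :: real) \<and>
       snd y \<le> (norm (fst y) + L * norm (fst y) ^ 3) / h} \<in> sets (borel \<Otimes>\<^sub>M borel)"
      by measurable
    moreover have "{y \<in> space (borel \<Otimes>\<^sub>M borel). (norm (fst y :: 'a) - 2 * L * norm (fst y) ^ 3) / h < (snd y :: real) \<and>
       snd y \<le> (norm (fst y) + L * norm (fst y) ^ 3) / h} = ?A"
      by (auto simp: space_pair_measure)
    ultimately show ?thesis using sets_pair_measure_cong[OF sets_lborel refl, of borel] by simp
  qed
  have "(\<integral>\<^sup>+ w\<in>ball 0 r. ennreal (\<bar>K (\<rho> w / h) - K (norm w / h)\<bar> * norm w) \<partial>lborel)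
    \<le> (\<integral>\<^sup>+ w. ennreal (measure \<nu> {s. (w, s) \<in> ?A}) * (ennreal (norm w) * indicator (ball 0 r) w) \<partial>lborel)"
  proof (rule nn_integral_mono)
    fix w :: 'a
    have "\<bar>K (\<rho> w / h) - K (norm w / h)\<bar> * norm w \<le> measure \<nu> {s. (w, s) \<in> ?A} * norm w" if w: "w \<in> ball 0 r"
    proof (cases "w = 0")
      case False
      then have pos: "0 < L * norm w ^ 3" using L by simp
      have "{s. (w, s) \<in> ?A} = {(norm w - 2 * L * norm w ^ 3) / h<..(norm w + L * norm w ^ 3) / h}" by auto
      moreover have "\<bar>K (\<rho> w / h) - K (norm w / h)\<bar> \<le> measure \<nu> {(norm w - 2 * L * norm w ^ 3) / h<..(norm w + L * norm w ^ 3) / h}"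
      proof (rule K_diff)
        have ab: "norm w - L * norm w ^ 3 \<le> \<rho> w" "\<rho> w \<le> norm w + L * norm w ^ 3" using \<rho>(2)[OF w] by (auto simp: abs_le_iff)
        show "0 \<le> \<rho> w / h" "0 \<le> norm w / h" using \<rho>(1)[OF w] h by auto
        show "(norm w - 2 * L * norm w ^ 3) / h < \<rho> w / h" "(norm w - 2 * L * norm w ^ 3) / h < norm w / h"
          "\<rho> w / h \<le> (norm w + L * norm w ^ 3) / h" "norm w / h \<le> (norm w + L * norm w ^ 3) / h"
          using ab pos h by (auto intro!: divide_strict_right_mono divide_right_mono)
      qed
      ultimately show ?thesis by (intro mult_right_mono) auto
    qed simp
    then show "ennreal (\<bar>K (\<rho> w / h) - K (norm w / h)\<bar> * norm w) * indicator (ball 0 r) w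
       \<le> ennreal (measure \<nu> {s. (w, s) \<in> ?A}) * (ennreal (norm w) * indicator (ball 0 r) w)"
      by (auto simp: indicator_def ennreal_leI simp flip: ennreal_mult)
  qed
  also have "\<dots> = (\<integral>\<^sup>+ s. (\<integral>\<^sup>+ w. ennreal (norm w) * indicator (ball 0 r) w * indicator ?A (w, s) \<partial>lborel) \<partial>\<nu>)"
    by (rule layer_integral[OF sigma_finite_lborel A]) measurable
  also have "\<dots> \<le> (\<integral>\<^sup>+ s. ennreal (c * h ^ (d + 3)) * (ennreal (s ^ (d + 3)) * indicator {0..} s) \<partial>\<nu>)"
  proof (rule nn_integral_mono)
    fix s :: real
    define \<sigma> where "\<sigma> = h * s"
    \<comment> \<open>Since 4 L |w|^2 \<le> 1, the term L |w|^3 is at most a quarter of |w|. This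
      gives |w| \<le> 2 \<sigma>, and then |w|^3 may be replaced by 8 \<sigma>^3 at both ends of the
      annulus.\<close>
    have key: "norm w \<le> 2 * \<sigma> \<and> 0 \<le> \<sigma> \<and> \<sigma> \<le> 2 \<and> max 0 (\<sigma> - 8 * L * \<sigma> ^ 3) \<le> norm w \<and> norm w \<le> \<sigma> + 16 * L * \<sigma> ^ 3"
      if w: "w \<in> ball 0 r" and wA: "(w, s) \<in> ?A" for w :: 'a
    proof -
      have n: "norm w < r" "0 \<le> norm w" using w by auto
      have "0 \<le> r" using n by linarith
      have "4 * L * (norm w * norm w) \<le> 4 * L * r ^ 2"
        unfolding power2_eq_square
        by (intro mult_left_mono mult_mono) (use n L \<open>0 \<le> r\<close> in linarith)+
      then have sm: "4 * L * (norm w * norm w) \<le> 1" using L by linarith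
      have "4 * L * norm w ^ 3 = (4 * L * (norm w * norm w)) * norm w" by (simp add: power3_eq_cube)
      also have "\<dots> \<le> 1 * norm w" using sm by (intro mult_right_mono) auto
      finally have cube: "4 * L * norm w ^ 3 \<le> norm w" by simp
      have s: "norm w - 2 * L * norm w ^ 3 < \<sigma>" "\<sigma> \<le> norm w + L * norm w ^ 3"
        using wA h by (auto simp: \<sigma>_def field_simps)
      have a: "norm w \<le> 2 * \<sigma>" "\<sigma> \<le> 2" using s cube n r L by (linarith, linarith)
      then have \<sigma>0: "0 \<le> \<sigma>" using n by linarith
      have "norm w ^ 3 \<le> (2 * \<sigma>) ^ 3" using a by (intro power_mono) auto
      then have "L * norm w ^ 3 \<le> L * (8 * \<sigma> ^ 3)" using L by (intro mult_left_mono) (auto simp: power_mult_distrib)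
      then show ?thesis unfolding max.bounded_iff
        by (intro conjI) (use a \<sigma>0 s n in linarith)+
    qed
    show "(\<integral>\<^sup>+ w. ennreal (norm w) * indicator (ball 0 r) w * indicator ?A (w, s) \<partial>(lborel :: 'a measure))
      \<le> ennreal (c * h ^ (d + 3)) * (ennreal (s ^ (d + 3)) * indicator {0..} s)"
    proof (cases "0 \<le> \<sigma> \<and> \<sigma> \<le> 2")
      case False
      then have zero: "indicator (ball 0 r) w * indicator ?A (w, s) = (0 :: ennreal)" for w :: 'a
        using key[of w] by (auto simp: indicator_def)
      have "(\<integral>\<^sup>+ w. ennreal (norm w) * indicator (ball 0 r) w * indicator ?A (w, s) \<partial>(lborel :: 'a measure))
        = (\<integral>\<^sup>+ w. 0 \<partial>(lborel :: 'a measure))"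
        by (rule nn_integral_cong, subst mult.assoc) (simp only: zero mult_zero_right)
      then show ?thesis by simp
    next
      case True
      define a b where "a = max 0 (\<sigma> - 8 * L * \<sigma> ^ 3)" and "b = \<sigma> + 16 * L * \<sigma> ^ 3"
      have s0: "0 \<le> s" using True h by (simp add: \<sigma>_def zero_le_mult_iff)
      have L\<sigma>: "0 \<le> L * \<sigma> ^ 3" using L True by simp
      have ab: "0 \<le> a" "a \<le> b" "b - a \<le> 24 * L * \<sigma> ^ 3" using L\<sigma> True by (auto simp: a_def b_def)
      have "\<sigma> * \<sigma> \<le> 2 * 2" using True by (intro mult_mono) auto
      then have "L * \<sigma> ^ 3 \<le> L * (4 * \<sigma>)" using L True unfolding power3_eq_cube by (intro mult_left_mono mult_right_mono) auto
      then have b: "b \<le> (1 + 64 * L) * \<sigma>" by (simp add: b_def algebra_simps)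
      have "(\<integral>\<^sup>+ w. ennreal (norm w) * indicator (ball 0 r) w * indicator ?A (w, s) \<partial>(lborel :: 'a measure))
        \<le> (\<integral>\<^sup>+ w. ennreal (2 * \<sigma>) * indicator {w. a \<le> norm w \<and> norm w \<le> b} w \<partial>(lborel :: 'a measure))"
        using key by (intro nn_integral_mono) (auto simp: indicator_def a_def b_def intro!: ennreal_leI)
      also have "\<dots> = ennreal (2 * \<sigma>) * emeasure lborel {w :: 'a. a \<le> norm w \<and> norm w \<le> b}"
        by (rule nn_integral_cmult_indicator) measurable
      also have "\<dots> \<le> ennreal (2 * \<sigma>) * ennreal (unit_ball_vol d * (real d * b ^ (d - 1) * (b - a)))"
        using emeasure_annulus_le[OF ab(1,2), where 'a = 'a] unfolding d by (intro mult_left_mono) auto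
      also have "\<dots> = ennreal (2 * \<sigma> * (unit_ball_vol d * (real d * b ^ (d - 1) * (b - a))))"
        using True ab by (intro ennreal_mult[symmetric]) auto
      also have "\<dots> \<le> ennreal (2 * \<sigma> * (unit_ball_vol d * (real d * ((1 + 64 * L) * \<sigma>) ^ (d - 1) * (24 * L * \<sigma> ^ 3))))"
        using True ab b L by (intro ennreal_leI mult_left_mono mult_mono power_mono) auto
      also have "2 * \<sigma> * (unit_ball_vol d * (real d * ((1 + 64 * L) * \<sigma>) ^ (d - 1) * (24 * L * \<sigma> ^ 3)))
         = c * (\<sigma> * \<sigma> ^ (d - 1) * \<sigma> ^ 3)"
        by (simp add: c_def power_mult_distrib)
      also have "\<sigma> * \<sigma> ^ (d - 1) * \<sigma> ^ 3 = \<sigma> ^ (d + 3)"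
      proof -
        have "d > 0" using d DIM_positive[where 'a = 'a] by simp
        then have "\<sigma> * \<sigma> ^ (d - 1) = \<sigma> ^ d" by (simp flip: power_Suc)
        then show ?thesis by (simp add: power_add)
      qed
      also have "c * \<sigma> ^ (d + 3) = (c * h ^ (d + 3)) * s ^ (d + 3)" by (simp add: \<sigma>_def power_mult_distrib)
      finally show ?thesis using s0 h c0 by (simp add: ennreal_mult)
    qed
  qed
  also have "\<dots> = ennreal (c * h ^ (d + 3)) * (\<integral>\<^sup>+ s\<in>{0..}. ennreal (s ^ (d + 3)) \<partial>\<nu>)"
    by (rule nn_integral_cmult) measurable
  also have "\<dots> \<le> ennreal (c * h ^ (d + 3)) * ennreal Mom" by (intro mult_left_mono moment_le) auto
  also have "\<dots> = ennreal (c * Mom * h ^ (d + 3))"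
    using h c0 Mom_ge by (simp add: mult_ac flip: ennreal_mult)
  finally show ?thesis by (simp add: c_def)
qed

end

section \<open>Radial integrals and the volume density\<close>

lemma integral_lborel_scale:
  fixes f :: "'a::euclidean_space \<Rightarrow> real"
  assumes [measurable]: "f \<in> borel_measurable borel" and c: "c > 0"
  shows "(\<integral>w. f w \<partial>lborel) = c ^ DIM('a) * (\<integral>w. f (c *\<^sub>R w) \<partial>lborel)"
proof -
  have "(\<integral>w. f w \<partial>lborel) = (\<integral>w. f w \<partial>density (distr lborel borel (\<lambda>x. 0 + c *\<^sub>R x)) (\<lambda>_. ennreal (\<bar>c\<bar> ^ DIM('a))))"
    using lborel_affine[of c "0::'a"] c by simp
  also have "\<dots> = c ^ DIM('a) * (\<integral>w. f (c *\<^sub>R w) \<partial>lborel)"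
    using c by (subst integral_density) (auto simp: integral_distr)
  finally show ?thesis .
qed

lemma emeasure_lborel_scale:
  fixes A :: "'a::euclidean_space set"
  assumes [measurable]: "A \<in> sets borel" and c: "c > 0"
  shows "emeasure lborel A = ennreal (c ^ DIM('a)) * emeasure lborel {x. c *\<^sub>R x \<in> A}"
proof -
  have "emeasure lborel A = emeasure (density (distr lborel borel (\<lambda>x. 0 + c *\<^sub>R x)) (\<lambda>_. ennreal (\<bar>c\<bar> ^ DIM('a)))) A"
    using lborel_affine[of c "0::'a"] c by simp
  also have "\<dots> = ennreal (c ^ DIM('a)) * emeasure lborel {x. c *\<^sub>R x \<in> A}"
    using c by (subst emeasure_density) (auto simp: nn_integral_cmult emeasure_distr vimage_def)
  finally show ?thesis .
qed

section \<open>Symmetries of Lebesgue measure and radial moments\<close>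

lemma lborel_distr_uminus_euclidean: "distr lborel borel uminus = (lborel :: 'a::euclidean_space measure)"
  using lborel_affine[of "-1" "0::'a"] by (simp add: density_1)

lemma lborel_distr_reflect:
  assumes b: "b \<in> Basis"
  shows "distr lborel borel (\<lambda>w. w - (2 * (w \<bullet> b)) *\<^sub>R b) = (lborel :: 'a::euclidean_space measure)"
proof -
  define c where "c j = (if j = b then -1 else 1 :: real)" for j :: 'a
  have T: "(\<Sum>j\<in>Basis. (c j * (x \<bullet> j)) *\<^sub>R j) = x - (2 * (x \<bullet> b)) *\<^sub>R b" for x
  proof -
    have "(\<Sum>j\<in>Basis. (c j * (x \<bullet> j)) *\<^sub>R j) = (\<Sum>j\<in>Basis. (x \<bullet> j) *\<^sub>R j - (if j = b then (2 * (x \<bullet> b)) *\<^sub>R b else 0))"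
      by (intro sum.cong refl) (auto simp: c_def simp flip: scaleR_left_diff_distrib)
    also have "\<dots> = x - (2 * (x \<bullet> b)) *\<^sub>R b"
      using b by (simp add: sum_subtractf euclidean_representation)
    finally show ?thesis .
  qed
  have ne: "c j \<noteq> 0" for j by (simp add: c_def)
  have "(\<Prod>j\<in>Basis. \<bar>c j\<bar>) = 1" by (intro prod.neutral) (simp add: c_def)
  then show ?thesis
    using lborel_affine_euclidean[of c "0::'a"] ne by (simp add: T density_1)
qed

lemma lborel_distr_swap:
  fixes b c :: "'a::euclidean_space"
  assumes "b \<in> Basis" "c \<in> Basis"
  shows "distr lborel borel (\<lambda>w. \<Sum>e\<in>Basis. (w \<bullet> Transposition.transpose b c e) *\<^sub>R e) = lborel"
proof (rule lborel_eqI[symmetric])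
  define \<sigma> where "\<sigma> = Transposition.transpose b c"
  define T where "T w = (\<Sum>e\<in>Basis. (w \<bullet> \<sigma> e) *\<^sub>R e)" for w
  have [measurable]: "T \<in> borel_measurable borel" unfolding T_def[abs_def] by measurable
  have \<sigma>: "\<sigma> e \<in> Basis" if "e \<in> Basis" for e
    using that assms by (simp add: \<sigma>_def Transposition.transpose_def)
  have TB: "T w \<bullet> e = w \<bullet> \<sigma> e" if "e \<in> Basis" for w e
    using that by (simp add: T_def)
  have bij: "bij_betw \<sigma> Basis Basis"
    using \<sigma> by (intro bij_betwI[where g = \<sigma>]) (auto simp: \<sigma>_def)
  fix l u :: 'a assume lu: "\<And>b. b \<in> Basis \<Longrightarrow> l \<bullet> b \<le> u \<bullet> b"
  have "T -` box l u = box (T l) (T u)"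
  proof (intro set_eqI iffI)
    fix w assume "w \<in> T -` box l u"
    then have *: "l \<bullet> e < w \<bullet> \<sigma> e \<and> w \<bullet> \<sigma> e < u \<bullet> e" if "e \<in> Basis" for e using that TB by (auto simp: mem_box)
    have "T l \<bullet> e < w \<bullet> e \<and> w \<bullet> e < T u \<bullet> e" if "e \<in> Basis" for e
      using *[OF \<sigma>[OF that]] that TB by (simp add: \<sigma>_def)
    then show "w \<in> box (T l) (T u)" by (simp add: mem_box)
  next
    fix w assume "w \<in> box (T l) (T u)"
    then have *: "T l \<bullet> e < w \<bullet> e \<and> w \<bullet> e < T u \<bullet> e" if "e \<in> Basis" for e using that by (auto simp: mem_box)
    have "l \<bullet> e < T w \<bullet> e \<and> T w \<bullet> e < u \<bullet> e" if "e \<in> Basis" for e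
      using *[OF \<sigma>[OF that]] that TB \<sigma>[OF that] by (simp add: \<sigma>_def)
    then show "w \<in> T -` box l u" by (simp add: mem_box)
  qed
  then have "emeasure (distr lborel borel T) (box l u) = emeasure lborel (box (T l) (T u))"
    by (simp add: emeasure_distr)
  also have "\<dots> = ennreal (\<Prod>e\<in>Basis. (T u - T l) \<bullet> e)"
    using lu \<sigma> TB by (subst emeasure_lborel_box) auto
  also have "(\<Prod>e\<in>Basis. (T u - T l) \<bullet> e) = (\<Prod>e\<in>Basis. (u - l) \<bullet> \<sigma> e)"
    using TB by (intro prod.cong refl) (simp add: inner_diff_left)
  also have "\<dots> = (\<Prod>e\<in>Basis. (u - l) \<bullet> e)" by (rule prod.reindex_bij_betw[OF bij])
  finally show "emeasure (distr lborel borel (\<lambda>w. \<Sum>e\<in>Basis. (w \<bullet> Transposition.transpose b c e) *\<^sub>R e)) (box l u) = (\<Prod>b\<in>Basis. (u - l) \<bullet> b)"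
    by (simp add: T_def[abs_def] \<sigma>_def)
qed simp

lemma integral_lborel_invariant:
  fixes f :: "'a::euclidean_space \<Rightarrow> real"
  assumes "distr lborel borel T = (lborel :: 'a measure)" "T \<in> borel_measurable borel" "f \<in> borel_measurable borel"
  shows "(\<integral>w. f (T w) \<partial>lborel) = (\<integral>w. f w \<partial>lborel)"
proof -
  have "(\<integral>w. f w \<partial>distr lborel borel T) = (\<integral>w. f (T w) \<partial>lborel)"
    using assms(2,3) by (intro integral_distr) auto
  then show ?thesis by (simp add: assms(1))
qed

lemma norm_sq_Basis_sum: "(norm (w :: 'a::euclidean_space))\<^sup>2 = (\<Sum>b\<in>Basis. (w \<bullet> b)\<^sup>2)"
  unfolding power2_norm_eq_inner by (subst euclidean_inner) (simp add: power2_eq_square)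

lemma linear_borel_measurable:
  "linear (a :: 'a::euclidean_space \<Rightarrow> 'b::euclidean_space) \<Longrightarrow> a \<in> borel_measurable borel"
  by (intro borel_measurable_continuous_onI linear_continuous_on) (simp add: linear_conv_bounded_linear)

lemma bilinear_expansion:
  fixes s :: "'a::euclidean_space \<Rightarrow> 'a \<Rightarrow> real"
  assumes "bilinear s"
  shows "s x y = (\<Sum>b\<in>Basis. \<Sum>c\<in>Basis. (x \<bullet> b) * (y \<bullet> c) * s b c)"
proof -
  have "s x y = (\<Sum>b\<in>Basis. (x \<bullet> b) *\<^sub>R s b y)"
    using assms by (intro linear_euclidean_expansion) (simp add: bilinear_def)
  also have "\<dots> = (\<Sum>b\<in>Basis. (x \<bullet> b) *\<^sub>R (\<Sum>c\<in>Basis. (y \<bullet> c) *\<^sub>R s b c))"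
    using assms by (intro sum.cong arg_cong2[where f = "(*\<^sub>R)"] linear_euclidean_expansion refl) (simp add: bilinear_def)
  finally show ?thesis by (simp add: sum_distrib_left mult.assoc)
qed

lemma radial_linear_integral:
  fixes a :: "'a::euclidean_space \<Rightarrow> real"
  assumes [measurable]: "\<phi> \<in> borel_measurable borel" and a: "linear a"
  shows "(\<integral>w. \<phi> (norm w) * a w \<partial>lborel) = 0"
proof -
  have [measurable]: "a \<in> borel_measurable borel" by (rule linear_borel_measurable[OF a])
  have "(\<integral>w. \<phi> (norm w) * a w \<partial>lborel) = (\<integral>w. \<phi> (norm (- w)) * a (- w) \<partial>lborel)"
    by (rule integral_lborel_invariant[OF lborel_distr_uminus_euclidean, symmetric]) measurable
  also have "\<dots> = - (\<integral>w. \<phi> (norm w) * a w \<partial>lborel)"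
    using a by (simp add: linear_neg)
  finally show ?thesis by simp
qed

text \<open>Reflecting one coordinate kills the mixed second moments, and exchanging two coordinates
  equates the diagonal ones. The diagonal moments add up to that of |w|^2, whence the division by
  the dimension.\<close>

lemma radial_bilinear_integral:
  fixes s :: "'a::euclidean_space \<Rightarrow> 'a \<Rightarrow> real"
  assumes [measurable]: "\<phi> \<in> borel_measurable borel" and s: "bilinear s"
    and int: "integrable lborel (\<lambda>w :: 'a. \<phi> (norm w) * norm w ^ 2)"
  shows "(\<integral>w. \<phi> (norm w) * s w w \<partial>lborel) = (\<Sum>b\<in>Basis. s b b) / DIM('a) * (\<integral>w. \<phi> (norm (w :: 'a)) * norm w ^ 2 \<partial>lborel)"
proof -
  define I where "I b c = (\<integral>w. \<phi> (norm w) * ((w \<bullet> b) * (w \<bullet> c)) \<partial>lborel)" for b c :: 'a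
  have int': "integrable lborel (\<lambda>w. \<phi> (norm w) * ((w \<bullet> b) * (w \<bullet> c)))" if "b \<in> Basis" "c \<in> Basis" for b c :: 'a
  proof (rule Bochner_Integration.integrable_bound[OF int])
    show "AE w in lborel. norm (\<phi> (norm w) * ((w \<bullet> b) * (w \<bullet> c))) \<le> norm (\<phi> (norm w) * norm w ^ 2)"
    proof (rule AE_I2)
      fix w :: 'a
      have "\<bar>w \<bullet> b\<bar> * \<bar>w \<bullet> c\<bar> \<le> norm w * norm w" using that Basis_le_norm by (intro mult_mono) auto
      then show "norm (\<phi> (norm w) * ((w \<bullet> b) * (w \<bullet> c))) \<le> norm (\<phi> (norm w) * norm w ^ 2)"
        by (simp add: abs_mult power2_eq_square mult_left_mono)
    qed
  qed measurable
  have off: "I b c = 0" if bc: "b \<in> Basis" "c \<in> Basis" "b \<noteq> c" for b c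
  proof -
    let ?T = "\<lambda>w :: 'a. w - (2 * (w \<bullet> b)) *\<^sub>R b"
    have nT: "norm (?T w) = norm w" for w
    proof -
      have "(norm (?T w))\<^sup>2 = (norm w)\<^sup>2"
        using bc(1) unfolding power2_norm_eq_inner by (simp add: inner_diff_left inner_diff_right inner_commute[of b w])
      then show ?thesis by (simp add: power2_eq_iff_nonneg)
    qed
    have "I b c = (\<integral>w. \<phi> (norm (?T w)) * ((?T w \<bullet> b) * (?T w \<bullet> c)) \<partial>lborel)"
      unfolding I_def by (rule integral_lborel_invariant[OF lborel_distr_reflect[OF bc(1)], symmetric]) measurable
    also have "\<dots> = (\<integral>w. - (\<phi> (norm w) * ((w \<bullet> b) * (w \<bullet> c))) \<partial>lborel)"
      unfolding nT using bc by (intro Bochner_Integration.integral_cong refl) (simp add: inner_diff_left inner_Basis)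
    also have "\<dots> = - I b c" by (simp add: I_def)
    finally show ?thesis by simp
  qed
  have diag: "I b b = I c c" if bc: "b \<in> Basis" "c \<in> Basis" for b c
  proof -
    let ?T = "\<lambda>w :: 'a. \<Sum>e\<in>Basis. (w \<bullet> Transposition.transpose b c e) *\<^sub>R e"
    have TB: "?T w \<bullet> e = w \<bullet> Transposition.transpose b c e" if "e \<in> Basis" for w e using that by simp
    have bij: "bij_betw (Transposition.transpose b c) Basis Basis"
    proof (rule bij_betwI[where g = "Transposition.transpose b c"])
      show "Transposition.transpose b c \<in> Basis \<rightarrow> Basis" "Transposition.transpose b c \<in> Basis \<rightarrow> Basis"
        using bc by (simp_all add: Transposition.transpose_def)
    qed simp_all
    have nT: "norm (?T w) = norm w" for w
    proof -
      have "(norm (?T w))\<^sup>2 = (\<Sum>e\<in>Basis. (w \<bullet> Transposition.transpose b c e)\<^sup>2)"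
        unfolding norm_sq_Basis_sum[of "?T w"] by (intro sum.cong refl) (simp only: TB)
      also have "\<dots> = (\<Sum>e\<in>Basis. (w \<bullet> e)\<^sup>2)" by (rule sum.reindex_bij_betw[OF bij])
      also have "\<dots> = (norm w)\<^sup>2" by (rule norm_sq_Basis_sum[symmetric])
      finally show ?thesis by (simp add: power2_eq_iff_nonneg)
    qed
    have "I b b = (\<integral>w. \<phi> (norm (?T w)) * ((?T w \<bullet> b) * (?T w \<bullet> b)) \<partial>lborel)"
      unfolding I_def by (rule integral_lborel_invariant[OF lborel_distr_swap[OF bc], symmetric]) measurable
    also have "\<dots> = I c c" unfolding nT TB[OF bc(1)] by (simp add: I_def)
    finally show ?thesis .
  qed
  have tot: "(\<Sum>b\<in>Basis. I b b) = (\<integral>w. \<phi> (norm (w :: 'a)) * norm w ^ 2 \<partial>lborel)"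
  proof -
    have "(\<Sum>b\<in>Basis. I b b) = (\<integral>w. (\<Sum>b\<in>Basis. \<phi> (norm w) * ((w \<bullet> b) * (w \<bullet> b))) \<partial>(lborel :: 'a measure))"
      unfolding I_def by (rule Bochner_Integration.integral_sum[symmetric]) (auto intro: int')
    also have "\<dots> = (\<integral>w. \<phi> (norm (w :: 'a)) * norm w ^ 2 \<partial>lborel)"
      unfolding norm_sq_Basis_sum by (simp add: sum_distrib_left power2_eq_square)
    finally show ?thesis .
  qed
  have Ib: "I b b = (\<integral>w. \<phi> (norm (w :: 'a)) * norm w ^ 2 \<partial>lborel) / DIM('a)" if b: "b \<in> Basis" for b
  proof -
    have "(\<Sum>c\<in>Basis. I c c) = (\<Sum>c\<in>(Basis :: 'a set). I b b)" using diag b by (intro sum.cong refl)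
    then show ?thesis using tot by (simp add: field_simps)
  qed
  have "(\<integral>w. \<phi> (norm w) * s w w \<partial>lborel) = (\<integral>w. (\<Sum>b\<in>Basis. \<Sum>c\<in>Basis. s b c * (\<phi> (norm w) * ((w \<bullet> b) * (w \<bullet> c)))) \<partial>lborel)"
    by (intro Bochner_Integration.integral_cong refl, subst bilinear_expansion[OF s]) (simp add: sum_distrib_left mult_ac)
  also have "\<dots> = (\<Sum>b\<in>Basis. \<Sum>c\<in>Basis. s b c * I b c)"
    unfolding I_def
    by (subst Bochner_Integration.integral_sum, auto intro!: Bochner_Integration.integrable_sum int' sum.cong,
        subst Bochner_Integration.integral_sum, auto intro!: int')
  also have "\<dots> = (\<Sum>b\<in>Basis. s b b * I b b)"
  proof (intro sum.cong refl)
    fix b :: 'a assume b: "b \<in> Basis"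
    have "(\<Sum>c\<in>Basis. s b c * I b c) = (\<Sum>c\<in>Basis. if c = b then s b b * I b b else 0)"
      using off b by (intro sum.cong refl) auto
    then show "(\<Sum>c\<in>Basis. s b c * I b c) = s b b * I b b" using b by simp
  qed
  also have "\<dots> = (\<Sum>b\<in>Basis. s b b) / DIM('a) * (\<integral>w. \<phi> (norm (w :: 'a)) * norm w ^ 2 \<partial>lborel)"
    by (simp add: Ib sum_distrib_right sum_divide_distrib)
  finally show ?thesis .
qed

text \<open>The Leibniz formula reduces this to differences of products. The telescoping bound for
  such differences requires factors of modulus at most 1, so the entries, bounded by 2, are halved,
  which costs the power of 2.\<close>

lemma det_near_identity:
  "\<exists>K\<ge>0. \<forall>(A :: real^'d^'d) \<epsilon>. 0 \<le> \<epsilon> \<and> \<epsilon> \<le> 1 \<and> (\<forall>i j. \<bar>A $ i $ j - mat 1 $ i $ j\<bar> \<le> \<epsilon>) \<longrightarrow> \<bar>det A - 1\<bar> \<le> K * \<epsilon>"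
proof -
  let ?P = "{p. p permutes (UNIV :: 'd set)}"
  define n where "n = CARD('d)"
  define K where "K = real (card ?P) * (2 ^ n * (real n / 2))"
  have "\<bar>det A - 1\<bar> \<le> K * \<epsilon>" if \<epsilon>: "0 \<le> \<epsilon>" "\<epsilon> \<le> 1" and A: "\<And>i j. \<bar>A $ i $ j - mat 1 $ i $ j\<bar> \<le> \<epsilon>" for A :: "real^'d^'d" and \<epsilon>
  proof -
    have m1: "\<bar>mat 1 $ i $ j :: real\<bar> \<le> 1" for i j :: 'd by (simp add: mat_def)
    have A2: "\<bar>A $ i $ j\<bar> \<le> 2" for i j using A[of i j] m1[of i j] \<epsilon> by linarith
    have prod: "\<bar>(\<Prod>i\<in>UNIV. A $ i $ p i) - (\<Prod>i\<in>UNIV. mat 1 $ i $ p i)\<bar> \<le> 2 ^ n * (real n / 2) * \<epsilon>" for p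
    proof -
      have "norm ((\<Prod>i\<in>UNIV. A $ i $ p i / 2) - (\<Prod>i\<in>UNIV. mat 1 $ i $ p i / 2)) \<le> (\<Sum>i\<in>UNIV. norm (A $ i $ p i / 2 - mat 1 $ i $ p i / 2))"
        using A2 m1 by (intro norm_prod_diff) (auto intro: order_trans[OF m1])
      also have "\<dots> \<le> (\<Sum>i\<in>(UNIV :: 'd set). \<epsilon> / 2)"
        using A by (intro sum_mono) (simp flip: diff_divide_distrib)
      finally have "\<bar>(\<Prod>i\<in>UNIV. A $ i $ p i) - (\<Prod>i\<in>UNIV. mat 1 $ i $ p i)\<bar> / 2 ^ n \<le> real n * (\<epsilon> / 2)"
        by (simp add: prod_dividef n_def flip: diff_divide_distrib)
      then show ?thesis by (simp add: field_simps)
    qed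
    have "det A - 1 = det A - det (mat 1 :: real^'d^'d)" by simp
    also have "\<dots> = (\<Sum>p\<in>?P. of_int (sign p) * ((\<Prod>i\<in>UNIV. A $ i $ p i) - (\<Prod>i\<in>UNIV. mat 1 $ i $ p i)))"
      unfolding det_def by (simp add: sum_subtractf right_diff_distrib)
    also have "\<bar>\<dots>\<bar> \<le> (\<Sum>p\<in>?P. 2 ^ n * (real n / 2) * \<epsilon>)"
    proof (rule order_trans[OF sum_abs], rule sum_mono)
      fix p assume "p \<in> ?P"
      have "\<bar>of_int (sign p) :: real\<bar> = 1" by (simp add: sign_def)
      then show "\<bar>of_int (sign p) * ((\<Prod>i\<in>UNIV. A $ i $ p i) - (\<Prod>i\<in>UNIV. mat 1 $ i $ p i))\<bar> \<le> 2 ^ n * (real n / 2) * \<epsilon>"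
        using prod[of p] by (simp add: abs_mult)
    qed
    finally show ?thesis by (simp add: K_def)
  qed
  moreover have "K \<ge> 0" by (simp add: K_def)
  ultimately show ?thesis by blast
qed

text \<open>Chosen once per dimension, so that the estimates in different charts refer to the same
  number.\<close>

definition det_bound :: "'d::finite itself \<Rightarrow> real" where
  "det_bound _ = (SOME K. K \<ge> 0 \<and> (\<forall>(A :: real^'d^'d) \<epsilon>. 0 \<le> \<epsilon> \<and> \<epsilon> \<le> 1 \<and> (\<forall>i j. \<bar>A $ i $ j - mat 1 $ i $ j\<bar> \<le> \<epsilon>) \<longrightarrow> \<bar>det A - 1\<bar> \<le> K * \<epsilon>))"

lemma det_bound:
  "det_bound TYPE('d::finite) \<ge> 0"
  "0 \<le> \<epsilon> \<Longrightarrow> \<epsilon> \<le> 1 \<Longrightarrow> (\<And>i j. \<bar>(A :: real^'d^'d) $ i $ j - mat 1 $ i $ j\<bar> \<le> \<epsilon>) \<Longrightarrow> \<bar>det A - 1\<bar> \<le> det_bound TYPE('d) * \<epsilon>"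
proof -
  have "\<exists>K. K \<ge> 0 \<and> (\<forall>(A :: real^'d^'d) \<epsilon>. 0 \<le> \<epsilon> \<and> \<epsilon> \<le> 1 \<and> (\<forall>i j. \<bar>A $ i $ j - mat 1 $ i $ j\<bar> \<le> \<epsilon>) \<longrightarrow> \<bar>det A - 1\<bar> \<le> K * \<epsilon>)"
    using det_near_identity by blast
  from someI_ex[OF this]
  show "det_bound TYPE('d) \<ge> 0"
    and "0 \<le> \<epsilon> \<Longrightarrow> \<epsilon> \<le> 1 \<Longrightarrow> (\<And>i j. \<bar>(A :: real^'d^'d) $ i $ j - mat 1 $ i $ j\<bar> \<le> \<epsilon>) \<Longrightarrow> \<bar>det A - 1\<bar> \<le> det_bound TYPE('d) * \<epsilon>"
    unfolding det_bound_def by auto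
qed

section \<open>Volume density and thin shells in a normal chart\<close>

context normal_chart
begin

text \<open>The truncation makes the density visibly nonnegative as a real function and does not
  change its image under \<open>ennreal\<close>.\<close>

definition J :: "real^'d \<Rightarrow> real" where "J w = max 0 (sqrt (det (gram_matrix \<psi> w)))"

lemma J_estimate:
  assumes w: "w \<in> ball 0 r1"
  shows "\<bar>J w - 1\<bar> \<le> det_bound TYPE('d) * (C ^ 2 + 3 * C) * norm w ^ 2"
proof -
  let ?\<epsilon> = "(C ^ 2 + 3 * C) * norm w ^ 2"
  have "C ^ 2 * norm w ^ 2 \<le> (1/16) ^ 2"
    unfolding power_mult_distrib[symmetric] using Cw[OF w] C by (intro power_mono) auto
  moreover have "C * norm w ^ 2 \<le> 1/16 * 1"
    unfolding power2_eq_square mult.assoc[symmetric] using Cw[OF w] C by (intro mult_mono) auto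
  ultimately have \<epsilon>: "?\<epsilon> \<le> 1" by (simp add: distrib_right power2_eq_square)
  have det: "\<bar>det (gram_matrix \<psi> w) - 1\<bar> \<le> det_bound TYPE('d) * ?\<epsilon>"
    using \<epsilon> C by (intro det_bound gram_estimate[OF w]) auto
  \<comment> \<open>Because |sqrt a - 1| (sqrt a + 1) = |a - 1| and the second factor is at least 1;
    for negative a the left-hand side is 1.\<close>
  have *: "\<bar>max 0 (sqrt a) - 1\<bar> \<le> \<bar>a - 1\<bar>" for a :: real
  proof (cases "0 \<le> a")
    case True
    have "(sqrt a - 1) * (sqrt a + 1) = a - 1" using True by (simp add: algebra_simps)
    then have "\<bar>sqrt a - 1\<bar> * \<bar>sqrt a + 1\<bar> = \<bar>a - 1\<bar>" by (simp only: abs_mult[symmetric])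
    then have "\<bar>sqrt a - 1\<bar> * (sqrt a + 1) = \<bar>a - 1\<bar>" using True by (simp add: abs_of_nonneg)
    moreover have "\<bar>sqrt a - 1\<bar> * 1 \<le> \<bar>sqrt a - 1\<bar> * (sqrt a + 1)" using True by (intro mult_left_mono) auto
    ultimately show ?thesis using True by simp
  qed (simp add: max_def real_sqrt_le_0_iff)
  show ?thesis unfolding J_def using order_trans[OF * det] by (simp add: mult.assoc)
qed

lemma J_nonneg: "0 \<le> J w" by (simp add: J_def)

lemma J_le: "w \<in> ball 0 r1 \<Longrightarrow> J w \<le> 1 + det_bound TYPE('d)"
proof -
  assume w: "w \<in> ball 0 r1"
  have "C ^ 2 * norm w ^ 2 \<le> (1/16) ^ 2"
    unfolding power_mult_distrib[symmetric] using Cw[OF w] C by (intro power_mono) auto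
  moreover have "C * norm w ^ 2 \<le> 1/16 * 1"
    unfolding power2_eq_square mult.assoc[symmetric] using Cw[OF w] C by (intro mult_mono) auto
  ultimately have "(C ^ 2 + 3 * C) * norm w ^ 2 \<le> 1" by (simp add: distrib_right power2_eq_square)
  then have "det_bound TYPE('d) * ((C ^ 2 + 3 * C) * norm w ^ 2) \<le> det_bound TYPE('d) * 1"
    by (intro mult_left_mono det_bound(1))
  then show ?thesis using J_estimate[OF w] by (simp add: mult.assoc abs_le_iff)
qed

lemma continuous_psi: "continuous_on (ball 0 r1) \<psi>"
  by (rule Ck_on_continuous[OF smooth])

lemma J_measurable: "(\<lambda>w. indicator (ball 0 r1) w *\<^sub>R J w) \<in> borel_measurable borel"
proof -
  have "continuous_on (ball 0 r1) (\<lambda>w. frechet_derivative \<psi> (at w) v)" for v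
    using Ck_on_continuous[OF Ck_on_frechet[OF smooth]] .
  then have "continuous_on (ball 0 r1) J"
    unfolding J_def[abs_def] gram_matrix_def det_def
    by (intro continuous_intros) auto
  then show ?thesis by (rule borel_measurable_continuous_on_indicator[rotated]) simp
qed

text \<open>As \<psi> is within a quarter of the isometry \<open>E\<close>, contracting w subtracts
  from z = \<psi> w - x a vector y with z . y \<ge> (7/16) \<tau> |w|^2 and |y|^2 \<le> (25/64)
  \<tau> |w|^2. Expanding |z - y|^2 shows that the distance decreases by a definite fraction of
  \<tau>.\<close>

lemma radial:
  assumes w: "w \<in> ball 0 r1" and \<tau>: "0 \<le> \<tau>" "\<tau> \<le> 1/4"
  shows "norm (\<psi> ((1 - \<tau>) *\<^sub>R w) - x) \<le> (1 - \<tau> / 8) * norm (\<psi> w - x)"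
proof -
  define z where "z = \<psi> w - x"
  define R where "R = z - E w"
  define e where "e = \<psi> w - \<psi> ((1 - \<tau>) *\<^sub>R w) - \<tau> *\<^sub>R E w"
  define n where "n = norm w"
  have "(1 - \<tau>) * norm w \<le> 1 * norm w" using \<tau> by (intro mult_right_mono) auto
  then have w': "(1 - \<tau>) *\<^sub>R w \<in> ball 0 r1" using w \<tau> by simp
  have Rn: "norm R \<le> n / 4" using near_isometry[OF w, of 0] r1 by (simp add: R_def z_def center n_def)
  have en: "norm e \<le> \<tau> * n / 4"
  proof -
    have "w - (1 - \<tau>) *\<^sub>R w = \<tau> *\<^sub>R w" by (simp add: algebra_simps)
    then show ?thesis using near_isometry[OF w w'] linE \<tau> by (simp add: e_def n_def linear_scale)
  qed
  define y where "y = \<tau> *\<^sub>R E w + e"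
  have z': "\<psi> ((1 - \<tau>) *\<^sub>R w) - x = z - y" by (simp add: y_def e_def z_def)
  have yn: "norm y \<le> (5/4) * (\<tau> * n)"
    using norm_triangle_ineq[of "\<tau> *\<^sub>R E w" e] en \<tau> by (simp add: y_def normE n_def)
  have "norm y ^ 2 \<le> ((5/4) * (\<tau> * n)) ^ 2" using yn by (intro power_mono) auto
  also have "\<dots> = (25/16) * \<tau> * (\<tau> * n ^ 2)" by (simp add: power2_eq_square)
  also have "\<dots> \<le> (25/16) * (1/4) * (\<tau> * n ^ 2)" using \<tau> by (intro mult_right_mono mult_left_mono) auto
  finally have y2: "norm y ^ 2 \<le> (25/64) * (\<tau> * n ^ 2)" by simp
  have zy: "z \<bullet> y \<ge> (7/16) * (\<tau> * n ^ 2)"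
  proof -
    have "z \<bullet> y = \<tau> * (E w \<bullet> E w) + E w \<bullet> e + \<tau> * (R \<bullet> E w) + R \<bullet> e"
      by (simp add: y_def R_def inner_add_right inner_diff_left algebra_simps)
    moreover have "E w \<bullet> E w = n ^ 2" by (simp add: n_def normE flip: power2_norm_eq_inner)
    moreover have "\<bar>E w \<bullet> e\<bar> \<le> n * (\<tau> * n / 4)"
      using en by (intro order_trans[OF Cauchy_Schwarz_ineq2] mult_mono) (auto simp: normE n_def)
    moreover have "\<tau> * \<bar>R \<bullet> E w\<bar> \<le> \<tau> * (n / 4 * n)"
      using Rn \<tau> by (intro mult_left_mono order_trans[OF Cauchy_Schwarz_ineq2] mult_mono) (auto simp: normE n_def)
    moreover have "\<bar>R \<bullet> e\<bar> \<le> n / 4 * (\<tau> * n / 4)"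
      using Rn en by (intro order_trans[OF Cauchy_Schwarz_ineq2] mult_mono) (auto simp: n_def)
    moreover have "\<tau> * \<bar>R \<bullet> E w\<bar> = \<bar>\<tau> * (R \<bullet> E w)\<bar>" using \<tau> by (simp add: abs_mult)
    ultimately show ?thesis by (simp add: power2_eq_square algebra_simps)
  qed
  have zn: "norm z ^ 2 \<le> (25/16) * n ^ 2"
  proof -
    have "norm z ^ 2 \<le> ((5/4) * n) ^ 2" using norm_bounds(2)[OF w] by (intro power_mono) (auto simp: z_def n_def)
    then show ?thesis by (simp add: power_mult_distrib power_divide)
  qed
  have "norm (z - y) ^ 2 = norm z ^ 2 - 2 * (z \<bullet> y) + norm y ^ 2"
    by (simp add: power2_norm_eq_inner inner_diff_left inner_diff_right inner_commute)
  also have "\<dots> \<le> norm z ^ 2 - (7/16) * (\<tau> * n ^ 2)"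
  proof -
    have "0 \<le> \<tau> * n ^ 2" using \<tau> by simp
    then show ?thesis using zy y2 by linarith
  qed
  also have "\<dots> \<le> norm z ^ 2 - (\<tau> / 4) * norm z ^ 2"
  proof -
    have "(\<tau> / 4) * norm z ^ 2 \<le> (\<tau> / 4) * ((25/16) * n ^ 2)" using zn \<tau> by (intro mult_left_mono) auto
    also have "\<dots> = (25/64) * (\<tau> * n ^ 2)" by simp
    also have "\<dots> \<le> (7/16) * (\<tau> * n ^ 2)" using \<tau> by (intro mult_right_mono) auto
    finally show ?thesis by linarith
  qed
  also have "\<dots> \<le> ((1 - \<tau> / 8) * norm z) ^ 2"
  proof -
    have "(1 - \<tau> / 8) ^ 2 = 1 - \<tau> / 4 + (\<tau> / 8) ^ 2" by (simp add: power2_eq_square algebra_simps)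
    then have "1 - \<tau> / 4 \<le> (1 - \<tau> / 8) ^ 2" by simp
    then have "(1 - \<tau> / 4) * norm z ^ 2 \<le> (1 - \<tau> / 8) ^ 2 * norm z ^ 2" by (intro mult_right_mono) auto
    moreover have "(1 - \<tau> / 4) * norm z ^ 2 = norm z ^ 2 - (\<tau> / 4) * norm z ^ 2" by (simp add: algebra_simps)
    ultimately show ?thesis by (simp only: power_mult_distrib)
  qed
  finally have sq: "norm (z - y) ^ 2 \<le> ((1 - \<tau> / 8) * norm z) ^ 2" .
  have "0 \<le> (1 - \<tau> / 8) * norm z" using \<tau> by (intro mult_nonneg_nonneg) auto
  then have "norm (z - y) \<le> (1 - \<tau> / 8) * norm z" by (rule power2_le_imp_le[OF sq])
  then show ?thesis unfolding z' by (simp add: z_def)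
qed

text \<open>Comparing the part of the shell outside of a small ball with a contracted copy of itself avoids
  polar coordinates, at the price of the exponent \<open>1/2\<close>, which is irrelevant here.\<close>

lemma shell_volume:
  assumes \<eta>: "0 < \<eta>" "sqrt \<eta> \<le> 1/100"
  shows "emeasure lborel {w \<in> ball 0 r1. s \<le> norm (\<psi> w - x) \<and> norm (\<psi> w - x) < s + 3 * \<eta>}
    \<le> ennreal (unit_ball_vol (real CARD('d)) * (24 * real CARD('d) + 6 ^ CARD('d)) * sqrt \<eta>)"
proof -
  define q where "q = sqrt \<eta>"
  define d where "d = CARD('d)"
  define \<omega> where "\<omega> = unit_ball_vol (real d)"
  have \<omega>: "0 \<le> \<omega>" by (simp add: \<omega>_def)
  have d: "DIM(real^'d) = d" "d > 0" by (simp_all add: d_def)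
  have q: "0 < q" "q \<le> 1/100" "\<eta> = q * q" using \<eta> by (auto simp: q_def)
  define G where "G t = {w \<in> ball 0 r1. norm (\<psi> w - x) < t}" for t
  have G_open: "open (G t)" for t
  proof -
    have "continuous_on (ball 0 r1) (\<lambda>w. norm (\<psi> w - x))" using continuous_psi by (intro continuous_intros)
    then have "open ((\<lambda>w. norm (\<psi> w - x)) -` {..<t} \<inter> ball 0 r1)"
      by (intro continuous_on_open_vimage[THEN iffD1, rule_format]) auto
    moreover have "(\<lambda>w. norm (\<psi> w - x)) -` {..<t} \<inter> ball 0 r1 = G t" by (auto simp: G_def)
    ultimately show ?thesis by simp
  qed
  then have G_meas [measurable]: "G t \<in> sets borel" for t by simp
  have shell: "{w \<in> ball 0 r1. s \<le> norm (\<psi> w - x) \<and> norm (\<psi> w - x) < s + 3 * \<eta>} = G (s + 3 * \<eta>) - G s"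
    by (auto simp: G_def)
  have le: "0 \<le> \<omega> * (24 * real d) * q" "0 \<le> \<omega> * 6 ^ d * q" using \<omega> q by auto
  show ?thesis
  proof (cases "s < q")
    case True
    \<comment> \<open>Near the centre contraction gains too little, but there the whole shell lies
      in a ball of radius 6 q, whose volume is at most a constant times q.\<close>
    have "G (s + 3 * \<eta>) \<subseteq> cball 0 (6 * q)"
    proof
      fix w assume w: "w \<in> G (s + 3 * \<eta>)"
      then have "norm w \<le> (4/3) * (s + 3 * \<eta>)" using norm_bounds(1)[of w] by (auto simp: G_def)
      also have "\<dots> \<le> (4/3) * (q + 3 * (1 * q))" using True q by (intro mult_left_mono add_mono) auto
      finally show "w \<in> cball 0 (6 * q)" using q by simp
    qed
    then have "emeasure lborel (G (s + 3 * \<eta>) - G s) \<le> emeasure lborel (cball (0::real^'d) (6 * q))"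
      by (intro emeasure_mono) auto
    also have "\<dots> = ennreal (\<omega> * (6 * q) ^ d)" using q by (simp add: emeasure_cball \<omega>_def d_def)
    also have "\<dots> \<le> ennreal (\<omega> * 6 ^ d * q)"
    proof (rule ennreal_leI)
      have "q ^ d \<le> q ^ 1" using q d by (intro power_decreasing) auto
      then have "\<omega> * 6 ^ d * q ^ d \<le> \<omega> * 6 ^ d * q ^ 1" using \<omega> by (intro mult_left_mono) auto
      then show "\<omega> * (6 * q) ^ d \<le> \<omega> * 6 ^ d * q" by (simp add: power_mult_distrib mult.assoc)
    qed
    also have "\<dots> \<le> ennreal (\<omega> * (24 * real d + 6 ^ d) * q)"
      using le by (intro ennreal_leI) (simp add: algebra_simps)
    finally show ?thesis unfolding shell by (simp add: \<omega>_def d_def q_def)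
  next
    case False
    \<comment> \<open>With \<tau>/8 = 3q, \<open>radial\<close> brings the outer radius s + 3 q^2
      down to at most s as soon as s \<ge> q.\<close>
    define \<tau> where "\<tau> = 24 * q"
    have \<tau>: "0 \<le> \<tau>" "\<tau> \<le> 1/4" "0 < 1 - \<tau>" using q by (auto simp: \<tau>_def)
    have sub: "G (s + 3 * \<eta>) \<subseteq> {w. (1 - \<tau>) *\<^sub>R w \<in> G s}"
    proof
      fix w assume w: "w \<in> G (s + 3 * \<eta>)"
      then have wb: "w \<in> ball 0 r1" by (simp add: G_def)
      have "norm (\<psi> ((1 - \<tau>) *\<^sub>R w) - x) \<le> (1 - \<tau> / 8) * norm (\<psi> w - x)" by (rule radial[OF wb \<tau>(1,2)])
      also have "\<dots> < (1 - \<tau> / 8) * (s + 3 * \<eta>)" using w \<tau> by (intro mult_strict_left_mono) (auto simp: G_def)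
      also have "\<dots> \<le> s"
      proof -
        have "q * q \<le> q * s" using False q by (intro mult_left_mono) auto
        moreover have "0 \<le> q * (q * q)" using q by simp
        ultimately show ?thesis by (simp add: \<tau>_def q(3) algebra_simps)
      qed
      finally have "norm (\<psi> ((1 - \<tau>) *\<^sub>R w) - x) < s" .
      moreover have "(1 - \<tau>) *\<^sub>R w \<in> ball 0 r1"
        using wb \<tau> mult_right_mono[of "1 - \<tau>" 1 "norm w"] by simp
      ultimately show "w \<in> {w. (1 - \<tau>) *\<^sub>R w \<in> G s}" by (simp add: G_def)
    qed
    define v where "v t = measure lborel (G t)" for t
    have fin: "emeasure lborel (G t) = ennreal (v t)" and vle: "v t \<le> \<omega>" for t
    proof -
      have "G t \<subseteq> cball 0 1" using r1 by (auto simp: G_def)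
      then have "emeasure lborel (G t) \<le> emeasure lborel (cball (0::real^'d) 1)" by (intro emeasure_mono) auto
      also have "\<dots> = ennreal \<omega>" by (simp add: emeasure_cball \<omega>_def d_def)
      finally have *: "emeasure lborel (G t) \<le> ennreal \<omega>" .
      then have "emeasure lborel (G t) \<noteq> \<infinity>" by (auto simp: top_unique)
      then show "emeasure lborel (G t) = ennreal (v t)" unfolding v_def by (simp add: emeasure_eq_ennreal_measure)
      then show "v t \<le> \<omega>" using * \<omega> by (simp add: ennreal_le_iff)
    qed
    have v0: "0 \<le> v t" for t by (simp add: v_def)
    have "ennreal ((1 - \<tau>) ^ d * v (s + 3 * \<eta>)) = ennreal ((1 - \<tau>) ^ d) * emeasure lborel (G (s + 3 * \<eta>))"
      using \<tau> by (simp add: fin ennreal_mult')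
    also have "\<dots> \<le> ennreal ((1 - \<tau>) ^ d) * emeasure lborel {w. (1 - \<tau>) *\<^sub>R w \<in> G s}"
      using sub by (intro mult_left_mono emeasure_mono) auto
    also have "\<dots> = ennreal (v s)"
      using emeasure_lborel_scale[OF G_meas \<tau>(3), of s] by (simp add: fin d_def)
    finally have "(1 - \<tau>) ^ d * v (s + 3 * \<eta>) \<le> v s" using v0 by (simp add: ennreal_le_iff)
    \<comment> \<open>Bernoulli's inequality makes the volume factor of the contraction a loss of at
      most d \<tau> = 24 d q, the first term of the constant.\<close>
    moreover have "(1 - real d * \<tau>) * v (s + 3 * \<eta>) \<le> (1 - \<tau>) ^ d * v (s + 3 * \<eta>)"
      using Bernoulli_inequality[of "- \<tau>" d] \<tau> v0 by (intro mult_right_mono) auto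
    ultimately have "v (s + 3 * \<eta>) - v s \<le> real d * \<tau> * v (s + 3 * \<eta>)" by (simp add: algebra_simps)
    also have "\<dots> \<le> real d * \<tau> * \<omega>" using vle \<tau> by (intro mult_left_mono) auto
    also have "\<dots> \<le> \<omega> * (24 * real d + 6 ^ d) * q" using le by (simp add: \<tau>_def algebra_simps)
    finally have "v (s + 3 * \<eta>) - v s \<le> \<omega> * (24 * real d + 6 ^ d) * q" .
    moreover have "emeasure lborel (G (s + 3 * \<eta>) - G s) = emeasure lborel (G (s + 3 * \<eta>)) - emeasure lborel (G s)"
    proof (rule emeasure_Diff)
      show "emeasure lborel (G s) \<noteq> \<infinity>" by (simp add: fin[of s])
      show "G s \<subseteq> G (s + 3 * \<eta>)" using \<eta> by (auto simp: G_def)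
    qed simp_all
    ultimately have "emeasure lborel (G (s + 3 * \<eta>) - G s) \<le> ennreal (\<omega> * (24 * real d + 6 ^ d) * q)"
      using v0[of s] by (simp add: fin ennreal_minus ennreal_leI)
    then show ?thesis unfolding shell by (simp add: \<omega>_def d_def q_def)
  qed
qed

end

section \<open>The bias in a normal chart\<close>

lemma abs_integral_le:
  fixes f :: "'a \<Rightarrow> real"
  assumes "integrable M f" "(\<integral>\<^sup>+ x. ennreal \<bar>f x\<bar> \<partial>M) \<le> ennreal c" "0 \<le> c"
  shows "\<bar>\<integral>x. f x \<partial>M\<bar> \<le> c"
proof -
  have "ennreal (norm (\<integral>x. f x \<partial>M)) \<le> (\<integral>\<^sup>+ x. ennreal (norm (f x)) \<partial>M)"
    by (rule integral_norm_bound_ennreal[OF assms(1)])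
  also have "\<dots> \<le> ennreal c" using assms(2) by simp
  finally show ?thesis using assms(3) by (simp add: ennreal_le_iff)
qed

lemma integrable_of_nn_bound:
  fixes f :: "'a \<Rightarrow> real"
  assumes "f \<in> borel_measurable M" "(\<integral>\<^sup>+ x. ennreal \<bar>f x\<bar> \<partial>M) \<le> ennreal c"
  shows "integrable M f"
  using assms by (intro integrableI_bounded) (auto intro: le_less_trans)

section \<open>Transfer of the sampling law to a chart\<close>

locale law_chart = normal_chart M r0 r1 C x \<psi> E B
  for M :: "(real^'m) set" and r0 r1 C x and \<psi> :: "real^'d \<Rightarrow> real^'m" and E B +
  fixes \<mu> :: "(real^'m) measure" and p :: "real^'m \<Rightarrow> real" and Cp :: real
  assumes volume: "riemannian_volume TYPE('d) M \<mu>"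
    and p_measurable [measurable]: "p \<in> borel_measurable \<mu>"
    and p_nonneg: "\<And>y. y \<in> M \<Longrightarrow> 0 \<le> p y"
    and p_mass: "(\<integral>\<^sup>+ x. ennreal (p x) \<partial>\<mu>) = 1"
    and p_le: "\<And>w. w \<in> ball 0 r1 \<Longrightarrow> p (\<psi> w) \<le> Cp"
begin

lemma sets_\<mu>: "sets \<mu> = sets (restrict_space borel M)"
  using volume by (simp add: riemannian_volume_def)

lemma space_\<mu>: "space \<mu> = M"
  using sets_eq_imp_space_eq[OF sets_\<mu>] by (simp add: space_restrict_space)

definition law :: "(real^'m) measure" where "law = density \<mu> (\<lambda>y. ennreal (p y))"

lemma space_law: "space law = M" and sets_law [measurable_cong]: "sets law = sets \<mu>"
  by (simp_all add: law_def space_\<mu>)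

lemma prob_space_law: "prob_space law"
proof
  have "emeasure law (space law) = (\<integral>\<^sup>+ y. ennreal (p y) * indicator (space \<mu>) y \<partial>\<mu>)"
    by (simp add: law_def emeasure_density)
  also have "\<dots> = (\<integral>\<^sup>+ y. ennreal (p y) \<partial>\<mu>)" by (rule nn_integral_cong) simp
  finally show "emeasure law (space law) = 1" using p_mass by simp
qed

definition S :: "(real^'m) set" where "S = \<psi> ` ball 0 r1"

lemma S_sets [measurable]: "S \<in> sets \<mu>"
proof -
  obtain O' where "open O'" "S = M \<inter> O'" using psi_open by (auto simp: openin_open S_def)
  then show ?thesis by (auto simp: sets_\<mu> sets_restrict_space)
qed

text \<open>Continued by the constant x off the ball, in order to have a measurable map into
  \<open>M\<close> on the whole space; the density \<open>Jc\<close> vanishes on the added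
  part.\<close>

definition \<psi>c :: "real^'d \<Rightarrow> real^'m" where "\<psi>c w = (if w \<in> ball 0 r1 then \<psi> w else x)"

lemma psic_M: "\<psi>c w \<in> M" using psi_in_M x_in_M by (simp add: \<psi>c_def)

lemma borel_to_\<mu>: "f \<in> borel_measurable borel \<Longrightarrow> f \<in> borel_measurable \<mu>"
  using measurable_restrict_space1[of f borel borel M] measurable_cong_sets[OF sets_\<mu> refl] by blast

lemma psic_measurable [measurable]: "\<psi>c \<in> measurable borel \<mu>"
proof -
  have "\<psi>c \<in> borel_measurable borel"
    unfolding \<psi>c_def[abs_def] by (intro borel_measurable_continuous_on_if continuous_psi) auto
  then have "\<psi>c \<in> measurable borel (restrict_space borel M)"
    using psic_M by (intro measurable_restrict_space2) auto
  then show ?thesis using measurable_cong_sets[OF refl sets_\<mu>] by blast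
qed

definition Jc :: "real^'d \<Rightarrow> real" where "Jc w = indicator (ball 0 r1) w *\<^sub>R J w"

lemma Jc_measurable [measurable]: "Jc \<in> borel_measurable borel"
  unfolding Jc_def[abs_def] by (rule J_measurable)

lemma Jc_nonneg: "0 \<le> Jc w" by (simp add: Jc_def J_nonneg)

text \<open>\<open>riemannian_volume\<close> speaks of one set at a time. As an identity of measures
  it yields the change of variables for all integrals over the chart.\<close>

lemma volume_transfer: "density \<mu> (\<lambda>y. ennreal (indicator S y)) = distr (density lborel (\<lambda>w. ennreal (Jc w))) \<mu> \<psi>c"
proof (rule measure_eqI)
  fix A assume "A \<in> sets (density \<mu> (\<lambda>y. ennreal (indicator S y)))"
  then have A [measurable]: "A \<in> sets \<mu>" by simp
  have vA: "\<psi>c -` A \<in> sets borel" using measurable_sets[OF psic_measurable A] by simp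
  have "emeasure (density \<mu> (\<lambda>y. ennreal (indicator S y))) A = (\<integral>\<^sup>+ y. ennreal (indicator S y) * indicator A y \<partial>\<mu>)"
    by (subst emeasure_density) auto
  also have "\<dots> = (\<integral>\<^sup>+ y. indicator (A \<inter> S) y \<partial>\<mu>)"
    by (intro nn_integral_cong) (auto simp: indicator_def)
  also have "\<dots> = emeasure \<mu> (A \<inter> S)" by simp
  also have "\<dots> = (\<integral>\<^sup>+ u\<in>{u\<in>ball 0 r1. \<psi> u \<in> A \<inter> S}. ennreal (sqrt (det (gram_matrix \<psi> u))) \<partial>lborel)"
  proof -
    have "\<forall>A\<in>sets \<mu>. A \<subseteq> \<psi> ` ball 0 r1 \<longrightarrow>
      emeasure \<mu> A = (\<integral>\<^sup>+ u\<in>{u\<in>ball 0 r1. \<psi> u \<in> A}. ennreal (sqrt (det (gram_matrix \<psi> u))) \<partial>lborel)"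
      using volume param unfolding riemannian_volume_def by blast
    moreover have "A \<inter> S \<in> sets \<mu>" "A \<inter> S \<subseteq> \<psi> ` ball 0 r1" by (auto simp: S_def[symmetric])
    ultimately show ?thesis by blast
  qed
  also have "\<dots> = (\<integral>\<^sup>+ w. ennreal (Jc w) * indicator (\<psi>c -` A \<inter> space (density lborel (\<lambda>w. ennreal (Jc w)))) w \<partial>lborel)"
    by (intro nn_integral_cong) (auto simp: indicator_def Jc_def J_def \<psi>c_def S_def ennreal_max_0)
  also have "\<dots> = emeasure (density lborel (\<lambda>w. ennreal (Jc w))) (\<psi>c -` A \<inter> space (density lborel (\<lambda>w. ennreal (Jc w))))"
    using vA by (subst emeasure_density) auto
  also have "\<dots> = emeasure (distr (density lborel (\<lambda>w. ennreal (Jc w))) \<mu> \<psi>c) A"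
    by (subst emeasure_distr) auto
  finally show "emeasure (density \<mu> (\<lambda>y. ennreal (indicator S y))) A = emeasure (distr (density lborel (\<lambda>w. ennreal (Jc w))) \<mu> \<psi>c) A" .
qed simp

lemma law_nn_integral:
  assumes [measurable]: "g \<in> borel_measurable \<mu>"
  shows "(\<integral>\<^sup>+ y. g y * indicator S y \<partial>law) = (\<integral>\<^sup>+ w. ennreal (Jc w) * (ennreal (p (\<psi>c w)) * g (\<psi>c w)) \<partial>lborel)"
proof -
  have "(\<integral>\<^sup>+ y. g y * indicator S y \<partial>law) = (\<integral>\<^sup>+ y. ennreal (indicator S y) * (ennreal (p y) * g y) \<partial>\<mu>)"
    unfolding law_def by (subst nn_integral_density) (auto intro!: nn_integral_cong simp: indicator_def)
  also have "\<dots> = (\<integral>\<^sup>+ y. ennreal (p y) * g y \<partial>density \<mu> (\<lambda>y. ennreal (indicator S y)))"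
    by (subst nn_integral_density) auto
  also have "\<dots> = (\<integral>\<^sup>+ w. ennreal (Jc w) * (ennreal (p (\<psi>c w)) * g (\<psi>c w)) \<partial>lborel)"
    unfolding volume_transfer by (subst nn_integral_distr) (auto simp: nn_integral_density)
  finally show ?thesis .
qed

lemma law_integral:
  fixes g :: "real^'m \<Rightarrow> real"
  assumes [measurable]: "g \<in> borel_measurable \<mu>"
  shows "(\<integral>y. indicator S y * g y \<partial>law) = (\<integral>w. Jc w * (p (\<psi>c w) * g (\<psi>c w)) \<partial>lborel)"
    and "integrable law (\<lambda>y. indicator S y * g y) \<longleftrightarrow> integrable lborel (\<lambda>w. Jc w * (p (\<psi>c w) * g (\<psi>c w)))"
proof -
  have AEp: "AE y in \<mu>. 0 \<le> p y" using p_nonneg by (auto intro!: AE_I2 simp: space_\<mu>)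
  have "(\<integral>y. indicator S y * g y \<partial>law) = (\<integral>y. indicator S y *\<^sub>R (p y * g y) \<partial>\<mu>)"
    unfolding law_def using AEp by (subst integral_density) (auto intro!: Bochner_Integration.integral_cong)
  also have "\<dots> = (\<integral>y. p y * g y \<partial>density \<mu> (\<lambda>y. ennreal (indicator S y)))"
    by (subst integral_density) auto
  also have "\<dots> = (\<integral>w. Jc w * (p (\<psi>c w) * g (\<psi>c w)) \<partial>lborel)"
    unfolding volume_transfer using Jc_nonneg by (subst integral_distr) (auto simp: integral_density)
  finally show "(\<integral>y. indicator S y * g y \<partial>law) = (\<integral>w. Jc w * (p (\<psi>c w) * g (\<psi>c w)) \<partial>lborel)" .
  have "integrable law (\<lambda>y. indicator S y * g y) \<longleftrightarrow> integrable \<mu> (\<lambda>y. indicator S y *\<^sub>R (p y * g y))"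
    unfolding law_def using AEp by (subst integrable_density) (auto simp: mult_ac)
  also have "\<dots> \<longleftrightarrow> integrable (density \<mu> (\<lambda>y. ennreal (indicator S y))) (\<lambda>y. p y * g y)"
    by (subst integrable_density) auto
  also have "\<dots> \<longleftrightarrow> integrable lborel (\<lambda>w. Jc w * (p (\<psi>c w) * g (\<psi>c w)))"
    unfolding volume_transfer using Jc_nonneg by (subst integrable_distr_eq) (auto simp: integrable_density)
  finally show "integrable law (\<lambda>y. indicator S y * g y) \<longleftrightarrow> integrable lborel (\<lambda>w. Jc w * (p (\<psi>c w) * g (\<psi>c w)))" .
qed

lemma Cp_nonneg: "0 \<le> Cp"
  using p_le[of 0] p_nonneg[OF psi_in_M[of 0]] r1 by simp

lemma law_nn_integral_le:
  assumes [measurable]: "g \<in> borel_measurable \<mu>"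
  shows "(\<integral>\<^sup>+ y. g y * indicator S y \<partial>law) \<le> ennreal ((1 + det_bound TYPE('d)) * Cp) * (\<integral>\<^sup>+ w\<in>ball 0 r1. g (\<psi> w) \<partial>lborel)"
proof -
  have [measurable]: "ball (0::real^'d) r1 \<in> sets borel" by simp
  have "(\<integral>\<^sup>+ y. g y * indicator S y \<partial>law) = (\<integral>\<^sup>+ w. ennreal (Jc w) * (ennreal (p (\<psi>c w)) * g (\<psi>c w)) \<partial>lborel)"
    by (rule law_nn_integral) measurable
  also have "\<dots> \<le> (\<integral>\<^sup>+ w. ennreal ((1 + det_bound TYPE('d)) * Cp) * (g (\<psi>c w) * indicator (ball 0 r1) w) \<partial>lborel)"
  proof (rule nn_integral_mono)
    fix w :: "real^'d"
    show "ennreal (Jc w) * (ennreal (p (\<psi>c w)) * g (\<psi>c w)) \<le> ennreal ((1 + det_bound TYPE('d)) * Cp) * (g (\<psi>c w) * indicator (ball 0 r1) w)"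
    proof (cases "w \<in> ball 0 r1")
      case True
      have "Jc w * p (\<psi>c w) \<le> (1 + det_bound TYPE('d)) * Cp"
        using True J_le[OF True] J_nonneg[of w] p_le[OF True] p_nonneg[OF psi_in_M[OF True]] det_bound(1)[where 'd = 'd]
        by (simp add: Jc_def \<psi>c_def) (intro mult_mono; simp)
      then have "ennreal (Jc w) * ennreal (p (\<psi>c w)) \<le> ennreal ((1 + det_bound TYPE('d)) * Cp)"
        using Jc_nonneg[of w] by (simp add: ennreal_leI flip: ennreal_mult')
      then show ?thesis using True by (simp add: mult.assoc[symmetric] mult_right_mono)
    qed (simp add: Jc_def)
  qed
  also have "\<dots> = ennreal ((1 + det_bound TYPE('d)) * Cp) * (\<integral>\<^sup>+ w\<in>ball 0 r1. g (\<psi>c w) \<partial>lborel)"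
    by (rule nn_integral_cmult) measurable
  also have "(\<integral>\<^sup>+ w\<in>ball 0 r1. g (\<psi>c w) \<partial>lborel) = (\<integral>\<^sup>+ w\<in>ball 0 r1. g (\<psi> w) \<partial>lborel)"
    by (intro nn_integral_cong) (simp add: indicator_def \<psi>c_def)
  finally show ?thesis .
qed

lemma far: "y \<in> M \<Longrightarrow> y \<notin> S \<Longrightarrow> r0 \<le> norm (y - x)"
  using cover by (force simp: S_def dist_norm norm_minus_commute)

lemma norm_measurable [measurable]: "(\<lambda>y. norm (y - x)) \<in> borel_measurable \<mu>"
  by (rule borel_to_\<mu>) measurable

end

locale law_kernel = law_chart M r0 r1 C x \<psi> E B \<mu> p Cp + kernel_bound K \<nu> "CARD('d)"
  for M :: "(real^'m) set" and r0 r1 C x and \<psi> :: "real^'d \<Rightarrow> real^'m" and E B \<mu> p Cp K \<nu>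
begin

text \<open>\<open>norm_bounds\<close> gives |\<psi> w - x| \<ge> (3/4) |w|; half of it leaves room
  for the strict inequality in \<open>K_tail\<close>.\<close>

lemma kernel_chart_le:
  assumes w: "w \<in> ball 0 r1" "w \<noteq> 0" and h: "0 < h"
  shows "\<bar>K (norm (\<psi> w - x) / h)\<bar> \<le> measure \<nu> {(3/8) * norm w / h<..}"
proof (rule K_tail)
  have "0 < norm w" using w by simp
  then have "(3/8) * norm w < norm (\<psi> w - x)" using norm_bounds(1)[OF w(1)] by linarith
  then show "(3/8) * norm w / h < norm (\<psi> w - x) / h" using h by (intro divide_strict_right_mono)
qed (use h in simp)

text \<open>Both sides are compared in the chart with \<open>tail_integral\<close>. The factor 2
  dominates (5/4)^j, and the exponent of 8/3 is the one for j = 3, so that one constant serves all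
  j.\<close>

lemma tail_law:
  assumes j: "1 \<le> j" "j \<le> 3" and h: "0 < h"
  shows "(\<integral>\<^sup>+ y. ennreal (\<bar>K (norm (y - x) / h)\<bar> * norm (y - x) ^ j) * indicator S y \<partial>law)
    \<le> ennreal ((1 + det_bound TYPE('d)) * Cp * (2 * (unit_ball_vol (real CARD('d)) * Mom * (8/3) ^ (CARD('d) + 3))) * h ^ (CARD('d) + j))"
proof -
  have [measurable]: "(\<lambda>y. ennreal (\<bar>K (norm (y - x) / h)\<bar> * norm (y - x) ^ j)) \<in> borel_measurable \<mu>" by measurable
  have "(\<integral>\<^sup>+ y. ennreal (\<bar>K (norm (y - x) / h)\<bar> * norm (y - x) ^ j) * indicator S y \<partial>law)
    \<le> ennreal ((1 + det_bound TYPE('d)) * Cp) * (\<integral>\<^sup>+ w\<in>ball 0 r1. ennreal (\<bar>K (norm (\<psi> w - x) / h)\<bar> * norm (\<psi> w - x) ^ j) \<partial>lborel)"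
    by (rule law_nn_integral_le) measurable
  also have "(\<integral>\<^sup>+ w\<in>ball 0 r1. ennreal (\<bar>K (norm (\<psi> w - x) / h)\<bar> * norm (\<psi> w - x) ^ j) \<partial>lborel)
    \<le> (\<integral>\<^sup>+ w. ennreal 2 * ennreal (measure \<nu> {(3/8) * norm w / h<..} * norm w ^ j) \<partial>(lborel :: (real^'d) measure))"
  proof (rule nn_integral_mono)
    fix w :: "real^'d"
    have "\<bar>K (norm (\<psi> w - x) / h)\<bar> * norm (\<psi> w - x) ^ j \<le> 2 * (measure \<nu> {(3/8) * norm w / h<..} * norm w ^ j)" if w: "w \<in> ball 0 r1"
    proof (cases "w = 0")
      case False
      have "norm (\<psi> w - x) ^ j \<le> ((5/4) * norm w) ^ j" using norm_bounds(2)[OF w] by (intro power_mono) auto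
      also have "\<dots> = (5/4) ^ j * norm w ^ j" by (rule power_mult_distrib)
      also have "\<dots> \<le> 2 * norm w ^ j"
      proof (rule mult_right_mono)
        have "(5/4 :: real) ^ j \<le> (5/4) ^ 3" using j by (intro power_increasing) auto
        then show "(5/4 :: real) ^ j \<le> 2" by (simp add: power3_eq_cube)
      qed simp
      finally have "\<bar>K (norm (\<psi> w - x) / h)\<bar> * norm (\<psi> w - x) ^ j \<le> measure \<nu> {(3/8) * norm w / h<..} * (2 * norm w ^ j)"
        using kernel_chart_le[OF w False h] by (intro mult_mono) auto
      then show ?thesis by simp
    next
      case True
      then show ?thesis using j by (simp add: center power_0_left)
    qed
    then show "ennreal (\<bar>K (norm (\<psi> w - x) / h)\<bar> * norm (\<psi> w - x) ^ j) * indicator (ball 0 r1) w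
      \<le> ennreal 2 * ennreal (measure \<nu> {(3/8) * norm w / h<..} * norm w ^ j)"
      by (auto simp: indicator_def ennreal_leI simp del: ennreal_numeral simp flip: ennreal_mult)
  qed
  also have "\<dots> = ennreal 2 * (\<integral>\<^sup>+ w. ennreal (measure \<nu> {(3/8) * norm w / h<..} * norm w ^ j) \<partial>(lborel :: (real^'d) measure))"
  proof (rule nn_integral_cmult)
    show "(\<lambda>w :: real^'d. ennreal (measure \<nu> {(3/8) * norm w / h<..} * norm w ^ j)) \<in> borel_measurable lborel"
      by measurable
  qed
  also have "\<dots> \<le> ennreal 2 * ennreal (unit_ball_vol (real CARD('d)) * Mom * (h / (3/8)) ^ (CARD('d) + j))"
    using tail_integral[where 'a = "real^'d", of j "3/8" h] j h by (intro mult_left_mono) auto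
  also have "\<dots> \<le> ennreal (2 * (unit_ball_vol (real CARD('d)) * Mom * (8/3) ^ (CARD('d) + 3)) * h ^ (CARD('d) + j))"
  proof -
    have "(h / (3/8)) ^ (CARD('d) + j) = (8/3) ^ (CARD('d) + j) * h ^ (CARD('d) + j)" 
    proof -
      have "h / (3/8) = (8/3) * h" by simp
      then show ?thesis by (simp only: power_mult_distrib)
    qed
    also have "\<dots> \<le> (8/3) ^ (CARD('d) + 3) * h ^ (CARD('d) + j)" using j h by (intro mult_right_mono power_increasing) auto
    finally have "2 * (unit_ball_vol (real CARD('d)) * Mom * (h / (3/8)) ^ (CARD('d) + j)) \<le> 2 * (unit_ball_vol (real CARD('d)) * Mom * ((8/3) ^ (CARD('d) + 3) * h ^ (CARD('d) + j)))"
      using Mom_ge by (intro mult_left_mono) auto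
    moreover have "ennreal 2 * ennreal (unit_ball_vol (real CARD('d)) * Mom * (h / (3/8)) ^ (CARD('d) + j))
      = ennreal (2 * (unit_ball_vol (real CARD('d)) * Mom * (h / (3/8)) ^ (CARD('d) + j)))"
      using Mom_ge h by (intro ennreal_mult[symmetric]) auto
    ultimately show ?thesis by (simp only: mult.assoc) (rule ennreal_leI)
  qed
  finally have "(\<integral>\<^sup>+ y. ennreal (\<bar>K (norm (y - x) / h)\<bar> * norm (y - x) ^ j) * indicator S y \<partial>law)
    \<le> ennreal ((1 + det_bound TYPE('d)) * Cp) * ennreal (2 * (unit_ball_vol (real CARD('d)) * Mom * (8/3) ^ (CARD('d) + 3)) * h ^ (CARD('d) + j))"
    by this (auto intro: mult_left_mono)
  moreover have "ennreal ((1 + det_bound TYPE('d)) * Cp) * ennreal (2 * (unit_ball_vol (real CARD('d)) * Mom * (8/3) ^ (CARD('d) + 3)) * h ^ (CARD('d) + j))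
    = ennreal (((1 + det_bound TYPE('d)) * Cp) * (2 * (unit_ball_vol (real CARD('d)) * Mom * (8/3) ^ (CARD('d) + 3)) * h ^ (CARD('d) + j)))"
    by (intro ennreal_mult[symmetric] mult_nonneg_nonneg)
      (use Mom_ge h Cp_nonneg det_bound(1)[where 'd = 'd] in auto)
  ultimately show ?thesis by (simp only: mult.assoc)
qed

text \<open>At a fixed level s the condition on w confines |\<psi> w - x| to an interval of length 3
  \<eta> near hs. The bound of \<open>shell_volume\<close> does not depend on the radius, so
  integrating over s costs just the total mass \<open>V\<close>.\<close>

lemma shell_law:
  assumes \<eta>: "0 < \<eta>" "sqrt \<eta> \<le> 1/100" and h: "0 < h"
  shows "(\<integral>\<^sup>+ y. ennreal (measure \<nu> {(norm (y - x) - 2 * \<eta>) / h<..(norm (y - x) + \<eta>) / h}) * indicator S y \<partial>law)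
    \<le> ennreal ((1 + det_bound TYPE('d)) * Cp * (V * (unit_ball_vol (real CARD('d)) * (24 * real CARD('d) + 6 ^ CARD('d)))) * sqrt \<eta>)"
proof -
  define c where "c = unit_ball_vol (real CARD('d)) * (24 * real CARD('d) + 6 ^ CARD('d)) * sqrt \<eta>"
  have c0: "0 \<le> c" using \<eta> by (simp add: c_def)
  have [measurable]: "ball (0::real^'d) r1 \<in> sets borel" by simp
  have [measurable]: "(\<lambda>w. norm (\<psi>c w - x)) \<in> borel_measurable borel"
    using measurable_comp[OF psic_measurable norm_measurable] by (simp add: o_def)
  have le: "(r - 2 * \<eta>) / h \<le> (r + \<eta>) / h" for r using \<eta> h by (intro divide_right_mono) auto
  have "(\<integral>\<^sup>+ y. ennreal (measure \<nu> {(norm (y - x) - 2 * \<eta>) / h<..(norm (y - x) + \<eta>) / h}) * indicator S y \<partial>law)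
    \<le> ennreal ((1 + det_bound TYPE('d)) * Cp) * (\<integral>\<^sup>+ w\<in>ball 0 r1. ennreal (measure \<nu> {(norm (\<psi> w - x) - 2 * \<eta>) / h<..(norm (\<psi> w - x) + \<eta>) / h}) \<partial>lborel)"
    by (rule law_nn_integral_le) (simp only: measure_interval_diff[OF le], measurable)
  also have "(\<integral>\<^sup>+ w\<in>ball 0 r1. ennreal (measure \<nu> {(norm (\<psi> w - x) - 2 * \<eta>) / h<..(norm (\<psi> w - x) + \<eta>) / h}) \<partial>lborel)
    = (\<integral>\<^sup>+ w. ennreal (measure \<nu> {s. (w, s) \<in> {(w, s). (norm (\<psi>c w - x) - 2 * \<eta>) / h < s \<and> s \<le> (norm (\<psi>c w - x) + \<eta>) / h}}) * indicator (ball 0 r1) w \<partial>lborel)"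
    by (intro nn_integral_cong) (auto simp: indicator_def \<psi>c_def greaterThanAtMost_def greaterThan_def atMost_def Int_def)
  also have "\<dots> = (\<integral>\<^sup>+ s. (\<integral>\<^sup>+ w. indicator (ball 0 r1) w * indicator {(w, s). (norm (\<psi>c w - x) - 2 * \<eta>) / h < s \<and> s \<le> (norm (\<psi>c w - x) + \<eta>) / h} (w, s) \<partial>lborel) \<partial>\<nu>)"
  proof (rule layer_integral[OF sigma_finite_lborel])
    have "{y \<in> space (borel \<Otimes>\<^sub>M borel). (norm (\<psi>c (fst y) - x) - 2 * \<eta>) / h < (snd y :: real) \<and> snd y \<le> (norm (\<psi>c (fst y) - x) + \<eta>) / h} \<in> sets (borel \<Otimes>\<^sub>M borel)"
      by measurable
    moreover have "{y \<in> space (borel \<Otimes>\<^sub>M borel). (norm (\<psi>c (fst y) - x) - 2 * \<eta>) / h < (snd y :: real) \<and> snd y \<le> (norm (\<psi>c (fst y) - x) + \<eta>) / h}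
      = {(w, s). (norm (\<psi>c w - x) - 2 * \<eta>) / h < s \<and> s \<le> (norm (\<psi>c w - x) + \<eta>) / h}"
      by (auto simp: space_pair_measure)
    ultimately show "{(w, s). (norm (\<psi>c w - x) - 2 * \<eta>) / h < s \<and> s \<le> (norm (\<psi>c w - x) + \<eta>) / h} \<in> sets (lborel \<Otimes>\<^sub>M borel)"
      using sets_pair_measure_cong[OF sets_lborel refl, of borel] by simp
  qed measurable
  also have "\<dots> \<le> (\<integral>\<^sup>+ s. ennreal c \<partial>\<nu>)"
  proof (rule nn_integral_mono)
    fix s :: real
    let ?T = "{w \<in> ball 0 r1. h * s - \<eta> \<le> norm (\<psi> w - x) \<and> norm (\<psi> w - x) < (h * s - \<eta>) + 3 * \<eta>}"
    have "?T = {w \<in> space borel. w \<in> ball 0 r1 \<and> h * s - \<eta> \<le> norm (\<psi>c w - x) \<and> norm (\<psi>c w - x) < (h * s - \<eta>) + 3 * \<eta>}"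
      by (auto simp: \<psi>c_def)
    also have "\<dots> \<in> sets borel" by measurable
    finally have T: "?T \<in> sets lborel" by simp
    have "(\<integral>\<^sup>+ w. indicator (ball 0 r1) w * indicator {(w, s). (norm (\<psi>c w - x) - 2 * \<eta>) / h < s \<and> s \<le> (norm (\<psi>c w - x) + \<eta>) / h} (w, s) \<partial>lborel)
      \<le> (\<integral>\<^sup>+ w. indicator ?T w \<partial>lborel)"
      using h by (intro nn_integral_mono) (auto simp: indicator_def \<psi>c_def field_simps)
    also have "\<dots> = emeasure lborel ?T" using T by simp
    also have "\<dots> \<le> ennreal c" unfolding c_def by (rule shell_volume[OF \<eta>])
    finally show "(\<integral>\<^sup>+ w. indicator (ball 0 r1) w * indicator {(w, s). (norm (\<psi>c w - x) - 2 * \<eta>) / h < s \<and> s \<le> (norm (\<psi>c w - x) + \<eta>) / h} (w, s) \<partial>lborel)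
      \<le> ennreal c" .
  qed
  also have "\<dots> = ennreal (c * V)" using c0 V_nonneg by (simp add: emeasure_eq_measure V_def ennreal_mult)
  finally have "(\<integral>\<^sup>+ y. ennreal (measure \<nu> {(norm (y - x) - 2 * \<eta>) / h<..(norm (y - x) + \<eta>) / h}) * indicator S y \<partial>law)
    \<le> ennreal ((1 + det_bound TYPE('d)) * Cp) * ennreal (c * V)"
    by this (auto intro: mult_left_mono)
  also have "\<dots> = ennreal ((1 + det_bound TYPE('d)) * Cp * (c * V))"
    using c0 V_nonneg Cp_nonneg det_bound(1)[where 'd = 'd] by (intro ennreal_mult[symmetric]) auto
  also have "(1 + det_bound TYPE('d)) * Cp * (c * V) = (1 + det_bound TYPE('d)) * Cp * (V * (unit_ball_vol (real CARD('d)) * (24 * real CARD('d) + 6 ^ CARD('d)))) * sqrt \<eta>"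
    by (simp only: c_def mult.assoc mult.commute mult.left_commute)
  finally show ?thesis .
qed

definition jacobian_const :: real where
  "jacobian_const = det_bound TYPE('d) * (C ^ 2 + 3 * C)"

definition perturbation_const :: real where
  "perturbation_const = 48 * unit_ball_vol (real CARD('d)) * real CARD('d) * (C + C\<^sup>2 + 1/16) * (1 + 64 * (C + C\<^sup>2 + 1/16)) ^ (CARD('d) - 1) * Mom"

text \<open>Four sources, in this order: the part of f p J beyond its second-order polynomial, the
  passage from |\<psi> w - x| to |w| inside \<open>K\<close>, the extension of the model integral
  from the ball to the whole space, and the points of \<open>M\<close> outside the chart.\<close>

definition bias_const :: "real \<Rightarrow> real" where
  "bias_const Kf =
     Kf * Cp * (9 * jacobian_const + 5) * (unit_ball_vol (real CARD('d)) * Mom * (8/3) ^ (CARD('d) + 3))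
     + (5/2) * Kf * Cp * perturbation_const
     + Kf * Cp * (1 / r1\<^sup>2 + 3 / (2 * r1)) * (unit_ball_vol (real CARD('d)) * Mom * 2 ^ (CARD('d) + 3))
     + 2 ^ (CARD('d) + 3) * Mom * (1 / r0) ^ (CARD('d) + 3) * (2 * Kf)"

lemma perturbed_chart_integral:
  assumes h: "0 < h"
  shows "(\<integral>\<^sup>+ w\<in>ball 0 r1. ennreal (\<bar>K (norm (\<psi> w - x) / h) - K (norm w / h)\<bar> * norm w) \<partial>lborel)
    \<le> ennreal (perturbation_const * h ^ (CARD('d) + 3))"
  unfolding perturbation_const_def
proof (rule perturbed_integral[OF _ h])
  \<comment> \<open>The summand 1/16 keeps the constant positive when \<open>C\<close> is 0.\<close>
  let ?L = "C + C\<^sup>2 + 1/16"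
  show "0 < ?L" using C by (simp add: add_nonneg_pos)
  have Cr: "C * r1 \<le> 1/16" "0 \<le> C * r1" using C r1 by auto
  have r: "r1 * r1 \<le> 1 * 1" using r1 by (intro mult_mono) auto
  have "C * r1\<^sup>2 \<le> 1/16 * 1" unfolding power2_eq_square mult.assoc[symmetric] using Cr r1 by (intro mult_mono) auto
  moreover have "C\<^sup>2 * r1\<^sup>2 \<le> (1/16)\<^sup>2" unfolding power_mult_distrib[symmetric] using Cr by (intro power_mono) auto
  moreover have "4 * ?L * r1\<^sup>2 = 4 * (C * r1\<^sup>2) + 4 * (C\<^sup>2 * r1\<^sup>2) + r1 * r1 / 4" by (simp add: power2_eq_square algebra_simps)
  ultimately show "4 * ?L * r1\<^sup>2 \<le> 1" using r by (simp add: power2_eq_square[of "1/16"])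
  show "\<bar>norm (\<psi> w - x) - norm w\<bar> \<le> ?L * norm w ^ 3" if "w \<in> ball 0 r1" for w
  proof -
    have "(C + C\<^sup>2) * norm w ^ 3 \<le> ?L * norm w ^ 3" by (intro mult_right_mono) auto
    then show ?thesis using distance_expansion[OF that] by linarith
  qed
qed (use r1 in auto)

text \<open>The model integrand contains all terms of f p J up to second order, multiplied by
  \<open>K\<close> at |w|, so that its dependence on \<open>h\<close> is pure scaling. Each
  replacement leading to it leaves a cubic error weighted by a kernel tail, except for the change of
  the argument of \<open>K\<close>, where the first-order size of the polynomial meets a shell of
  cubic width.\<close>

lemma near_bias:
  fixes F :: "real^'d \<Rightarrow> real" and f :: "real^'m \<Rightarrow> real"
  assumes h: "0 < h" and f [measurable]: "f \<in> borel_measurable \<mu>"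
    and a: "linear a" "\<And>w. \<bar>a w\<bar> \<le> Kf * norm w"
    and s: "bilinear s" "\<And>w v. \<bar>s w v\<bar> \<le> Kf * norm w * norm v"
    and jet_f: "\<And>w. w \<in> ball 0 r1 \<Longrightarrow> \<bar>f (\<psi> w) - f x - a w - s w w / 2\<bar> \<le> Kf * norm w ^ 3"
    and g: "linear g" "\<And>w. \<bar>g w\<bar> \<le> Cp * norm w"
    and jet_p: "\<And>w. w \<in> ball 0 r1 \<Longrightarrow> \<bar>p (\<psi> w) - p x - g w\<bar> \<le> Cp * norm w ^ 2"
    and f_bound: "\<And>y. y \<in> M \<Longrightarrow> \<bar>f y\<bar> \<le> Kf"
  shows "\<bar>(\<integral>y. K (norm (y - x) / h) * (f y - f x) \<partial>law)
    - (\<integral>w. K (norm w / h) * (p x * a w + (p x * s w w / 2 + a w * g w)) \<partial>lborel)\<bar> \<le> bias_const Kf * h ^ (CARD('d) + 3)"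
proof -
  interpret L: prob_space law by (rule prob_space_law)
  have Kf: "0 \<le> Kf" using f_bound[OF x_in_M] by linarith
  note Cp = Cp_nonneg
  have px: "0 \<le> p x" "p x \<le> Cp" using p_nonneg[OF x_in_M] p_le[of 0] r1 by (auto simp: center)
  note Mom0 = Mom_ge(2)
  let ?\<omega> = "unit_ball_vol (real CARD('d))"
  have jc: "0 \<le> jacobian_const" using det_bound(1)[where 'd = 'd] C by (simp add: jacobian_const_def)
  have pc: "0 \<le> perturbation_const" using C Mom0 by (simp add: perturbation_const_def)
  define P where "P w = p x * a w + (p x * s w w / 2 + a w * g w)" for w
  define G where "G y = K (norm (y - x) / h) * (f y - f x)" for y
  have [measurable]: "a \<in> borel_measurable borel" "g \<in> borel_measurable borel" using a(1) g(1) by (auto intro: linear_borel_measurable)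
  have "continuous_on UNIV (\<lambda>w. s w w)"
    using s(1) by (intro bounded_bilinear.continuous_on[of s] continuous_on_id) (simp add: bilinear_conv_bounded_bilinear)
  then have [measurable]: "(\<lambda>w. s w w) \<in> borel_measurable borel" by (rule borel_measurable_continuous_onI)
  have [measurable]: "P \<in> borel_measurable borel" unfolding P_def[abs_def] by measurable
  have G [measurable]: "G \<in> borel_measurable \<mu>" unfolding G_def[abs_def] by measurable
  have G_bound: "\<bar>G y\<bar> \<le> V * (2 * Kf)" if "y \<in> M" for y
  proof -
    have "\<bar>f y - f x\<bar> \<le> 2 * Kf" using f_bound[OF that] f_bound[OF x_in_M] by linarith
    then show ?thesis unfolding G_def abs_mult using K_le[of "norm (y - x) / h"] h V_nonneg by (intro mult_mono) auto
  qed
  have intG: "integrable law (\<lambda>y. indicator A y * G y)" if [measurable]: "A \<in> sets \<mu>" for A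
  proof (rule L.integrable_const_bound[where B = "V * (2 * Kf)"])
    show "AE y in law. norm (indicator A y * G y) \<le> V * (2 * Kf)"
      using G_bound Kf V_nonneg by (auto intro!: AE_I2 simp: space_law indicator_def)
  qed measurable
  have Pb: "\<bar>P w\<bar> \<le> Kf * Cp * norm w + (3/2) * (Kf * Cp * norm w ^ 2)" for w
  proof -
    have "\<bar>p x * a w\<bar> \<le> Cp * (Kf * norm w)" unfolding abs_mult using px a(2)[of w] Cp by (intro mult_mono) auto
    moreover have "\<bar>p x * s w w\<bar> \<le> Cp * (Kf * norm w * norm w)" unfolding abs_mult using px s(2)[of w w] Cp by (intro mult_mono) auto
    moreover have "\<bar>a w * g w\<bar> \<le> (Kf * norm w) * (Cp * norm w)" unfolding abs_mult using a(2)[of w] g(2)[of w] Kf by (intro mult_mono) auto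
    ultimately have "\<bar>P w\<bar> \<le> Cp * (Kf * norm w) + (Cp * (Kf * norm w * norm w) / 2 + (Kf * norm w) * (Cp * norm w))"
      unfolding P_def by linarith
    then show ?thesis by (simp add: power2_eq_square algebra_simps)
  qed
  have Ktail: "\<bar>K (norm w / h)\<bar> \<le> measure \<nu> {(1/2) * norm w / h<..}" if "w \<noteq> 0" for w :: "real^'d"
    using that h by (intro K_tail) (auto simp: field_simps)
  have tail: "(\<integral>\<^sup>+ w. ennreal (c * (measure \<nu> {k * norm w / h<..} * norm w ^ j)) \<partial>(lborel :: (real^'d) measure))
      \<le> ennreal (c * (?\<omega> * Mom * (h / k) ^ (CARD('d) + j)))" if "0 \<le> c" "j \<le> 3" "0 < k" for c j k
  proof -
    have "(\<integral>\<^sup>+ w. ennreal (c * (measure \<nu> {k * norm w / h<..} * norm w ^ j)) \<partial>(lborel :: (real^'d) measure))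
      = ennreal c * (\<integral>\<^sup>+ w. ennreal (measure \<nu> {k * norm w / h<..} * norm w ^ j) \<partial>(lborel :: (real^'d) measure))"
      using that by (subst nn_integral_cmult[symmetric]) (auto simp: ennreal_mult)
    also have "\<dots> \<le> ennreal c * ennreal (?\<omega> * Mom * (h / k) ^ (CARD('d) + j))"
      using tail_integral[where 'a = "real^'d", of j k h] that h by (intro mult_left_mono) auto
    also have "\<dots> = ennreal (c * (?\<omega> * Mom * (h / k) ^ (CARD('d) + j)))"
      using that h Mom0 by (intro ennreal_mult[symmetric]) auto
    finally show ?thesis .
  qed
  have intP: "integrable lborel (\<lambda>w. K (norm w / h) * P w)"
  proof (rule integrable_of_nn_bound)
    have "(\<integral>\<^sup>+ w. ennreal \<bar>K (norm w / h) * P w\<bar> \<partial>lborel)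
      \<le> (\<integral>\<^sup>+ w. ennreal (Kf * Cp * (measure \<nu> {(1/2) * norm w / h<..} * norm w ^ 1))
          + ennreal ((3/2) * (Kf * Cp) * (measure \<nu> {(1/2) * norm w / h<..} * norm w ^ 2)) \<partial>(lborel :: (real^'d) measure))"
    proof (rule nn_integral_mono)
      fix w :: "real^'d"
      have "\<bar>K (norm w / h) * P w\<bar> \<le> measure \<nu> {(1/2) * norm w / h<..} * (Kf * Cp * norm w + (3/2) * (Kf * Cp * norm w ^ 2))"
      proof (cases "w = 0")
        case True
        then show ?thesis using Pb[of 0] by simp
      next
        case False
        show ?thesis unfolding abs_mult using Ktail[OF False] Pb[of w] by (intro mult_mono) auto
      qed
      then have "ennreal \<bar>K (norm w / h) * P w\<bar> \<le> ennreal (Kf * Cp * (measure \<nu> {(1/2) * norm w / h<..} * norm w ^ 1)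
          + (3/2) * (Kf * Cp) * (measure \<nu> {(1/2) * norm w / h<..} * norm w ^ 2))"
        by (intro ennreal_leI) (simp add: algebra_simps)
      then show "ennreal \<bar>K (norm w / h) * P w\<bar> \<le> ennreal (Kf * Cp * (measure \<nu> {(1/2) * norm w / h<..} * norm w ^ 1))
          + ennreal ((3/2) * (Kf * Cp) * (measure \<nu> {(1/2) * norm w / h<..} * norm w ^ 2))"
        using Kf Cp by (subst ennreal_plus[symmetric]) auto
    qed
    also have "\<dots> \<le> ennreal (Kf * Cp * (?\<omega> * Mom * (h / (1/2)) ^ (CARD('d) + 1))) + ennreal ((3/2) * (Kf * Cp) * (?\<omega> * Mom * (h / (1/2)) ^ (CARD('d) + 2)))"
    proof (subst nn_integral_add)
      show "(\<integral>\<^sup>+ w. ennreal (Kf * Cp * (measure \<nu> {(1/2) * norm w / h<..} * norm w ^ 1)) \<partial>(lborel :: (real^'d) measure))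
        + (\<integral>\<^sup>+ w. ennreal ((3/2) * (Kf * Cp) * (measure \<nu> {(1/2) * norm w / h<..} * norm w ^ 2)) \<partial>(lborel :: (real^'d) measure))
        \<le> ennreal (Kf * Cp * (?\<omega> * Mom * (h / (1/2)) ^ (CARD('d) + 1))) + ennreal ((3/2) * (Kf * Cp) * (?\<omega> * Mom * (h / (1/2)) ^ (CARD('d) + 2)))"
        by (rule add_mono[OF tail tail]) (use Kf Cp in auto)
    qed measurable
    also have "\<dots> = ennreal (Kf * Cp * (?\<omega> * Mom * (h / (1/2)) ^ (CARD('d) + 1)) + (3/2) * (Kf * Cp) * (?\<omega> * Mom * (h / (1/2)) ^ (CARD('d) + 2)))"
      using Kf Cp Mom0 h by (intro ennreal_plus[symmetric]) auto
    finally show "(\<integral>\<^sup>+ w. ennreal \<bar>K (norm w / h) * P w\<bar> \<partial>lborel)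
      \<le> ennreal (Kf * Cp * (?\<omega> * Mom * (h / (1/2)) ^ (CARD('d) + 1)) + (3/2) * (Kf * Cp) * (?\<omega> * Mom * (h / (1/2)) ^ (CARD('d) + 2)))" .
  qed measurable
  define N where "N w = Jc w * (p (\<psi>c w) * G (\<psi>c w))" for w
  have intN: "integrable lborel N" using intG[OF S_sets] law_integral(2)[OF G] by (simp add: N_def[abs_def])
  have near: "(\<integral>y. indicator S y * G y \<partial>law) = (\<integral>w. N w \<partial>lborel)" unfolding N_def by (rule law_integral(1)[OF G])
  define R where "R w = (f (\<psi> w) - f x) * p (\<psi> w) * J w - P w" for w
  have Rb: "\<bar>R w\<bar> \<le> Kf * Cp * (9 * jacobian_const + 5) * norm w ^ 3" if w: "w \<in> ball 0 r1" for w
  proof -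
    define n where "n = norm w"
    have n: "0 \<le> n" "n \<le> 1" using w r1 by (auto simp: n_def)
    have n2: "n ^ 2 \<le> n" "n ^ 3 \<le> n" "n ^ 3 \<le> n ^ 2" "n ^ 4 \<le> n ^ 3" "n ^ 5 \<le> n ^ 3"
      using n power_decreasing[of 1 2 n] power_decreasing[of 1 3 n] power_decreasing[of 2 3 n] power_decreasing[of 3 4 n] power_decreasing[of 3 5 n] by auto
    define A where "A = a w"
    define Sq where "Sq = s w w / 2"
    define rF where "rF = f (\<psi> w) - f x - A - Sq"
    define Gp where "Gp = p (\<psi> w)"
    define gl where "gl = g w"
    define rG where "rG = Gp - p x - gl"
    define rJ where "rJ = J w - 1"
    have A: "\<bar>A\<bar> \<le> Kf * n" using a(2)[of w] by (simp add: A_def n_def)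
    have Sq: "\<bar>Sq\<bar> \<le> Kf * n ^ 2 / 2" using s(2)[of w w] by (simp add: Sq_def n_def power2_eq_square mult.assoc)
    have rF: "\<bar>rF\<bar> \<le> Kf * n ^ 3" using jet_f[OF w] by (simp add: rF_def A_def Sq_def n_def)
    have gl: "\<bar>gl\<bar> \<le> Cp * n" using g(2)[of w] by (simp add: gl_def n_def)
    have rG: "\<bar>rG\<bar> \<le> Cp * n ^ 2" using jet_p[OF w] by (simp add: rG_def gl_def Gp_def n_def)
    have rJ: "\<bar>rJ\<bar> \<le> jacobian_const * n ^ 2" using J_estimate[OF w] by (simp add: rJ_def n_def jacobian_const_def)
    have Gp: "\<bar>Gp\<bar> \<le> Cp" using p_le[OF w] p_nonneg[OF psi_in_M[OF w]] by (simp add: Gp_def)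
    have FF: "\<bar>A + Sq + rF\<bar> \<le> 3 * (Kf * n)"
    proof -
      have "Kf * n ^ 2 \<le> Kf * n" "Kf * n ^ 3 \<le> Kf * n" using n2 Kf by (auto intro: mult_left_mono)
      moreover have "0 \<le> Kf * n" using Kf n by simp
      ultimately show ?thesis using A Sq rF by linarith
    qed
    \<comment> \<open>Grouped so that every summand has order at least three in n: a quadratic
      density error times a first-order factor, or products of jet terms whose orders add
      up.\<close>
    have eq: "R w = (A + Sq + rF) * Gp * rJ + rF * Gp + A * rG + Sq * (gl + rG)"
    proof -
      have "s w w = 2 * Sq" "p x = Gp - gl - rG" "J w = 1 + rJ" "f (\<psi> w) - f x = A + Sq + rF"
        by (simp_all add: rJ_def rF_def rG_def A_def Sq_def gl_def Gp_def)
      then have "R w = (A + Sq + rF) * Gp * (1 + rJ) - ((Gp - gl - rG) * A + ((Gp - gl - rG) * Sq + A * gl))"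
        by (simp add: R_def P_def A_def[symmetric] gl_def[symmetric] Gp_def[symmetric])
      then show ?thesis by (simp add: algebra_simps)
    qed
    have t1: "\<bar>(A + Sq + rF) * Gp * rJ\<bar> \<le> (3 * (Kf * n)) * Cp * (jacobian_const * n ^ 2)"
      unfolding abs_mult using FF Gp rJ Kf Cp n by (intro mult_mono mult_nonneg_nonneg) auto
    have t2: "\<bar>rF * Gp\<bar> \<le> (Kf * n ^ 3) * Cp" unfolding abs_mult using rF Gp Kf n by (intro mult_mono) auto
    have t3: "\<bar>A * rG\<bar> \<le> (Kf * n) * (Cp * n ^ 2)" unfolding abs_mult using A rG Kf n by (intro mult_mono) auto
    have "\<bar>gl + rG\<bar> \<le> 2 * (Cp * n)"
    proof -
      have "Cp * n ^ 2 \<le> Cp * n" using n2 Cp by (auto intro: mult_left_mono)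
      then show ?thesis using gl rG by linarith
    qed
    then have t4: "\<bar>Sq * (gl + rG)\<bar> \<le> (Kf * n ^ 2 / 2) * (2 * (Cp * n))"
      unfolding abs_mult using Sq Kf n by (intro mult_mono) auto
    have "\<bar>R w\<bar> \<le> (3 * (Kf * n)) * Cp * (jacobian_const * n ^ 2) + (Kf * n ^ 3) * Cp + (Kf * n) * (Cp * n ^ 2) + (Kf * n ^ 2 / 2) * (2 * (Cp * n))"
      unfolding eq using t1 t2 t3 t4 by linarith
    also have "\<dots> = Kf * Cp * (3 * jacobian_const + 3) * n ^ 3"
      by (simp add: power2_eq_square power3_eq_cube algebra_simps)
    also have "\<dots> \<le> Kf * Cp * (9 * jacobian_const + 5) * n ^ 3"
      using Kf Cp jc n by (intro mult_right_mono mult_left_mono) auto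
    finally show ?thesis by (simp add: n_def)
  qed
  define c1 where "c1 = Kf * Cp * (9 * jacobian_const + 5)"
  define c2 where "c2 = (5/2) * (Kf * Cp)"
  define c3 where "c3 = Kf * Cp * (1 / r1\<^sup>2 + 3 / (2 * r1))"
  have c: "0 \<le> c1" "0 \<le> c2" "0 \<le> c3" using Kf Cp jc r1 by (auto simp: c1_def c2_def c3_def)
  have [measurable]: "ball (0::real^'d) r1 \<in> sets borel" by simp
  let ?T = "\<lambda>w. ennreal (c2 * (\<bar>K (norm (\<psi>c w - x) / h) - K (norm w / h)\<bar> * norm w)) * indicator (ball 0 r1) w"
  have [measurable]: "(\<lambda>w. norm (\<psi>c w - x)) \<in> borel_measurable borel"
    using measurable_comp[OF psic_measurable norm_measurable] by (simp add: o_def)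
  have "(\<integral>\<^sup>+ w. ennreal \<bar>N w - K (norm w / h) * P w\<bar> \<partial>lborel)
    \<le> (\<integral>\<^sup>+ w. ennreal (c1 * (measure \<nu> {(3/8) * norm w / h<..} * norm w ^ 3)) + (?T w + ennreal (c3 * (measure \<nu> {(1/2) * norm w / h<..} * norm w ^ 3))) \<partial>lborel)"
  proof (rule nn_integral_mono)
    fix w :: "real^'d"
    show "ennreal \<bar>N w - K (norm w / h) * P w\<bar> \<le> ennreal (c1 * (measure \<nu> {(3/8) * norm w / h<..} * norm w ^ 3)) + (?T w + ennreal (c3 * (measure \<nu> {(1/2) * norm w / h<..} * norm w ^ 3)))"
    proof (cases "w \<in> ball 0 r1")
      case w: True
      show ?thesis
      proof (cases "w = 0")
        case True
        have "P 0 = 0" using Pb[of 0] by simp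
        then show ?thesis using True w by (simp add: N_def G_def \<psi>c_def center)
      next
        case False
        have Nw: "N w = K (norm (\<psi> w - x) / h) * ((f (\<psi> w) - f x) * p (\<psi> w) * J w)"
          using w by (simp add: N_def G_def \<psi>c_def Jc_def mult_ac)
        \<comment> \<open>The cubic error \<open>R\<close> goes with the kernel at the true
          distance, for which a tail bound suffices; the polynomial \<open>P\<close> goes with the
          difference of kernels, which is left to \<open>perturbed_chart_integral\<close>.\<close>
        have "N w - K (norm w / h) * P w = K (norm (\<psi> w - x) / h) * R w + (K (norm (\<psi> w - x) / h) - K (norm w / h)) * P w"
          unfolding Nw R_def by (simp add: algebra_simps)
        then have "\<bar>N w - K (norm w / h) * P w\<bar> \<le> \<bar>K (norm (\<psi> w - x) / h)\<bar> * \<bar>R w\<bar> + \<bar>K (norm (\<psi> w - x) / h) - K (norm w / h)\<bar> * \<bar>P w\<bar>"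
          using abs_triangle_ineq by (simp add: abs_mult[symmetric])
        also have "\<dots> \<le> measure \<nu> {(3/8) * norm w / h<..} * (c1 * norm w ^ 3) + \<bar>K (norm (\<psi> w - x) / h) - K (norm w / h)\<bar> * (c2 * norm w)"
        proof (intro add_mono mult_mono kernel_chart_le[OF w False h])
          show "\<bar>R w\<bar> \<le> c1 * norm w ^ 3" using Rb[OF w] by (simp add: c1_def)
          have "norm w ^ 2 \<le> norm w" using w r1 power_decreasing[of 1 2 "norm w"] by simp
          then have "Kf * Cp * norm w ^ 2 \<le> Kf * Cp * norm w" using Kf Cp by (intro mult_left_mono) auto
          then show "\<bar>P w\<bar> \<le> c2 * norm w" using Pb[of w] unfolding c2_def by linarith
        qed auto
        also have "\<dots> = c1 * (measure \<nu> {(3/8) * norm w / h<..} * norm w ^ 3) + c2 * (\<bar>K (norm (\<psi>c w - x) / h) - K (norm w / h)\<bar> * norm w)"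
          using w by (simp add: \<psi>c_def)
        finally have "ennreal \<bar>N w - K (norm w / h) * P w\<bar> \<le> ennreal (c1 * (measure \<nu> {(3/8) * norm w / h<..} * norm w ^ 3) + c2 * (\<bar>K (norm (\<psi>c w - x) / h) - K (norm w / h)\<bar> * norm w))"
          by (rule ennreal_leI)
        also have "\<dots> = ennreal (c1 * (measure \<nu> {(3/8) * norm w / h<..} * norm w ^ 3)) + (?T w + 0)"
          using c w by (subst ennreal_plus) auto
        also have "\<dots> \<le> ennreal (c1 * (measure \<nu> {(3/8) * norm w / h<..} * norm w ^ 3)) + (?T w + ennreal (c3 * (measure \<nu> {(1/2) * norm w / h<..} * norm w ^ 3)))"
          by (intro add_left_mono) simp
        finally show ?thesis .
      qed
    next
      case w: False
      then have n: "r1 \<le> norm w" "w \<noteq> 0" using r1 by auto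
      have "N w = 0" using w by (simp add: N_def Jc_def)
      then have "\<bar>N w - K (norm w / h) * P w\<bar> = \<bar>K (norm w / h)\<bar> * \<bar>P w\<bar>" by (simp add: abs_mult)
      also have "\<dots> \<le> measure \<nu> {(1/2) * norm w / h<..} * (c3 * norm w ^ 3)"
      proof (intro mult_mono Ktail n)
        \<comment> \<open>Outside the ball, factors |w| / r1 \<ge> 1 raise both terms of
          \<open>P\<close> to order three, so that this part too is O(h^(d+3)).\<close>
        have r: "1 \<le> norm w / r1" using n r1 by (simp add: field_simps)
        have "norm w * 1 \<le> norm w * (norm w / r1) ^ 2" using one_le_power[OF r, of 2] by (intro mult_left_mono) auto
        then have q1: "norm w \<le> norm w * (norm w / r1) ^ 2" by (simp only: mult_1_right)
        have "norm w ^ 2 * 1 \<le> norm w ^ 2 * (norm w / r1)" using r by (intro mult_left_mono) auto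
        then have q2: "norm w ^ 2 \<le> norm w ^ 2 * (norm w / r1)" by (simp only: mult_1_right)
        have KC: "0 \<le> Kf * Cp" using Kf Cp by simp
        have "\<bar>P w\<bar> \<le> Kf * Cp * (norm w * (norm w / r1) ^ 2) + (3/2) * (Kf * Cp * (norm w ^ 2 * (norm w / r1)))"
          by (rule order_trans[OF Pb add_mono[OF mult_left_mono[OF q1 KC] mult_left_mono[OF mult_left_mono[OF q2 KC]]]]) simp
        also have "\<dots> = c3 * norm w ^ 3" using r1 by (simp add: c3_def power2_eq_square power3_eq_cube field_simps)
        finally show "\<bar>P w\<bar> \<le> c3 * norm w ^ 3" .
      qed auto
      also have "\<dots> = c3 * (measure \<nu> {(1/2) * norm w / h<..} * norm w ^ 3)" by simp
      finally have "ennreal \<bar>N w - K (norm w / h) * P w\<bar> \<le> ennreal (c3 * (measure \<nu> {(1/2) * norm w / h<..} * norm w ^ 3))" by (rule ennreal_leI)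
      then show ?thesis by (intro add_increasing zero_le)
    qed
  qed
  also have "\<dots> = (\<integral>\<^sup>+ w. ennreal (c1 * (measure \<nu> {(3/8) * norm w / h<..} * norm w ^ 3)) \<partial>(lborel :: (real^'d) measure))
     + ((\<integral>\<^sup>+ w. ?T w \<partial>lborel) + (\<integral>\<^sup>+ w. ennreal (c3 * (measure \<nu> {(1/2) * norm w / h<..} * norm w ^ 3)) \<partial>(lborel :: (real^'d) measure)))"
  proof -
    have m1: "(\<lambda>w :: real^'d. ennreal (c1 * (measure \<nu> {(3/8) * norm w / h<..} * norm w ^ 3))) \<in> borel_measurable lborel" by measurable
    have m2: "?T \<in> borel_measurable lborel" by measurable
    have m3: "(\<lambda>w :: real^'d. ennreal (c3 * (measure \<nu> {(1/2) * norm w / h<..} * norm w ^ 3))) \<in> borel_measurable lborel" by measurable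
    show ?thesis unfolding nn_integral_add[OF m1 borel_measurable_add[OF m2 m3]] nn_integral_add[OF m2 m3] ..
  qed
  also have "\<dots> \<le> ennreal (c1 * (?\<omega> * Mom * (h / (3/8)) ^ (CARD('d) + 3)))
     + (ennreal (c2 * (perturbation_const * h ^ (CARD('d) + 3))) + ennreal (c3 * (?\<omega> * Mom * (h / (1/2)) ^ (CARD('d) + 3))))"
  proof (intro add_mono tail c)
    have "(\<integral>\<^sup>+ w. ?T w \<partial>lborel) = ennreal c2 * (\<integral>\<^sup>+ w\<in>ball 0 r1. ennreal (\<bar>K (norm (\<psi>c w - x) / h) - K (norm w / h)\<bar> * norm w) \<partial>lborel)"
      using c by (subst nn_integral_cmult[symmetric]) (auto simp: ennreal_mult mult.assoc)
    also have "(\<integral>\<^sup>+ w\<in>ball 0 r1. ennreal (\<bar>K (norm (\<psi>c w - x) / h) - K (norm w / h)\<bar> * norm w) \<partial>lborel)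
      = (\<integral>\<^sup>+ w\<in>ball 0 r1. ennreal (\<bar>K (norm (\<psi> w - x) / h) - K (norm w / h)\<bar> * norm w) \<partial>lborel)"
      by (intro nn_integral_cong) (simp add: indicator_def \<psi>c_def)
    also have "ennreal c2 * \<dots> \<le> ennreal c2 * ennreal (perturbation_const * h ^ (CARD('d) + 3))"
      by (intro mult_left_mono perturbed_chart_integral[OF h]) simp
    also have "\<dots> = ennreal (c2 * (perturbation_const * h ^ (CARD('d) + 3)))"
      using c pc h by (intro ennreal_mult[symmetric]) auto
    finally show "(\<integral>\<^sup>+ w. ?T w \<partial>lborel) \<le> ennreal (c2 * (perturbation_const * h ^ (CARD('d) + 3)))" .
  qed auto
  also have "\<dots> = ennreal (c1 * (?\<omega> * Mom * (h / (3/8)) ^ (CARD('d) + 3))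
     + (c2 * (perturbation_const * h ^ (CARD('d) + 3)) + c3 * (?\<omega> * Mom * (h / (1/2)) ^ (CARD('d) + 3))))"
    using c pc h Mom0 by (subst ennreal_plus[symmetric], simp, simp, subst ennreal_plus[symmetric]) auto
  finally have nb: "(\<integral>\<^sup>+ w. ennreal \<bar>N w - K (norm w / h) * P w\<bar> \<partial>lborel) \<le> ennreal (c1 * (?\<omega> * Mom * (h / (3/8)) ^ (CARD('d) + 3))
     + (c2 * (perturbation_const * h ^ (CARD('d) + 3)) + c3 * (?\<omega> * Mom * (h / (1/2)) ^ (CARD('d) + 3))))" .
  have near_le: "\<bar>(\<integral>w. N w - K (norm w / h) * P w \<partial>lborel)\<bar> \<le> c1 * (?\<omega> * Mom * (h / (3/8)) ^ (CARD('d) + 3))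
     + (c2 * (perturbation_const * h ^ (CARD('d) + 3)) + c3 * (?\<omega> * Mom * (h / (1/2)) ^ (CARD('d) + 3)))"
    using c pc h Mom0 by (intro abs_integral_le[OF _ nb] Bochner_Integration.integrable_diff intN intP) auto
  have MS [measurable]: "M - S \<in> sets \<mu>" using sets.compl_sets[OF S_sets] by (simp add: space_\<mu>)
  \<comment> \<open>Off the chart |y - x| \<ge> r0, and the decay of \<open>K\<close> beyond r0 / h
    already supplies h^(d+3).\<close>
  define c4 where "c4 = 2 ^ (CARD('d) + 3) * Mom * (h / r0) ^ (CARD('d) + 3) * (2 * Kf)"
  have c4: "0 \<le> c4" using Mom0 Kf h r0 by (simp add: c4_def)
  have far_le: "\<bar>\<integral>y. indicator (M - S) y * G y \<partial>law\<bar> \<le> c4"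
  proof (rule abs_integral_le[OF intG[OF MS] _ c4])
    have "(\<integral>\<^sup>+ y. ennreal \<bar>indicator (M - S) y * G y\<bar> \<partial>law) \<le> (\<integral>\<^sup>+ y. ennreal c4 \<partial>law)"
    proof (rule nn_integral_mono)
      fix y assume "y \<in> space law"
      then have y: "y \<in> M" by (simp add: space_law)
      show "ennreal \<bar>indicator (M - S) y * G y\<bar> \<le> ennreal c4"
      proof (cases "y \<in> S")
        case False
        have ry: "r0 \<le> norm (y - x)" by (rule far[OF y False])
        have "\<bar>K (norm (y - x) / h)\<bar> \<le> 2 ^ (CARD('d) + 3) * Mom / (norm (y - x) / h) ^ (CARD('d) + 3)"
          by (intro K_decay divide_pos_pos h) (use ry r0 in linarith)
        also have "\<dots> \<le> 2 ^ (CARD('d) + 3) * Mom / (r0 / h) ^ (CARD('d) + 3)"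
        proof (intro divide_left_mono power_mono mult_pos_pos zero_less_power divide_right_mono divide_pos_pos)
          show "0 < norm (y - x)" using ry r0 by linarith
        qed (use ry r0 h Mom0 in auto)
        also have "\<dots> = 2 ^ (CARD('d) + 3) * Mom * (h / r0) ^ (CARD('d) + 3)" by (simp add: power_divide)
        finally have "\<bar>K (norm (y - x) / h)\<bar> \<le> 2 ^ (CARD('d) + 3) * Mom * (h / r0) ^ (CARD('d) + 3)" .
        moreover have "\<bar>f y - f x\<bar> \<le> 2 * Kf" using f_bound[OF y] f_bound[OF x_in_M] by linarith
        ultimately have "\<bar>G y\<bar> \<le> c4" unfolding G_def abs_mult c4_def using Mom0 h r0 by (intro mult_mono) auto
        then show ?thesis using False y by (simp add: ennreal_leI)
      qed simp
    qed
    also have "\<dots> = ennreal c4" by (simp add: L.emeasure_space_1)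
    finally show "(\<integral>\<^sup>+ y. ennreal \<bar>indicator (M - S) y * G y\<bar> \<partial>law) \<le> ennreal c4" .
  qed
  have "(\<integral>y. G y \<partial>law) = (\<integral>y. indicator S y * G y + indicator (M - S) y * G y \<partial>law)"
    by (intro Bochner_Integration.integral_cong refl) (auto simp: indicator_def space_law)
  also have "\<dots> = (\<integral>w. N w \<partial>lborel) + (\<integral>y. indicator (M - S) y * G y \<partial>law)"
    using intG[OF S_sets] intG[OF MS] near by (subst Bochner_Integration.integral_add) auto
  finally have split: "(\<integral>y. G y \<partial>law) - (\<integral>w. K (norm w / h) * P w \<partial>lborel)
     = (\<integral>w. N w - K (norm w / h) * P w \<partial>lborel) + (\<integral>y. indicator (M - S) y * G y \<partial>law)"
    using intN intP by (simp add: Bochner_Integration.integral_diff)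
  have "\<bar>(\<integral>y. G y \<partial>law) - (\<integral>w. K (norm w / h) * P w \<partial>lborel)\<bar> \<le> c1 * (?\<omega> * Mom * (h / (3/8)) ^ (CARD('d) + 3))
     + (c2 * (perturbation_const * h ^ (CARD('d) + 3)) + c3 * (?\<omega> * Mom * (h / (1/2)) ^ (CARD('d) + 3))) + c4"
    unfolding split using near_le far_le by linarith
  also have "\<dots> = bias_const Kf * h ^ (CARD('d) + 3)"
  proof -
    have "h / (3/8) = (8/3) * h" "h / (1/2) = 2 * h" "h / r0 = (1 / r0) * h" by simp_all
    then have e: "(h / (3/8)) ^ (CARD('d) + 3) = (8/3) ^ (CARD('d) + 3) * h ^ (CARD('d) + 3)"
      "(h / (1/2)) ^ (CARD('d) + 3) = 2 ^ (CARD('d) + 3) * h ^ (CARD('d) + 3)"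
      "(h / r0) ^ (CARD('d) + 3) = (1 / r0) ^ (CARD('d) + 3) * h ^ (CARD('d) + 3)"
      by (simp_all only: power_mult_distrib)
    show ?thesis unfolding bias_const_def c1_def[symmetric] c2_def c3_def[symmetric] c4_def e
      by (simp only: distrib_right distrib_left mult.assoc mult.commute mult.left_commute add.assoc add.commute add.left_commute)
  qed
  finally show ?thesis unfolding G_def P_def .
qed

end

section \<open>The limit operator in a chart, and estimates prepared for the random part\<close>

context law_kernel
begin

lemma integrable_kernel_power:
  assumes [measurable]: "u \<in> borel_measurable borel" and u: "\<And>w. \<bar>u w\<bar> \<le> c * norm w ^ j" and j: "1 \<le> j" "j \<le> 3" and c: "0 \<le> c"
  shows "integrable lborel (\<lambda>w :: real^'d. K (norm w) * u w)"
proof (rule integrable_of_nn_bound)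
  have "(\<integral>\<^sup>+ w. ennreal \<bar>K (norm w) * u w\<bar> \<partial>lborel)
    \<le> (\<integral>\<^sup>+ w. ennreal c * ennreal (measure \<nu> {(1/2) * norm w / 1<..} * norm w ^ j) \<partial>(lborel :: (real^'d) measure))"
  proof (rule nn_integral_mono)
    fix w :: "real^'d"
    have "\<bar>K (norm w) * u w\<bar> \<le> measure \<nu> {(1/2) * norm w / 1<..} * (c * norm w ^ j)"
    proof (cases "w = 0")
      case True
      then show ?thesis using u[of 0] j by (simp add: power_0_left)
    next
      case False
      then have "\<bar>K (norm w)\<bar> \<le> measure \<nu> {(1/2) * norm w / 1<..}" by (intro K_tail) auto
      then show ?thesis unfolding abs_mult using u[of w] by (intro mult_mono) auto
    qed
    also have "\<dots> = c * (measure \<nu> {(1/2) * norm w / 1<..} * norm w ^ j)" by simp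
    finally have "ennreal \<bar>K (norm w) * u w\<bar> \<le> ennreal (c * (measure \<nu> {(1/2) * norm w / 1<..} * norm w ^ j))" by (rule ennreal_leI)
    also have "\<dots> = ennreal c * ennreal (measure \<nu> {(1/2) * norm w / 1<..} * norm w ^ j)"
      using c by (intro ennreal_mult) auto
    finally show "ennreal \<bar>K (norm w) * u w\<bar> \<le> ennreal c * ennreal (measure \<nu> {(1/2) * norm w / 1<..} * norm w ^ j)" .
  qed
  also have "\<dots> = ennreal c * (\<integral>\<^sup>+ w. ennreal (measure \<nu> {(1/2) * norm w / 1<..} * norm w ^ j) \<partial>(lborel :: (real^'d) measure))"
    by (rule nn_integral_cmult) measurable
  also have "\<dots> \<le> ennreal c * ennreal (unit_ball_vol (real CARD('d)) * Mom * (1 / (1/2)) ^ (CARD('d) + j))"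
    using tail_integral[where 'a = "real^'d", of j "1/2" 1] j by (intro mult_left_mono) auto
  also have "\<dots> = ennreal (c * (unit_ball_vol (real CARD('d)) * Mom * (1 / (1/2)) ^ (CARD('d) + j)))"
    using c Mom_ge by (intro ennreal_mult[symmetric]) auto
  finally show "(\<integral>\<^sup>+ w. ennreal \<bar>K (norm w) * u w\<bar> \<partial>lborel) \<le> ennreal (c * (unit_ball_vol (real CARD('d)) * Mom * (1 / (1/2)) ^ (CARD('d) + j)))" .
qed measurable

text \<open>After scaling, the linear part is odd and integrates to 0, and the quadratic part
  contributes its trace. The trace of the product of a and g is the inner product of the gradients
  and that of s is the Laplacian, as the jets of the chart agree with the flat derivatives at its
  centre.\<close>

lemma limit_integral:
  fixes f :: "real^'m \<Rightarrow> real"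
  assumes h: "0 < h" and sub: "smooth_submanifold TYPE('d) M"
    and f: "Ck_manifold TYPE('d) 3 M f" and p: "Ck_manifold TYPE('d) 2 M p"
    and a: "linear a" "\<And>w. \<bar>a w\<bar> \<le> Kf * norm w"
    and s: "bilinear s" "\<And>w v. \<bar>s w v\<bar> \<le> Kf * norm w * norm v"
    and jet_f: "\<And>w. w \<in> ball 0 r1 \<Longrightarrow> \<bar>f (\<psi> w) - f x - a w - s w w / 2\<bar> \<le> Kf * norm w ^ 3"
    and g: "linear g" "\<And>w. \<bar>g w\<bar> \<le> Cp * norm w"
    and jet_p: "\<And>w. w \<in> ball 0 r1 \<Longrightarrow> \<bar>p (\<psi> w) - p x - g w\<bar> \<le> Cp * norm w ^ 2"
  shows "(\<integral>w. K (norm w / h) * (p x * a w + (p x * s w w / 2 + a w * g w)) \<partial>lborel)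
    = h ^ (CARD('d) + 2) * limit_operator TYPE('d) K M p f x"
proof -
  have Kf: "0 \<le> Kf"
    using a(2)[of "axis undefined 1"] by (simp add: norm_axis_1)
  define q where "q w v = p x * s w v / 2 + a w * g v" for w v
  have q: "bilinear q"
  proof -
    have s': "linear (s w)" "linear (\<lambda>w. s w v)" for w v using s(1) by (auto simp: bilinear_def)
    show ?thesis unfolding bilinear_def q_def[abs_def]
      using linear_add[OF a(1)] linear_cmul[OF a(1)] linear_add[OF g(1)] linear_cmul[OF g(1)]
        linear_add[OF s'(1)] linear_cmul[OF s'(1)] linear_add[OF s'(2)] linear_cmul[OF s'(2)]
      by (auto intro!: linearI simp: algebra_simps)
  qed
  have [measurable]: "a \<in> borel_measurable borel" "g \<in> borel_measurable borel" using a(1) g(1) by (auto intro: linear_borel_measurable)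
  have "continuous_on UNIV (\<lambda>w. q w w)"
    using q by (intro bounded_bilinear.continuous_on[of q] continuous_on_id) (simp add: bilinear_conv_bounded_bilinear)
  then have [measurable]: "(\<lambda>w. q w w) \<in> borel_measurable borel" by (rule borel_measurable_continuous_onI)
  have q_bound: "\<bar>q w w\<bar> \<le> (\<bar>p x\<bar> * Kf + Kf * Cp) * norm w ^ 2" for w
  proof -
    have "\<bar>p x * s w w\<bar> \<le> \<bar>p x\<bar> * (Kf * norm w * norm w)" unfolding abs_mult using s(2)[of w w] by (intro mult_left_mono) auto
    moreover have "0 \<le> \<bar>p x\<bar> * (Kf * norm w * norm w)" using Kf by simp
    moreover have "\<bar>a w * g w\<bar> \<le> (Kf * norm w) * (Cp * norm w)" unfolding abs_mult using a(2)[of w] g(2)[of w] Kf by (intro mult_mono) auto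
    ultimately have "\<bar>q w w\<bar> \<le> \<bar>p x\<bar> * (Kf * norm w * norm w) + (Kf * norm w) * (Cp * norm w)"
      unfolding q_def by linarith
    then show ?thesis by (simp add: power2_eq_square algebra_simps)
  qed
  have i1: "integrable lborel (\<lambda>w. K (norm w) * a w)"
    using a(2) Kf by (intro integrable_kernel_power[where c = Kf and j = 1]) auto
  have i2: "integrable lborel (\<lambda>w. K (norm w) * q w w)"
    using q_bound Kf Cp_nonneg by (intro integrable_kernel_power[where c = "\<bar>p x\<bar> * Kf + Kf * Cp" and j = 2]) auto
  have i3: "integrable lborel (\<lambda>w :: real^'d. K (norm w) * norm w ^ 2)"
    by (intro integrable_kernel_power[where c = 1 and j = 2]) auto
  have "(\<integral>w. K (norm w / h) * (p x * a w + (p x * s w w / 2 + a w * g w)) \<partial>lborel) = (\<integral>w. K (norm w / h) * (p x * a w + q w w) \<partial>lborel)"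
    by (simp add: q_def)
  also have "\<dots> = h ^ DIM(real^'d) * (\<integral>w. K (norm (h *\<^sub>R w) / h) * (p x * a (h *\<^sub>R w) + q (h *\<^sub>R w) (h *\<^sub>R w)) \<partial>lborel)"
    by (rule integral_lborel_scale[OF _ h]) measurable
  also have "(\<lambda>w. K (norm (h *\<^sub>R w) / h) * (p x * a (h *\<^sub>R w) + q (h *\<^sub>R w) (h *\<^sub>R w)))
    = (\<lambda>w. (h * p x) * (K (norm w) * a w) + h\<^sup>2 * (K (norm w) * q w w))"
    using h linear_cmul[OF a(1)] bilinear_lmul[OF q] bilinear_rmul[OF q]
    by (auto simp: fun_eq_iff power2_eq_square algebra_simps)
  also have "(\<integral>w. (h * p x) * (K (norm w) * a w) + h\<^sup>2 * (K (norm w) * q w w) \<partial>lborel)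
    = (h * p x) * (\<integral>w. K (norm w) * a w \<partial>lborel) + h\<^sup>2 * (\<integral>w. K (norm w) * q w w \<partial>lborel)"
    using i1 i2 by simp
  also have "(\<integral>w. K (norm w) * a w \<partial>lborel) = 0" by (rule radial_linear_integral[OF K_borel a(1)])
  also have "(\<integral>w. K (norm w) * q w w \<partial>lborel)
    = (\<Sum>b\<in>Basis. q b b) / DIM(real^'d) * (\<integral>w. K (norm (w :: real^'d)) * norm w ^ 2 \<partial>lborel)"
    by (rule radial_bilinear_integral[OF K_borel q i3])
  also have "\<dots> = kernel_constant TYPE('d) K * (\<Sum>b\<in>Basis. q b b)"
    by (simp add: kernel_constant_def)
  also have "(\<Sum>b\<in>Basis. q b b) = manifold_gradient M p x \<bullet> manifold_gradient M f x + 1/2 * p x * laplace_beltrami M f x"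
  proof -
    note f3 = f[unfolded numeral_3_eq_3] and p2 = p[unfolded numeral_2_eq_2]
    have jf: "\<bar>f (\<psi> w) - f (\<psi> 0) - a w - s w w / 2\<bar> \<le> Kf * norm w ^ 3" if "w \<in> ball 0 r1" for w
      using jet_f[OF that] by (simp add: center)
    have jet2: "frechet_derivative (\<lambda>w. f (\<psi> w)) (at 0) v = a v" "second_derivative (\<lambda>w. f (\<psi> w)) 0 v v = s v v" for v
      by (rule jet2_unique[OF Ck_pullback[OF f3] r1(1) a(1) s(1)], erule jf)+
    have jp: "\<bar>p (\<psi> w) - p (\<psi> 0) - g w\<bar> \<le> Cp * norm w ^ 2" if "w \<in> ball 0 r1" for w
      using jet_p[OF that] by (simp add: center)
    note jet1 = jet1_unique[OF Ck_pullback[OF p2] r1(1) g(1) jp]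
    have "manifold_gradient M p x \<bullet> manifold_gradient M f x = grad_at (\<lambda>w. p (\<psi> w)) 0 \<bullet> grad_at (\<lambda>w. f (\<psi> w)) 0"
      unfolding gradient_center[OF p2] gradient_center[OF f3] by (rule inner_of_norm_preserving[OF linE normE])
    also have "\<dots> = g (grad_at (\<lambda>w. f (\<psi> w)) 0)"
      using grad_at_inner[of "\<lambda>w. p (\<psi> w)" 0 "grad_at (\<lambda>w. f (\<psi> w)) 0"] g(1) jet1 by simp
    also have "\<dots> = (\<Sum>b\<in>Basis. a b * g b)"
      unfolding grad_at_def jet2(1) linear_sum[OF g(1)] linear_cmul[OF g(1)] by simp
    finally have "manifold_gradient M p x \<bullet> manifold_gradient M f x = (\<Sum>b\<in>Basis. a b * g b)" .
    moreover have "laplace_beltrami M f x = (\<Sum>b\<in>Basis. s b b)"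
      unfolding laplace_beltrami_center[OF sub f3] jet2(2) ..
    ultimately show ?thesis unfolding q_def by (simp add: sum.distrib sum_distrib_left sum_divide_distrib)
  qed
  finally show ?thesis by (simp only: limit_operator_def power_add mult_zero_right add_0 DIM_cart DIM_real mult_1_right mult.assoc)
qed

lemma chart_bias:
  fixes f :: "real^'m \<Rightarrow> real"
  assumes h: "0 < h" and sub: "smooth_submanifold TYPE('d) M" and fm: "f \<in> borel_measurable \<mu>"
    and f: "Ck_manifold TYPE('d) 3 M f" and p: "Ck_manifold TYPE('d) 2 M p"
    and jet_f: "jet2 r1 Kf (\<lambda>w. f (\<psi> w))" and jet_p: "jet1 r1 Cp (\<lambda>w. p (\<psi> w))"
    and f_bound: "\<And>y. y \<in> M \<Longrightarrow> \<bar>f y\<bar> \<le> Kf"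
  shows "\<bar>(\<integral>y. K (norm (x - y) / h) * (f y - f x) \<partial>law) - h ^ (CARD('d) + 2) * limit_operator TYPE('d) K M p f x\<bar>
    \<le> bias_const Kf * h ^ (CARD('d) + 3)"
proof -
  obtain a s where a: "linear a" "\<And>w. \<bar>a w\<bar> \<le> Kf * norm w"
    and s: "bilinear s" "\<And>w v. \<bar>s w v\<bar> \<le> Kf * norm w * norm v"
    and jf: "\<And>w. w \<in> ball 0 r1 \<Longrightarrow> \<bar>f (\<psi> w) - f x - a w - s w w / 2\<bar> \<le> Kf * norm w ^ 3"
    using jet_f unfolding jet2_def center by blast
  obtain g where g: "linear g" "\<And>w. \<bar>g w\<bar> \<le> Cp * norm w"
    and jp: "\<And>w. w \<in> ball 0 r1 \<Longrightarrow> \<bar>p (\<psi> w) - p x - g w\<bar> \<le> Cp * norm w ^ 2"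
    using jet_p unfolding jet1_def center by blast
  show ?thesis
    using near_bias[OF h fm a s jf g jp f_bound] limit_integral[OF h sub f p a s jf g jp]
    by (simp add: norm_minus_commute)
qed

text \<open>The chart coordinate of \<open>y\<close> agrees with the projection \<open>adjoint E (y - x)\<close> up to third order.\<close>

lemma ambient_jet:
  fixes f :: "real^'m \<Rightarrow> real"
  assumes jet_f: "jet2 r1 Kf (\<lambda>w. f (\<psi> w))" and f_bound: "\<And>y. y \<in> M \<Longrightarrow> \<bar>f y\<bar> \<le> Kf"
    and diam: "\<And>y. y \<in> M \<Longrightarrow> norm (y - x) \<le> D"
  shows "\<exists>a s. linear a \<and> bilinear s \<and> (\<forall>z. \<bar>a z\<bar> \<le> Kf * norm z) \<and> (\<forall>z v. \<bar>s z v\<bar> \<le> Kf * norm z * norm v) \<and>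
    (\<forall>y\<in>M. \<bar>f y - f x - a (y - x) - s (y - x) (y - x)\<bar> \<le> (Kf * (8 + 8 * C) + (2 * Kf + Kf * D + Kf * D\<^sup>2) / r0 ^ 3) * norm (y - x) ^ 3)"
proof -
  obtain a s where a: "linear a" "\<And>w. \<bar>a w\<bar> \<le> Kf * norm w"
    and s: "bilinear s" "\<And>w v. \<bar>s w v\<bar> \<le> Kf * norm w * norm v"
    and jf: "\<And>w. w \<in> ball 0 r1 \<Longrightarrow> \<bar>f (\<psi> w) - f x - a w - s w w / 2\<bar> \<le> Kf * norm w ^ 3"
    using jet_f unfolding jet2_def center by blast
  have Kf: "0 \<le> Kf" using f_bound[OF x_in_M] by linarith
  have D: "0 \<le> D" using diam[OF x_in_M] by simp
  have linA: "linear (adjoint E)" by (rule adjoint_linear[OF linE])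
  define a' where "a' z = a (adjoint E z)" for z
  \<comment> \<open>The factor 1/2 of the chart expansion is absorbed here; the ambient expansion is
    written without it.\<close>
  define s' where "s' z v = s (adjoint E z) (adjoint E v) / 2" for z v
  have a'l: "linear a'" unfolding a'_def[abs_def] using linear_compose[OF linA a(1)] by (simp add: o_def)
  have s'b: "bilinear s'" unfolding s'_def[abs_def] bilinear_def
    using bilinear_ladd[OF s(1)] bilinear_radd[OF s(1)] bilinear_lmul[OF s(1)] bilinear_rmul[OF s(1)]
      linear_add[OF linA] linear_cmul[OF linA] by (auto intro!: linearI simp: field_simps)
  have nA: "norm (adjoint E z) \<le> norm z" for z by (rule norm_adjoint_isometry_le[OF linE normE])
  have a'b: "\<bar>a' z\<bar> \<le> Kf * norm z" for z
    unfolding a'_def by (rule order_trans[OF a(2) mult_left_mono[OF nA Kf]])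
  have s'b0: "\<bar>s' z v\<bar> \<le> Kf * norm z * norm v" for z v
  proof -
    have "\<bar>s (adjoint E z) (adjoint E v)\<bar> \<le> Kf * norm z * norm v"
      using Kf nA by (intro order_trans[OF s(2)] mult_mono) auto
    then show ?thesis unfolding s'_def by simp
  qed
  have near: "\<bar>f y - f x - a' (y - x) - s' (y - x) (y - x)\<bar> \<le> Kf * (8 + 8 * C) * norm (y - x) ^ 3"
    if yS: "y \<in> S" for y
  proof -
    obtain w where w: "w \<in> ball 0 r1" "y = \<psi> w" using yS unfolding S_def by blast
    define z where "z = y - x"
    define e where "e = w - adjoint E z"
    have e: "norm e \<le> C * norm w ^ 3" using adjoint_expansion[OF w(1)] by (simp add: e_def z_def w(2))
    have nw: "norm w \<le> 1" using w r1 by simp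
    have we: "adjoint E z = w - e" by (simp add: e_def)
    have e2: "norm e \<le> norm w / 16"
    proof -
      have "C * norm w ^ 3 = (C * norm w) * norm w ^ 2" by (simp add: power3_eq_cube power2_eq_square)
      also have "\<dots> \<le> (1/16) * norm w"
        using Cw(1)[OF w(1)] nw power_decreasing[of 1 2 "norm w"] by (intro mult_mono) auto
      finally show ?thesis using e by simp
    qed
    have "f y - f x - a' z - s' z z = (f (\<psi> w) - f x - a w - s w w / 2) + a e + (s w e / 2 + s e w / 2 - s e e / 2)"
      unfolding a'_def s'_def we w(2)[symmetric]
      by (simp add: linear_diff[OF a(1)] bilinear_lsub[OF s(1)] bilinear_rsub[OF s(1)] field_simps)
    then have "\<bar>f y - f x - a' z - s' z z\<bar> \<le> Kf * norm w ^ 3 + Kf * norm e + (Kf * norm w * norm e / 2 + Kf * norm e * norm w / 2 + Kf * norm e * norm e / 2)"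
      using jf[OF w(1)] a(2)[of e] s(2)[of w e] s(2)[of e w] s(2)[of e e] by linarith
    also have "\<dots> \<le> Kf * norm w ^ 3 + 3 * (Kf * norm e)"
    proof -
      have 1: "Kf * norm e * norm w \<le> Kf * norm e * 1" using Kf nw by (intro mult_left_mono) auto
      have 2: "Kf * norm e * norm e \<le> Kf * norm e * 1" using Kf e2 nw by (intro mult_left_mono) auto
      have 3: "Kf * norm w * norm e = Kf * norm e * norm w" by simp
      have 4: "0 \<le> Kf * norm e" using Kf by simp
      have "A + k + (u / 2 + u / 2 + t / 2) \<le> A + 3 * k" if "u \<le> k * 1" "t \<le> k * 1" "0 \<le> k" for A k u t :: real
        using that by linarith
      from this[OF 1 2 4] show ?thesis unfolding 3 .
    qed
    also have "\<dots> \<le> Kf * norm w ^ 3 + 3 * (Kf * (C * norm w ^ 3))"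
      using e Kf by (intro add_left_mono mult_left_mono) auto
    also have "\<dots> = Kf * (1 + 3 * C) * norm w ^ 3" by (simp add: algebra_simps)
    also have "\<dots> \<le> Kf * (1 + 3 * C) * ((4/3) * norm z) ^ 3"
      using Kf C norm_bounds(1)[OF w(1)] by (intro mult_left_mono power_mono) (auto simp: z_def w(2))
    also have "\<dots> = Kf * ((64/27) * (1 + 3 * C)) * norm z ^ 3" by (simp add: power_mult_distrib power_divide)
    also have "\<dots> \<le> Kf * (8 + 8 * C) * norm z ^ 3" using Kf C by (intro mult_right_mono mult_left_mono) auto
    finally show ?thesis by (simp add: z_def)
  qed
  \<comment> \<open>A crude bound for the whole difference off the chart, where |y - x|^3 / r0^3 is
    at least 1.\<close>
  define c where "c = 2 * Kf + Kf * D + Kf * D\<^sup>2"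
  have c: "0 \<le> c" using Kf D by (simp add: c_def)
  have "\<bar>f y - f x - a' (y - x) - s' (y - x) (y - x)\<bar> \<le> (Kf * (8 + 8 * C) + c / r0 ^ 3) * norm (y - x) ^ 3" if y: "y \<in> M" for y
  proof (cases "y \<in> S")
    case True
    have "0 \<le> c / r0 ^ 3 * norm (y - x) ^ 3" using c r0 by simp
    then show ?thesis using near[OF True] by (simp only: distrib_right; linarith)
  next
    case False
    have r: "r0 \<le> norm (y - x)" by (rule far[OF y False])
    have n: "norm (y - x) \<le> D" by (rule diam[OF y])
    have 1: "\<bar>a' (y - x)\<bar> \<le> Kf * D" by (rule order_trans[OF a'b mult_left_mono[OF n Kf]])
    have 2: "\<bar>s' (y - x) (y - x)\<bar> \<le> Kf * D\<^sup>2"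
      unfolding power2_eq_square mult.assoc[symmetric] using n Kf D by (intro order_trans[OF s'b0] mult_mono) auto
    have "\<bar>fy - fx - \<alpha> - \<beta>\<bar> \<le> (2 * k + k1 + k2) * 1"
      if "\<bar>fy\<bar> \<le> k" "\<bar>fx\<bar> \<le> k" "\<bar>\<alpha>\<bar> \<le> k1" "\<bar>\<beta>\<bar> \<le> k2" for fy fx \<alpha> \<beta> k k1 k2 :: real
      using that by (simp add: abs_le_iff)
    from this[OF f_bound[OF y] f_bound[OF x_in_M] 1 2]
    have "\<bar>f y - f x - a' (y - x) - s' (y - x) (y - x)\<bar> \<le> c * 1" unfolding c_def .
    also have "\<dots> \<le> c * (norm (y - x) ^ 3 / r0 ^ 3)"
      using c power_mono[OF r, of 3] r0 by (intro mult_left_mono) auto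
    also have "\<dots> = c / r0 ^ 3 * norm (y - x) ^ 3" by simp
    finally have "\<bar>f y - f x - a' (y - x) - s' (y - x) (y - x)\<bar> \<le> c / r0 ^ 3 * norm (y - x) ^ 3" .
    moreover have "0 \<le> Kf * (8 + 8 * C) * norm (y - x) ^ 3" using Kf C by simp
    ultimately show ?thesis by (simp only: distrib_right; linarith)
  qed
  then show ?thesis using a'l s'b a'b s'b0 unfolding c_def by blast
qed

text \<open>Off the chart the decay of \<open>K\<close> gives h^(d+3) over a power of |y - x|, with
  |y - x| \<ge> r0. The conditions h \<le> 1 and r0 \<le> 1 allow the exponents to be adjusted to
  one bound for all j.\<close>

lemma tail_law_total:
  assumes j: "1 \<le> j" "j \<le> 3" and h: "0 < h" "h \<le> 1" and r: "r0 \<le> 1"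
  shows "(\<integral>\<^sup>+ y. ennreal (\<bar>K (norm (x - y) / h)\<bar> * norm (y - x) ^ j) \<partial>law)
    \<le> ennreal (((1 + det_bound TYPE('d)) * Cp * (2 * (unit_ball_vol (real CARD('d)) * Mom * (8/3) ^ (CARD('d) + 3)))
        + 2 ^ (CARD('d) + 3) * Mom / r0 ^ (CARD('d) + 3)) * h ^ (CARD('d) + j))"
proof -
  interpret L: prob_space law by (rule prob_space_law)
  have MS [measurable]: "M - S \<in> sets \<mu>" using sets.compl_sets[OF S_sets] by (simp add: space_\<mu>)
  let ?g = "\<lambda>y. ennreal (\<bar>K (norm (y - x) / h)\<bar> * norm (y - x) ^ j)"
  define c where "c = 2 ^ (CARD('d) + 3) * Mom / r0 ^ (CARD('d) + 3) * h ^ (CARD('d) + j)"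
  have c: "0 \<le> c" using Mom_ge r0 h by (simp add: c_def)
  have far': "?g y \<le> ennreal c" if y: "y \<in> M" "y \<notin> S" for y
  proof (rule ennreal_leI)
    define n where "n = norm (y - x)"
    have n: "r0 \<le> n" using far[OF y] by (simp add: n_def)
    have n0: "0 < n" using n r0 by linarith
    have "\<bar>K (n / h)\<bar> * n ^ j \<le> 2 ^ (CARD('d) + 3) * Mom / (n / h) ^ (CARD('d) + 3) * n ^ j"
      using n0 h by (intro mult_right_mono K_decay divide_pos_pos) auto
    also have "\<dots> = 2 ^ (CARD('d) + 3) * Mom * h ^ (CARD('d) + 3) / n ^ (CARD('d) + (3 - j))"
    proof -
      have "n ^ (CARD('d) + 3) = n ^ (CARD('d) + (3 - j)) * n ^ j" using j by (simp flip: power_add)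
      then show ?thesis using n0 by (simp add: power_divide)
    qed
    also have "\<dots> \<le> 2 ^ (CARD('d) + 3) * Mom * h ^ (CARD('d) + j) / r0 ^ (CARD('d) + 3)"
    proof (rule frac_le)
      show "2 ^ (CARD('d) + 3) * Mom * h ^ (CARD('d) + 3) \<le> 2 ^ (CARD('d) + 3) * Mom * h ^ (CARD('d) + j)"
        using j h Mom_ge by (intro mult_left_mono power_decreasing) auto
      have "r0 ^ (CARD('d) + 3) \<le> r0 ^ (CARD('d) + (3 - j))" using r r0 by (intro power_decreasing) auto
      also have "\<dots> \<le> n ^ (CARD('d) + (3 - j))" using n r0 by (intro power_mono) auto
      finally show "r0 ^ (CARD('d) + 3) \<le> n ^ (CARD('d) + (3 - j))" .
    qed (use r0 h Mom_ge in auto)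
    finally show "\<bar>K (norm (y - x) / h)\<bar> * norm (y - x) ^ j \<le> c" by (simp add: c_def n_def)
  qed
  have "(\<integral>\<^sup>+ y. ennreal (\<bar>K (norm (x - y) / h)\<bar> * norm (y - x) ^ j) \<partial>law) \<le> (\<integral>\<^sup>+ y. ?g y * indicator S y + ennreal c \<partial>law)"
    using far' by (intro nn_integral_mono) (auto simp: space_law indicator_def norm_minus_commute[of x])
  also have "\<dots> = (\<integral>\<^sup>+ y. ?g y * indicator S y \<partial>law) + ennreal c"
    by (subst nn_integral_add) (auto simp: L.emeasure_space_1)
  also have "\<dots> \<le> ennreal ((1 + det_bound TYPE('d)) * Cp * (2 * (unit_ball_vol (real CARD('d)) * Mom * (8/3) ^ (CARD('d) + 3))) * h ^ (CARD('d) + j)) + ennreal c"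
    by (intro add_right_mono tail_law j h)
  also have "\<dots> = ennreal ((1 + det_bound TYPE('d)) * Cp * (2 * (unit_ball_vol (real CARD('d)) * Mom * (8/3) ^ (CARD('d) + 3))) * h ^ (CARD('d) + j) + c)"
    using c Mom_ge h Cp_nonneg det_bound(1)[where 'd = 'd] by (intro ennreal_plus[symmetric]) auto
  finally show ?thesis by (simp only: c_def distrib_right)
qed

end

section \<open>Uniformity over the manifold\<close>

lemma jet1_mono: "jet1 r K F \<Longrightarrow> K \<le> K' \<Longrightarrow> jet1 r K' F"
  unfolding jet1_def by (meson mult_right_mono norm_ge_zero order_trans zero_le_power)

lemma jet2_mono: "jet2 r K F \<Longrightarrow> K \<le> K' \<Longrightarrow> jet2 r K' F"
proof -
  assume J: "jet2 r K F" and K: "K \<le> K'"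
  then obtain a s where *: "\<bar>F 0\<bar> \<le> K" "linear a" "bilinear s" "\<And>w. \<bar>a w\<bar> \<le> K * norm w"
    "\<And>w v. \<bar>s w v\<bar> \<le> K * norm w * norm v" "\<And>w. w \<in> ball 0 r \<Longrightarrow> \<bar>F w - F 0 - a w - s w w / 2\<bar> \<le> K * norm w ^ 3"
    unfolding jet2_def by blast
  have "K * norm w \<le> K' * norm w" "K * norm w ^ 3 \<le> K' * norm w ^ 3" "K * norm w * norm v \<le> K' * norm w * norm v" for w v :: 'a
    using K by (auto intro!: mult_right_mono)
  then have "\<bar>F 0\<bar> \<le> K'" "\<And>w. \<bar>a w\<bar> \<le> K' * norm w"
    "\<And>w v. \<bar>s w v\<bar> \<le> K' * norm w * norm v" "\<And>w. w \<in> ball 0 r \<Longrightarrow> \<bar>F w - F 0 - a w - s w w / 2\<bar> \<le> K' * norm w ^ 3"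
    using * K by (meson order_trans)+
  then show ?thesis using *(2,3) unfolding jet2_def by blast
qed

locale sampled_manifold = kernel_bound K \<nu> "CARD('d)"
  for D :: "'d::finite itself" and K :: "real \<Rightarrow> real" and \<nu> :: "real measure" +
  fixes M :: "(real^'m) set" and \<mu> :: "(real^'m) measure" and p :: "real^'m \<Rightarrow> real"
  assumes compact_M: "compact M" and submanifold: "smooth_submanifold TYPE('d) M"
    and volume: "riemannian_volume TYPE('d) M \<mu>"
    and p_C2: "Ck_manifold TYPE('d) 2 M p"
    and p_nonneg: "\<And>y. y \<in> M \<Longrightarrow> 0 \<le> p y"
    and p_mass: "(\<integral>\<^sup>+ x. ennreal (p x) \<partial>\<mu>) = 1"
begin

lemma sets_\<mu>: "sets \<mu> = sets (restrict_space borel M)"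
  using volume by (simp add: riemannian_volume_def)

lemma space_\<mu>: "space \<mu> = M"
  using sets_eq_imp_space_eq[OF sets_\<mu>] by (simp add: space_restrict_space)

lemma borel_to_\<mu>: "f \<in> borel_measurable borel \<Longrightarrow> f \<in> borel_measurable \<mu>"
  using measurable_restrict_space1[of f borel borel M] measurable_cong_sets[OF sets_\<mu> refl] by blast

lemma Ck_continuous:
  assumes "Ck_manifold TYPE('d) (Suc k) M f"
  shows "continuous_on M f"
  unfolding continuous_on_eq_continuous_within
proof
  fix x assume "x \<in> M"
  then obtain r0 r1 C and \<psi> :: "real^'d \<Rightarrow> real^'m" and E B where "normal_chart M r0 r1 C x \<psi> E B"
    using normal_chart_exists[OF submanifold] by blast
  then interpret normal_chart M r0 r1 C x \<psi> E B .
  show "continuous (at x within M) f" using derivative_within[OF assms] by (rule has_derivative_continuous)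
qed

lemma Ck_measurable: "Ck_manifold TYPE('d) (Suc k) M f \<Longrightarrow> f \<in> borel_measurable \<mu>"
  using borel_measurable_continuous_on_restrict[OF Ck_continuous] measurable_cong_sets[OF sets_\<mu> refl] by blast

lemma Ck_bounded: "Ck_manifold TYPE('d) (Suc k) M f \<Longrightarrow> \<exists>c. \<forall>y\<in>M. \<bar>f y\<bar> \<le> c"
  using compact_imp_bounded[OF compact_continuous_image[OF Ck_continuous compact_M]]
  by (auto simp: bounded_iff)

lemma p_measurable [measurable]: "p \<in> borel_measurable \<mu>"
  using Ck_measurable p_C2 by (simp add: numeral_2_eq_2)

definition L :: "(real^'m) measure" where "L = density \<mu> (\<lambda>y. ennreal (p y))"

lemma space_L: "space L = M" and sets_L [measurable_cong]: "sets L = sets \<mu>"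
  by (simp_all add: L_def space_\<mu>)

sublocale prob_space L
proof
  have "emeasure L (space L) = (\<integral>\<^sup>+ y. ennreal (p y) * indicator (space \<mu>) y \<partial>\<mu>)"
    by (simp add: L_def emeasure_density)
  also have "\<dots> = (\<integral>\<^sup>+ y. ennreal (p y) \<partial>\<mu>)" by (rule nn_integral_cong) simp
  finally show "emeasure L (space L) = 1" using p_mass by simp
qed

lemma M_nonempty: "M \<noteq> {}" using not_empty by (simp add: space_L)

text \<open>The bounds are merged: \<open>Cp\<close> is both a jet constant and an upper bound of
  \<open>p\<close>, and \<open>Kf\<close> likewise for \<open>f\<close>. Shrinking \<open>r0\<close>
  to at most 1 only weakens \<open>cover\<close>.\<close>

lemma patch:
  assumes x: "x \<in> M"
  shows "\<exists>N r0 r1 C Cp (\<Psi> :: real^'m \<Rightarrow> real^'d \<Rightarrow> real^'m). open N \<and> x \<in> N \<and> 0 < r0 \<and> r0 \<le> 1 \<and>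
    (\<forall>y\<in>M \<inter> N. \<exists>E B. law_kernel M r0 r1 C y (\<Psi> y) E B \<mu> p Cp K \<nu>) \<and>
    (\<forall>y\<in>M \<inter> N. jet1 r1 Cp (\<lambda>w. p (\<Psi> y w))) \<and>
    (\<forall>f. Ck_manifold TYPE('d) 3 M f \<longrightarrow> (\<exists>Kf. (\<forall>y\<in>M \<inter> N. jet2 r1 Kf (\<lambda>w. f (\<Psi> y w))) \<and> (\<forall>y\<in>M. \<bar>f y\<bar> \<le> Kf)))"
proof -
  from normal_charts_patch[OF submanifold x] obtain N r0 r1 C and \<Psi> :: "real^'m \<Rightarrow> real^'d \<Rightarrow> real^'m"
    where N: "open N" "x \<in> N" and ch: "\<forall>y\<in>M \<inter> N. \<exists>E B. normal_chart M r0 r1 C y (\<Psi> y) E B"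
    and j2: "\<forall>f. Ck_manifold TYPE('d) 3 M f \<longrightarrow> (\<exists>K. \<forall>y\<in>M \<inter> N. jet2 r1 K (\<lambda>w. f (\<Psi> y w)))"
    and j1: "\<forall>f. Ck_manifold TYPE('d) 2 M f \<longrightarrow> (\<exists>K. \<forall>y\<in>M \<inter> N. jet1 r1 K (\<lambda>w. f (\<Psi> y w)))"
    by (elim exE conjE) (rule that)
  obtain c1 where c1: "\<forall>y\<in>M \<inter> N. jet1 r1 c1 (\<lambda>w. p (\<Psi> y w))" using j1 p_C2 by blast
  obtain c2 where c2: "\<forall>y\<in>M. \<bar>p y\<bar> \<le> c2" using Ck_bounded[OF p_C2[unfolded numeral_2_eq_2]] by blast
  define Cp where "Cp = max c1 c2"
  define r0' where "r0' = min r0 1"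
  have r: "0 < r0" using ch N(2) x by (auto simp: normal_chart_def)
  have j: "jet1 r1 Cp (\<lambda>w. p (\<Psi> y w))" if "y \<in> M \<inter> N" for y
    by (rule jet1_mono[of _ c1]) (use c1 that in \<open>auto simp: Cp_def\<close>)
  have lk: "\<exists>E B. law_kernel M r0' r1 C y (\<Psi> y) E B \<mu> p Cp K \<nu>" if y: "y \<in> M \<inter> N" for y
  proof -
    obtain E B where nc: "normal_chart M r0 r1 C y (\<Psi> y) E B" using ch y by blast
    interpret n: normal_chart M r0 r1 C y "\<Psi> y" E B by (rule nc)
    have nc': "normal_chart M r0' r1 C y (\<Psi> y) E B"
    proof (rule normal_chart.intro)
      show "0 < r0'" using r by (simp add: r0'_def)
      have "M \<inter> ball y r0' \<subseteq> M \<inter> ball y r0" by (auto simp: r0'_def)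
      then show "M \<inter> ball y r0' \<subseteq> \<Psi> y ` ball 0 r1" using n.cover by blast
    qed (fact n.r1 n.C n.param n.center n.linE n.normE n.bilB n.normalB n.B_bound n.derivative_expansion)+
    have "law_kernel M r0' r1 C y (\<Psi> y) E B \<mu> p Cp K \<nu>"
    proof (intro law_kernel.intro law_chart.intro law_chart_axioms.intro nc' volume p_measurable p_nonneg p_mass)
      show "p (\<Psi> y w) \<le> Cp" if "w \<in> ball 0 r1" for w
      proof -
        have "p (\<Psi> y w) \<le> c2" using c2 n.psi_in_M[OF that] by fastforce
        then show ?thesis by (simp add: Cp_def)
      qed
    qed (assumption | rule kernel_bound_axioms)+
    then show ?thesis by blast
  qed
  have jf: "\<exists>Kf. (\<forall>y\<in>M \<inter> N. jet2 r1 Kf (\<lambda>w. f (\<Psi> y w))) \<and> (\<forall>y\<in>M. \<bar>f y\<bar> \<le> Kf)" if f: "Ck_manifold TYPE('d) 3 M f" for f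
  proof -
    obtain k1 where k1: "\<forall>y\<in>M \<inter> N. jet2 r1 k1 (\<lambda>w. f (\<Psi> y w))" using j2 f by blast
    obtain k2 where k2: "\<forall>y\<in>M. \<bar>f y\<bar> \<le> k2" using Ck_bounded[OF f[unfolded numeral_3_eq_3]] by blast
    have "jet2 r1 (max k1 k2) (\<lambda>w. f (\<Psi> y w))" if "y \<in> M \<inter> N" for y
      by (rule jet2_mono[of _ k1]) (use k1 that in auto)
    moreover have "\<bar>f y\<bar> \<le> max k1 k2" if "y \<in> M" for y using k2 that by (auto simp: le_max_iff_disj)
    ultimately show ?thesis by blast
  qed
  have r': "0 < r0'" "r0' \<le> 1" using r by (auto simp: r0'_def)
  show ?thesis
    by (rule exI[of _ N], rule exI[of _ r0'], rule exI[of _ r1], rule exI[of _ C], rule exI[of _ Cp], rule exI[of _ \<Psi>])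
      (intro conjI ballI allI impI N r' lk j jf)
qed

lemma law_eq:
  fixes \<psi> :: "real^'d \<Rightarrow> real^'m"
  assumes "law_kernel M r0 r1 C y \<psi> E B \<mu> p Cp K \<nu>"
  shows "law_chart.law \<mu> p = L"
proof -
  interpret law_kernel M r0 r1 C y \<psi> E B \<mu> p Cp K \<nu> by (rule assms)
  show ?thesis by (simp add: law_def L_def)
qed

text \<open>The common scheme of the next four lemmas. On a patch the numbers \<open>r0\<close>,
  \<open>r1\<close>, \<open>C\<close>, \<open>Cp\<close> are the same for all centres, while the
  chart, \<open>E\<close> and \<open>B\<close> vary; hence an estimate whose constant involves only
  those numbers is already locally uniform.\<close>

lemma uniform_constant:
  fixes P :: "real^'m \<Rightarrow> real \<Rightarrow> bool"
  assumes mono: "\<And>y c c'. P y c \<Longrightarrow> c \<le> c' \<Longrightarrow> P y c'"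
    and loc: "\<And>N r0 r1 C Cp \<Psi>. 0 < r0 \<Longrightarrow> r0 \<le> 1 \<Longrightarrow>
      (\<And>y. y \<in> M \<inter> N \<Longrightarrow> \<exists>E B. law_kernel M r0 r1 C y (\<Psi> y :: real^'d \<Rightarrow> real^'m) E B \<mu> p Cp K \<nu>) \<Longrightarrow>
      (\<And>y. y \<in> M \<inter> N \<Longrightarrow> jet1 r1 Cp (\<lambda>w. p (\<Psi> y w))) \<Longrightarrow>
      (\<And>f. Ck_manifold TYPE('d) 3 M f \<Longrightarrow> \<exists>Kf. (\<forall>y\<in>M \<inter> N. jet2 r1 Kf (\<lambda>w. f (\<Psi> y w))) \<and> (\<forall>y\<in>M. \<bar>f y\<bar> \<le> Kf)) \<Longrightarrow>
      \<exists>c. \<forall>y\<in>M \<inter> N. P y c"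
  shows "\<exists>c\<ge>0. \<forall>y\<in>M. P y c"
proof -
  have "\<exists>c. \<forall>y\<in>M. P y c"
  proof (rule compact_uniform_constant[OF compact_M])
    show "P y c \<Longrightarrow> c \<le> c' \<Longrightarrow> P y c'" for y c c' by (rule mono)
    fix x assume x: "x \<in> M"
    from patch[OF x] show "\<exists>N c. open N \<and> x \<in> N \<and> (\<forall>y\<in>M \<inter> N. P y c)"
    proof (elim exE conjE)
      fix N r0 r1 C Cp and \<Psi> :: "real^'m \<Rightarrow> real^'d \<Rightarrow> real^'m"
      assume N: "open N" "x \<in> N" and r: "0 < r0" "r0 \<le> 1"
        and lk: "\<forall>y\<in>M \<inter> N. \<exists>E B. law_kernel M r0 r1 C y (\<Psi> y) E B \<mu> p Cp K \<nu>"
        and j: "\<forall>y\<in>M \<inter> N. jet1 r1 Cp (\<lambda>w. p (\<Psi> y w))"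
        and jf: "\<forall>f. Ck_manifold TYPE('d) 3 M f \<longrightarrow> (\<exists>Kf. (\<forall>y\<in>M \<inter> N. jet2 r1 Kf (\<lambda>w. f (\<Psi> y w))) \<and> (\<forall>y\<in>M. \<bar>f y\<bar> \<le> Kf))"
      have "\<exists>c. \<forall>y\<in>M \<inter> N. P y c"
        by (rule loc[OF r, of N r1 C \<Psi> Cp]; rule bspec[OF lk] bspec[OF j] jf[rule_format])
      then show ?thesis using N by blast
    qed
  qed
  then obtain c where "\<forall>y\<in>M. P y c" by blast
  then have "\<forall>y\<in>M. P y (max c 0)" using mono by (meson max.cobounded1)
  then show ?thesis by (intro exI[of _ "max c 0"]) simp
qed

lemma tail_uniform:
  "\<exists>c\<ge>0. \<forall>x\<in>M. \<forall>h j. 0 < h \<longrightarrow> h \<le> 1 \<longrightarrow> 1 \<le> j \<longrightarrow> j \<le> 3 \<longrightarrow>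
    (\<integral>\<^sup>+ y. ennreal (\<bar>K (norm (x - y) / h)\<bar> * norm (y - x) ^ j) \<partial>L) \<le> ennreal (c * h ^ (CARD('d) + j))"
proof (rule uniform_constant, goal_cases)
  case (1 y c c')
  have "ennreal (c * h ^ (CARD('d) + j)) \<le> ennreal (c' * h ^ (CARD('d) + j))" if "0 < h" for h j
    using that 1(2) by (intro ennreal_leI mult_right_mono) auto
  then show ?case using 1(1) order_trans by blast
next
  case (2 N r0 r1 C Cp \<Psi>)
  show ?case
  proof (intro exI ballI allI impI)
    fix x and h :: real and j :: nat assume x: "x \<in> M \<inter> N" and h: "0 < h" "h \<le> 1" and j: "1 \<le> j" "j \<le> 3"
    from 2(3)[OF x] obtain E B where lk: "law_kernel M r0 r1 C x (\<Psi> x) E B \<mu> p Cp K \<nu>" by blast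
    show "(\<integral>\<^sup>+ y. ennreal (\<bar>K (norm (x - y) / h)\<bar> * norm (y - x) ^ j) \<partial>L) \<le>
      ennreal (((1 + det_bound TYPE('d)) * Cp * (2 * (unit_ball_vol (real CARD('d)) * Mom * (8/3) ^ (CARD('d) + 3)))
        + 2 ^ (CARD('d) + 3) * Mom / r0 ^ (CARD('d) + 3)) * h ^ (CARD('d) + j))"
      using law_kernel.tail_law_total[OF lk j h 2(2)] by (simp only: law_eq[OF lk])
  qed
qed

text \<open>The constant occurs twice, as a factor and as the inverse radius of the region treated.
  Enlarging it weakens both, which gives the monotonicity demanded by
  \<open>uniform_constant\<close>, and 1 / r0 keeps the region inside the chart.\<close>

lemma shell_uniform:
  "\<exists>c\<ge>0. \<forall>x\<in>M. \<forall>h \<eta>. 0 < h \<longrightarrow> 0 < \<eta> \<longrightarrow> sqrt \<eta> \<le> 1/100 \<longrightarrow>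
    (\<integral>\<^sup>+ y. ennreal (measure \<nu> {(norm (y - x) - 2 * \<eta>) / h<..(norm (y - x) + \<eta>) / h}) * indicator {y. c * norm (y - x) < 1} y \<partial>L)
      \<le> ennreal (c * sqrt \<eta>)"
proof (rule uniform_constant, goal_cases)
  case (1 x c c')
  show ?case
  proof (intro allI impI)
    fix h \<eta> :: real assume *: "0 < h" "0 < \<eta>" "sqrt \<eta> \<le> 1/100"
    have "(\<integral>\<^sup>+ y. ennreal (measure \<nu> {(norm (y - x) - 2 * \<eta>) / h<..(norm (y - x) + \<eta>) / h}) * indicator {y. c' * norm (y - x) < 1} y \<partial>L)
      \<le> (\<integral>\<^sup>+ y. ennreal (measure \<nu> {(norm (y - x) - 2 * \<eta>) / h<..(norm (y - x) + \<eta>) / h}) * indicator {y. c * norm (y - x) < 1} y \<partial>L)"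
    proof (intro nn_integral_mono mult_left_mono)
      fix y
      have "c * norm (y - x) \<le> c' * norm (y - x)" using 1(2) by (intro mult_right_mono) auto
      then show "indicator {y. c' * norm (y - x) < 1} y \<le> (indicator {y. c * norm (y - x) < 1} y :: ennreal)"
        by (auto simp: indicator_def)
    qed simp
    also have "\<dots> \<le> ennreal (c * sqrt \<eta>)" using 1(1) * by blast
    also have "\<dots> \<le> ennreal (c' * sqrt \<eta>)" using 1(2) * by (intro ennreal_leI mult_right_mono) auto
    finally show "(\<integral>\<^sup>+ y. ennreal (measure \<nu> {(norm (y - x) - 2 * \<eta>) / h<..(norm (y - x) + \<eta>) / h}) * indicator {y. c' * norm (y - x) < 1} y \<partial>L)
      \<le> ennreal (c' * sqrt \<eta>)" .
  qed
next
  case (2 N r0 r1 C Cp \<Psi>)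
  define c1 where "c1 = (1 + det_bound TYPE('d)) * Cp * (V * (unit_ball_vol (real CARD('d)) * (24 * real CARD('d) + 6 ^ CARD('d))))"
  show ?case
  proof (intro exI[of _ "max c1 (1 / r0)"] ballI allI impI)
    fix x and h \<eta> :: real assume x: "x \<in> M \<inter> N" and *: "0 < h" "0 < \<eta>" "sqrt \<eta> \<le> 1/100"
    from 2(3)[OF x] obtain E B where lk: "law_kernel M r0 r1 C x (\<Psi> x) E B \<mu> p Cp K \<nu>" by blast
    interpret k: law_kernel M r0 r1 C x "\<Psi> x" E B \<mu> p Cp K \<nu> by (rule lk)
    have "(\<integral>\<^sup>+ y. ennreal (measure \<nu> {(norm (y - x) - 2 * \<eta>) / h<..(norm (y - x) + \<eta>) / h}) * indicator {y. max c1 (1 / r0) * norm (y - x) < 1} y \<partial>L)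
      \<le> (\<integral>\<^sup>+ y. ennreal (measure \<nu> {(norm (y - x) - 2 * \<eta>) / h<..(norm (y - x) + \<eta>) / h}) * indicator k.S y \<partial>L)"
    proof (intro nn_integral_mono mult_left_mono)
      fix y assume "y \<in> space L"
      then have y: "y \<in> M" by (simp add: space_L)
      have "y \<in> k.S" if m: "max c1 (1 / r0) * norm (y - x) < 1"
      proof (rule ccontr)
        assume "y \<notin> k.S"
        then have "r0 \<le> norm (y - x)" using k.far[OF y] by blast
        then have "1 / r0 * r0 \<le> max c1 (1 / r0) * norm (y - x)" using 2(1) by (intro mult_mono) (auto simp: le_max_iff_disj)
        then show False using m 2(1) by simp
      qed
      then show "indicator {y. max c1 (1 / r0) * norm (y - x) < 1} y \<le> (indicator k.S y :: ennreal)"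
        by (auto simp: indicator_def)
    qed simp
    also have "\<dots> \<le> ennreal (c1 * sqrt \<eta>)"
      using k.shell_law[OF *(2,3,1)] unfolding law_eq[OF lk] c1_def .
    also have "\<dots> \<le> ennreal (max c1 (1 / r0) * sqrt \<eta>)" using * by (intro ennreal_leI mult_right_mono) auto
    finally show "(\<integral>\<^sup>+ y. ennreal (measure \<nu> {(norm (y - x) - 2 * \<eta>) / h<..(norm (y - x) + \<eta>) / h}) * indicator {y. max c1 (1 / r0) * norm (y - x) < 1} y \<partial>L)
      \<le> ennreal (max c1 (1 / r0) * sqrt \<eta>)" .
  qed
qed

lemma bias_uniform:
  assumes f: "Ck_manifold TYPE('d) 3 M f"
  shows "\<exists>c\<ge>0. \<forall>x\<in>M. \<forall>h>0. \<bar>(\<integral>y. K (norm (x - y) / h) * (f y - f x) \<partial>L) - h ^ (CARD('d) + 2) * limit_operator TYPE('d) K M p f x\<bar>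
    \<le> c * h ^ (CARD('d) + 3)"
proof (rule uniform_constant, goal_cases)
  case (1 y c c')
  have "c * h ^ (CARD('d) + 3) \<le> c' * h ^ (CARD('d) + 3)" if "0 < h" for h
    using that 1(2) by (intro mult_right_mono) auto
  then show ?case using 1(1) order_trans by blast
next
  case (2 N r0 r1 C Cp \<Psi>)
  from 2(5)[OF f] obtain Kf where Kf: "\<And>y. y \<in> M \<inter> N \<Longrightarrow> jet2 r1 Kf (\<lambda>w. f (\<Psi> y w))" "\<And>y. y \<in> M \<Longrightarrow> \<bar>f y\<bar> \<le> Kf" by blast
  have fm: "f \<in> borel_measurable \<mu>" using Ck_measurable f by (simp add: numeral_3_eq_3)
  show ?case
  proof (intro exI ballI allI impI)
    fix x and h :: real assume x: "x \<in> M \<inter> N" and h: "0 < (h :: real)"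
    from 2(3)[OF x] obtain E B where lk: "law_kernel M r0 r1 C x (\<Psi> x) E B \<mu> p Cp K \<nu>" by blast
    interpret k: law_kernel M r0 r1 C x "\<Psi> x" E B \<mu> p Cp K \<nu> by (rule lk)
    show "\<bar>(\<integral>y. K (norm (x - y) / h) * (f y - f x) \<partial>L) - h ^ (CARD('d) + 2) * limit_operator TYPE('d) K M p f x\<bar>
      \<le> law_kernel.bias_const TYPE('d) r0 r1 C Cp \<nu> Kf * h ^ (CARD('d) + 3)"
      using k.chart_bias[OF h submanifold fm f p_C2 Kf(1)[OF x] 2(4)[OF x] Kf(2)] unfolding law_eq[OF lk] .
  qed
qed

lemma ambient_jet_uniform:
  assumes f: "Ck_manifold TYPE('d) 3 M f"
  shows "\<exists>c\<ge>0. \<forall>x\<in>M. \<exists>a s. linear a \<and> bilinear s \<and> (\<forall>z. \<bar>a z\<bar> \<le> c * norm z) \<and> (\<forall>z v. \<bar>s z v\<bar> \<le> c * norm z * norm v) \<and>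
    (\<forall>y\<in>M. \<bar>f y - f x - a (y - x) - s (y - x) (y - x)\<bar> \<le> c * norm (y - x) ^ 3)"
proof (rule uniform_constant, goal_cases)
  case (1 x c c')
  have "c * norm z \<le> c' * norm z" "c * norm z * norm v \<le> c' * norm z * norm v" "c * norm z ^ 3 \<le> c' * norm z ^ 3" for z v :: "real^'m"
    using 1(2) by (auto intro!: mult_right_mono)
  then show ?case using 1(1) by (meson order_trans)
next
  case (2 N r0 r1 C Cp \<Psi>)
  from 2(5)[OF f] obtain Kf where Kf: "\<And>y. y \<in> M \<inter> N \<Longrightarrow> jet2 r1 Kf (\<lambda>w. f (\<Psi> y w))" "\<And>y. y \<in> M \<Longrightarrow> \<bar>f y\<bar> \<le> Kf" by blast
  define d where "d = diameter M"
  have d: "norm (y - x) \<le> d" if "y \<in> M" "x \<in> M" for x y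
    using diameter_bounded_bound[OF compact_imp_bounded[OF compact_M] that] by (simp add: d_def dist_norm)
  define c1 where "c1 = Kf * (8 + 8 * C) + (2 * Kf + Kf * d + Kf * d\<^sup>2) / r0 ^ 3"
  show ?case
  proof (intro exI[of _ "max Kf c1"] ballI)
    fix x assume x: "x \<in> M \<inter> N"
    from 2(3)[OF x] obtain E B where lk: "law_kernel M r0 r1 C x (\<Psi> x) E B \<mu> p Cp K \<nu>" by blast
    interpret k: law_kernel M r0 r1 C x "\<Psi> x" E B \<mu> p Cp K \<nu> by (rule lk)
    obtain a s where as: "linear a" "bilinear s" "\<And>z. \<bar>a z\<bar> \<le> Kf * norm z" "\<And>z v. \<bar>s z v\<bar> \<le> Kf * norm z * norm v"
      "\<And>y. y \<in> M \<Longrightarrow> \<bar>f y - f x - a (y - x) - s (y - x) (y - x)\<bar> \<le> c1 * norm (y - x) ^ 3"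
      using k.ambient_jet[OF Kf(1)[OF x] Kf(2) d] x unfolding c1_def by blast
    have "Kf * norm z \<le> max Kf c1 * norm z" "Kf * norm z * norm v \<le> max Kf c1 * norm z * norm v" "c1 * norm z ^ 3 \<le> max Kf c1 * norm z ^ 3" for z v :: "real^'m"
      by (auto intro!: mult_right_mono)
    then show "\<exists>a s. linear a \<and> bilinear s \<and> (\<forall>z. \<bar>a z\<bar> \<le> max Kf c1 * norm z) \<and> (\<forall>z v. \<bar>s z v\<bar> \<le> max Kf c1 * norm z * norm v) \<and>
      (\<forall>y\<in>M. \<bar>f y - f x - a (y - x) - s (y - x) (y - x)\<bar> \<le> max Kf c1 * norm (y - x) ^ 3)"
      using as by (intro exI[of _ a] exI[of _ s]) (meson order_trans)
  qed
qed

end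

section \<open>Bernstein inequality and deviations over finite nets\<close>

text \<open>For z = -x negative it is enough that 1 - x + x^2, multiplied by the quadratic Taylor
  lower bound of exp x, is at least 1.\<close>

lemma exp_le_quadratic:
  fixes z :: real
  assumes "\<bar>z\<bar> \<le> 1"
  shows "exp z \<le> 1 + z + z\<^sup>2"
proof (cases "0 \<le> z")
  case True
  then show ?thesis using assms by (intro exp_bound) auto
next
  case False
  define x where "x = - z"
  have x: "0 \<le> x" "x \<le> 1" using False assms by (auto simp: x_def)
  have "1 \<le> (1 + x + x\<^sup>2 / 2) * (1 - x + x\<^sup>2)"
  proof -
    have "(1 + x + x\<^sup>2 / 2) * (1 - x + x\<^sup>2) = 1 + (x\<^sup>2 / 2 + x ^ 3 / 2 + x ^ 4 / 2)"
      by (simp add: power2_eq_square power3_eq_cube power4_eq_xxxx field_simps)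
    then show ?thesis using x by simp
  qed
  also have "\<dots> \<le> exp x * (1 - x + x\<^sup>2)"
  proof (rule mult_right_mono[OF exp_lower_Taylor_quadratic])
    show "0 \<le> 1 - x + x\<^sup>2" using x by (smt (verit) zero_le_power2)
  qed (use x in auto)
  finally have "exp (- x) * 1 \<le> exp (- x) * (exp x * (1 - x + x\<^sup>2))" by (intro mult_left_mono) auto
  also have "\<dots> = 1 - x + x\<^sup>2" by (simp add: mult.assoc[symmetric] exp_minus_inverse[of x] mult.commute flip: exp_add)
  finally show ?thesis by (simp add: x_def)
qed

section \<open>Exponential inequality for independent bounded variables\<close>

context prob_space
begin

text \<open>A Chernoff bound at a fixed parameter: exp(lY) \<le> 1 + lY + l^2 Y^2 as long as l |Y|
  \<le> 1, and centring removes the linear term. The parameter l is left free because it will be the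
  convergence rate itself.\<close>

lemma bernstein_upper:
  fixes Y :: "'i \<Rightarrow> 'a \<Rightarrow> real"
  assumes I: "finite I" and indep: "indep_vars (\<lambda>_. borel) Y I"
    and bound: "\<And>i \<omega>. i \<in> I \<Longrightarrow> \<omega> \<in> space M \<Longrightarrow> l * \<bar>Y i \<omega>\<bar> \<le> 1"
    and centred: "\<And>i. i \<in> I \<Longrightarrow> expectation (Y i) = 0"
    and var: "\<And>i. i \<in> I \<Longrightarrow> expectation (\<lambda>\<omega>. (Y i \<omega>)\<^sup>2) \<le> w" and l: "0 < l"
  shows "prob {\<omega> \<in> space M. t \<le> (\<Sum>i\<in>I. Y i \<omega>)} \<le> exp (real (card I) * (l\<^sup>2 * w) - l * t)"
proof -
  have rv [measurable]: "random_variable borel (Y i)" if "i \<in> I" for i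
    using indep that unfolding indep_vars_def by blast
  have mgf: "(\<integral>\<^sup>+ \<omega>. ennreal (exp (l * Y i \<omega>)) \<partial>M) \<le> ennreal (exp (l\<^sup>2 * w))" if i: "i \<in> I" for i
  proof -
    note [measurable] = rv[OF i]
    have Yb: "\<bar>Y i \<omega>\<bar> \<le> 1 / l" if "\<omega> \<in> space M" for \<omega>
      using bound[OF i that] l by (simp add: field_simps)
    have i1: "integrable M (Y i)"
      by (rule integrable_const_bound[where B = "1 / l"]) (use Yb in auto)
    have i2: "integrable M (\<lambda>\<omega>. (Y i \<omega>)\<^sup>2)"
    proof (rule integrable_const_bound[where B = "(1 / l)\<^sup>2"])
      show "AE \<omega> in M. norm ((Y i \<omega>)\<^sup>2) \<le> (1 / l)\<^sup>2"
        using Yb l by (auto intro!: AE_I2 simp: abs_le_square_iff[symmetric])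
    qed measurable
    have "(\<integral>\<^sup>+ \<omega>. ennreal (exp (l * Y i \<omega>)) \<partial>M) \<le> (\<integral>\<^sup>+ \<omega>. ennreal (1 + l * Y i \<omega> + l\<^sup>2 * (Y i \<omega>)\<^sup>2) \<partial>M)"
      using exp_le_quadratic[of "l * Y i _"] bound[OF i] l
      by (intro nn_integral_mono ennreal_leI) (auto simp: abs_mult power_mult_distrib)
    also have "\<dots> = ennreal (\<integral>\<omega>. 1 + l * Y i \<omega> + l\<^sup>2 * (Y i \<omega>)\<^sup>2 \<partial>M)"
    proof (rule nn_integral_eq_integral)
      show "integrable M (\<lambda>\<omega>. 1 + l * Y i \<omega> + l\<^sup>2 * (Y i \<omega>)\<^sup>2)" using i1 i2 by simp
      show "AE \<omega> in M. 0 \<le> 1 + l * Y i \<omega> + l\<^sup>2 * (Y i \<omega>)\<^sup>2"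
      proof (rule AE_I2)
        fix \<omega> assume "\<omega> \<in> space M"
        then have "\<bar>l * Y i \<omega>\<bar> \<le> 1" using bound[OF i] l by (simp add: abs_mult)
        then have "0 \<le> 1 + l * Y i \<omega>" by linarith
        then show "0 \<le> 1 + l * Y i \<omega> + l\<^sup>2 * (Y i \<omega>)\<^sup>2" by (rule add_nonneg_nonneg) simp
      qed
    qed
    also have "(\<integral>\<omega>. 1 + l * Y i \<omega> + l\<^sup>2 * (Y i \<omega>)\<^sup>2 \<partial>M) = 1 + l\<^sup>2 * expectation (\<lambda>\<omega>. (Y i \<omega>)\<^sup>2)"
      using i1 i2 centred[OF i] by (simp add: prob_space)
    also have "\<dots> \<le> 1 + l\<^sup>2 * w" using var[OF i] by (intro add_left_mono mult_left_mono) auto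
    also have "\<dots> \<le> exp (l\<^sup>2 * w)" by (rule exp_ge_add_one_self)
    finally show ?thesis by (simp add: ennreal_leI)
  qed
  have "ennreal (prob {\<omega> \<in> space M. t \<le> (\<Sum>i\<in>I. Y i \<omega>)}) = emeasure M {\<omega> \<in> space M. t \<le> (\<Sum>i\<in>I. Y i \<omega>)}"
    by (simp add: emeasure_eq_measure)
  also have "\<dots> \<le> ennreal (exp (- l * t)) * (\<integral>\<^sup>+ \<omega>\<in>space M. ennreal (exp (l * (\<Sum>i\<in>I. Y i \<omega>))) \<partial>M)"
    by (intro Chernoff_ineq_nn_integral_ge l) auto
  also have "(\<integral>\<^sup>+ \<omega>\<in>space M. ennreal (exp (l * (\<Sum>i\<in>I. Y i \<omega>))) \<partial>M) = (\<integral>\<^sup>+ \<omega>. (\<Prod>i\<in>I. ennreal (exp (l * Y i \<omega>))) \<partial>M)"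
    by (intro nn_integral_cong) (simp add: sum_distrib_left exp_sum I prod_ennreal)
  also have "\<dots> = (\<Prod>i\<in>I. \<integral>\<^sup>+ \<omega>. ennreal (exp (l * Y i \<omega>)) \<partial>M)"
    by (intro indep_vars_nn_integral I indep_vars_compose2[OF indep]) auto
  also have "ennreal (exp (- l * t)) * \<dots> \<le> ennreal (exp (- l * t)) * (\<Prod>i\<in>I. ennreal (exp (l\<^sup>2 * w)))"
    by (intro mult_left_mono prod_mono_ennreal mgf) auto
  also have "\<dots> = ennreal (exp (- l * t) * exp (real (card I) * (l\<^sup>2 * w)))"
    by (simp add: prod_ennreal ennreal_mult exp_of_nat_mult ennreal_power)
  also have "exp (- l * t) * exp (real (card I) * (l\<^sup>2 * w)) = exp (real (card I) * (l\<^sup>2 * w) - l * t)"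
    by (simp flip: exp_add)
  finally show ?thesis by (simp add: ennreal_le_iff)
qed

lemma bernstein:
  fixes Y :: "'i \<Rightarrow> 'a \<Rightarrow> real"
  assumes I: "finite I" and indep: "indep_vars (\<lambda>_. borel) Y I"
    and bound: "\<And>i \<omega>. i \<in> I \<Longrightarrow> \<omega> \<in> space M \<Longrightarrow> l * \<bar>Y i \<omega>\<bar> \<le> 1"
    and centred: "\<And>i. i \<in> I \<Longrightarrow> expectation (Y i) = 0"
    and var: "\<And>i. i \<in> I \<Longrightarrow> expectation (\<lambda>\<omega>. (Y i \<omega>)\<^sup>2) \<le> w" and l: "0 < l"
  shows "prob {\<omega> \<in> space M. t \<le> \<bar>\<Sum>i\<in>I. Y i \<omega>\<bar>} \<le> 2 * exp (real (card I) * (l\<^sup>2 * w) - l * t)"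
proof -
  have rv [measurable]: "random_variable borel (Y i)" if "i \<in> I" for i
    using indep that unfolding indep_vars_def by blast
  have indep': "indep_vars (\<lambda>_. borel) (\<lambda>i \<omega>. - Y i \<omega>) I" by (rule indep_vars_compose2[OF indep]) auto
  have "prob {\<omega> \<in> space M. t \<le> \<bar>\<Sum>i\<in>I. Y i \<omega>\<bar>}
    \<le> prob ({\<omega> \<in> space M. t \<le> (\<Sum>i\<in>I. Y i \<omega>)} \<union> {\<omega> \<in> space M. t \<le> (\<Sum>i\<in>I. - Y i \<omega>)})"
    by (intro finite_measure_mono) (auto simp: sum_negf)
  also have "\<dots> \<le> prob {\<omega> \<in> space M. t \<le> (\<Sum>i\<in>I. Y i \<omega>)} + prob {\<omega> \<in> space M. t \<le> (\<Sum>i\<in>I. - Y i \<omega>)}"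
    by (intro measure_Un_le) auto
  also have "\<dots> \<le> exp (real (card I) * (l\<^sup>2 * w) - l * t) + exp (real (card I) * (l\<^sup>2 * w) - l * t)"
    using assms by (intro add_mono bernstein_upper indep indep') auto
  finally show ?thesis by simp
qed

end

section \<open>Deviations of an i.i.d. sample at a shrinking bandwidth\<close>

locale iid_sampling = P: prob_space P + L: prob_space L
  for P :: "'w measure" and L S :: "'e measure" +
  fixes X :: "nat \<Rightarrow> 'w \<Rightarrow> 'e" and h :: "nat \<Rightarrow> real" and d :: nat
  assumes sets_L': "sets L = sets S"
    and indep_X: "P.indep_vars (\<lambda>_. S) X {1..}"
    and distr_X: "\<And>i. 1 \<le> i \<Longrightarrow> distr P S (X i) = L"
    and h_pos: "\<And>n. 1 \<le> n \<Longrightarrow> 0 < h n" and h_lim: "h \<longlonglongrightarrow> 0"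
    and rate_lim: "(\<lambda>n. ln (1 / h n) / (real n * h n ^ (d + 2))) \<longlonglongrightarrow> 0"
begin

definition rate :: "nat \<Rightarrow> real" where
  "rate n = sqrt (ln (1 / h n) / (real n * h n ^ (d + 2))) + h n"

lemma rate_tendsto: "rate \<longlonglongrightarrow> 0"
  unfolding rate_def[abs_def] using tendsto_add[OF tendsto_real_sqrt[OF rate_lim] h_lim] by simp

lemma eventually_h: "0 < c \<Longrightarrow> \<forall>\<^sub>F n in sequentially. 1 \<le> n \<and> 0 < h n \<and> h n < c"
  using order_tendstoD(2)[OF h_lim, of c] eventually_ge_at_top[of 1]
  by (auto elim!: eventually_elim2 intro: h_pos)

text \<open>The last bound is (a + b)^2 \<ge> a^2 + b^2 for the stochastic part a and the bias part
  b = h n. The resulting summand n h^(d+4) brings in the dependence on n that log(1/h) may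
  lack.\<close>

lemma rate_facts:
  assumes "1 \<le> n" "0 < h n" "h n < 1"
  shows "h n \<le> rate n" "0 < rate n" "ln (1 / h n) + real n * h n ^ (d + 4) \<le> real n * (rate n)\<^sup>2 * h n ^ (d + 2)"
proof -
  define q where "q = ln (1 / h n) / (real n * h n ^ (d + 2))"
  have q: "0 \<le> q" using assms by (auto simp: q_def intro!: divide_nonneg_nonneg mult_nonneg_nonneg)
  have r: "rate n = sqrt q + h n" by (simp add: rate_def q_def)
  show "h n \<le> rate n" using q by (simp add: r)
  then show "0 < rate n" using assms by linarith
  have "q + (h n)\<^sup>2 \<le> (rate n)\<^sup>2" using q assms by (simp add: r power2_sum)
  then have "real n * h n ^ (d + 2) * (q + (h n)\<^sup>2) \<le> real n * h n ^ (d + 2) * (rate n)\<^sup>2" using assms by (intro mult_left_mono) auto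
  moreover have "real n * h n ^ (d + 2) * q = ln (1 / h n)" using assms by (simp add: q_def)
  moreover have "h n ^ (d + 4) = h n ^ (d + 2) * (h n)\<^sup>2" by (simp add: power_add power4_eq_xxxx power2_eq_square)
  ultimately show "ln (1 / h n) + real n * h n ^ (d + 4) \<le> real n * (rate n)\<^sup>2 * h n ^ (d + 2)"
    by (simp add: algebra_simps)
qed

text \<open>Bernstein's inequality with parameter \<open>rate n\<close>: the variance uses up v of
  the factor v + Q, and the exponent -Q n rate^2 h^(d+2) remains. Its logarithmic part is h^Q; the
  other is at most exp(-u) \<le> 2/u^2 with u = n h^(d+4). The size of Q pays for the negative power
  of h in u^(-2) and leaves h^e for a union bound.\<close>

lemma tail_probability:
  assumes n: "1 \<le> n" "0 < h n" "h n < 1" and Z [measurable]: "Z \<in> borel_measurable S"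
    and b: "\<And>y. y \<in> space S \<Longrightarrow> \<bar>Z y\<bar> \<le> b" and rb: "rate n * (2 * b) \<le> 1"
    and var: "(\<integral>y. (Z y)\<^sup>2 \<partial>L) \<le> v * h n ^ (d + 2)" and Q: "1 \<le> Q" "2 * (d + 4) + e \<le> Q"
  shows "P.prob {\<omega> \<in> space P. real n * ((v + real Q) * h n ^ (d + 2) * rate n) \<le> \<bar>\<Sum>i=1..n. Z (X i \<omega>) - (\<integral>y. Z y \<partial>L)\<bar>}
    \<le> 4 / real n ^ 2 * h n ^ e"
proof -
  note [measurable_cong] = sets_L'
  have X [measurable]: "X i \<in> measurable P S" if "1 \<le> i" for i
    using indep_X that unfolding P.indep_vars_def by auto
  have spL: "space L = space S" using sets_eq_imp_space_eq[OF sets_L'] .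
  define m where "m = (\<integral>y. Z y \<partial>L)"
  have b0: "0 \<le> b"
  proof -
    obtain y where "y \<in> space S" using L.not_empty spL by auto
    then show ?thesis using b[of y] by linarith
  qed
  have intZ: "integrable L Z" by (rule L.integrable_const_bound[where B = b]) (use b in \<open>auto simp: spL\<close>)
  have intZ2: "integrable L (\<lambda>y. (Z y)\<^sup>2)"
  proof (rule L.integrable_const_bound[where B = "b\<^sup>2"])
    show "AE y in L. norm ((Z y)\<^sup>2) \<le> b\<^sup>2" using b b0 by (auto intro!: AE_I2 simp: abs_le_square_iff[symmetric] spL)
  qed measurable
  have mb: "\<bar>m\<bar> \<le> b"
  proof -
    have "\<bar>m\<bar> \<le> (\<integral>y. \<bar>Z y\<bar> \<partial>L)" unfolding m_def by (rule integral_abs_bound)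
    also have "\<dots> \<le> (\<integral>y. b \<partial>L)" using intZ b by (intro integral_mono) (auto simp: spL)
    finally show ?thesis by (simp add: L.prob_space)
  qed
  have E: "P.expectation (\<lambda>\<omega>. g (X i \<omega>)) = (\<integral>y. g y \<partial>L)" if "1 \<le> i" "g \<in> borel_measurable S" for i and g :: "'e \<Rightarrow> real"
    using integral_distr[OF X[OF that(1)] that(2)] by (simp add: distr_X[OF that(1)])
  have "P.prob {\<omega> \<in> space P. real n * ((v + real Q) * h n ^ (d + 2) * rate n) \<le> \<bar>\<Sum>i\<in>{1..n}. Z (X i \<omega>) - m\<bar>}
    \<le> 2 * exp (real (card {1..n}) * ((rate n)\<^sup>2 * (v * h n ^ (d + 2))) - rate n * (real n * ((v + real Q) * h n ^ (d + 2) * rate n)))"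
  proof (rule P.bernstein)
    show "P.indep_vars (\<lambda>_. borel) (\<lambda>i \<omega>. Z (X i \<omega>) - m) {1..n}"
    proof (rule P.indep_vars_compose2[where M' = "\<lambda>_. S" and Y = "\<lambda>_ y. Z y - m"])
      show "P.indep_vars (\<lambda>_. S) X {1..n}" by (rule P.indep_vars_subset[OF indep_X]) auto
    qed measurable
    fix i assume i: "i \<in> {1..n}"
    show "rate n * \<bar>Z (X i \<omega>) - m\<bar> \<le> 1" if "\<omega> \<in> space P" for \<omega>
    proof -
      have "X i \<omega> \<in> space S" using measurable_space[OF X that] i by simp
      then have "\<bar>Z (X i \<omega>) - m\<bar> \<le> 2 * b" using b mb by fastforce
      then have "rate n * \<bar>Z (X i \<omega>) - m\<bar> \<le> rate n * (2 * b)" using rate_facts(2)[OF n] by (intro mult_left_mono) auto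
      then show ?thesis using rb by linarith
    qed
    show "P.expectation (\<lambda>\<omega>. Z (X i \<omega>) - m) = 0"
      using E[of i "\<lambda>y. Z y - m"] i intZ by (simp add: m_def L.prob_space)
    have "P.expectation (\<lambda>\<omega>. (Z (X i \<omega>) - m)\<^sup>2) = (\<integral>y. (Z y - m)\<^sup>2 \<partial>L)" using E[of i "\<lambda>y. (Z y - m)\<^sup>2"] i by simp
    also have "\<dots> = (\<integral>y. (Z y)\<^sup>2 - 2 * m * Z y + m\<^sup>2 \<partial>L)" by (simp add: power2_diff algebra_simps)
    also have "\<dots> = (\<integral>y. (Z y)\<^sup>2 \<partial>L) - 2 * m * m + m\<^sup>2" using intZ intZ2 by (simp add: m_def L.prob_space)
    also have "\<dots> \<le> v * h n ^ (d + 2)" using var by (simp add: power2_eq_square) (smt (verit) zero_le_square)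
    finally show "P.expectation (\<lambda>\<omega>. (Z (X i \<omega>) - m)\<^sup>2) \<le> v * h n ^ (d + 2)" .
  qed (use rate_facts(2)[OF n] in auto)
  also have "\<dots> = 2 * exp (- (real Q * (real n * (rate n)\<^sup>2 * h n ^ (d + 2))))"
    by (simp add: power2_eq_square algebra_simps)
  also have "\<dots> \<le> 2 * exp (- (real Q * (ln (1 / h n) + real n * h n ^ (d + 4))))"
    by (intro mult_left_mono iffD2[OF exp_le_cancel_iff] le_imp_neg_le rate_facts(3)[OF n]) auto
  also have "exp (- (real Q * (ln (1 / h n) + real n * h n ^ (d + 4)))) = h n ^ Q * exp (- (real Q * (real n * h n ^ (d + 4))))"
  proof -
    have "exp (- (real Q * ln (1 / h n))) = h n ^ Q"
      using n by (simp add: ln_div exp_of_nat_mult)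
    moreover have "- (real Q * (ln (1 / h n) + real n * h n ^ (d + 4))) = - (real Q * ln (1 / h n)) + - (real Q * (real n * h n ^ (d + 4)))"
      by (simp only: distrib_left minus_add_distrib)
    ultimately show ?thesis by (simp only: exp_add)
  qed
  also have "\<dots> \<le> h n ^ Q * (2 / (real n * h n ^ (d + 4))\<^sup>2)"
  proof (rule mult_left_mono)
    define u where "u = real n * h n ^ (d + 4)"
    have u: "0 < u" using n by (simp add: u_def)
    have "exp (- (real Q * u)) \<le> exp (- u)" using Q u mult_right_mono[of 1 "real Q" u] by simp
    also have "\<dots> \<le> 2 / u\<^sup>2"
    proof -
      have "u\<^sup>2 / 2 \<le> exp u" using exp_lower_Taylor_quadratic[of u] u by linarith
      then show ?thesis using u by (simp add: exp_minus field_simps)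
    qed
    finally show "exp (- (real Q * (real n * h n ^ (d + 4)))) \<le> 2 / (real n * h n ^ (d + 4))\<^sup>2" by (simp add: u_def)
  qed (use n in auto)
  also have "2 * (h n ^ Q * (2 / (real n * h n ^ (d + 4))\<^sup>2)) \<le> 4 / real n ^ 2 * h n ^ e"
  proof -
    have "h n ^ Q \<le> h n ^ (2 * (d + 4) + e)" using n Q by (intro power_decreasing) auto
    also have "\<dots> = (h n ^ (d + 4))\<^sup>2 * h n ^ e" by (subst power_add, subst mult.commute[of 2], subst power_mult, rule refl)
    finally have "h n ^ Q \<le> (h n ^ (d + 4))\<^sup>2 * h n ^ e" .
    then have "2 * (h n ^ Q * (2 / (real n * h n ^ (d + 4))\<^sup>2)) \<le> 2 * ((h n ^ (d + 4))\<^sup>2 * h n ^ e * (2 / (real n * h n ^ (d + 4))\<^sup>2))"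
      by (intro mult_left_mono mult_right_mono) auto
    also have "\<dots> = 4 / real n ^ 2 * h n ^ e" using n by (simp add: power_mult_distrib)
    finally show ?thesis .
  qed
  finally show ?thesis by (simp add: m_def)
qed

text \<open>A union bound over O(h^(-e)) indices leaves a multiple of n^(-2), which Borel-Cantelli
  accepts. A bound b independent of n is enough since the Bernstein parameter \<open>rate n\<close>
  tends to 0.\<close>

lemma deviation_AE:
  fixes N :: "nat \<Rightarrow> 'i set" and Z :: "nat \<Rightarrow> 'i \<Rightarrow> 'e \<Rightarrow> real"
  assumes Z: "\<And>n x. x \<in> N n \<Longrightarrow> Z n x \<in> borel_measurable S"
    and b: "\<And>n x y. x \<in> N n \<Longrightarrow> y \<in> space S \<Longrightarrow> \<bar>Z n x y\<bar> \<le> b"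
    and var: "\<forall>\<^sub>F n in sequentially. \<forall>x\<in>N n. (\<integral>y. (Z n x y)\<^sup>2 \<partial>L) \<le> v * h n ^ (d + 2)"
    and card: "\<forall>\<^sub>F n in sequentially. finite (N n) \<and> real (card (N n)) * h n ^ e \<le> c"
  shows "\<exists>A\<ge>0. AE \<omega> in P. \<forall>\<^sub>F n in sequentially. \<forall>x\<in>N n.
    \<bar>(\<Sum>i=1..n. Z n x (X i \<omega>)) - real n * (\<integral>y. Z n x y \<partial>L)\<bar> \<le> real n * (A * h n ^ (d + 2) * rate n)"
proof -
  have X [measurable]: "X i \<in> measurable P S" if "1 \<le> i" for i
    using indep_X that unfolding P.indep_vars_def by auto
  define Q where "Q = 2 * (d + 4) + e"
  have rb: "\<forall>\<^sub>F n in sequentially. rate n * (2 * b) \<le> 1"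
    using order_tendstoD(2)[OF tendsto_mult_right[OF rate_tendsto, of "2 * b"], of 1] by (auto elim: eventually_mono)
  have "\<forall>\<^sub>F n in sequentially. (1 \<le> n \<and> 0 < h n \<and> h n < 1) \<and> rate n * (2 * b) \<le> 1 \<and>
      (\<forall>x\<in>N n. (\<integral>y. (Z n x y)\<^sup>2 \<partial>L) \<le> v * h n ^ (d + 2)) \<and> (finite (N n) \<and> real (card (N n)) * h n ^ e \<le> c)"
    by (intro eventually_conj eventually_h rb var card) simp
  then obtain n0 where n0: "\<And>n. n0 \<le> n \<Longrightarrow> (1 \<le> n \<and> 0 < h n \<and> h n < 1) \<and> rate n * (2 * b) \<le> 1 \<and>
      (\<forall>x\<in>N n. (\<integral>y. (Z n x y)\<^sup>2 \<partial>L) \<le> v * h n ^ (d + 2)) \<and> (finite (N n) \<and> real (card (N n)) * h n ^ e \<le> c)"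
    unfolding eventually_sequentially by blast
  define Bad where "Bad n x = {\<omega> \<in> space P. real n * ((v + real Q) * h n ^ (d + 2) * rate n) \<le> \<bar>\<Sum>i=1..n. Z n x (X i \<omega>) - (\<integral>y. Z n x y \<partial>L)\<bar>}" for n x
  \<comment> \<open>Empty before n0, where \<open>N n\<close> may be infinite; this keeps every
    \<open>A n\<close> measurable.\<close>
  define A where "A n = (if n0 \<le> n then (\<Union>x\<in>N n. Bad n x) else {})" for n
  have Bad_m: "Bad n x \<in> sets P" if "x \<in> N n" for n x
  proof -
    note [measurable] = Z[OF that]
    show ?thesis unfolding Bad_def by measurable
  qed
  have A_m: "A n \<in> sets P" for n
    using n0[of n] Bad_m by (auto simp: A_def intro!: sets.finite_UN)
  have A_le: "P.prob (A n) \<le> 4 * c * (1 / real n ^ 2)" if n: "n0 \<le> n" for n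
  proof -
    have *: "1 \<le> n" "0 < h n" "h n < 1" "rate n * (2 * b) \<le> 1" "finite (N n)" "real (card (N n)) * h n ^ e \<le> c" using n0[OF n] by auto
    have "P.prob (A n) \<le> (\<Sum>x\<in>N n. P.prob (Bad n x))"
      using n *(5) Bad_m by (simp add: A_def) (intro P.finite_measure_subadditive_finite; auto)
    also have "\<dots> \<le> (\<Sum>x\<in>N n. 4 / real n ^ 2 * h n ^ e)"
    proof (rule sum_mono)
      fix x assume x: "x \<in> N n"
      show "P.prob (Bad n x) \<le> 4 / real n ^ 2 * h n ^ e"
        unfolding Bad_def using n0[OF n] x
        by (intro tail_probability[where b = b]) (auto simp: Z b Q_def)
    qed
    also have "\<dots> = (real (card (N n)) * h n ^ e) * (4 / real n ^ 2)" by simp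
    also have "\<dots> \<le> c * (4 / real n ^ 2)" using *(6) by (intro mult_right_mono) auto
    finally show ?thesis by (simp add: mult.commute)
  qed
  have "summable (\<lambda>n. P.prob (A n))"
  proof (rule summable_comparison_test_ev)
    show "\<forall>\<^sub>F n in sequentially. norm (P.prob (A n)) \<le> 4 * c * (1 / real n ^ 2)"
      by (rule eventually_mono[OF eventually_ge_at_top[of n0]]) (use A_le in simp)
    show "summable (\<lambda>n. 4 * c * (1 / real n ^ 2))"
      using inverse_power_summable[of 2, where 'a = real] by (intro summable_mult) (simp add: inverse_eq_divide)
  qed
  then have AE: "AE \<omega> in P. \<forall>\<^sub>F n in sequentially. \<omega> \<in> space P - A n"
    by (intro borel_cantelli_AE1 A_m) (auto simp: P.emeasure_eq_measure)
  have "AE \<omega> in P. \<forall>\<^sub>F n in sequentially. \<forall>x\<in>N n.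
    \<bar>(\<Sum>i=1..n. Z n x (X i \<omega>)) - real n * (\<integral>y. Z n x y \<partial>L)\<bar> \<le> real n * ((\<bar>v\<bar> + real Q) * h n ^ (d + 2) * rate n)"
    using AE
  proof eventually_elim
    case (elim \<omega>)
    then show ?case using eventually_ge_at_top[of n0]
    proof eventually_elim
      case (elim n)
      have *: "1 \<le> n" "0 < h n" "h n < 1" using n0[OF elim(2)] by auto
      show ?case
      proof
        fix x assume x: "x \<in> N n"
        have "\<omega> \<notin> Bad n x" "\<omega> \<in> space P" using elim x by (auto simp: A_def)
        then have "\<bar>\<Sum>i=1..n. Z n x (X i \<omega>) - (\<integral>y. Z n x y \<partial>L)\<bar> \<le> real n * ((v + real Q) * h n ^ (d + 2) * rate n)"
          by (simp add: Bad_def)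
        also have "\<dots> \<le> real n * ((\<bar>v\<bar> + real Q) * h n ^ (d + 2) * rate n)"
          using * rate_facts(2)[OF *] by (intro mult_left_mono mult_right_mono) auto
        finally show "\<bar>(\<Sum>i=1..n. Z n x (X i \<omega>)) - real n * (\<integral>y. Z n x y \<partial>L)\<bar> \<le> real n * ((\<bar>v\<bar> + real Q) * h n ^ (d + 2) * rate n)"
          by (simp add: sum_subtractf)
      qed
    qed
  qed
  then show ?thesis by (intro exI[of _ "\<bar>v\<bar> + real Q"]) simp
qed

end

text \<open>Points are rounded to a grid of mesh \<eta> divided by the ambient dimension, and one
  point of \<open>M\<close> is chosen in each occupied cell. Points of one cell are within \<eta> of
  each other in the sum norm, and the cells are counted in a cube containing
  \<open>M\<close>.\<close>

lemma finite_net: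
  fixes M :: "(real^'m) set"
  assumes "bounded M"
  shows "\<exists>c\<ge>0. \<forall>\<eta>>0. \<eta> \<le> 1 \<longrightarrow> (\<exists>N. finite N \<and> N \<subseteq> M \<and> real (card N) * \<eta> ^ CARD('m) \<le> c \<and> (\<forall>x\<in>M. \<exists>y\<in>N. norm (x - y) \<le> \<eta>))"
proof -
  obtain D where D: "0 < D" "\<And>x. x \<in> M \<Longrightarrow> norm x \<le> D" using assms by (auto simp: bounded_pos)
  define m where "m = real CARD('m)"
  have m: "1 \<le> m" by (simp add: m_def Suc_leI)
  define c where "c = (2 * m * D + 3) ^ CARD('m)"
  have "\<exists>N. finite N \<and> N \<subseteq> M \<and> real (card N) * \<eta> ^ CARD('m) \<le> c \<and> (\<forall>x\<in>M. \<exists>y\<in>N. norm (x - y) \<le> \<eta>)"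
    if \<eta>: "0 < \<eta>" "\<eta> \<le> 1" for \<eta>
  proof -
    define k where "k = m / \<eta>"
    have k: "0 < k" using m \<eta> by (simp add: k_def)
    define q :: "real^'m \<Rightarrow> 'm \<Rightarrow> int" where "q x i = \<lfloor>k * x $ i\<rfloor>" for x i
    define G where "G = {- \<lceil>k * D\<rceil>..\<lceil>k * D\<rceil>}"
    have qG: "q x \<in> (\<Pi>\<^sub>E i\<in>UNIV. G)" if "x \<in> M" for x
    proof -
      have "q x i \<in> G" for i
      proof -
        have "\<bar>k * x $ i\<bar> \<le> k * D"
          using k D(2)[OF that] component_le_norm_cart[of x i] by (simp add: abs_mult)
        then have "- (k * D) \<le> k * x $ i" "k * x $ i \<le> k * D" by linarith+
        then show ?thesis unfolding q_def G_def by (auto simp: floor_le_iff le_floor_iff) linarith+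
      qed
      then show ?thesis by auto
    qed
    have finG: "finite (\<Pi>\<^sub>E i\<in>(UNIV :: 'm set). G)" by (intro finite_PiE) (auto simp: G_def)
    have fin: "finite (q ` M)" by (rule finite_subset[OF image_subsetI[OF qG] finG])
    define N where "N = (\<lambda>z. SOME x. x \<in> M \<and> q x = z) ` q ` M"
    have some: "(SOME x'. x' \<in> M \<and> q x' = q x) \<in> M \<and> q (SOME x'. x' \<in> M \<and> q x' = q x) = q x" if "x \<in> M" for x
      using someI[of "\<lambda>x'. x' \<in> M \<and> q x' = q x" x] that by simp
    have "card N \<le> card (q ` M)" unfolding N_def by (rule card_image_le[OF fin])
    also have "\<dots> \<le> card (\<Pi>\<^sub>E i\<in>(UNIV :: 'm set). G)" by (rule card_mono[OF finG image_subsetI[OF qG]])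
    also have "\<dots> = card G ^ CARD('m)" by (simp add: card_PiE)
    finally have "real (card N) * \<eta> ^ CARD('m) \<le> real (card G ^ CARD('m)) * \<eta> ^ CARD('m)"
      using \<eta> by (intro mult_right_mono) auto
    also have "\<dots> = (real (card G) * \<eta>) ^ CARD('m)" by (simp add: power_mult_distrib)
    also have "\<dots> \<le> c" unfolding c_def
    proof (rule power_mono)
      have "0 \<le> \<lceil>k * D\<rceil>" using k D by (simp add: ceiling_le_iff le_ceiling_iff order_less_le_trans[of _ 0])
      then have "real (card G) = 2 * of_int \<lceil>k * D\<rceil> + 1" by (simp add: G_def)
      also have "\<dots> \<le> 2 * (k * D + 1) + 1" by (intro add_right_mono mult_left_mono of_int_ceiling_le_add_one) simp
      finally have "real (card G) * \<eta> \<le> (2 * (k * D + 1) + 1) * \<eta>" using \<eta> by (intro mult_right_mono) auto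
      also have "\<dots> = 2 * m * D + 3 * \<eta>" using \<eta> by (simp add: k_def field_simps)
      finally show "real (card G) * \<eta> \<le> 2 * m * D + 3" using \<eta> by linarith
    qed (use \<eta> in auto)
    finally have cN: "real (card N) * \<eta> ^ CARD('m) \<le> c" .
    have close: "norm (x - y) \<le> \<eta>" if "q x = q y" for x y
    proof -
      have "\<bar>(x - y) $ i\<bar> \<le> 1 / k" for i
      proof -
        have "\<lfloor>k * x $ i\<rfloor> = \<lfloor>k * y $ i\<rfloor>" using that unfolding q_def by meson
        then have "\<bar>k * x $ i - k * y $ i\<bar> \<le> 1" by linarith
        then have "k * \<bar>(x - y) $ i\<bar> \<le> 1" using k by (simp add: abs_mult right_diff_distrib[symmetric])
        then show ?thesis using k by (simp add: field_simps)
      qed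
      then have "(\<Sum>i\<in>UNIV. \<bar>(x - y) $ i\<bar>) \<le> (\<Sum>i\<in>(UNIV :: 'm set). 1 / k)" by (intro sum_mono)
      also have "\<dots> = \<eta>" using m \<eta> by (simp add: k_def m_def)
      finally show ?thesis using norm_le_l1_cart[of "x - y"] by linarith
    qed
    have "\<exists>y\<in>N. norm (x - y) \<le> \<eta>" if x: "x \<in> M" for x
    proof -
      have "(SOME x'. x' \<in> M \<and> q x' = q x) \<in> N" unfolding N_def using x by blast
      moreover have "norm (x - (SOME x'. x' \<in> M \<and> q x' = q x)) \<le> \<eta>" using some[OF x] by (intro close) simp
      ultimately show ?thesis by blast
    qed
    moreover have "finite N" "N \<subseteq> M" using fin some by (auto simp: N_def)
    ultimately show ?thesis using cN by blast
  qed
  moreover have "0 \<le> c" using m D by (simp add: c_def)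
  ultimately show ?thesis by blast
qed

section \<open>Uniform deviations\<close>

context sampled_manifold
begin

text \<open>The factor |z| in \<open>g_le\<close> brings the variance down to h^(d+2): the squared
  summand is at most V G^2 |K| |y - x|^2, whose mean is bounded by \<open>tail_uniform\<close>. The
  Lipschitz condition serves the comparison with net points.\<close>

lemma deviation_uniform:
  fixes g :: "real^'m \<Rightarrow> real"
  assumes iid: "iid_sampling P L \<mu> X h CARD('d)"
    and diam: "\<And>x y. x \<in> M \<Longrightarrow> y \<in> M \<Longrightarrow> norm (y - x) \<le> d" and G: "0 \<le> G"
    and g_meas [measurable]: "g \<in> borel_measurable borel"
    and g_le: "\<And>z. norm z \<le> d \<Longrightarrow> \<bar>g z\<bar> \<le> G * norm z"
    and g_lip: "\<And>z z'. norm z \<le> d \<Longrightarrow> norm z' \<le> d \<Longrightarrow> \<bar>g z - g z'\<bar> \<le> G * norm (z - z')"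
  shows "\<exists>A\<ge>0. AE \<omega> in P. \<forall>\<^sub>F n in sequentially. \<forall>x\<in>M.
    \<bar>(\<Sum>i=1..n. K (norm (x - X i \<omega>) / h n) * g (X i \<omega> - x)) - real n * (\<integral>y. K (norm (x - y) / h n) * g (y - x) \<partial>L)\<bar>
      \<le> real n * (A * h n ^ (CARD('d) + 2) * iid_sampling.rate h CARD('d) n)"
proof -
  interpret S: iid_sampling P L \<mu> X h "CARD('d)" by (rule iid)
  let ?d = "CARD('d)"
  note V0 = V_nonneg and Mom0 = Mom_ge(2)
  have d: "0 \<le> d" using M_nonempty diam by fastforce
  obtain ct where ct: "0 \<le> ct" and tail: "\<And>x h j. x \<in> M \<Longrightarrow> 0 < h \<Longrightarrow> h \<le> 1 \<Longrightarrow> 1 \<le> j \<Longrightarrow> j \<le> 3 \<Longrightarrow>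
      (\<integral>\<^sup>+ y. ennreal (\<bar>K (norm (x - y) / h)\<bar> * norm (y - x) ^ j) \<partial>L) \<le> ennreal (ct * h ^ (?d + j))"
    using tail_uniform by blast
  obtain cs where cs: "0 \<le> cs" and shell: "\<And>x h \<eta>. x \<in> M \<Longrightarrow> 0 < h \<Longrightarrow> 0 < \<eta> \<Longrightarrow> sqrt \<eta> \<le> 1/100 \<Longrightarrow>
      (\<integral>\<^sup>+ y. ennreal (measure \<nu> {(norm (y - x) - 2 * \<eta>) / h<..(norm (y - x) + \<eta>) / h}) * indicator {y. cs * norm (y - x) < 1} y \<partial>L)
      \<le> ennreal (cs * sqrt \<eta>)"
    using shell_uniform by blast
  obtain cN where net: "\<And>\<eta>. 0 < \<eta> \<Longrightarrow> \<eta> \<le> 1 \<Longrightarrow>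
      \<exists>N. finite N \<and> N \<subseteq> M \<and> real (card N) * \<eta> ^ CARD('m) \<le> cN \<and> (\<forall>x\<in>M. \<exists>y\<in>N. norm (x - y) \<le> \<eta>)"
    using finite_net[OF compact_imp_bounded[OF compact_M]] by blast
  \<comment> \<open>The exponent is twice d + 3 because the shell estimate is in terms of sqrt
    \<eta>, which then equals h^(d+3) and is at most h^(d+2) times the rate.\<close>
  define \<eta> where "\<eta> n = h n ^ (2 * (?d + 3))" for n
  define good where "good n \<longleftrightarrow> 1 \<le> n \<and> 0 < h n \<and> h n \<le> 1 \<and> sqrt (\<eta> n) \<le> 1/100 \<and> 2 * cs * \<eta> n \<le> 1" for n
  have sqrt_\<eta>: "sqrt (\<eta> n) = h n ^ (?d + 3)" if "0 < h n" for n
  proof (rule real_sqrt_unique)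
    show "(h n ^ (?d + 3))\<^sup>2 = \<eta> n" unfolding \<eta>_def power_mult[symmetric] mult.commute[of 2] ..
  qed (use that in simp)
  have \<eta>_le: "\<eta> n \<le> h n ^ (?d + 3)" "\<eta> n \<le> 1" "0 < \<eta> n" if "0 < h n" "h n \<le> 1" for n
    using that by (auto simp: \<eta>_def intro!: power_decreasing power_le_one)
  have ev_good: "\<forall>\<^sub>F n in sequentially. good n"
  proof -
    have "(\<lambda>n. h n ^ (2 * (?d + 3))) \<longlonglongrightarrow> 0 ^ (2 * (?d + 3))" by (intro tendsto_power S.h_lim)
    moreover have "(0 :: real) ^ (2 * (?d + 3)) = 0" by (intro zero_power) simp
    ultimately have \<eta>0: "\<eta> \<longlonglongrightarrow> 0" unfolding \<eta>_def[abs_def] by (simp only:)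
    have "\<forall>\<^sub>F n in sequentially. sqrt (\<eta> n) < 1/100"
      using order_tendstoD(2)[OF tendsto_real_sqrt[OF \<eta>0], of "1/100"] by simp
    moreover have "\<forall>\<^sub>F n in sequentially. 2 * cs * \<eta> n < 1"
      using order_tendstoD(2)[OF tendsto_mult_left[OF \<eta>0, of "2 * cs"], of 1] by simp
    moreover have "\<forall>\<^sub>F n in sequentially. 1 \<le> n \<and> 0 < h n \<and> h n < 1" by (rule S.eventually_h) simp
    ultimately show ?thesis by eventually_elim (auto simp: good_def)
  qed
  \<comment> \<open>Empty for the finitely many bad n, so that measurability and boundedness on the
    net hold for every n.\<close>
  define N where "N n = (if good n then SOME N. finite N \<and> N \<subseteq> M \<and> real (card N) * \<eta> n ^ CARD('m) \<le> cN \<and> (\<forall>x\<in>M. \<exists>y\<in>N. norm (x - y) \<le> \<eta> n) else {})" for n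
  have N: "finite (N n) \<and> N n \<subseteq> M \<and> real (card (N n)) * \<eta> n ^ CARD('m) \<le> cN \<and> (\<forall>x\<in>M. \<exists>y\<in>N n. norm (x - y) \<le> \<eta> n)" if "good n" for n
  proof -
    have "0 < h n" "h n \<le> 1" using that by (auto simp: good_def)
    then show ?thesis unfolding N_def using that someI_ex[OF net[of "\<eta> n"]] \<eta>_le[of n] by simp
  qed
  have N_good: "good n" "x \<in> M" if "x \<in> N n" for n x
    using that N[of n] by (auto simp: N_def split: if_splits)
  define \<Phi> where "\<Phi> n x y = K (norm (x - y) / h n) * g (y - x)" for n and x y :: "real^'m"
  \<comment> \<open>Bounds the change of \<open>K\<close> when the centre moves by at most \<eta>.
    The indicator cuts out the region of \<open>shell_uniform\<close>; farther points are left to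
    the decay of \<open>K\<close>.\<close>
  define W where "W n x y = measure \<nu> {(norm (y - x) - 2 * \<eta> n) / h n<..(norm (y - x) + \<eta> n) / h n} * indicator {y. cs * norm (y - x) < 1} y" for n and x y :: "real^'m"
  have \<Phi>_meas [measurable]: "\<Phi> n x \<in> borel_measurable \<mu>" for n x
    unfolding \<Phi>_def[abs_def] by (rule borel_to_\<mu>) measurable
  have W_meas: "W n x \<in> borel_measurable \<mu>" if "good n" for n x
  proof (rule borel_to_\<mu>)
    have hn: "0 < h n" "0 < \<eta> n" using that \<eta>_le(3)[of n] by (auto simp: good_def)
    have "(norm (y - x) - 2 * \<eta> n) / h n \<le> (norm (y - x) + \<eta> n) / h n" for y
      using hn by (intro divide_right_mono) auto
    note measure_interval_diff[OF this]
    then have "W n x = (\<lambda>y. (measure \<nu> {..(norm (y - x) + \<eta> n) / h n} - measure \<nu> {..(norm (y - x) - 2 * \<eta> n) / h n}) * indicator {y. cs * norm (y - x) < 1} y)"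
      by (auto simp: W_def fun_eq_iff)
    also have "\<dots> \<in> borel_measurable borel" by measurable
    finally show "W n x \<in> borel_measurable borel" .
  qed
  have \<Phi>_le: "\<bar>\<Phi> n x y\<bar> \<le> V * (G * d)" if "0 < h n" "x \<in> M" "y \<in> M" for n x y
  proof -
    have "\<bar>g (y - x)\<bar> \<le> G * d" using g_le[OF diam[OF that(2,3)]] mult_left_mono[OF diam[OF that(2,3)] G] by linarith
    then show ?thesis unfolding \<Phi>_def abs_mult using K_le[of "norm (x - y) / h n"] that(1) V0 by (intro mult_mono) auto
  qed
  have W_le: "0 \<le> W n x y" "W n x y \<le> V" for n x y
  proof -
    show "0 \<le> W n x y" by (simp add: W_def)
    have "measure \<nu> A \<le> V" for A unfolding V_def
      by (cases "A \<in> sets \<nu>") (auto intro!: finite_measure.finite_measure_mono[OF finite_\<nu>] simp: measure_notin_sets)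
    then show "W n x y \<le> V" using V0 by (auto simp: W_def indicator_def)
  qed
  have int_W: "integrable L (W n x)" if "good n" for n x
    using W_meas[OF that] W_le by (intro integrable_const_bound[where B = V]) (auto intro!: AE_I2 simp: measurable_cong_sets[OF sets_L refl])
  have nn_W: "(\<integral>\<^sup>+ y. ennreal \<bar>W n x y\<bar> \<partial>L) \<le> ennreal (cs * h n ^ (?d + 3))" if "good n" "x \<in> M" for n x
  proof -
    have hn: "0 < h n" "0 < \<eta> n" "sqrt (\<eta> n) \<le> 1/100" using that \<eta>_le(3)[of n] by (auto simp: good_def)
    have "(\<integral>\<^sup>+ y. ennreal \<bar>W n x y\<bar> \<partial>L) = (\<integral>\<^sup>+ y. ennreal (measure \<nu> {(norm (y - x) - 2 * \<eta> n) / h n<..(norm (y - x) + \<eta> n) / h n}) * indicator {y. cs * norm (y - x) < 1} y \<partial>L)"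
      by (intro nn_integral_cong) (auto simp: W_def indicator_def)
    also have "\<dots> \<le> ennreal (cs * sqrt (\<eta> n))" by (rule shell[OF that(2) hn])
    finally show ?thesis by (simp add: sqrt_\<eta>[OF hn(1)])
  qed
  have EW: "(\<integral>y. W n x y \<partial>L) \<le> cs * h n ^ (?d + 3)" if "good n" "x \<in> M" for n x
    using abs_integral_le[OF int_W[OF that(1)] nn_W[OF that]] cs that by (auto simp: good_def)
  have int_\<Phi>: "integrable L (\<Phi> n x)" if "0 < h n" "x \<in> M" for n x
    using \<Phi>_le[OF that] by (intro integrable_const_bound[where B = "V * (G * d)"]) (auto intro!: AE_I2 simp: space_L)
  have var1: "(\<integral>y. (\<Phi> n x y)\<^sup>2 \<partial>L) \<le> (V * G\<^sup>2 * ct) * h n ^ (?d + 2)" if "good n" "x \<in> M" for n x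
  proof -
    have hn: "0 < h n" "h n \<le> 1" using that by (auto simp: good_def)
    have int: "integrable L (\<lambda>y. (\<Phi> n x y)\<^sup>2)"
    proof (rule integrable_const_bound[where B = "(V * (G * d))\<^sup>2"])
      show "AE y in L. norm ((\<Phi> n x y)\<^sup>2) \<le> (V * (G * d))\<^sup>2"
      proof (rule AE_I2)
        fix y assume "y \<in> space L"
        then have "\<bar>\<Phi> n x y\<bar> ^ 2 \<le> (V * (G * d)) ^ 2" using \<Phi>_le[OF hn(1) that(2)] by (intro power_mono) (auto simp: space_L)
        then show "norm ((\<Phi> n x y)\<^sup>2) \<le> (V * (G * d))\<^sup>2" by simp
      qed
    qed measurable
    have "(\<integral>\<^sup>+ y. ennreal \<bar>(\<Phi> n x y)\<^sup>2\<bar> \<partial>L) \<le> (\<integral>\<^sup>+ y. ennreal (V * G\<^sup>2) * ennreal (\<bar>K (norm (x - y) / h n)\<bar> * norm (y - x) ^ 2) \<partial>L)"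
    proof (rule nn_integral_mono)
      fix y assume "y \<in> space L"
      then have y: "norm (y - x) \<le> d" using diam that by (simp add: space_L)
      define k where "k = \<bar>K (norm (x - y) / h n)\<bar>"
      have k: "0 \<le> k" "k \<le> V" using K_le[of "norm (x - y) / h n"] hn by (auto simp: k_def)
      have "\<bar>(\<Phi> n x y)\<^sup>2\<bar> = (k * k) * \<bar>g (y - x)\<bar> ^ 2"
        by (simp add: \<Phi>_def k_def power_mult_distrib flip: power2_eq_square)
      also have "\<dots> \<le> (V * k) * (G * norm (y - x)) ^ 2"
        using k g_le[OF y] V0 by (intro mult_mono power_mono mult_right_mono) auto
      also have "\<dots> = (V * G\<^sup>2) * (k * norm (y - x) ^ 2)" by (simp add: power_mult_distrib)
      finally have "ennreal \<bar>(\<Phi> n x y)\<^sup>2\<bar> \<le> ennreal ((V * G\<^sup>2) * (k * norm (y - x) ^ 2))" by (rule ennreal_leI)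
      also have "\<dots> = ennreal (V * G\<^sup>2) * ennreal (k * norm (y - x) ^ 2)" using V0 k by (intro ennreal_mult) auto
      finally show "ennreal \<bar>(\<Phi> n x y)\<^sup>2\<bar> \<le> ennreal (V * G\<^sup>2) * ennreal (\<bar>K (norm (x - y) / h n)\<bar> * norm (y - x) ^ 2)" by (simp add: k_def)
    qed
    also have "\<dots> = ennreal (V * G\<^sup>2) * (\<integral>\<^sup>+ y. ennreal (\<bar>K (norm (x - y) / h n)\<bar> * norm (y - x) ^ 2) \<partial>L)"
    proof (rule nn_integral_cmult)
      have "(\<lambda>y. \<bar>K (norm (x - y) / h n)\<bar> * norm (y - x) ^ 2) \<in> borel_measurable \<mu>" by (rule borel_to_\<mu>) measurable
      then show "(\<lambda>y. ennreal (\<bar>K (norm (x - y) / h n)\<bar> * norm (y - x) ^ 2)) \<in> borel_measurable L" by measurable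
    qed
    also have "\<dots> \<le> ennreal (V * G\<^sup>2) * ennreal (ct * h n ^ (?d + 2))"
      using tail[OF that(2) hn, of 2] by (intro mult_left_mono) auto
    also have "\<dots> = ennreal (V * G\<^sup>2 * (ct * h n ^ (?d + 2)))" using V0 ct hn by (intro ennreal_mult[symmetric]) auto
    finally have "\<bar>\<integral>y. (\<Phi> n x y)\<^sup>2 \<partial>L\<bar> \<le> V * G\<^sup>2 * (ct * h n ^ (?d + 2))"
      using V0 ct hn by (intro abs_integral_le[OF int]) auto
    then show ?thesis by (simp add: mult.assoc)
  qed
  have var2: "(\<integral>y. (W n x y)\<^sup>2 \<partial>L) \<le> (V * cs) * h n ^ (?d + 2)" if "good n" "x \<in> M" for n x
  proof -
    have hn: "0 < h n" "h n \<le> 1" using that by (auto simp: good_def)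
    have "(\<integral>y. (W n x y)\<^sup>2 \<partial>L) \<le> (\<integral>y. V * W n x y \<partial>L)"
    proof (rule integral_mono')
      show "integrable L (\<lambda>y. V * W n x y)" using int_W[OF that(1)] by simp
      fix y
      show "(W n x y)\<^sup>2 \<le> V * W n x y" using W_le[of n x y] by (simp add: power2_eq_square mult_right_mono)
      then show "0 \<le> V * W n x y" using W_le[of n x y] V0 by simp
    qed
    also have "\<dots> = V * (\<integral>y. W n x y \<partial>L)" by simp
    also have "\<dots> \<le> V * (cs * h n ^ (?d + 3))" using EW[OF that] V0 by (intro mult_left_mono) auto
    also have "\<dots> \<le> V * (cs * h n ^ (?d + 2))" using hn cs V0 by (intro mult_left_mono power_decreasing) auto
    finally show ?thesis by (simp add: mult.assoc)
  qed
  have cardN: "\<forall>\<^sub>F n in sequentially. finite (N n) \<and> real (card (N n)) * h n ^ (2 * (?d + 3) * CARD('m)) \<le> cN"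
    using ev_good
  proof eventually_elim
    case (elim n)
    have "\<eta> n ^ CARD('m) = h n ^ (2 * (?d + 3) * CARD('m))" unfolding \<eta>_def by (rule power_mult[symmetric])
    then show ?case using N[OF elim] by simp
  qed
  have sp: "y \<in> M" if "y \<in> space \<mu>" for y using that by (simp add: space_\<mu>)
  have "\<exists>A\<ge>0. AE \<omega> in P. \<forall>\<^sub>F n in sequentially. \<forall>x\<in>N n.
    \<bar>(\<Sum>i=1..n. \<Phi> n x (X i \<omega>)) - real n * (\<integral>y. \<Phi> n x y \<partial>L)\<bar> \<le> real n * (A * h n ^ (?d + 2) * S.rate n)"
  proof (rule S.deviation_AE[where b = "V * (G * d)" and v = "V * G\<^sup>2 * ct", OF \<Phi>_meas _ _ cardN])
    show "\<bar>\<Phi> n x y\<bar> \<le> V * (G * d)" if "x \<in> N n" "y \<in> space \<mu>" for n x y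
      using N_good[OF that(1)] \<Phi>_le sp[OF that(2)] by (auto simp: good_def)
    show "\<forall>\<^sub>F n in sequentially. \<forall>x\<in>N n. (\<integral>y. (\<Phi> n x y)\<^sup>2 \<partial>L) \<le> V * G\<^sup>2 * ct * h n ^ (?d + 2)"
      using N_good by (intro always_eventually allI ballI var1) auto
  qed
  then obtain A1 where A1: "0 \<le> A1" and dev1: "AE \<omega> in P. \<forall>\<^sub>F n in sequentially. \<forall>x\<in>N n.
    \<bar>(\<Sum>i=1..n. \<Phi> n x (X i \<omega>)) - real n * (\<integral>y. \<Phi> n x y \<partial>L)\<bar> \<le> real n * (A1 * h n ^ (?d + 2) * S.rate n)" by blast
  have "\<exists>A\<ge>0. AE \<omega> in P. \<forall>\<^sub>F n in sequentially. \<forall>x\<in>N n.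
    \<bar>(\<Sum>i=1..n. W n x (X i \<omega>)) - real n * (\<integral>y. W n x y \<partial>L)\<bar> \<le> real n * (A * h n ^ (?d + 2) * S.rate n)"
  proof (rule S.deviation_AE[where b = V and v = "V * cs", OF _ _ _ cardN])
    show "W n x \<in> borel_measurable \<mu>" if "x \<in> N n" for n x using N_good[OF that] W_meas by blast
    show "\<bar>W n x y\<bar> \<le> V" for n x y using W_le[of n x y] by simp
    show "\<forall>\<^sub>F n in sequentially. \<forall>x\<in>N n. (\<integral>y. (W n x y)\<^sup>2 \<partial>L) \<le> V * cs * h n ^ (?d + 2)"
      using N_good by (intro always_eventually allI ballI var2) auto
  qed
  then obtain A2 where A2: "0 \<le> A2" and dev2: "AE \<omega> in P. \<forall>\<^sub>F n in sequentially. \<forall>x\<in>N n.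
    \<bar>(\<Sum>i=1..n. W n x (X i \<omega>)) - real n * (\<integral>y. W n x y \<partial>L)\<bar> \<le> real n * (A2 * h n ^ (?d + 2) * S.rate n)" by blast
  \<comment> \<open>The first summand accounts for the variation of \<open>g\<close> where
    \<open>W\<close> acts. The second bounds the summands at both centres where \<open>W\<close> is
    cut off, through the decay of \<open>K\<close> at distances of at least 1 / (2 cs).\<close>
  define c5 where "c5 = V * G + 2 * (2 ^ (?d + 3) * Mom * (2 * cs) ^ (?d + 3) * (G * d))"
  have c5: "0 \<le> c5" using V0 G Mom0 cs d by (simp add: c5_def)
  have bracket: "\<bar>\<Phi> n x y - \<Phi> n x' y\<bar> \<le> G * d * W n x' y + c5 * h n ^ (?d + 3)"
    if n: "good n" and M: "x \<in> M" "x' \<in> M" "y \<in> M" and close: "norm (x - x') \<le> \<eta> n" for n x x' y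
  proof -
    have hn: "0 < h n" "h n \<le> 1" "0 < \<eta> n" "2 * cs * \<eta> n \<le> 1" "\<eta> n \<le> h n ^ (?d + 3)" using n \<eta>_le[of n] by (auto simp: good_def)
    define r where "r = norm (x - y)"
    define r' where "r' = norm (y - x')"
    have r': "norm (x' - y) = r'" by (simp add: r'_def norm_minus_commute)
    have rr: "\<bar>r - r'\<bar> \<le> \<eta> n"
    proof -
      have "\<bar>norm (x - y) - norm (x' - y)\<bar> \<le> norm ((x - y) - (x' - y))" by (rule norm_triangle_ineq3)
      then show ?thesis using close by (simp add: r_def r')
    qed
    have nonneg: "0 \<le> r" "0 \<le> r'" by (auto simp: r_def r'_def)
    have gx: "\<bar>g (y - x)\<bar> \<le> G * d" if "x \<in> M" for x
      using g_le[OF diam[OF that M(3)]] mult_left_mono[OF diam[OF that M(3)] G] by linarith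
    show ?thesis
    proof (cases "cs * norm (y - x') < 1")
      case True
      have Kd: "\<bar>K (r / h n) - K (r' / h n)\<bar> \<le> measure \<nu> {(r' - 2 * \<eta> n) / h n<..(r' + \<eta> n) / h n}"
        using rr hn nonneg by (intro K_diff divide_strict_right_mono divide_right_mono) (auto simp: abs_le_iff)
      have W: "measure \<nu> {(r' - 2 * \<eta> n) / h n<..(r' + \<eta> n) / h n} = W n x' y" using True by (simp add: W_def r'_def)
      have gd: "\<bar>g (y - x) - g (y - x')\<bar> \<le> G * \<eta> n"
        using g_lip[OF diam[OF M(1,3)] diam[OF M(2,3)]] mult_left_mono[OF close G] by (simp add: norm_minus_commute)
      have "\<Phi> n x y - \<Phi> n x' y = (K (r / h n) - K (r' / h n)) * g (y - x) + K (r' / h n) * (g (y - x) - g (y - x'))"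
        by (simp add: \<Phi>_def r_def r'[symmetric] algebra_simps)
      then have "\<bar>\<Phi> n x y - \<Phi> n x' y\<bar> \<le> \<bar>K (r / h n) - K (r' / h n)\<bar> * \<bar>g (y - x)\<bar> + \<bar>K (r' / h n)\<bar> * \<bar>g (y - x) - g (y - x')\<bar>"
        by (metis abs_mult abs_triangle_ineq)
      also have "\<dots> \<le> W n x' y * (G * d) + V * (G * \<eta> n)"
        using Kd[unfolded W] gx[OF M(1)] gd K_le[of "r' / h n"] nonneg hn V0 W_le(1)[of n x' y]
        by (intro add_mono mult_mono) auto
      also have "V * (G * \<eta> n) \<le> V * (G * h n ^ (?d + 3))" using V0 G hn by (intro mult_left_mono) auto
      also have "\<dots> \<le> c5 * h n ^ (?d + 3)"
      proof -
        have "V * G \<le> c5" using Mom0 cs G d by (simp add: c5_def)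
        then show ?thesis unfolding mult.assoc[symmetric] using hn by (intro mult_right_mono) auto
      qed
      finally show ?thesis by (simp add: mult.commute)
    next
      case False
      then have f: "1 \<le> cs * r'" by (simp add: r'_def)
      have decay: "\<bar>K (\<rho> / h n)\<bar> \<le> 2 ^ (?d + 3) * Mom * (2 * cs) ^ (?d + 3) * h n ^ (?d + 3)" if \<rho>: "1 \<le> 2 * cs * \<rho>" "0 \<le> \<rho>" for \<rho>
      proof -
        have \<rho>0: "0 < \<rho>" using \<rho> by (cases "\<rho> = 0") auto
        have "\<bar>K (\<rho> / h n)\<bar> \<le> 2 ^ (?d + 3) * Mom / (\<rho> / h n) ^ (?d + 3)" using \<rho>0 hn by (intro K_decay) auto
        also have "\<dots> = 2 ^ (?d + 3) * Mom * (1 / \<rho>) ^ (?d + 3) * h n ^ (?d + 3)" by (simp add: power_divide)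
        also have "\<dots> \<le> 2 ^ (?d + 3) * Mom * (2 * cs) ^ (?d + 3) * h n ^ (?d + 3)"
          using \<rho> \<rho>0 Mom0 hn by (intro mult_right_mono mult_left_mono power_mono) (auto simp: field_simps)
        finally show ?thesis .
      qed
      define q where "q = 2 ^ (?d + 3) * Mom * (2 * cs) ^ (?d + 3) * h n ^ (?d + 3)"
      \<comment> \<open>The condition 2 cs \<eta> \<le> 1 carries the lower bound from the net point
        over to the other centre at the cost of a factor 2.\<close>
      have "cs * r' \<le> cs * (r + \<eta> n)" using rr cs by (intro mult_left_mono) auto
      then have r2: "1 \<le> 2 * cs * r" using f hn(4) by (simp add: distrib_left)
      have r2': "1 \<le> 2 * cs * r'" using f by simp
      have "\<bar>\<Phi> n x y - \<Phi> n x' y\<bar> \<le> \<bar>K (r / h n)\<bar> * \<bar>g (y - x)\<bar> + \<bar>K (r' / h n)\<bar> * \<bar>g (y - x')\<bar>"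
        unfolding \<Phi>_def r_def[symmetric] r' abs_mult[symmetric] by (rule abs_triangle_ineq4)
      also have "\<dots> \<le> q * (G * d) + q * (G * d)"
        unfolding q_def using decay[OF r2 nonneg(1)] decay[OF r2' nonneg(2)] gx[OF M(1)] gx[OF M(2)] Mom0 cs hn
        by (intro add_mono mult_mono) auto
      also have "\<dots> = 2 * (2 ^ (?d + 3) * Mom * (2 * cs) ^ (?d + 3) * (G * d)) * h n ^ (?d + 3)"
        by (simp add: q_def mult_ac)
      also have "\<dots> \<le> c5 * h n ^ (?d + 3)" using V0 G hn by (intro mult_right_mono) (auto simp: c5_def)
      finally show ?thesis using W_le(1)[of n x' y] G d by (simp add: add_increasing)
    qed
  qed
  \<comment> \<open>\<open>A1\<close> is the deviation at the net point and G d A2 that of the shell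
    sum. The terms with \<open>cs\<close> and \<open>c5\<close> are doubled because the comparison
    is made once for the sample sum and once for the mean.\<close>
  define A where "A = A1 + G * d * A2 + 2 * (G * d * cs) + 2 * c5"
  have "AE \<omega> in P. \<forall>\<^sub>F n in sequentially. \<forall>x\<in>M.
    \<bar>(\<Sum>i=1..n. \<Phi> n x (X i \<omega>)) - real n * (\<integral>y. \<Phi> n x y \<partial>L)\<bar> \<le> real n * (A * h n ^ (?d + 2) * S.rate n)"
    using dev1 dev2 AE_space
  proof eventually_elim
    case (elim \<omega>)
    have XM: "X i \<omega> \<in> M" if "1 \<le> i" for i
    proof -
      have "X i \<in> measurable P \<mu>" using S.indep_X that unfolding S.P.indep_vars_def by auto
      from measurable_space[OF this elim(3)] show ?thesis by (rule sp)
    qed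
    have "\<forall>\<^sub>F n in sequentially. 1 \<le> n \<and> 0 < h n \<and> h n < 1" by (rule S.eventually_h) simp
    with elim(1,2) ev_good show ?case
    proof eventually_elim
      case (elim n)
      have n: "1 \<le> n" "0 < h n" "h n < 1" using elim(4) by auto
      define R where "R = h n ^ (?d + 2) * S.rate n"
      have hR: "h n ^ (?d + 3) \<le> R"
      proof -
        have "h n ^ (?d + 3) = h n ^ (?d + 2) * h n" by (simp add: numeral_3_eq_3)
        also have "\<dots> \<le> R" unfolding R_def using S.rate_facts(1)[OF n] n by (intro mult_left_mono) auto
        finally show ?thesis .
      qed
      show ?case
      proof
        fix x assume x: "x \<in> M"
        obtain x' where x': "x' \<in> N n" "norm (x - x') \<le> \<eta> n" using N[OF elim(3)] x by blast
        have x'M: "x' \<in> M" using N_good(2)[OF x'(1)] .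
        note br = bracket[OF elim(3) x x'M _ x'(2)]
        note i1 = int_\<Phi>[OF n(2) x] and i2 = int_\<Phi>[OF n(2) x'M] and i3 = int_W[OF elim(3), of x']
        define q where "q = c5 * h n ^ (?d + 3)"
        define SW where "SW = (\<Sum>i=1..n. W n x' (X i \<omega>))"
        define IW where "IW = (\<integral>y. W n x' y \<partial>L)"
        have a: "\<bar>(\<Sum>i=1..n. \<Phi> n x' (X i \<omega>)) - real n * (\<integral>y. \<Phi> n x' y \<partial>L)\<bar> \<le> real n * (A1 * R)"
          using elim(1) x'(1) by (simp add: R_def mult.assoc)
        have b: "\<bar>SW - real n * IW\<bar> \<le> real n * (A2 * R)"
          using elim(2) x'(1) by (simp add: R_def SW_def IW_def mult.assoc)
        have "\<bar>(\<Sum>i=1..n. \<Phi> n x (X i \<omega>)) - (\<Sum>i=1..n. \<Phi> n x' (X i \<omega>))\<bar> \<le> (\<Sum>i=1..n. \<bar>\<Phi> n x (X i \<omega>) - \<Phi> n x' (X i \<omega>)\<bar>)"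
          unfolding sum_subtractf[symmetric] by (rule sum_abs)
        also have "\<dots> \<le> (\<Sum>i=1..n. G * d * W n x' (X i \<omega>) + q)" unfolding q_def by (intro sum_mono br XM) simp
        also have "\<dots> = G * d * SW + real n * q" by (simp add: sum.distrib sum_distrib_left SW_def)
        finally have c: "\<bar>(\<Sum>i=1..n. \<Phi> n x (X i \<omega>)) - (\<Sum>i=1..n. \<Phi> n x' (X i \<omega>))\<bar> \<le> G * d * SW + real n * q" .
        have "\<bar>(\<integral>y. \<Phi> n x y \<partial>L) - (\<integral>y. \<Phi> n x' y \<partial>L)\<bar> = \<bar>\<integral>y. \<Phi> n x y - \<Phi> n x' y \<partial>L\<bar>"
          using i1 i2 by simp
        also have "\<dots> \<le> (\<integral>y. \<bar>\<Phi> n x y - \<Phi> n x' y\<bar> \<partial>L)" by (rule integral_abs_bound)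
        also have "\<dots> \<le> (\<integral>y. G * d * W n x' y + q \<partial>L)"
          using i1 i2 i3 br by (intro integral_mono) (auto simp: q_def space_L)
        also have "\<dots> = G * d * IW + q" using i3 prob_space by (simp add: IW_def)
        finally have "real n * \<bar>(\<integral>y. \<Phi> n x y \<partial>L) - (\<integral>y. \<Phi> n x' y \<partial>L)\<bar> \<le> real n * (G * d * IW + q)" by (intro mult_left_mono) auto
        then have e: "\<bar>real n * (\<integral>y. \<Phi> n x y \<partial>L) - real n * (\<integral>y. \<Phi> n x' y \<partial>L)\<bar> \<le> real n * (G * d * IW + q)"
          by (simp add: abs_mult flip: right_diff_distrib)
        have SWle: "G * d * SW \<le> G * d * (real n * IW + real n * (A2 * R))" using b G d by (intro mult_left_mono) auto
        have "IW \<le> cs * R" using EW[OF elim(3) x'M] mult_left_mono[OF hR cs] by (simp add: IW_def)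
        then have IWle: "real n * (G * d * IW) \<le> real n * (G * d * (cs * R))" using G d by (intro mult_left_mono) auto
        have qle: "real n * q \<le> real n * (c5 * R)" unfolding q_def using hR c5 by (intro mult_left_mono) auto
        have "\<bar>(\<Sum>i=1..n. \<Phi> n x (X i \<omega>)) - real n * (\<integral>y. \<Phi> n x y \<partial>L)\<bar>
          \<le> real n * (A1 * R) + (G * d * SW + real n * q) + real n * (G * d * IW + q)"
          using a c e by linarith
        also have "\<dots> \<le> real n * (A1 * R) + G * d * (real n * IW + real n * (A2 * R)) + real n * (G * d * IW) + 2 * (real n * q)"
          using SWle by (simp only: distrib_left)
        also have "\<dots> = real n * (A1 * R) + real n * (G * d * A2 * R) + 2 * (real n * (G * d * IW)) + 2 * (real n * q)"
          by (simp add: algebra_simps)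
        also have "\<dots> \<le> real n * (A1 * R) + real n * (G * d * A2 * R) + 2 * (real n * (G * d * (cs * R))) + 2 * (real n * (c5 * R))"
          using IWle qle by linarith
        also have "\<dots> = real n * (A * R)" by (simp add: A_def algebra_simps)
        finally show "\<bar>(\<Sum>i=1..n. \<Phi> n x (X i \<omega>)) - real n * (\<integral>y. \<Phi> n x y \<partial>L)\<bar> \<le> real n * (A * h n ^ (?d + 2) * S.rate n)"
          by (simp add: R_def mult.assoc)
      qed
    qed
  qed
  moreover have "0 \<le> A" using A1 A2 G d cs c5 by (simp add: A_def)
  ultimately show ?thesis unfolding \<Phi>_def by blast
qed

end

context sampled_manifold
begin

text \<open>The coefficients of the ambient expansion depend on x and f but enter linearly and are
  bounded by c. Hence the final constant is c times deviation and tail constants that are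
  independent of f, plus the bias constant.\<close>

lemma operator_deviation:
  assumes iid: "iid_sampling P L \<mu> X h CARD('d)" and K_nonneg: "\<And>a. 0 \<le> a \<Longrightarrow> 0 \<le> K a"
  shows "AE \<omega> in P. \<forall>f. Ck_manifold TYPE('d) 3 M f \<longrightarrow> (\<exists>C\<ge>0. \<forall>\<^sub>F n in sequentially. \<forall>x\<in>M.
    \<bar>kernel_operator TYPE('d) K (h n) n (\<lambda>i. X i \<omega>) f x - limit_operator TYPE('d) K M p f x\<bar> \<le> C * iid_sampling.rate h CARD('d) n)"
proof -
  interpret S: iid_sampling P L \<mu> X h "CARD('d)" by (rule iid)
  let ?d = "CARD('d)"
  define dm where "dm = diameter M"
  have diam: "norm (y - x) \<le> dm" if "x \<in> M" "y \<in> M" for x y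
    using diameter_bounded_bound[OF compact_imp_bounded[OF compact_M] that(2,1)] by (simp add: dm_def dist_norm)
  have dm: "0 \<le> dm" using M_nonempty diam by fastforce
  define dev where "dev \<omega> n x g = (\<Sum>i=1..n. K (norm (x - X i \<omega>) / h n) * g (X i \<omega> - x)) - real n * (\<integral>y. K (norm (x - y) / h n) * g (y - x) \<partial>L)"
    for \<omega> n and x :: "real^'m" and g :: "real^'m \<Rightarrow> real"
  have uniform: "\<exists>A\<ge>0. AE \<omega> in P. \<forall>\<^sub>F n in sequentially. \<forall>x\<in>M. \<bar>dev \<omega> n x g\<bar> \<le> real n * (A * h n ^ (?d + 2) * S.rate n)"
    if "0 \<le> G" "g \<in> borel_measurable borel" "\<And>z. norm z \<le> dm \<Longrightarrow> \<bar>g z\<bar> \<le> G * norm z"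
      "\<And>z z'. norm z \<le> dm \<Longrightarrow> norm z' \<le> dm \<Longrightarrow> \<bar>g z - g z'\<bar> \<le> G * norm (z - z')" for G g
    using deviation_uniform[OF iid diam that] unfolding dev_def .
  have "\<exists>A\<ge>0. AE \<omega> in P. \<forall>\<^sub>F n in sequentially. \<forall>x\<in>M. \<bar>dev \<omega> n x (\<lambda>z. z $ j)\<bar> \<le> real n * (A * h n ^ (?d + 2) * S.rate n)" for j
  proof (rule uniform[of "1"])
    show "\<bar>z $ j - z' $ j\<bar> \<le> 1 * norm (z - z')" for z z' :: "real^'m" using component_le_norm_cart[of "z - z'" j] by simp
  qed (use component_le_norm_cart in auto)
  then have "\<exists>A1. \<forall>j. 0 \<le> A1 j \<and> (AE \<omega> in P. \<forall>\<^sub>F n in sequentially. \<forall>x\<in>M. \<bar>dev \<omega> n x (\<lambda>z. z $ j)\<bar> \<le> real n * (A1 j * h n ^ (?d + 2) * S.rate n))"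
    by (intro choice) blast
  then obtain A1 where A1: "\<And>j. 0 \<le> A1 j" and dev1: "\<And>j. AE \<omega> in P. \<forall>\<^sub>F n in sequentially. \<forall>x\<in>M. \<bar>dev \<omega> n x (\<lambda>z. z $ j)\<bar> \<le> real n * (A1 j * h n ^ (?d + 2) * S.rate n)"
    by blast
  have "\<exists>A\<ge>0. AE \<omega> in P. \<forall>\<^sub>F n in sequentially. \<forall>x\<in>M. \<bar>dev \<omega> n x (\<lambda>z. z $ fst jk * z $ snd jk)\<bar> \<le> real n * (A * h n ^ (?d + 2) * S.rate n)" for jk
  \<comment> \<open>A product of two coordinates has Lipschitz constant at most 2 dm on the ball of
    radius dm.\<close>
  proof (rule uniform[of "2 * dm"])
    show "\<bar>z $ fst jk * z $ snd jk\<bar> \<le> 2 * dm * norm z" if "norm z \<le> dm" for z :: "real^'m"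
    proof -
      have "\<bar>z $ fst jk\<bar> * \<bar>z $ snd jk\<bar> \<le> dm * norm z"
        using that component_le_norm_cart[of z] dm by (intro mult_mono) (auto intro: order_trans)
      moreover have "0 \<le> dm * norm z" using dm by simp
      ultimately show ?thesis unfolding abs_mult by linarith
    qed
    show "\<bar>z $ fst jk * z $ snd jk - z' $ fst jk * z' $ snd jk\<bar> \<le> 2 * dm * norm (z - z')" if z: "norm z \<le> dm" "norm z' \<le> dm" for z z' :: "real^'m"
    proof -
      have "z $ fst jk * z $ snd jk - z' $ fst jk * z' $ snd jk = z $ fst jk * (z - z') $ snd jk + (z - z') $ fst jk * z' $ snd jk"
        by (simp add: algebra_simps)
      then have "\<bar>z $ fst jk * z $ snd jk - z' $ fst jk * z' $ snd jk\<bar> \<le> \<bar>z $ fst jk\<bar> * \<bar>(z - z') $ snd jk\<bar> + \<bar>(z - z') $ fst jk\<bar> * \<bar>z' $ snd jk\<bar>"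
        by (metis abs_mult abs_triangle_ineq)
      also have "\<dots> \<le> dm * norm (z - z') + norm (z - z') * dm"
      proof (intro add_mono mult_mono dm norm_ge_zero abs_ge_zero component_le_norm_cart)
        show "\<bar>z $ fst jk\<bar> \<le> dm" "\<bar>z' $ snd jk\<bar> \<le> dm"
          using z component_le_norm_cart order_trans by blast+
      qed
      finally show ?thesis by simp
    qed
  qed (use dm in auto)
  then have "\<exists>A2. \<forall>jk. 0 \<le> A2 jk \<and> (AE \<omega> in P. \<forall>\<^sub>F n in sequentially. \<forall>x\<in>M. \<bar>dev \<omega> n x (\<lambda>z. z $ fst jk * z $ snd jk)\<bar> \<le> real n * (A2 jk * h n ^ (?d + 2) * S.rate n))"
    by (intro choice) blast
  then obtain A2 where A2: "\<And>jk. 0 \<le> A2 jk" and dev2: "\<And>jk. AE \<omega> in P. \<forall>\<^sub>F n in sequentially. \<forall>x\<in>M. \<bar>dev \<omega> n x (\<lambda>z. z $ fst jk * z $ snd jk)\<bar> \<le> real n * (A2 jk * h n ^ (?d + 2) * S.rate n)"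
    by blast
  have "\<exists>A\<ge>0. AE \<omega> in P. \<forall>\<^sub>F n in sequentially. \<forall>x\<in>M. \<bar>dev \<omega> n x (\<lambda>z. norm z ^ 3)\<bar> \<le> real n * (A * h n ^ (?d + 2) * S.rate n)"
  \<comment> \<open>The Lipschitz constant of the cube on the interval from 0 to dm.\<close>
  proof (rule uniform[of "3 * dm\<^sup>2"])
    show "\<bar>norm z ^ 3\<bar> \<le> 3 * dm\<^sup>2 * norm z" if "norm z \<le> dm" for z :: "real^'m"
    proof -
      have "norm z ^ 2 * norm z \<le> dm\<^sup>2 * norm z" using that by (intro mult_right_mono power_mono) auto
      moreover have "0 \<le> dm\<^sup>2 * norm z" by simp
      moreover have "norm z ^ 3 = norm z ^ 2 * norm z" by (simp add: power2_eq_square power3_eq_cube)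
      ultimately have "norm z ^ 3 \<le> 3 * dm\<^sup>2 * norm z" by linarith
      then show ?thesis by simp
    qed
    show "\<bar>norm z ^ 3 - norm z' ^ 3\<bar> \<le> 3 * dm\<^sup>2 * norm (z - z')" if z: "norm z \<le> dm" "norm z' \<le> dm" for z z' :: "real^'m"
    proof -
      have "norm z ^ 3 - norm z' ^ 3 = (norm z * norm z + norm z * norm z' + norm z' * norm z') * (norm z - norm z')"
        by (simp add: power3_eq_cube algebra_simps)
      then have "\<bar>norm z ^ 3 - norm z' ^ 3\<bar> = \<bar>norm z * norm z + norm z * norm z' + norm z' * norm z'\<bar> * \<bar>norm z - norm z'\<bar>"
        by (simp only: abs_mult)
      also have "\<dots> \<le> (dm * dm + dm * dm + dm * dm) * norm (z - z')"
        using z dm norm_triangle_ineq3[of z z'] unfolding abs_of_nonneg[OF add_nonneg_nonneg[OF add_nonneg_nonneg[OF mult_nonneg_nonneg mult_nonneg_nonneg] mult_nonneg_nonneg], OF norm_ge_zero norm_ge_zero norm_ge_zero norm_ge_zero norm_ge_zero norm_ge_zero]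
        by (intro mult_mono add_mono) auto
      finally show ?thesis by (simp add: power2_eq_square)
    qed
  qed auto
  then obtain A3 where A3: "0 \<le> A3"
    and dev3: "AE \<omega> in P. \<forall>\<^sub>F n in sequentially. \<forall>x\<in>M. \<bar>dev \<omega> n x (\<lambda>z. norm z ^ 3)\<bar> \<le> real n * (A3 * h n ^ (?d + 2) * S.rate n)"
    by blast
  obtain ct where ct: "0 \<le> ct" and tail: "\<And>x h j. x \<in> M \<Longrightarrow> 0 < h \<Longrightarrow> h \<le> 1 \<Longrightarrow> 1 \<le> j \<Longrightarrow> j \<le> 3 \<Longrightarrow>
      (\<integral>\<^sup>+ y. ennreal (\<bar>K (norm (x - y) / h)\<bar> * norm (y - x) ^ j) \<partial>L) \<le> ennreal (ct * h ^ (?d + j))"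
    using tail_uniform by blast
  \<comment> \<open>The finitely many indices move inside the almost sure statement here, and inside
    the quantifier over large n in \<open>E1\<close> and \<open>E2\<close>.\<close>
  have "AE \<omega> in P. \<forall>j. \<forall>\<^sub>F n in sequentially. \<forall>x\<in>M. \<bar>dev \<omega> n x (\<lambda>z. z $ j)\<bar> \<le> real n * (A1 j * h n ^ (?d + 2) * S.rate n)"
    using dev1 by (subst AE_all_countable) blast
  moreover have "AE \<omega> in P. \<forall>jk. \<forall>\<^sub>F n in sequentially. \<forall>x\<in>M. \<bar>dev \<omega> n x (\<lambda>z. z $ fst jk * z $ snd jk)\<bar> \<le> real n * (A2 jk * h n ^ (?d + 2) * S.rate n)"
    using dev2 by (subst AE_all_countable) blast
  ultimately show ?thesis using dev3 AE_space
  proof eventually_elim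
    case (elim \<omega>)
    have XM: "X i \<omega> \<in> M" if "1 \<le> i" for i
    proof -
      have "X i \<in> measurable P \<mu>" using S.indep_X that unfolding S.P.indep_vars_def by auto
      from measurable_space[OF this elim(4)] show ?thesis by (simp add: space_\<mu>)
    qed
    have E1: "\<forall>\<^sub>F n in sequentially. \<forall>j. \<forall>x\<in>M. \<bar>dev \<omega> n x (\<lambda>z. z $ j)\<bar> \<le> real n * (A1 j * h n ^ (?d + 2) * S.rate n)"
      using elim(1) by (intro eventually_all_finite) blast
    have E2: "\<forall>\<^sub>F n in sequentially. \<forall>jk. \<forall>x\<in>M. \<bar>dev \<omega> n x (\<lambda>z. z $ fst jk * z $ snd jk)\<bar> \<le> real n * (A2 jk * h n ^ (?d + 2) * S.rate n)"
      using elim(2) by (intro eventually_all_finite) blast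
    have E4: "\<forall>\<^sub>F n in sequentially. 1 \<le> n \<and> 0 < h n \<and> h n < 1" by (rule S.eventually_h) simp
    show ?case
    proof (intro allI impI)
      fix f assume f: "Ck_manifold TYPE('d) 3 M f"
      obtain cb where cb: "0 \<le> cb" and bias: "\<And>x h. x \<in> M \<Longrightarrow> 0 < h \<Longrightarrow>
        \<bar>(\<integral>y. K (norm (x - y) / h) * (f y - f x) \<partial>L) - h ^ (?d + 2) * limit_operator TYPE('d) K M p f x\<bar> \<le> cb * h ^ (?d + 3)"
        using bias_uniform[OF f] by blast
      obtain c where c: "0 \<le> c" and jet: "\<And>x. x \<in> M \<Longrightarrow> \<exists>a s. linear a \<and> bilinear s \<and> (\<forall>z. \<bar>a z\<bar> \<le> c * norm z) \<and> (\<forall>z v. \<bar>s z v\<bar> \<le> c * norm z * norm v) \<and>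
        (\<forall>y\<in>M. \<bar>f y - f x - a (y - x) - s (y - x) (y - x)\<bar> \<le> c * norm (y - x) ^ 3)"
        using ambient_jet_uniform[OF f] by blast
      obtain cf where cf: "\<And>y. y \<in> M \<Longrightarrow> \<bar>f y\<bar> \<le> cf" using Ck_bounded[OF f[unfolded numeral_3_eq_3]] by blast
      note fm [measurable] = Ck_measurable[OF f[unfolded numeral_3_eq_3]]
      define C where "C = c * ((\<Sum>j\<in>UNIV. A1 j) + (\<Sum>jk\<in>UNIV. A2 jk) + A3 + 2 * ct) + cb"
      have C: "0 \<le> C" using c A1 A2 A3 ct cb by (auto simp: C_def intro!: add_nonneg_nonneg mult_nonneg_nonneg sum_nonneg)
      have "\<forall>\<^sub>F n in sequentially. \<forall>x\<in>M. \<bar>kernel_operator TYPE('d) K (h n) n (\<lambda>i. X i \<omega>) f x - limit_operator TYPE('d) K M p f x\<bar> \<le> C * S.rate n"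
        using E1 E2 elim(3) E4
      proof eventually_elim
        case (elim n)
        have n: "1 \<le> n" "0 < h n" "h n < 1" using elim(4) by auto
        define R where "R = h n ^ (?d + 2) * S.rate n"
        have hR: "h n ^ (?d + 3) \<le> R"
        proof -
          have "h n ^ (?d + 3) = h n ^ (?d + 2) * h n" by (simp add: numeral_3_eq_3)
          also have "\<dots> \<le> R" unfolding R_def using S.rate_facts(1)[OF n] n by (intro mult_left_mono) auto
          finally show ?thesis .
        qed
        have R0: "0 \<le> R" using S.rate_facts(2)[OF n] n by (simp add: R_def)
        show ?case
        proof
          fix x assume x: "x \<in> M"
          obtain a s where a: "linear a" "\<And>z. \<bar>a z\<bar> \<le> c * norm z" and s: "bilinear s" "\<And>z v. \<bar>s z v\<bar> \<le> c * norm z * norm v"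
            and rem: "\<And>y. y \<in> M \<Longrightarrow> \<bar>f y - f x - a (y - x) - s (y - x) (y - x)\<bar> \<le> c * norm (y - x) ^ 3"
            using jet[OF x] by blast
          define k where "k y = K (norm (x - y) / h n)" for y
          have k0: "0 \<le> k y" "k y \<le> V" for y using K_nonneg[of "norm (x - y) / h n"] K_le[of "norm (x - y) / h n"] n by (auto simp: k_def)
          have [measurable]: "k \<in> borel_measurable \<mu>" unfolding k_def[abs_def] by (rule borel_to_\<mu>) measurable
          have meas_g: "(\<lambda>y. g (y - x)) \<in> borel_measurable \<mu>" if "g \<in> borel_measurable borel" for g :: "real^'m \<Rightarrow> real"
            by (rule borel_to_\<mu>) (use that in measurable)
          have int: "integrable L (\<lambda>y. k y * u y)" if [measurable]: "u \<in> borel_measurable \<mu>" and u: "\<And>y. y \<in> M \<Longrightarrow> \<bar>u y\<bar> \<le> b" for u b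
          proof (rule integrable_const_bound[where B = "V * b"])
            show "AE y in L. norm (k y * u y) \<le> V * b"
            proof (rule AE_I2)
              fix y assume "y \<in> space L"
              then have "\<bar>u y\<bar> \<le> b" using u by (simp add: space_L)
              then show "norm (k y * u y) \<le> V * b" using k0[of y] V_nonneg by (simp add: abs_mult mult_mono)
            qed
          qed measurable
          \<comment> \<open>In coordinates, all dependence on f sits in numerical coefficients, and
            what remains are test functions of the displacement alone.\<close>
          define l where "l y = (\<Sum>j\<in>UNIV. a (axis j 1) * (y - x) $ j)" for y
          define q where "q y = (\<Sum>jk\<in>UNIV. s (axis (fst jk) 1) (axis (snd jk) 1) * ((y - x) $ fst jk * (y - x) $ snd jk))" for y
          have l: "a (y - x) = l y" for y
            using linear_euclidean_expansion[OF a(1), of "y - x"] unfolding l_def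
            by (simp add: Basis_vec_def sum.UNION_disjoint axis_eq_axis inner_axis mult.commute)
          have q: "s (y - x) (y - x) = q y" for y
          proof -
            have "s (y - x) (y - x) = (\<Sum>j\<in>UNIV. \<Sum>k\<in>UNIV. s (axis j 1) (axis k 1) * ((y - x) $ j * (y - x) $ k))"
              using bilinear_expansion[OF s(1), of "y - x" "y - x"]
              by (simp add: Basis_vec_def sum.UNION_disjoint axis_eq_axis inner_axis mult_ac)
            then show ?thesis unfolding q_def UNIV_Times_UNIV[symmetric] sum.cartesian_product' by simp
          qed
          define r where "r y = f y - f x - l y - q y" for y
          have r: "\<bar>r y\<bar> \<le> c * norm (y - x) ^ 3" if "y \<in> M" for y using rem[OF that] by (simp add: r_def l q)
          have dec: "f y - f x = l y + q y + r y" for y by (simp add: r_def)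
          have [measurable]: "(\<lambda>y. (y - x) $ j) \<in> borel_measurable borel" for j
            by (intro borel_measurable_continuous_onI continuous_intros)
          have ml [measurable]: "l \<in> borel_measurable \<mu>" "q \<in> borel_measurable \<mu>"
            unfolding l_def[abs_def] q_def[abs_def] by (rule borel_to_\<mu>, measurable)+
          have mr [measurable]: "r \<in> borel_measurable \<mu>" unfolding r_def[abs_def] by measurable
          have comp: "\<bar>(y - x) $ j\<bar> \<le> dm" if "y \<in> M" for y j
            using component_le_norm_cart[of "y - x" j] diam[OF x that] by linarith
          have comp2: "\<bar>(y - x) $ j * (y - x) $ i\<bar> \<le> dm * dm" if "y \<in> M" for y i j
            unfolding abs_mult using comp[OF that] dm by (intro mult_mono) auto
          have i1: "integrable L (\<lambda>y. k y * (y - x) $ j)" for j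
            by (rule int[OF meas_g[of "\<lambda>z. z $ j"] comp]) auto
          have i2: "integrable L (\<lambda>y. k y * ((y - x) $ fst jk * (y - x) $ snd jk))" for jk
            by (rule int[OF meas_g[of "\<lambda>z. z $ fst jk * z $ snd jk"] comp2]) auto
          have i3: "integrable L (\<lambda>y. k y * norm (y - x) ^ 3)"
          proof (rule int[of _ "dm ^ 3", OF meas_g[of "\<lambda>z. norm z ^ 3"]])
            show "\<bar>norm (y - x) ^ 3\<bar> \<le> dm ^ 3" if "y \<in> M" for y
              using diam[OF x that] by (simp add: power_mono)
          qed auto
          have ir: "integrable L (\<lambda>y. k y * r y)"
          proof (rule int[of _ "c * dm ^ 3"])
            show "\<bar>r y\<bar> \<le> c * dm ^ 3" if "y \<in> M" for y
              using r[OF that] mult_left_mono[OF power_mono[OF diam[OF x that], of 3] c] by simp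
          qed measurable
          have kl: "k y * l y = (\<Sum>j\<in>UNIV. a (axis j 1) * (k y * (y - x) $ j))" for y
            by (simp add: l_def sum_distrib_left mult_ac)
          have kq: "k y * q y = (\<Sum>jk\<in>UNIV. s (axis (fst jk) 1) (axis (snd jk) 1) * (k y * ((y - x) $ fst jk * (y - x) $ snd jk)))" for y
            by (simp add: q_def sum_distrib_left mult_ac)
          have il: "integrable L (\<lambda>y. k y * l y)" unfolding kl using i1 by auto
          have iq: "integrable L (\<lambda>y. k y * q y)" unfolding kq using i2 by auto
          define D where "D u = (\<Sum>i=1..n. k (X i \<omega>) * u (X i \<omega>)) - real n * (\<integral>y. k y * u y \<partial>L)" for u
          have Dl: "D l = (\<Sum>j\<in>UNIV. a (axis j 1) * dev \<omega> n x (\<lambda>z. z $ j))"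
          proof -
            have "(\<Sum>i=1..n. k (X i \<omega>) * l (X i \<omega>)) = (\<Sum>j\<in>UNIV. a (axis j 1) * (\<Sum>i=1..n. k (X i \<omega>) * (X i \<omega> - x) $ j))"
              unfolding kl sum_distrib_left by (rule sum.swap)
            moreover have "(\<integral>y. k y * l y \<partial>L) = (\<Sum>j\<in>UNIV. a (axis j 1) * (\<integral>y. k y * (y - x) $ j \<partial>L))"
              unfolding kl using i1 by (subst Bochner_Integration.integral_sum) auto
            ultimately show ?thesis unfolding D_def dev_def k_def
              by (simp add: right_diff_distrib sum_subtractf sum_distrib_left mult_ac)
          qed
          have Dq: "D q = (\<Sum>jk\<in>UNIV. s (axis (fst jk) 1) (axis (snd jk) 1) * dev \<omega> n x (\<lambda>z. z $ fst jk * z $ snd jk))"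
          proof -
            have "(\<Sum>i=1..n. k (X i \<omega>) * q (X i \<omega>)) = (\<Sum>jk\<in>UNIV. s (axis (fst jk) 1) (axis (snd jk) 1) * (\<Sum>i=1..n. k (X i \<omega>) * ((X i \<omega> - x) $ fst jk * (X i \<omega> - x) $ snd jk)))"
              unfolding kq sum_distrib_left by (rule sum.swap)
            moreover have "(\<integral>y. k y * q y \<partial>L) = (\<Sum>jk\<in>UNIV. s (axis (fst jk) 1) (axis (snd jk) 1) * (\<integral>y. k y * ((y - x) $ fst jk * (y - x) $ snd jk) \<partial>L))"
              unfolding kq using i2 by (subst Bochner_Integration.integral_sum) auto
            ultimately show ?thesis unfolding D_def dev_def k_def
              by (simp add: right_diff_distrib sum_subtractf sum_distrib_left mult_ac)
          qed
          have n1: "norm (axis j 1 :: real^'m) = 1" for j by (simp add: norm_axis_1)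
          have Dl_le: "\<bar>D l\<bar> \<le> real n * (c * (\<Sum>j\<in>UNIV. A1 j) * R)"
          proof -
            have "\<bar>D l\<bar> \<le> (\<Sum>j\<in>UNIV. \<bar>a (axis j 1) * dev \<omega> n x (\<lambda>z. z $ j)\<bar>)" unfolding Dl by (rule sum_abs)
            also have "\<dots> \<le> (\<Sum>j\<in>UNIV. c * (real n * (A1 j * R)))"
            proof (rule sum_mono)
              fix j
              have "\<bar>a (axis j 1)\<bar> \<le> c" using a(2)[of "axis j 1"] by (simp add: n1)
              moreover have "\<bar>dev \<omega> n x (\<lambda>z. z $ j)\<bar> \<le> real n * (A1 j * R)" using elim(1) x by (simp add: R_def mult.assoc)
              ultimately show "\<bar>a (axis j 1) * dev \<omega> n x (\<lambda>z. z $ j)\<bar> \<le> c * (real n * (A1 j * R))"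
                unfolding abs_mult using c by (intro mult_mono) auto
            qed
            also have "\<dots> = real n * (c * (\<Sum>j\<in>UNIV. A1 j) * R)" by (simp add: sum_distrib_left sum_distrib_right mult_ac)
            finally show ?thesis .
          qed
          have Dq_le: "\<bar>D q\<bar> \<le> real n * (c * (\<Sum>jk\<in>UNIV. A2 jk) * R)"
          proof -
            have "\<bar>D q\<bar> \<le> (\<Sum>jk\<in>UNIV. \<bar>s (axis (fst jk) 1) (axis (snd jk) 1) * dev \<omega> n x (\<lambda>z. z $ fst jk * z $ snd jk)\<bar>)" unfolding Dq by (rule sum_abs)
            also have "\<dots> \<le> (\<Sum>jk\<in>UNIV. c * (real n * (A2 jk * R)))"
            proof (rule sum_mono)
              fix jk
              have "\<bar>s (axis (fst jk) 1) (axis (snd jk) 1)\<bar> \<le> c" using s(2)[of "axis (fst jk) 1" "axis (snd jk) 1"] by (simp add: n1)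
              moreover have "\<bar>dev \<omega> n x (\<lambda>z. z $ fst jk * z $ snd jk)\<bar> \<le> real n * (A2 jk * R)" using bspec[OF spec[OF elim(2), of jk] x] by (simp only: R_def mult.assoc)
              ultimately show "\<bar>s (axis (fst jk) 1) (axis (snd jk) 1) * dev \<omega> n x (\<lambda>z. z $ fst jk * z $ snd jk)\<bar> \<le> c * (real n * (A2 jk * R))"
                unfolding abs_mult using c by (intro mult_mono) auto
            qed
            also have "\<dots> = real n * (c * (\<Sum>jk\<in>UNIV. A2 jk) * R)" by (simp add: sum_distrib_left sum_distrib_right mult_ac)
            finally show ?thesis .
          qed
          define I3 where "I3 = (\<integral>y. k y * norm (y - x) ^ 3 \<partial>L)"
          define S3 where "S3 = (\<Sum>i=1..n. k (X i \<omega>) * norm (X i \<omega> - x) ^ 3)"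
          have I3: "I3 \<le> ct * R"
          proof -
            have "\<bar>I3\<bar> \<le> ct * h n ^ (?d + 3)" unfolding I3_def
            proof (rule abs_integral_le[OF i3])
              have "(\<integral>\<^sup>+ y. ennreal \<bar>k y * norm (y - x) ^ 3\<bar> \<partial>L) = (\<integral>\<^sup>+ y. ennreal (\<bar>K (norm (x - y) / h n)\<bar> * norm (y - x) ^ 3) \<partial>L)"
                by (simp add: k_def abs_mult)
              also have "\<dots> \<le> ennreal (ct * h n ^ (?d + 3))" using n x by (intro tail) auto
              finally show "(\<integral>\<^sup>+ y. ennreal \<bar>k y * norm (y - x) ^ 3\<bar> \<partial>L) \<le> ennreal (ct * h n ^ (?d + 3))" .
            qed (use ct n in auto)
            then show ?thesis using mult_left_mono[OF hR ct] by linarith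
          qed
          have S3: "S3 \<le> real n * I3 + real n * (A3 * R)"
          proof -
            have "\<bar>S3 - real n * I3\<bar> \<le> real n * (A3 * R)"
              using elim(3) x by (simp add: dev_def S3_def I3_def k_def R_def mult.assoc)
            then show ?thesis by linarith
          qed
          \<comment> \<open>The remainder depends on f and is no fixed test function. Because k is
            nonnegative, its sample sum and its mean are dominated by those of |y - x|^3; this costs
            the mean \<open>I3\<close> twice, hence 2 ct, and the deviation \<open>A3\<close>
            once.\<close>
          have Dr_le: "\<bar>D r\<bar> \<le> real n * (c * (A3 + 2 * ct) * R)"
          proof -
            have kr: "\<bar>k y * r y\<bar> \<le> c * (k y * norm (y - x) ^ 3)" if "y \<in> M" for y
            proof -
              have "\<bar>k y * r y\<bar> \<le> k y * (c * norm (y - x) ^ 3)"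
                unfolding abs_mult using r[OF that] k0[of y] by (intro mult_mono) auto
              then show ?thesis by (simp add: mult_ac)
            qed
            have "\<bar>\<Sum>i=1..n. k (X i \<omega>) * r (X i \<omega>)\<bar> \<le> (\<Sum>i=1..n. \<bar>k (X i \<omega>) * r (X i \<omega>)\<bar>)" by (rule sum_abs)
            also have "\<dots> \<le> (\<Sum>i=1..n. c * (k (X i \<omega>) * norm (X i \<omega> - x) ^ 3))" by (intro sum_mono kr XM) simp
            also have "\<dots> = c * S3" by (simp add: S3_def sum_distrib_left)
            also have "\<dots> \<le> c * (real n * I3 + real n * (A3 * R))" by (rule mult_left_mono[OF S3 c])
            finally have 1: "\<bar>\<Sum>i=1..n. k (X i \<omega>) * r (X i \<omega>)\<bar> \<le> c * (real n * I3 + real n * (A3 * R))" .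
            have "\<bar>\<integral>y. k y * r y \<partial>L\<bar> \<le> (\<integral>y. \<bar>k y * r y\<bar> \<partial>L)" by (rule integral_abs_bound)
            also have "\<dots> \<le> (\<integral>y. c * (k y * norm (y - x) ^ 3) \<partial>L)"
              using ir i3 kr by (intro integral_mono) (auto simp: space_L)
            also have "\<dots> = c * I3" by (simp add: I3_def)
            finally have "real n * \<bar>\<integral>y. k y * r y \<partial>L\<bar> \<le> real n * (c * I3)" by (intro mult_left_mono) auto
            then have 2: "\<bar>real n * (\<integral>y. k y * r y \<partial>L)\<bar> \<le> real n * (c * I3)" by (simp add: abs_mult)
            have "\<bar>D r\<bar> \<le> c * (real n * I3 + real n * (A3 * R)) + real n * (c * I3)"
              unfolding D_def using 1 2 by linarith
            also have "\<dots> = 2 * c * (real n * I3) + real n * (c * A3 * R)" by (simp add: algebra_simps)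
            also have "\<dots> \<le> 2 * c * (real n * (ct * R)) + real n * (c * A3 * R)"
              using I3 c by (intro add_right_mono mult_left_mono) auto
            also have "\<dots> = real n * (c * (A3 + 2 * ct) * R)" by (simp add: algebra_simps)
            finally show ?thesis .
          qed
          have Df: "D (\<lambda>y. f y - f x) = D l + D q + D r"
            unfolding D_def dec using il iq ir by (simp add: distrib_left sum.distrib)
          define I where "I = (\<integral>y. k y * (f y - f x) \<partial>L)"
          define lim where "lim = limit_operator TYPE('d) K M p f x"
          have Ib: "\<bar>I - h n ^ (?d + 2) * lim\<bar> \<le> cb * R"
            using bias[OF x n(2)] mult_left_mono[OF hR cb] unfolding I_def k_def lim_def by linarith
          then have "real n * \<bar>I - h n ^ (?d + 2) * lim\<bar> \<le> real n * (cb * R)" by (intro mult_left_mono) auto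
          then have nI: "\<bar>real n * I - real n * (h n ^ (?d + 2) * lim)\<bar> \<le> real n * (cb * R)"
            by (simp add: abs_mult flip: right_diff_distrib)
          define T where "T = (\<Sum>i=1..n. k (X i \<omega>) * (f (X i \<omega>) - f x))"
          have "T - real n * I = D l + D q + D r" using Df by (simp add: D_def T_def I_def)
          then have "\<bar>T - real n * (h n ^ (?d + 2) * lim)\<bar> \<le> real n * (c * (\<Sum>j\<in>UNIV. A1 j) * R) + real n * (c * (\<Sum>jk\<in>UNIV. A2 jk) * R) + real n * (c * (A3 + 2 * ct) * R) + real n * (cb * R)"
            using Dl_le Dq_le Dr_le nI by linarith
          also have "\<dots> = real n * (C * R)" by (simp add: C_def algebra_simps)
          finally have main: "\<bar>T - real n * (h n ^ (?d + 2) * lim)\<bar> \<le> real n * (C * R)" .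
          have pos: "0 < real n * h n ^ (?d + 2)" using n by simp
          have "kernel_operator TYPE('d) K (h n) n (\<lambda>i. X i \<omega>) f x = T / (real n * h n ^ (?d + 2))"
            by (simp add: kernel_operator_def T_def k_def)
          then have "kernel_operator TYPE('d) K (h n) n (\<lambda>i. X i \<omega>) f x - lim = (T - real n * (h n ^ (?d + 2) * lim)) / (real n * h n ^ (?d + 2))"
            using n by (simp add: diff_divide_distrib)
          then have "\<bar>kernel_operator TYPE('d) K (h n) n (\<lambda>i. X i \<omega>) f x - lim\<bar> = \<bar>T - real n * (h n ^ (?d + 2) * lim)\<bar> / (real n * h n ^ (?d + 2))"
            using pos by (simp add: abs_divide)
          also have "\<dots> \<le> real n * (C * R) / (real n * h n ^ (?d + 2))" by (intro divide_right_mono main) (use pos in simp)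
          also have "\<dots> = C * S.rate n" using n by (simp add: R_def)
          finally show "\<bar>kernel_operator TYPE('d) K (h n) n (\<lambda>i. X i \<omega>) f x - limit_operator TYPE('d) K M p f x\<bar> \<le> C * S.rate n"
            by (simp add: lim_def)
        qed
      qed
      then show "\<exists>C\<ge>0. \<forall>\<^sub>F n in sequentially. \<forall>x\<in>M. \<bar>kernel_operator TYPE('d) K (h n) n (\<lambda>i. X i \<omega>) f x - limit_operator TYPE('d) K M p f x\<bar> \<le> C * S.rate n"
        using C by blast
    qed
  qed
qed

end

theorem theorem1p1:
  fixes M :: "(real^'m) set"
    and \<mu> :: "(real^'m) measure"
    and p :: "real^'m \<Rightarrow> real"
    and P :: "'w measure"
    and X :: "nat \<Rightarrow> 'w \<Rightarrow> real^'m"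
    and K :: "real \<Rightarrow> real"
    and h :: "nat \<Rightarrow> real"
  assumes "compact M" and "smooth_submanifold TYPE('d::finite) M"
    and "riemannian_volume TYPE('d) M \<mu>"
    and "Ck_manifold TYPE('d) 2 M p"
    and "\<And>x. x \<in> M \<Longrightarrow> 0 \<le> p x" and "(\<integral>\<^sup>+ x. ennreal (p x) \<partial>\<mu>) = 1"
    and "prob_space P"
    and "prob_space.indep_vars P (\<lambda>_. \<mu>) X {1..}"
    and "\<And>i. i \<ge> 1 \<Longrightarrow> distributed P \<mu> (X i) (\<lambda>x. ennreal (p x))"
    and "\<And>a. a \<ge> 0 \<Longrightarrow> 0 \<le> K a"
    and "K \<in> borel_measurable (restrict_space borel {0..})"
    and "(K \<longlongrightarrow> 0) at_top"
    and "bounded_variation_halfline K"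
    and "(\<integral>\<^sup>+ a\<in>{0..}. ennreal (a ^ (CARD('d) + 3))
            \<partial>stieltjes_measure (total_variation K)) < \<infinity>"
    and "\<And>n. n \<ge> 1 \<Longrightarrow> 0 < h n"
    and "h \<longlonglongrightarrow> 0"
    and "(\<lambda>n. ln (1 / h n) / (real n * h n ^ (CARD('d) + 2))) \<longlonglongrightarrow> 0"
  shows "AE \<omega> in P. \<forall>f. Ck_manifold TYPE('d) 3 M f \<longrightarrow>
           (\<lambda>n. SUP x\<in>M. \<bar>kernel_operator TYPE('d) K (h n) n (\<lambda>i. X i \<omega>) f x
                            - limit_operator TYPE('d) K M p f x\<bar>)
           \<in> O(\<lambda>n. sqrt (ln (1 / h n) / (real n * h n ^ (CARD('d) + 2))) + h n)"

proof -
  \<comment> \<open>The hypotheses concern \<open>K\<close> on the nonnegative half-line, while the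
    auxiliary results want a Borel function on the whole line. Both operators evaluate
    \<open>K\<close> at nonnegative arguments, so cutting it off changes neither of them.\<close>
  define K0 where "K0 a = (if a \<in> {0..} then K a else 0)" for a
  define \<nu> where "\<nu> = stieltjes_measure (total_variation K)"
  have kb: "kernel_bound K0 \<nu> CARD('d)"
    unfolding K0_def[abs_def] \<nu>_def by (rule kernel_bound_stieltjes) fact+
  have sm: "sampled_manifold TYPE('d) K0 \<nu> M \<mu> p"
    by (intro sampled_manifold.intro sampled_manifold_axioms.intro kb) fact+
  interpret sampled_manifold "TYPE('d)" K0 \<nu> M \<mu> p by (rule sm)
  have iid: "iid_sampling P L \<mu> X h CARD('d)"
  proof (intro iid_sampling.intro iid_sampling_axioms.intro)
    show "distr P \<mu> (X i) = L" if "1 \<le> i" for i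
      using assms(9)[OF that] by (simp add: distributed_def L_def)
  qed (fact sets_L prob_space_axioms | fact)+
  have K0: "0 \<le> K0 a" for a using assms(10) by (simp add: K0_def)
  have lim_eq: "limit_operator TYPE('d) K0 M p f x = limit_operator TYPE('d) K M p f x" for f x
    by (simp add: limit_operator_def kernel_constant_def K0_def)
  show ?thesis using operator_deviation[OF iid K0]
  proof eventually_elim
    case (elim \<omega>)
    show ?case
    proof (intro allI impI)
      fix f assume "Ck_manifold TYPE('d) 3 M f"
      then obtain C where C: "0 \<le> C" and ev: "\<forall>\<^sub>F n in sequentially. \<forall>x\<in>M.
        \<bar>kernel_operator TYPE('d) K0 (h n) n (\<lambda>i. X i \<omega>) f x - limit_operator TYPE('d) K0 M p f x\<bar> \<le> C * iid_sampling.rate h CARD('d) n"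
        using elim by blast
      have rate: "iid_sampling.rate h CARD('d) n = sqrt (ln (1 / h n) / (real n * h n ^ (CARD('d) + 2))) + h n" for n
        by (rule iid_sampling.rate_def[OF iid])
      show "(\<lambda>n. SUP x\<in>M. \<bar>kernel_operator TYPE('d) K (h n) n (\<lambda>i. X i \<omega>) f x - limit_operator TYPE('d) K M p f x\<bar>)
        \<in> O(\<lambda>n. sqrt (ln (1 / h n) / (real n * h n ^ (CARD('d) + 2))) + h n)"
      proof (rule bigoI)
        show "\<forall>\<^sub>F n in sequentially. norm (SUP x\<in>M. \<bar>kernel_operator TYPE('d) K (h n) n (\<lambda>i. X i \<omega>) f x - limit_operator TYPE('d) K M p f x\<bar>)
          \<le> C * norm (sqrt (ln (1 / h n) / (real n * h n ^ (CARD('d) + 2))) + h n)"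
          using ev eventually_ge_at_top[of 1]
        proof eventually_elim
          case (elim n)
          define F where "F x = \<bar>kernel_operator TYPE('d) K (h n) n (\<lambda>i. X i \<omega>) f x - limit_operator TYPE('d) K M p f x\<bar>" for x
          define r where "r = sqrt (ln (1 / h n) / (real n * h n ^ (CARD('d) + 2))) + h n"
          have "0 < h n" using assms(15) elim(2) by simp
          then have "kernel_operator TYPE('d) K0 (h n) n (\<lambda>i. X i \<omega>) f x = kernel_operator TYPE('d) K (h n) n (\<lambda>i. X i \<omega>) f x" for x
            by (simp add: kernel_operator_def K0_def)
          then have F: "0 \<le> F x" "x \<in> M \<Longrightarrow> F x \<le> C * r" for x
            using elim(1) by (auto simp: F_def r_def rate lim_eq)
          \<comment> \<open>The real supremum is meaningful since \<open>F\<close> is bounded on the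
            nonempty set \<open>M\<close>, and the value at x0 shows that it is nonnegative, so that
            its norm is the supremum itself.\<close>
          obtain x0 where x0: "x0 \<in> M" using M_nonempty by blast
          have "(SUP x\<in>M. F x) \<le> C * r" using M_nonempty F by (intro cSUP_least) auto
          moreover have "F x0 \<le> (SUP x\<in>M. F x)" using F by (intro cSUP_upper x0 bdd_aboveI2[where M = "C * r"])
          moreover have "C * r \<le> C * norm r" using C by (intro mult_left_mono) auto
          ultimately show ?case using F(1)[of x0] unfolding F_def[symmetric] r_def[symmetric] by simp
        qed
      qed
    qed
  qed
qed

end
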